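(* Let $\beta\ge4$, $\lambda,\alpha,\varepsilon>0$, $\tilde y\in L^2(\Omega_T)$, $y_0\in H^2(\Omega)$ with $y_0\ge C_0>0$, where $C_0$ is such that the unique weak solution $\hat y$ of $\hat y_t=-(\lambda|\hat y|^\beta\hat y_{xxx})_x$, $\hat y(0,\cdot)=y_0$, $\hat y_x=\hat y_{xxx}=0$ at $x=a,b$, satisfies $\hat y\ge 2C_0$ in $\overline\Omega_T$. Let $(y,u)$ be a minimizer of $$J(y,u)=\frac12\int_0^T\!\!\int_\Omega |y-\tilde y|^2\,dx\,dt+\frac{\alpha}{2}\int_0^T\!\!\int_\Omega |u_x|^2\,dx\,dt$$ over all $(y,u)\in X\times L^2(H^1_0)$ satisfying $y_t=-([\lambda|y|^\beta+\varepsilon]y_{xxx})_x+u_x$ in $\Omega_T$, $y(0,\cdot)=y_0$, $y_x=y_{xxx}=0$ at $x=a,b$, and $y\ge C_0$ in $\Omega_T$. Then there exist $z\in L^2(L^2)$ and $\mu\in X^*$ such that $$y_t=-\big([\lambda|y|^\beta+\varepsilon]y_{xxx}\big)_x+u_x,\qquad y\ge C_0,$$ $$0\ge\langle w-y,\mu\rangle\quad\text{for all } w\in X \text{ with } w\ge C_0,$$ $$0=\langle y-\tilde y,\varphi\rangle+\big\langle z,\varphi_t+(\beta\lambda y^{\beta-1}y_{xxx}\varphi)_x\big\rangle+\big\langle z,([\lambda|y|^\beta+\varepsilon]\varphi_{xxx})_x\big\rangle+\langle\varphi,\mu\rangle\quad\text{for all }\varphi\in X \text{ with }\varphi(0,\cdot)=0,\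 \varphi_x=\varphi_{xxx}=0\text{ at }x=a,b,$$ $$0=-\alpha u_{xx}+z_x\quad\text{in }L^2(0,T;H^{-1}(\Omega)),$$ together with $y(0,\cdot)=y_0$, $z(T,\cdot)=0$ and $y_x=y_{xxx}=z_x=z_{xxx}=0$ at $x=a,b$, where the terminal and boundary conditions for $z$ are understood in the weak sense expressed by the variational identity $0=\langle y-\tilde y,\varphi\rangle+\big\langle z,\varphi_t+(\beta\lambda y^{\beta-1}y_{xxx}\varphi)_x\big\rangle+\big\langle z,([\lambda|y|^\beta+\varepsilon]\varphi_{xxx})_x\big\rangle+\langle\varphi,\mu\rangle$ holding for all $\varphi\in X$ with $\varphi(0,\cdot)=0$ and $\varphi_x=\varphi_{xxx}=0$ at $x=a,b$.
   Context: $\Omega=(a,b)\subset\mathbb R$ is a bounded interval, $0<T<\infty$, $\Omega_T=(0,T)\times\Omega$. $W^{k,p}(W^{m,q})$ denotes the Bochner space $W^{k,p}(0,T;W^{m,q}(\Omega))$. $X:=L^2(H^4)\cap H^1(L^2)$ and $X^*$ is its dual; by embedding $X\subset C(\overline{\Omega_T})$. $\langle\cdot,\cdot\rangle$ is the $L^2(\Omega_T)$ inner product when both entries are functions, and the duality pairing of $X$ and $X^*$ when one entry is $\mu$. A test function $\varphi$ with $\varphi(0,\cdot)=0$, $\varphi_x=\varphi_{xxx}=0$ at $x=a,b$ tested against $z$ encodes formally (for smooth $z$) the conditions $z(T,\cdot)=0$ and $z_x=z_{xxx}=0$ at $x=a,b$. A weak solution of the thin-film equation without control is meant in the usual sense (tested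 in space-time with functions in $L^2(H^1)$, with the no-flux condition built in, and with the given initial condition and $y_x=0$ at $x=a,b$). *)

theory Defs
  imports "HOL-Analysis.Analysis"
begin

text \<open>
  Elements of Lebesgue, Sobolev and Bochner spaces are represented by functions, not by their
  almost-everywhere classes. Apart from \<^const>\<open>continuous_on\<close>, applied to the continuous
  representative, the notions below are invariant under changes on null sets.
\<close>

section \<open>Lebesgue and Sobolev spaces on an interval\<close>

definition L2 :: "'a::euclidean_space set \<Rightarrow> ('a \<Rightarrow> real) set" where
  "L2 S = {f. f \<in> borel_measurable (lebesgue_on S) \<and> integrable (lebesgue_on S) (\<lambda>p. (f p)\<^sup>2)}"

definition inner_L2 :: "'a::euclidean_space set \<Rightarrow> ('a \<Rightarrow> real) \<Rightarrow> ('a \<Rightarrow> real) \<Rightarrow> real" where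
  "inner_L2 S f g = (LINT p|lebesgue_on S. f p * g p)"

definition test_fun :: "real \<Rightarrow> real \<Rightarrow> (real \<Rightarrow> real) set" where
  "test_fun a b = {\<psi>. (\<forall>k x. ((deriv ^^ k) \<psi>) differentiable (at x)) \<and>
     (\<exists>c d. a < c \<and> d < b \<and> (\<forall>x. x \<notin> {c..d} \<longrightarrow> \<psi> x = 0))}"

definition locally_integrable :: "real \<Rightarrow> real \<Rightarrow> (real \<Rightarrow> real) \<Rightarrow> bool" where
  "locally_integrable a b f \<longleftrightarrow>
     (\<forall>c d. a < c \<longrightarrow> d < b \<longrightarrow> integrable (lebesgue_on {c..d}) f)"

definition weak_deriv :: "real \<Rightarrow> real \<Rightarrow> nat \<Rightarrow> (real \<Rightarrow> real) \<Rightarrow> (real \<Rightarrow> real) \<Rightarrow> bool" where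
  "weak_deriv a b k f g \<longleftrightarrow> locally_integrable a b f \<and> locally_integrable a b g \<and>
     (\<forall>\<psi>\<in>test_fun a b.
        (LINT x|lebesgue_on {a<..<b}. f x * (deriv ^^ k) \<psi> x)
          = (- 1) ^ k * (LINT x|lebesgue_on {a<..<b}. g x * \<psi> x))"

definition wderiv :: "real \<Rightarrow> real \<Rightarrow> nat \<Rightarrow> (real \<Rightarrow> real) \<Rightarrow> real \<Rightarrow> real" where
  "wderiv a b k f = (SOME g. weak_deriv a b k f g)"

definition H :: "real \<Rightarrow> real \<Rightarrow> nat \<Rightarrow> (real \<Rightarrow> real) set" where
  "H a b m = {f. \<forall>k\<le>m. \<exists>g\<in>L2 {a<..<b}. weak_deriv a b k f g}"

definition norm_H :: "real \<Rightarrow> real \<Rightarrow> nat \<Rightarrow> (real \<Rightarrow> real) \<Rightarrow> real" where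
  "norm_H a b m f =
     sqrt (\<Sum>k\<le>m. inner_L2 {a<..<b} (wderiv a b k f) (wderiv a b k f))"

definition H10 :: "real \<Rightarrow> real \<Rightarrow> (real \<Rightarrow> real) set" where
  "H10 a b = {f \<in> H a b 1. \<forall>e>0. \<exists>\<psi>\<in>test_fun a b. norm_H a b 1 (\<lambda>x. f x - \<psi> x) < e}"

text \<open>For \<open>f\<close> in \<open>H\<^sup>1(a,b)\<close> this is the vanishing of both boundary traces.\<close>

definition zero_at_ends :: "real \<Rightarrow> real \<Rightarrow> (real \<Rightarrow> real) \<Rightarrow> bool" where
  "zero_at_ends a b f \<longleftrightarrow> (\<exists>F. continuous_on {a..b} F \<and>
     (AE x in lebesgue_on {a<..<b}. F x = f x) \<and> F a = 0 \<and> F b = 0)"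

text \<open>The derivative of \<open>g \<in> L\<^sup>2(a,b)\<close> as an element of the dual space \<open>H\<^sup>-\<^sup>1(a,b)\<close> of \<open>H\<^sup>1\<^sub>0(a,b)\<close>.\<close>

definition deriv_Hm1 :: "real \<Rightarrow> real \<Rightarrow> (real \<Rightarrow> real) \<Rightarrow> (real \<Rightarrow> real) \<Rightarrow> real" where
  "deriv_Hm1 a b g v = - inner_L2 {a<..<b} g (wderiv a b 1 v)"


section \<open>Bochner spaces\<close>

text \<open>
  Points of the space-time cylinder are pairs \<open>(t, x)\<close>. A function \<open>t \<mapsto> f(t, \<cdot>)\<close> is given by its
  jointly measurable representative \<open>f\<close>, so that \<open>L\<^sup>2(0,T;L\<^sup>2(a,b))\<close> is \<open>L2 (cyl T a b)\<close>.
\<close>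

definition cyl :: "real \<Rightarrow> real \<Rightarrow> real \<Rightarrow> (real \<times> real) set" where
  "cyl T a b = {0<..<T} \<times> {a<..<b}"

text \<open>
  The \<open>k\<close>-th weak derivative of almost every slice \<open>f(t, \<cdot>)\<close>, assembled into a jointly measurable
  function.
\<close>

definition weak_dx ::
    "real \<Rightarrow> real \<Rightarrow> real \<Rightarrow> nat \<Rightarrow> (real \<times> real \<Rightarrow> real) \<Rightarrow> (real \<times> real \<Rightarrow> real) \<Rightarrow> bool" where
  "weak_dx T a b k f g \<longleftrightarrow> g \<in> borel_measurable (lebesgue_on (cyl T a b)) \<and>
     (AE t in lebesgue_on {0<..<T}. weak_deriv a b k (\<lambda>x. f (t, x)) (\<lambda>x. g (t, x)))"

definition Dx :: "real \<Rightarrow> real \<Rightarrow> real \<Rightarrow> nat \<Rightarrow> (real \<times> real \<Rightarrow> real) \<Rightarrow> real \<times> real \<Rightarrow> real" where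
  "Dx T a b k f = (SOME g. weak_dx T a b k f g)"

text \<open>
  \<open>L\<^sup>2(0,T;H\<^sup>m(a,b))\<close>: almost every slice lies in \<open>H\<^sup>m(a,b)\<close> and, by Tonelli, square integrability of
  the derivatives over the cylinder says that \<open>\<integral>\<^sub>0\<^sup>T \<parallel>f(t)\<parallel>\<^sup>2 dt\<close> is finite, the norm being that of
  \<open>H\<^sup>m(a,b)\<close>.
\<close>

definition L2H :: "real \<Rightarrow> real \<Rightarrow> real \<Rightarrow> nat \<Rightarrow> (real \<times> real \<Rightarrow> real) set" where
  "L2H T a b m = {f \<in> L2 (cyl T a b). \<forall>k\<le>m. \<exists>g\<in>L2 (cyl T a b). weak_dx T a b k f g}"

definition norm_L2H :: "real \<Rightarrow> real \<Rightarrow> real \<Rightarrow> nat \<Rightarrow> (real \<times> real \<Rightarrow> real) \<Rightarrow> real" where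
  "norm_L2H T a b m f =
     sqrt (\<Sum>k\<le>m. inner_L2 (cyl T a b) (Dx T a b k f) (Dx T a b k f))"

definition L2H10 :: "real \<Rightarrow> real \<Rightarrow> real \<Rightarrow> (real \<times> real \<Rightarrow> real) set" where
  "L2H10 T a b =
     {f \<in> L2H T a b 1. AE t in lebesgue_on {0<..<T}. (\<lambda>x. f (t, x)) \<in> H10 a b}"

text \<open>
  The weak derivative of \<open>t \<mapsto> f(t, \<cdot>)\<close> as an \<open>L\<^sup>2(a,b)\<close>-valued function: for each scalar test
  function, the two \<open>L\<^sup>2(a,b)\<close>-valued integrals over \<open>(0,T)\<close> agree as elements of \<open>L\<^sup>2(a,b)\<close>.
\<close>

definition weak_dt ::
    "real \<Rightarrow> real \<Rightarrow> real \<Rightarrow> (real \<times> real \<Rightarrow> real) \<Rightarrow> (real \<times> real \<Rightarrow> real) \<Rightarrow> bool" where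
  "weak_dt T a b f g \<longleftrightarrow> f \<in> L2 (cyl T a b) \<and> g \<in> L2 (cyl T a b) \<and>
     (\<forall>\<psi>\<in>test_fun 0 T. AE x in lebesgue_on {a<..<b}.
        (LINT t|lebesgue_on {0<..<T}. f (t, x) * deriv \<psi> t)
          = - (LINT t|lebesgue_on {0<..<T}. g (t, x) * \<psi> t))"

definition Dt :: "real \<Rightarrow> real \<Rightarrow> real \<Rightarrow> (real \<times> real \<Rightarrow> real) \<Rightarrow> real \<times> real \<Rightarrow> real" where
  "Dt T a b f = (SOME g. weak_dt T a b f g)"

definition H1L2 :: "real \<Rightarrow> real \<Rightarrow> real \<Rightarrow> (real \<times> real \<Rightarrow> real) set" where
  "H1L2 T a b = {f. \<exists>g. weak_dt T a b f g}"

definition norm_H1L2 :: "real \<Rightarrow> real \<Rightarrow> real \<Rightarrow> (real \<times> real \<Rightarrow> real) \<Rightarrow> real" where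
  "norm_H1L2 T a b f =
     sqrt (inner_L2 (cyl T a b) f f + inner_L2 (cyl T a b) (Dt T a b f) (Dt T a b f))"

definition X :: "real \<Rightarrow> real \<Rightarrow> real \<Rightarrow> (real \<times> real \<Rightarrow> real) set" where
  "X T a b = L2H T a b 4 \<inter> H1L2 T a b"

definition norm_X :: "real \<Rightarrow> real \<Rightarrow> real \<Rightarrow> (real \<times> real \<Rightarrow> real) \<Rightarrow> real" where
  "norm_X T a b f = norm_L2H T a b 4 f + norm_H1L2 T a b f"

text \<open>
  The dual of a function space \<open>V\<close> with norm \<open>N\<close>. Since \<open>N\<close> vanishes on functions that are zero
  almost everywhere, such functionals respect almost-everywhere equality.
\<close>

definition dual_space :: "('a \<Rightarrow> real) set \<Rightarrow> (('a \<Rightarrow> real) \<Rightarrow> real) \<Rightarrow> (('a \<Rightarrow> real) \<Rightarrow> real) set" where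
  "dual_space V N = {\<mu>.
     (\<forall>f\<in>V. \<forall>g\<in>V. \<mu> (\<lambda>p. f p + g p) = \<mu> f + \<mu> g) \<and>
     (\<forall>c. \<forall>f\<in>V. \<mu> (\<lambda>p. c * f p) = c * \<mu> f) \<and>
     (\<exists>K. \<forall>f\<in>V. \<bar>\<mu> f\<bar> \<le> K * N f)}"

text \<open>\<open>f(0, \<cdot>) = g\<close>, read off from the continuous representative of \<open>f\<close> on the closed cylinder.\<close>

definition initial_value ::
    "real \<Rightarrow> real \<Rightarrow> real \<Rightarrow> (real \<times> real \<Rightarrow> real) \<Rightarrow> (real \<Rightarrow> real) \<Rightarrow> bool" where
  "initial_value T a b f g \<longleftrightarrow> (\<exists>F. continuous_on ({0..T} \<times> {a..b}) F \<and>
     (AE p in lebesgue_on (cyl T a b). F p = f p) \<and>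
     (AE x in lebesgue_on {a<..<b}. F (0, x) = g x))"

text \<open>The \<open>k\<close>-th \<open>x\<close>-derivative of \<open>f\<close> vanishes at \<open>x = a\<close> and \<open>x = b\<close>.\<close>

definition dx_zero_bdry :: "real \<Rightarrow> real \<Rightarrow> real \<Rightarrow> nat \<Rightarrow> (real \<times> real \<Rightarrow> real) \<Rightarrow> bool" where
  "dx_zero_bdry T a b k f \<longleftrightarrow>
     (AE t in lebesgue_on {0<..<T}. zero_at_ends a b (\<lambda>x. Dx T a b k f (t, x)))"


section \<open>The thin-film equation and the control problem\<close>

text \<open>
  Weak solutions of the uncontrolled equation \<open>v\<^sub>t = - (lam |v|\<^sup>\<beta> v\<^sub>x\<^sub>x\<^sub>x)\<^sub>x\<close>. The functional \<open>dtv\<close> is the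
  weak time derivative \<open>v\<^sub>t\<close> in \<open>L\<^sup>2(0,T;(H\<^sup>1)\<^sup>*)\<close>, the dual of \<open>L\<^sup>2(0,T;H\<^sup>1)\<close>. The test functions do
  not vanish at the lateral boundary, which is how the no-flux condition enters. The usual weak
  formulation only asks for the flux to be square integrable where \<open>v \<noteq> 0\<close>; for solutions bounded
  away from zero, the only ones used here, this amounts to \<open>v\<^sub>x\<^sub>x\<^sub>x\<close> being square integrable on the
  cylinder.
\<close>

definition thin_film_weak_solution ::
    "real \<Rightarrow> real \<Rightarrow> real \<Rightarrow> real \<Rightarrow> real \<Rightarrow> (real \<Rightarrow> real) \<Rightarrow> (real \<times> real \<Rightarrow> real) \<Rightarrow> bool" where
  "thin_film_weak_solution T a b lam \<beta> y0 v \<longleftrightarrow>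
     continuous_on ({0..T} \<times> {a..b}) v \<and> v \<in> L2H T a b 3 \<and>
     (\<exists>dtv \<in> dual_space (L2H T a b 1) (norm_L2H T a b 1).
        (\<forall>\<psi>\<in>test_fun 0 T. \<forall>h\<in>H a b 1.
           dtv (\<lambda>(t, x). \<psi> t * h x) = - inner_L2 (cyl T a b) v (\<lambda>(t, x). deriv \<psi> t * h x)) \<and>
        (\<forall>\<phi>\<in>L2H T a b 1.
           dtv \<phi> = inner_L2 (cyl T a b)
                   (\<lambda>p. lam * \<bar>v p\<bar> powr \<beta> * Dx T a b 3 v p) (Dx T a b 1 \<phi>))) \<and>
     initial_value T a b v y0 \<and> dx_zero_bdry T a b 1 v"

definition state_equation ::
    "real \<Rightarrow> real \<Rightarrow> real \<Rightarrow> real \<Rightarrow> real \<Rightarrow> real \<Rightarrow>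
     (real \<times> real \<Rightarrow> real) \<Rightarrow> (real \<times> real \<Rightarrow> real) \<Rightarrow> bool" where
  "state_equation T a b lam \<beta> \<epsilon> y u \<longleftrightarrow>
     (\<exists>G. weak_dx T a b 1 (\<lambda>p. (lam * \<bar>y p\<bar> powr \<beta> + \<epsilon>) * Dx T a b 3 y p) G \<and>
        (AE p in lebesgue_on (cyl T a b). Dt T a b y p = - G p + Dx T a b 1 u p))"

definition admissible ::
    "real \<Rightarrow> real \<Rightarrow> real \<Rightarrow> real \<Rightarrow> real \<Rightarrow> real \<Rightarrow> (real \<Rightarrow> real) \<Rightarrow> real \<Rightarrow>
     (real \<times> real \<Rightarrow> real) \<Rightarrow> (real \<times> real \<Rightarrow> real) \<Rightarrow> bool" where
  "admissible T a b lam \<beta> \<epsilon> y0 C0 y u \<longleftrightarrow>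
     y \<in> X T a b \<and> u \<in> L2H10 T a b \<and>
     state_equation T a b lam \<beta> \<epsilon> y u \<and>
     initial_value T a b y y0 \<and> dx_zero_bdry T a b 1 y \<and> dx_zero_bdry T a b 3 y \<and>
     (AE p in lebesgue_on (cyl T a b). y p \<ge> C0)"

definition cost ::
    "real \<Rightarrow> real \<Rightarrow> real \<Rightarrow> real \<Rightarrow> (real \<times> real \<Rightarrow> real) \<Rightarrow>
     (real \<times> real \<Rightarrow> real) \<Rightarrow> (real \<times> real \<Rightarrow> real) \<Rightarrow> real" where
  "cost T a b \<alpha> yd y u =
     1 / 2 * (LINT p|lebesgue_on (cyl T a b). \<bar>y p - yd p\<bar>\<^sup>2)
     + \<alpha> / 2 * (LINT p|lebesgue_on (cyl T a b). \<bar>Dx T a b 1 u p\<bar>\<^sup>2)"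

end

theory Submission
  imports Defs
begin

text \<open>
  The control enters the equation only through \<open>u\<^sub>x\<close>, and \<open>u\<close> vanishes at both ends. So a state \<open>y \<in> X\<close> with the
  right initial and boundary values is produced by some control exactly when its mass \<open>\<integral> y dx\<close> does not depend on time:
  \<open>u\<close> must be the primitive of \<open>N(y) = y\<^sub>t + ([lam \<bar>y\<bar>^\<beta> + \<epsilon>] y\<^sub>x\<^sub>x\<^sub>x)\<^sub>x\<close>, and the flux has mean zero. This turns
  the problem into the minimisation of a functional of \<open>y\<close> alone over the mass-conserving states with \<open>y \<ge> C0\<close>, and
  the first variation at the minimiser says that \<open>J'(\<phi>) = \<langle>y - yd, \<phi>\<rangle> + \<alpha> \<langle>u\<^sub>x, L \<phi>\<rangle> \<ge> 0\<close> whenever \<open>\<phi>\<close>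
  conserves mass and \<open>y + \<phi> \<ge> C0\<close>; here \<open>L\<close> is the linearisation of \<open>N\<close> at \<open>y\<close>
  (\<open>admissible_of_state\<close>, \<open>first_variation\<close>, \<open>variational_inequality\<close>).

  The multiplier is the extension of a positive functional. The values at \<open>t = 0\<close> of the continuous function \<open>yhat \<ge> 2 C0\<close>
  give \<open>y0 \<ge> 2 C0\<close>, so the mean \<open>m\<close> of \<open>y0\<close> is at least \<open>2 C0\<close> and \<open>\<phi> = (t/T)(m - y)\<close> is a mass-conserving
  direction with \<open>y + \<phi> - C0 \<ge> d > 0\<close> on the whole cylinder (\<open>slater_direction\<close>). On the space of all \<open>\<phi> + s (y - C0)\<close>
  the functional \<open>\<phi> + s (y - C0) \<mapsto> J'(\<phi>)\<close> is nonnegative on nonnegative functions, and the space contains a function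
  bounded below by \<open>d\<close>. The M. Riesz theorem extends it to a positive functional \<open>\<nu>\<close> on all essentially bounded functions
  (\<open>positive_extension\<close>, \<open>positive_multiplier\<close>), and \<open>\<mu> = -\<nu>\<close>. Complementarity is \<open>\<nu>(y - C0) = 0\<close> together with
  positivity. Since \<open>\<nu>\<close> is bounded for the essential supremum, it is continuous on \<open>X\<close> once \<open>X\<close> is
  embedded into the bounded functions.

  A test function that does not conserve mass is a mass-conserving one plus a function \<open>t \<mapsto> \<integral>\<^sub>0\<^sup>t q\<close>, where \<open>q\<close> is the
  mean of \<open>\<phi>\<^sub>t\<close>. On functions of time alone both \<open>\<nu>\<close> and \<open>J'\<close> are integrals of \<open>q\<close> against bounded densities, the first by
  the Radon-Nikodym theorem, the second by an integration by parts in time. So \<open>\<nu>(\<phi>) - J'(\<phi>)\<close> is the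
  integral of \<open>q\<close> against some \<open>(b - a) c(t)\<close>, which is \<open>\<langle>c, L \<phi>\<rangle>\<close> because fluxes have mean zero (\<open>costate\<close>). Thus
  \<open>z = \<alpha> u\<^sub>x + c(t)\<close>, and \<open>z\<^sub>x = \<alpha> u\<^sub>x\<^sub>x\<close> because \<open>c\<close> does not depend on \<open>x\<close>.

  The embedding \<open>X \<subset> L\<^sup>\<infinity>\<close> and the bound for \<open>y\<^sub>x\<close> rest on an energy estimate that uses difference quotients in time only:
  if \<open>\<langle>f(s), P(t)\<rangle> = \<langle>Q(s), Q(t)\<rangle>\<close> for almost all \<open>s\<close> and \<open>t\<close>, then \<open>f\<^sub>t, P, Q \<in> L\<^sup>2\<close> bound
  \<open>\<parallel>Q(t)\<parallel>\<close> uniformly in \<open>t\<close> (\<open>energy_bound\<close>). Sobolev functions are handled through the absolutely continuous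
  representatives of almost all their slices.
\<close>

abbreviation Leb :: "real \<Rightarrow> real \<Rightarrow> real measure" where
  "Leb a b \<equiv> lebesgue_on {a<..<b}"

abbreviation Leb2 :: "real \<Rightarrow> real \<Rightarrow> real \<Rightarrow> (real \<times> real) measure" where
  "Leb2 T a b \<equiv> lebesgue_on (cyl T a b)"

lemmas LINT_integrable_add = Bochner_Integration.integrable_add
lemmas LINT_integrable_bound = Bochner_Integration.integrable_bound
lemmas LINT_add = Bochner_Integration.integral_add
lemmas LINT_cong = Bochner_Integration.integral_cong
lemmas LINT_diff = Bochner_Integration.integral_diff
lemmas LINT_nonneg = Bochner_Integration.integral_nonneg
lemmas HK_add = Henstock_Kurzweil_Integration.integral_add
lemmas HK_combine = Henstock_Kurzweil_Integration.integral_combine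
lemmas HK_diff = Henstock_Kurzweil_Integration.integral_diff
lemmas HK_norm_bound = Henstock_Kurzweil_Integration.integral_norm_bound_integral
lemmas abs_integrable_on = set_lebesgue_integral_eq_integral(1)

section \<open>Smooth functions and bump functions\<close>

definition smooth :: "(real \<Rightarrow> real) \<Rightarrow> bool" where
  "smooth f \<longleftrightarrow> (\<forall>k x. ((deriv ^^ k) f) differentiable (at x))"

lemma smooth_coinduct:
  assumes "f \<in> S" and "\<And>g x. g \<in> S \<Longrightarrow> g differentiable (at x)" and "\<And>g. g \<in> S \<Longrightarrow> deriv g \<in> S"
  shows "smooth f"
proof -
  have "(deriv ^^ k) f \<in> S" for k
    by (induction k) (auto simp: assms)
  then show ?thesis using assms(2) by (auto simp: smooth_def)
qed

lemma smooth_differentiable: "smooth f \<Longrightarrow> f differentiable (at x)"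
  unfolding smooth_def by (metis funpow_0)

lemma smooth_deriv: "smooth f \<Longrightarrow> smooth (deriv f)"
  unfolding smooth_def by (metis funpow_Suc_right comp_apply)

lemma smooth_has_deriv: "smooth f \<Longrightarrow> (f has_real_derivative deriv f x) (at x within S)"
  by (meson DERIV_deriv_iff_real_differentiable has_field_derivative_at_within smooth_differentiable)

lemma smooth_continuous: "smooth f \<Longrightarrow> continuous_on S f"
  by (meson DERIV_continuous_on smooth_has_deriv)

lemma smoothI_deriv:
  assumes "\<And>x. (f has_real_derivative g x) (at x)" and "smooth g"
  shows "smooth f"
proof -
  have d: "deriv f = g" using assms(1) DERIV_imp_deriv by blast
  have "((deriv ^^ k) f) differentiable (at x)" for k x
  proof (cases k)
    case 0
    then show ?thesis using assms(1) real_differentiable_def by auto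
  next
    case (Suc m)
    then have "(deriv ^^ k) f = (deriv ^^ m) g" by (simp add: funpow_Suc_right d del: funpow.simps)
    then show ?thesis using assms(2) by (simp add: smooth_def)
  qed
  then show ?thesis by (simp add: smooth_def)
qed

text \<open>A set of functions that contains all products of smooth functions and is closed under differentiation;
  with \<open>smooth_coinduct\<close> this gives smoothness of products without the Leibniz formula for higher derivatives.\<close>

inductive_set product_sums :: "(real \<Rightarrow> real) set" where
  prod: "smooth f \<Longrightarrow> smooth g \<Longrightarrow> (\<lambda>x. f x * g x) \<in> product_sums"
| add: "f \<in> product_sums \<Longrightarrow> g \<in> product_sums \<Longrightarrow> (\<lambda>x. f x + g x) \<in> product_sums"

lemma product_sums_closed:
  assumes "h \<in> product_sums"
  shows "(\<forall>x. h differentiable (at x)) \<and> deriv h \<in> product_sums"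
  using assms
proof induction
  case (prod f g)
  have "deriv (\<lambda>x. f x * g x) = (\<lambda>x. f x * deriv g x + deriv f x * g x)"
    by (rule ext, rule DERIV_imp_deriv) (auto intro!: derivative_eq_intros smooth_has_deriv prod)
  then show ?case
    using prod by (auto intro!: product_sums.add product_sums.prod smooth_deriv
        smooth_differentiable[OF prod(1)] smooth_differentiable[OF prod(2)] derivative_intros)
next
  case (add f g)
  have "deriv (\<lambda>x. f x + g x) = (\<lambda>x. deriv f x + deriv g x)"
    by (rule ext, rule DERIV_imp_deriv)
       (use add in \<open>auto intro!: DERIV_add DERIV_cmult simp: DERIV_deriv_iff_real_differentiable\<close>)
  then show ?case using add by (auto intro!: product_sums.intros derivative_intros)
qed

lemma smooth_product_sums: "h \<in> product_sums \<Longrightarrow> smooth h"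
  by (rule smooth_coinduct[of _ product_sums]) (use product_sums_closed in blast)+

lemma smooth_mult: "smooth f \<Longrightarrow> smooth g \<Longrightarrow> smooth (\<lambda>x. f x * g x)"
  by (rule smooth_product_sums, rule product_sums.prod)

lemma smooth_const: "smooth (\<lambda>x. c)"
proof (rule smooth_coinduct[of _ "range (\<lambda>c x. c)"])
  fix g :: "real \<Rightarrow> real" assume "g \<in> range (\<lambda>c x. c)"
  then obtain d where g: "g = (\<lambda>x. d)" by auto
  have "deriv g = (\<lambda>x. 0)" unfolding g by (rule ext) simp
  then show "deriv g \<in> range (\<lambda>c x. c)" by auto
qed auto

lemma smooth_add:
  assumes "smooth f" "smooth g" shows "smooth (\<lambda>x. f x + g x)"
proof -
  have "(\<lambda>x. f x * 1 + g x * 1) \<in> product_sums"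
    by (intro product_sums.intros assms smooth_const)
  then show ?thesis using smooth_product_sums by simp
qed

lemma smooth_cmult: "smooth f \<Longrightarrow> smooth (\<lambda>x. c * f x)"
  by (intro smooth_mult smooth_const)

lemma smooth_ident: "smooth (\<lambda>x. x)"
  by (rule smoothI_deriv[where g="\<lambda>x. 1"]) (auto intro: smooth_const)

lemma smooth_affine:
  assumes "smooth f" shows "smooth (\<lambda>x. f (r * x + s))"
proof (rule smooth_coinduct[of _ "{\<lambda>x. c * g (r * x + s) | c g. smooth g}"])
  show "(\<lambda>x. f (r * x + s)) \<in> {\<lambda>x. c * g (r * x + s) |c g. smooth g}"
    using assms by (intro CollectI exI[of _ 1] exI[of _ f]) auto
  fix h assume "h \<in> {\<lambda>x. c * g (r * x + s) |c g. smooth g}"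
  then obtain c g where h: "h = (\<lambda>x. c * g (r * x + s))" "smooth g" by auto
  have d: "(h has_real_derivative (c * r) * deriv g (r * x + s)) (at x)" for x
    unfolding h(1)
    by (auto intro!: derivative_eq_intros DERIV_chain2[OF smooth_has_deriv[OF h(2)]])
  then show "h differentiable at x" for x by (auto simp: real_differentiable_def)
  have "deriv h = (\<lambda>x. (c * r) * deriv g (r * x + s))" using d DERIV_imp_deriv by blast
  then show "deriv h \<in> {\<lambda>x. c * g (r * x + s) |c g. smooth g}"
    using smooth_deriv[OF h(2)] by blast
qed

text \<open>The functions \<open>x \<mapsto> x\<^sup>-\<^sup>k exp(-1/x)\<close>, extended by zero to the left half line, span a space
  closed under differentiation; this makes \<open>exp(-1/x)\<close> smooth.\<close>

definition flat :: "nat \<Rightarrow> real \<Rightarrow> real" where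
  "flat k x = (if x > 0 then (1 / x) ^ k * exp (- (1 / x)) else 0)"

lemma flat_tendsto_0: "((\<lambda>x. flat k x) \<longlongrightarrow> 0) (at_right 0)"
proof -
  have "((\<lambda>t::real. t ^ k / exp t) \<longlongrightarrow> 0) at_top" by (rule tendsto_power_div_exp_0)
  then have "((\<lambda>x::real. inverse x ^ k / exp (inverse x)) \<longlongrightarrow> 0) (at_right 0)"
    by (rule filterlim_compose) (rule filterlim_inverse_at_top_right)
  then show ?thesis
  proof (rule Lim_transform_eventually)
    show "\<forall>\<^sub>F x in at_right 0. inverse x ^ k / exp (inverse x) = flat k x"
      unfolding eventually_at_right_field flat_def
      by (intro exI[of _ 1]) (auto simp: inverse_eq_divide exp_minus field_simps)
  qed
qed

lemma flat_deriv:
  "(flat k has_real_derivative - real k * flat (k + 1) x + flat (k + 2) x) (at x)"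
proof -
  consider "x > 0" | "x < 0" | "x = 0" by linarith
  then show ?thesis
  proof cases
    case 1
    have "((\<lambda>x. (1 / x) ^ k * exp (- (1 / x))) has_real_derivative
        - real k * flat (k + 1) x + flat (k + 2) x) (at x)"
    proof -
      have p: "real k * (1 / x) ^ (k - 1) * (1 / x)\<^sup>2 = real k * (1 / x) ^ (k + 1)"
        by (cases k) (simp_all add: power2_eq_square)
      have "((\<lambda>x. (1 / x) ^ k * exp (- (1 / x))) has_real_derivative
          - (real k * (1 / x) ^ (k - 1) * (1 / x)\<^sup>2) * exp (- (1 / x))
          + (1 / x) ^ k * (1 / x)\<^sup>2 * exp (- (1 / x))) (at x)"
      proof -
        have i: "((\<lambda>x. 1 / x) has_real_derivative - ((1 / x)\<^sup>2)) (at x)"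
          using 1 by (auto intro!: derivative_eq_intros simp: power2_eq_square)
        show ?thesis
          by (rule DERIV_cong[OF DERIV_mult[OF DERIV_power[OF i, of k]
                DERIV_chain2[OF DERIV_exp DERIV_minus[OF i]]]]) (simp add: algebra_simps)
      qed
      then show ?thesis
        unfolding p using 1 by (simp add: flat_def power_add power2_eq_square mult.assoc)
    qed
    then show ?thesis
      by (rule has_field_derivative_transform_within_open[of _ _ _ "{0<..}"])
         (use 1 in \<open>auto simp: flat_def\<close>)
  next
    case 2
    have "((\<lambda>x. 0) has_real_derivative - real k * flat (k + 1) x + flat (k + 2) x) (at x)"
      using 2 by (simp add: flat_def)
    then show ?thesis
      by (rule has_field_derivative_transform_within_open[of "\<lambda>x. 0" _ _ "{..<0}"])
         (use 2 in \<open>auto simp: flat_def\<close>)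
  next
    case 3
    have "((\<lambda>y. flat k y / y) \<longlongrightarrow> 0) (at 0)"
    proof (subst filterlim_at_split, intro conjI)
      show "((\<lambda>y. flat k y / y) \<longlongrightarrow> 0) (at_left 0)"
      proof (rule Lim_transform_eventually[of "\<lambda>_. 0"])
        show "\<forall>\<^sub>F x in at_left 0. 0 = flat k x / x"
          unfolding eventually_at_left_field by (intro exI[of _ "-1"]) (auto simp: flat_def)
      qed simp
      show "((\<lambda>y. flat k y / y) \<longlongrightarrow> 0) (at_right 0)"
      proof (rule Lim_transform_eventually[OF flat_tendsto_0[of "Suc k"]])
        show "\<forall>\<^sub>F x in at_right 0. flat (Suc k) x = flat k x / x"
          unfolding eventually_at_right_field by (intro exI[of _ 1]) (auto simp: flat_def)
      qed
    qed
    then show ?thesis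
      using 3 by (simp add: has_field_derivative_iff flat_def)
  qed
qed

inductive_set flat_span :: "(real \<Rightarrow> real) set" where
  base: "flat k \<in> flat_span"
| add: "f \<in> flat_span \<Longrightarrow> g \<in> flat_span \<Longrightarrow> (\<lambda>x. c * f x + d * g x) \<in> flat_span"

lemma flat_span_closed:
  assumes "h \<in> flat_span"
  shows "(\<forall>x. h differentiable (at x)) \<and> deriv h \<in> flat_span"
  using assms
proof induction
  case (base k)
  have "deriv (flat k) = (\<lambda>x. - real k * flat (k + 1) x + 1 * flat (k + 2) x)"
    by (rule ext, rule DERIV_imp_deriv) (use flat_deriv[of k] in simp)
  moreover have "flat k differentiable at x" for x
    using flat_deriv real_differentiable_def by blast
  ultimately show ?case
    using flat_span.add[OF flat_span.base[of "k + 1"] flat_span.base[of "k + 2"], of "- real k" 1] by metis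
next
  case (add f g c d)
  have "deriv (\<lambda>x. c * f x + d * g x) = (\<lambda>x. c * deriv f x + d * deriv g x)"
    by (rule ext, rule DERIV_imp_deriv)
       (use add in \<open>auto intro!: DERIV_add DERIV_cmult simp: DERIV_deriv_iff_real_differentiable\<close>)
  then show ?case using add by (auto intro!: flat_span.intros derivative_intros)
qed

lemma smooth_flat: "smooth (flat k)"
  by (rule smooth_coinduct[of _ flat_span]) (use flat_span_closed flat_span.base in blast)+

text \<open>A bump on \<open>(c,d)\<close>, which tends to the indicator as \<open>n\<close> grows.\<close>

definition bump :: "nat \<Rightarrow> real \<Rightarrow> real \<Rightarrow> real \<Rightarrow> real" where
  "bump n c d x = flat 0 (real n * x + - (real n * c)) * flat 0 (- real n * x + real n * d)"

lemma smooth_bump: "smooth (bump n c d)"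
  unfolding bump_def[abs_def] by (intro smooth_mult smooth_affine smooth_flat)

lemma flat0_bounds: "0 \<le> flat 0 x" "flat 0 x \<le> 1"
  by (auto simp: flat_def)

lemma bump_bounds: "0 \<le> bump n c d x" "bump n c d x \<le> 1"
  unfolding bump_def using flat0_bounds by (auto intro!: mult_nonneg_nonneg mult_le_one)

lemma bump_outside: "x \<le> c \<or> d \<le> x \<Longrightarrow> bump n c d x = 0"
proof -
  assume "x \<le> c \<or> d \<le> x"
  then have "real n * x + - (real n * c) \<le> 0 \<or> - real n * x + real n * d \<le> 0"
    using mult_left_mono[of x c "real n"] mult_left_mono[of d x "real n"] by auto
  moreover have "flat 0 s = 0" if "s \<le> 0" for s using that by (simp add: flat_def)
  ultimately show ?thesis unfolding bump_def by (metis mult_zero_left mult_zero_right)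
qed

lemma bump_pos: "c < x \<Longrightarrow> x < d \<Longrightarrow> n > 0 \<Longrightarrow> bump n c d x > 0"
proof -
  assume a: "c < x" "x < d" "n > 0"
  have "real n * x + - (real n * c) = real n * (x - c)" "- real n * x + real n * d = real n * (d - x)"
    by (simp_all add: algebra_simps)
  then show ?thesis unfolding bump_def flat_def using a by simp
qed

lemma flat0_limit: "s > 0 \<Longrightarrow> (\<lambda>n. flat 0 (real n * s)) \<longlonglongrightarrow> 1"
proof -
  assume s: "s > 0"
  have "(\<lambda>n. exp (- (1 / s * inverse (real n)))) \<longlonglongrightarrow> exp (- (1 / s * 0))"
    by (intro tendsto_intros lim_inverse_n)
  then have "(\<lambda>n. exp (- (1 / s * inverse (real n)))) \<longlonglongrightarrow> 1" by simp
  then show ?thesis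
  proof (rule Lim_transform_eventually)
    show "\<forall>\<^sub>F n in sequentially. exp (- (1 / s * inverse (real n))) = flat 0 (real n * s)"
      using eventually_gt_at_top[of 0] by eventually_elim (use s in \<open>auto simp: flat_def field_simps\<close>)
  qed
qed

lemma bump_limit: "(\<lambda>n. bump n c d x) \<longlonglongrightarrow> indicator {c<..<d} x"
proof (cases "c < x \<and> x < d")
  case True
  have "(\<lambda>n. flat 0 (real n * (x - c)) * flat 0 (real n * (d - x))) \<longlonglongrightarrow> 1 * 1"
    using True by (intro tendsto_mult flat0_limit) auto
  then show ?thesis using True by (simp add: bump_def[abs_def] algebra_simps)
next
  case False
  then have "bump n c d x = 0" for n by (intro bump_outside) auto
  then show ?thesis using False by auto
qed

lemma test_fun_smooth: "\<psi> \<in> test_fun a b \<Longrightarrow> smooth \<psi>"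
  by (auto simp: test_fun_def smooth_def)

lemma test_funI:
  "smooth \<psi> \<Longrightarrow> a < c \<Longrightarrow> d < b \<Longrightarrow> (\<And>x. x \<notin> {c..d} \<Longrightarrow> \<psi> x = 0) \<Longrightarrow> \<psi> \<in> test_fun a b"
  by (auto simp: test_fun_def smooth_def)

lemma test_fun_supp:
  "\<psi> \<in> test_fun a b \<Longrightarrow> \<exists>c d. a < c \<and> d < b \<and> (\<forall>x. x \<notin> {c..d} \<longrightarrow> \<psi> x = 0)"
  by (auto simp: test_fun_def)

lemma bump_test_fun: "a < c \<Longrightarrow> d < b \<Longrightarrow> bump n c d \<in> test_fun a b"
  by (rule test_funI[of _ _ c d]) (auto intro: smooth_bump bump_outside)

lemma test_fun_smooth_mult:
  assumes "\<psi> \<in> test_fun a b" "smooth h" shows "(\<lambda>x. h x * \<psi> x) \<in> test_fun a b"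
proof -
  obtain c d where "a < c" "d < b" "\<forall>x. x \<notin> {c..d} \<longrightarrow> \<psi> x = 0" using test_fun_supp[OF assms(1)] by blast
  then show ?thesis
    using smooth_mult[OF assms(2) test_fun_smooth[OF assms(1)]] by (intro test_funI[of _ _ c d]) auto
qed

lemma test_fun_cmult: "\<psi> \<in> test_fun a b \<Longrightarrow> (\<lambda>x. k * \<psi> x) \<in> test_fun a b"
  by (rule test_fun_smooth_mult[OF _ smooth_const])

lemma test_fun_add:
  assumes "\<psi> \<in> test_fun a b" "\<eta> \<in> test_fun a b" shows "(\<lambda>x. \<psi> x + \<eta> x) \<in> test_fun a b"
proof -
  obtain c d where 1: "a < c" "d < b" "\<forall>x. x \<notin> {c..d} \<longrightarrow> \<psi> x = 0" using test_fun_supp[OF assms(1)] by blast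
  obtain c' d' where 2: "a < c'" "d' < b" "\<forall>x. x \<notin> {c'..d'} \<longrightarrow> \<eta> x = 0" using test_fun_supp[OF assms(2)] by blast
  show ?thesis
  proof (rule test_funI[of _ _ "min c c'" "max d d'"])
    show "smooth (\<lambda>x. \<psi> x + \<eta> x)" by (intro smooth_add test_fun_smooth[OF assms(1)] test_fun_smooth[OF assms(2)])
    show "\<psi> x + \<eta> x = 0" if "x \<notin> {min c c'..max d d'}" for x
    proof -
      have "x \<notin> {c..d}" "x \<notin> {c'..d'}" using that by auto
      then show ?thesis by (simp add: 1(3) 2(3))
    qed
  qed (use 1 2 in auto)
qed

lemma test_fun_deriv:
  assumes "\<psi> \<in> test_fun a b" shows "deriv \<psi> \<in> test_fun a b"
proof -
  obtain c d where 1: "a < c" "d < b" "\<forall>x. x \<notin> {c..d} \<longrightarrow> \<psi> x = 0" using test_fun_supp[OF assms(1)] by blast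
  have "deriv \<psi> x = 0" if "x \<notin> {c..d}" for x
  proof -
    have "(\<psi> has_real_derivative 0) (at x)"
      by (rule has_field_derivative_transform_within_open[of "\<lambda>_. 0" _ _ "- {c..d}"])
         (use that 1 in \<open>auto simp: open_Compl\<close>)
    then show ?thesis by (rule DERIV_imp_deriv)
  qed
  then show ?thesis using 1 smooth_deriv[OF test_fun_smooth[OF assms]] by (intro test_funI[of _ _ c d]) auto
qed

lemma test_fun_zero:
  assumes "\<psi> \<in> test_fun a b" "x \<le> a \<or> b \<le> x" shows "\<psi> x = 0"
  using test_fun_supp[OF assms(1)] assms(2) by auto

lemma test_fun_bounded:
  assumes "\<psi> \<in> test_fun a b" obtains K where "\<And>x. \<bar>\<psi> x\<bar> \<le> K"
proof -
  obtain c d where 1: "a < c" "d < b" "\<forall>x. x \<notin> {c..d} \<longrightarrow> \<psi> x = 0" using test_fun_supp[OF assms(1)] by blast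
  have "bounded (\<psi> ` {c..d})"
    by (intro compact_imp_bounded compact_continuous_image smooth_continuous test_fun_smooth[OF assms]) auto
  then obtain K where K: "\<forall>x\<in>{c..d}. \<bar>\<psi> x\<bar> \<le> K" by (auto simp: bounded_iff)
  have "\<bar>\<psi> x\<bar> \<le> max K 0" for x
    using K 1(3) by (cases "x \<in> {c..d}") (auto simp: le_max_iff_disj)
  then show ?thesis using that by blast
qed

text \<open>The primitive vanishes to the right of the support because the total integral does. Hence the test functions of mean
  zero are derivatives of test functions.\<close>

lemma test_fun_primitive:
  assumes "a < b" "\<eta> \<in> test_fun a b" "(\<eta> has_integral 0) {a..b}"
  defines "\<psi> \<equiv> \<lambda>x. integral {a..x} \<eta>"
  shows "\<psi> \<in> test_fun a b" "\<And>x. deriv \<psi> x = \<eta> x"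
proof -
  obtain c d where 1: "a < c" "d < b" "\<forall>x. x \<notin> {c..d} \<longrightarrow> \<eta> x = 0" using test_fun_supp[OF assms(2)] by blast
  have z: "\<psi> x = 0" if "x < c" for x
    unfolding \<psi>_def using 1 that by (intro integral_unique has_integral_is_0) auto
  have c: "continuous_on S \<eta>" for S by (intro smooth_continuous test_fun_smooth[OF assms(2)])
  have d: "(\<psi> has_real_derivative \<eta> x) (at x)" for x
  proof (cases "x < c")
    case True
    then have "((\<lambda>_. 0) has_real_derivative \<eta> x) (at x)" using spec[OF 1(3), of x] by auto
    then show ?thesis
      by (rule has_field_derivative_transform_within_open[of _ _ _ "{..<c}"]) (use True z in auto)
  next
    case False
    have "(\<psi> has_real_derivative \<eta> x) (at x within {a..x+1})"
      unfolding \<psi>_def has_real_derivative_iff_has_vector_derivative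
      by (rule integral_has_vector_derivative) (use False 1 c in auto)
    moreover have "at x within {a..x+1} = at x"
      by (rule at_within_interior) (use False 1 in auto)
    ultimately show ?thesis by simp
  qed
  then show "deriv \<psi> x = \<eta> x" for x by (rule DERIV_imp_deriv)
  have "smooth \<psi>" using d assms(2) test_fun_smooth by (metis smoothI_deriv)
  moreover have "\<psi> x = 0" if "x \<notin> {c..d}" for x
  proof (cases "x < c")
    case False
    with that have x: "x > d" "x > a" using 1 by auto
    show ?thesis
    proof (cases "x \<le> b")
      case True
      have "integral {a..x} \<eta> + integral {x..b} \<eta> = integral {a..b} \<eta>"
        by (rule HK_combine)
           (use x True c in \<open>auto intro!: integrable_continuous_real\<close>)
      moreover have "integral {x..b} \<eta> = 0"
        using 1 x by (intro integral_unique has_integral_is_0) auto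
      ultimately show ?thesis using assms(3) by (simp add: \<psi>_def integral_unique)
    next
      case False
      have "integral {a..b} \<eta> + integral {b..x} \<eta> = integral {a..x} \<eta>"
        by (rule HK_combine)
           (use x False c assms(1) in \<open>auto intro!: integrable_continuous_real\<close>)
      moreover have "integral {b..x} \<eta> = 0"
        using 1 x by (intro integral_unique has_integral_is_0) auto
      ultimately show ?thesis using assms(3) by (simp add: \<psi>_def integral_unique)
    qed
  qed (use z in auto)
  ultimately show "\<psi> \<in> test_fun a b" using 1 by (intro test_funI[of _ _ c d]) auto
qed

section \<open>Absolutely continuous functions on an interval\<close>

lemma integrable_lebesgue_on_interval:
  fixes f :: "real \<Rightarrow> real"
  shows "integrable (Leb a b) f \<longleftrightarrow> f absolutely_integrable_on {a..b}"
proof -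
  have "integrable (Leb a b) f \<longleftrightarrow> f absolutely_integrable_on box a b"
    by (simp add: integrable_restrict_space set_integrable_def)
  then show ?thesis by (simp only: absolutely_integrable_on_open_interval cbox_interval)
qed

lemma LINT_interval:
  fixes f :: "real \<Rightarrow> real"
  assumes "f absolutely_integrable_on {a..b}"
  shows "(LINT x|Leb a b. f x) = integral {a..b} f"
  using lebesgue_integral_eq_integral[OF integrable_lebesgue_on_interval[THEN iffD2, OF assms]]
  by (simp add: integral_open_interval_real)

lemma AE_interval_iff:
  "(AE x in Leb a b. P (x::real)) \<longleftrightarrow> (\<exists>N. negligible N \<and> (\<forall>x\<in>{a<..<b} - N. P x))"
proof -
  have "(AE x in Leb a b. P x) \<longleftrightarrow> (AE x in lebesgue. x \<in> {a<..<b} \<longrightarrow> P x)"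
    by (simp add: AE_restrict_space_iff)
  also have "\<dots> \<longleftrightarrow> (\<exists>N. negligible N \<and> (\<forall>x\<in>{a<..<b} - N. P x))"
  proof
    assume "AE x in lebesgue. x \<in> {a<..<b} \<longrightarrow> P x"
    then obtain N where "{x. \<not> (x \<in> {a<..<b} \<longrightarrow> P x)} \<subseteq> N" "N \<in> null_sets lebesgue"
      unfolding eventually_ae_filter by auto
    then show "\<exists>N. negligible N \<and> (\<forall>x\<in>{a<..<b} - N. P x)"
      by (intro exI[of _ N]) (auto simp: negligible_iff_null_sets)
  next
    assume "\<exists>N. negligible N \<and> (\<forall>x\<in>{a<..<b} - N. P x)"
    then obtain N where "N \<in> null_sets lebesgue" "\<forall>x\<in>{a<..<b} - N. P x"
      by (auto simp: negligible_iff_null_sets)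
    then show "AE x in lebesgue. x \<in> {a<..<b} \<longrightarrow> P x"
      unfolding eventually_ae_filter by (intro bexI[of _ N]) auto
  qed
  finally show ?thesis .
qed

lemma absolutely_integrable_cong_AE:
  fixes f g :: "real \<Rightarrow> real"
  assumes "f absolutely_integrable_on {a..b}" "AE x in Leb a b. f x = g x"
  shows "g absolutely_integrable_on {a..b}"
proof -
  obtain N where N: "negligible N" "\<forall>x\<in>{a<..<b} - N. f x = g x"
    using assms(2) unfolding AE_interval_iff by blast
  show ?thesis
    by (rule absolutely_integrable_spike[OF assms(1), of "N \<union> {a,b}"]) (use N in auto)
qed

lemma integral_cong_AE_interval:
  fixes f g :: "real \<Rightarrow> real"
  assumes "AE x in Leb a b. f x = g x" "a \<le> c" "d \<le> b"
  shows "integral {c..d} f = integral {c..d} g"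
proof -
  obtain N where N: "negligible N" "\<forall>x\<in>{a<..<b} - N. f x = g x"
    using assms(1) unfolding AE_interval_iff by blast
  show ?thesis
    by (rule integral_spike[of "N \<union> {a,b}"]) (use N assms in auto)
qed

text \<open>Absolute continuity with a chosen derivative \<open>f\<close>, expressed through the Henstock-Kurzweil integral so that \<open>F\<close>
  is determined at every point of the closed interval.\<close>

definition ac :: "real \<Rightarrow> real \<Rightarrow> (real \<Rightarrow> real) \<Rightarrow> (real \<Rightarrow> real) \<Rightarrow> bool" where
  "ac a b F f \<longleftrightarrow> f absolutely_integrable_on {a..b} \<and>
     (\<forall>x\<in>{a..b}. (f has_integral (F x - F a)) {a..x})"

lemma acD_integrable: "ac a b F f \<Longrightarrow> f absolutely_integrable_on {a..b}"
  by (simp add: ac_def)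

lemma ac_sub_integrable: "ac a b F f \<Longrightarrow> a \<le> c \<Longrightarrow> d \<le> b \<Longrightarrow> f absolutely_integrable_on {c..d}"
  by (meson absolutely_integrable_on_subinterval acD_integrable atLeastatMost_subset_iff)

lemma ac_integral:
  assumes "ac a b F f" "a \<le> c" "c \<le> d" "d \<le> b"
  shows "(f has_integral (F d - F c)) {c..d}"
proof -
  have i: "f integrable_on {c..d}" "f integrable_on {a..d}"
    using ac_sub_integrable[OF assms(1)] assms abs_integrable_on by auto
  have "integral {a..c} f + integral {c..d} f = integral {a..d} f"
    by (rule HK_combine) (use assms i in auto)
  moreover have "integral {a..c} f = F c - F a" "integral {a..d} f = F d - F a"
    using assms by (auto simp: ac_def intro!: integral_unique)
  ultimately show ?thesis using i(1) by (auto simp: has_integral_iff)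
qed

lemma acI_primitive:
  assumes "f absolutely_integrable_on {a..b}" "\<And>x. x \<in> {a..b} \<Longrightarrow> F x = C + integral {a..x} f"
  shows "ac a b F f"
proof -
  have "(f has_integral (F x - F a)) {a..x}" if "x \<in> {a..b}" for x
  proof -
    have "f absolutely_integrable_on {a..x}"
      using assms(1) that by (meson absolutely_integrable_on_subinterval atLeastAtMost_iff atLeastatMost_subset_iff order_refl)
    then show ?thesis
      using assms(2)[OF that] assms(2)[of a] that abs_integrable_on[of "{a..x}" f]
      by (auto simp: has_integral_iff)
  qed
  then show ?thesis using assms(1) by (simp add: ac_def)
qed

lemma ac_continuous: assumes "ac a b F f" shows "continuous_on {a..b} F"
proof -
  have "f integrable_on {a..b}" using assms acD_integrable abs_integrable_on by blast
  then have "continuous_on {a..b} (\<lambda>x. F a + integral {a..x} f)"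
    by (intro continuous_intros indefinite_integral_continuous_1)
  moreover have "F a + integral {a..x} f = F x" if "x \<in> {a..b}" for x
    using assms that by (auto simp: ac_def dest!: bspec[of _ _ x] integral_unique)
  ultimately show ?thesis by (metis (no_types, lifting) continuous_on_cong)
qed

lemma ac_cong:
  assumes "ac a b F f" "\<And>x. x \<in> {a..b} \<Longrightarrow> F x = G x" "AE x in Leb a b. f x = g x"
  shows "ac a b G g"
proof -
  have g: "g absolutely_integrable_on {a..b}"
    using absolutely_integrable_cong_AE[OF acD_integrable[OF assms(1)] assms(3)] .
  show ?thesis
  proof (rule acI_primitive[OF g, of _ "F a"])
    fix x assume x: "x \<in> {a..b}"
    have "integral {a..x} f = F x - F a" using assms(1) x by (auto simp: ac_def intro!: integral_unique)
    moreover have "integral {a..x} f = integral {a..x} g"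
      using integral_cong_AE_interval[OF assms(3)] x by auto
    ultimately show "G x = F a + integral {a..x} g" using assms(2)[OF x] by simp
  qed
qed

lemma ac_add: "ac a b F f \<Longrightarrow> ac a b G g \<Longrightarrow> ac a b (\<lambda>x. F x + G x) (\<lambda>x. f x + g x)"
  unfolding ac_def
proof (intro conjI ballI; elim conjE)
  assume f: "f absolutely_integrable_on {a..b}" "\<forall>x\<in>{a..b}. (f has_integral F x - F a) {a..x}"
    and g: "g absolutely_integrable_on {a..b}" "\<forall>x\<in>{a..b}. (g has_integral G x - G a) {a..x}"
  show "(\<lambda>x. f x + g x) absolutely_integrable_on {a..b}" by (rule set_integral_add(1)[OF f(1) g(1)])
  show "((\<lambda>x. f x + g x) has_integral F x + G x - (F a + G a)) {a..x}" if "x \<in> {a..b}" for x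
    using has_integral_add[OF bspec[OF f(2) that] bspec[OF g(2) that]] by (simp add: algebra_simps)
qed

lemma ac_cmult: assumes "ac a b F f" shows "ac a b (\<lambda>x. c * F x) (\<lambda>x. c * f x)"
  unfolding ac_def
proof (intro conjI ballI)
  show "(\<lambda>x. c * f x) absolutely_integrable_on {a..b}"
    using absolutely_integrable_scaleR_left[OF acD_integrable[OF assms], of c] by simp
  show "((\<lambda>x. c * f x) has_integral c * F x - c * F a) {a..x}" if "x \<in> {a..b}" for x
    using has_integral_mult_right[of f "F x - F a" "{a..x}" c] that assms
    by (simp add: ac_def right_diff_distrib)
qed

lemma ac_diff: "ac a b F f \<Longrightarrow> ac a b G g \<Longrightarrow> ac a b (\<lambda>x. F x - G x) (\<lambda>x. f x - g x)"
  using ac_add[of a b F f "\<lambda>x. -1 * G x" "\<lambda>x. -1 * g x"] ac_cmult[of a b G g "-1"] by simp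

lemma ac_C1:
  assumes "\<And>x. x \<in> {a..b} \<Longrightarrow> (F has_real_derivative f x) (at x within {a..b})" "continuous_on {a..b} f"
  shows "ac a b F f"
  unfolding ac_def
proof (intro conjI ballI)
  show "f absolutely_integrable_on {a..b}"
    using absolutely_integrable_continuous_real assms(2) by blast
  fix x assume x: "x \<in> {a..b}"
  show "(f has_integral F x - F a) {a..x}"
  proof (rule fundamental_theorem_of_calculus)
    show "a \<le> x" using x by simp
    show "(F has_vector_derivative f y) (at y within {a..x})" if "y \<in> {a..x}" for y
      using assms(1)[of y] that x
      by (auto simp: has_real_derivative_iff_has_vector_derivative intro: has_vector_derivative_within_subset)
  qed
qed

lemma ac_const: "ac a b (\<lambda>x. c) (\<lambda>x. 0)"
  by (rule ac_C1) auto

lemma ac_smooth: "smooth \<psi> \<Longrightarrow> ac a b \<psi> (deriv \<psi>)"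
  by (intro ac_C1 smooth_has_deriv smooth_continuous smooth_deriv)

lemma absolutely_integrable_cont_mult:
  fixes f :: "real \<Rightarrow> real"
  assumes "f absolutely_integrable_on {a..b}" "continuous_on {a..b} G"
  shows "(\<lambda>x. G x * f x) absolutely_integrable_on {a..b}"
  by (rule absolutely_integrable_bounded_measurable_product_real)
     (use assms in \<open>auto intro!: continuous_imp_measurable_on_sets_lebesgue compact_imp_bounded compact_continuous_image\<close>)

text \<open>If the increments of \<open>\<phi>\<close> on short intervals are at most \<open>e\<close> times the mass of \<open>k\<close>, then adding them up gives
  \<open>\<bar>\<phi>(x) - \<phi>(a)\<bar> \<le> e \<integral> k\<close> for every \<open>e\<close>. It replaces differentiation almost everywhere in the product rule.\<close>

lemma constant_of_small_increments:
  fixes \<phi> K :: "real \<Rightarrow> real"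
  assumes "a \<le> b"
    and small: "\<And>e. e > 0 \<Longrightarrow> \<exists>\<delta>>0. \<forall>u v. a \<le> u \<longrightarrow> u \<le> v \<longrightarrow> v \<le> b \<longrightarrow> v - u < \<delta> \<longrightarrow> \<bar>\<phi> v - \<phi> u\<bar> \<le> e * (K v - K u)"
  shows "\<phi> b = \<phi> a"
proof -
  have le: "\<bar>\<phi> b - \<phi> a\<bar> \<le> e * (K b - K a)" if e0: "e > 0" for e
  proof -
    obtain \<delta> where d: "\<delta> > 0" and *: "\<And>u v. a \<le> u \<Longrightarrow> u \<le> v \<Longrightarrow> v \<le> b \<Longrightarrow> v - u < \<delta> \<Longrightarrow> \<bar>\<phi> v - \<phi> u\<bar> \<le> e * (K v - K u)"
      using small[OF e0] by metis
    obtain n where n: "real n * \<delta> > b - a" using reals_Archimedean3[OF d] by metis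
    have n0: "n > 0" using n assms(1) by (cases n) auto
    define h where "h = (b - a) / real n"
    have h: "h \<ge> 0" "h < \<delta>" "real n * h = b - a"
      using n n0 assms(1) by (auto simp: h_def field_simps)
    have "\<bar>\<phi> (a + real i * h) - \<phi> a\<bar> \<le> e * (K (a + real i * h) - K a)" if "i \<le> n" for i
      using that
    proof (induction i)
      case (Suc i)
      have "real (Suc i) * h \<le> real n * h" using Suc.prems h(1) by (intro mult_right_mono) auto
      then have "\<bar>\<phi> (a + real (Suc i) * h) - \<phi> (a + real i * h)\<bar> \<le> e * (K (a + real (Suc i) * h) - K (a + real i * h))"
        using h by (intro *) (auto simp: algebra_simps)
      then show ?case using Suc by (simp add: right_diff_distrib)
    qed auto
    from this[of n] show ?thesis using h(3) by simp
  qed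
  show ?thesis
  proof (rule ccontr)
    assume ne: "\<phi> b \<noteq> \<phi> a"
    define D where "D = \<bar>\<phi> b - \<phi> a\<bar>"
    have D: "D > 0" using ne by (simp add: D_def)
    have k: "K b - K a > 0" using le[of 1] D by (simp add: D_def)
    have "D \<le> D / (2 * (K b - K a)) * (K b - K a)"
      unfolding D_def using D k by (intro le) (simp add: D_def)
    also have "\<dots> = D / 2" using k by (simp add: field_simps)
    finally show False using D by simp
  qed
qed

text \<open>On a short interval \<open>[u,v]\<close> the increment of \<open>F G\<close> is the integral of \<open>f G(v) + F(u) g\<close>, and by uniform
  continuity this differs from the integral of \<open>f G + F g\<close> by a small multiple of the mass of \<open>\<bar>f\<bar> + \<bar>g\<bar>\<close>.\<close>

lemma ac_mult:
  assumes F: "ac a b F f" and G: "ac a b G g"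
  shows "ac a b (\<lambda>x. F x * G x) (\<lambda>x. f x * G x + F x * g x)"
proof -
  define h where "h x = G x * f x + F x * g x" for x
  note cF = ac_continuous[OF F] and cG = ac_continuous[OF G]
  have hi: "h absolutely_integrable_on {a..b}"
    unfolding h_def by (intro set_integral_add(1) absolutely_integrable_cont_mult acD_integrable[OF F]
        acD_integrable[OF G] cF cG)
  have "F x * G x = F a * G a + integral {a..x} h" if x: "x \<in> {a..b}" for x
  proof -
    define \<phi> where "\<phi> u = F u * G u - integral {a..u} h" for u
    define k where "k u = \<bar>f u\<bar> + \<bar>g u\<bar>" for u
    have ki: "k absolutely_integrable_on {a..b}"
      unfolding k_def by (intro set_integral_add(1) set_integrable_abs acD_integrable[OF F] acD_integrable[OF G])
    have sub: "q integrable_on {u..v}" if "q absolutely_integrable_on {a..b}" "a \<le> u" "v \<le> b" for q :: "real \<Rightarrow> real" and u v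
      using that by (meson absolutely_integrable_on_subinterval atLeastatMost_subset_iff abs_integrable_on)
    have comb: "integral {a..u} q + integral {u..v} q = integral {a..v} q"
      if "q absolutely_integrable_on {a..b}" "a \<le> u" "u \<le> v" "v \<le> b" for q :: "real \<Rightarrow> real" and u v
      using that sub[OF that(1), of a v] by (intro HK_combine) auto
    have "\<phi> x = \<phi> a"
    proof (rule constant_of_small_increments[where a=a and b=x and \<phi>=\<phi> and K="\<lambda>u. integral {a..u} k"])
      show "a \<le> x" using x by simp
      fix e :: real assume e: "e > 0"
      have "uniformly_continuous_on {a..b} F" "uniformly_continuous_on {a..b} G"
        using cF cG by (auto intro: compact_uniformly_continuous)
      then obtain d1 d2 where d: "d1 > 0" "d2 > 0"
        "\<And>s t. s \<in> {a..b} \<Longrightarrow> t \<in> {a..b} \<Longrightarrow> \<bar>s - t\<bar> < d1 \<Longrightarrow> \<bar>F s - F t\<bar> < e"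
        "\<And>s t. s \<in> {a..b} \<Longrightarrow> t \<in> {a..b} \<Longrightarrow> \<bar>s - t\<bar> < d2 \<Longrightarrow> \<bar>G s - G t\<bar> < e"
        using e unfolding uniformly_continuous_on_def dist_real_def by metis
      show "\<exists>\<delta>>0. \<forall>u v. a \<le> u \<longrightarrow> u \<le> v \<longrightarrow> v \<le> x \<longrightarrow> v - u < \<delta> \<longrightarrow>
          \<bar>\<phi> v - \<phi> u\<bar> \<le> e * (integral {a..v} k - integral {a..u} k)"
      proof (intro exI[of _ "min d1 d2"] conjI allI impI)
        fix u v assume uv: "a \<le> u" "u \<le> v" "v \<le> x" "v - u < min d1 d2"
        have vb: "v \<le> b" using uv x by simp
        have 1: "((\<lambda>s. f s * G v + F u * g s) has_integral ((F v - F u) * G v + F u * (G v - G u))) {u..v}"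
          using uv vb by (intro has_integral_add has_integral_mult_left has_integral_mult_right ac_integral[OF F] ac_integral[OF G])
        have 2: "(h has_integral (integral {a..v} h - integral {a..u} h)) {u..v}"
          using comb[OF hi uv(1,2) vb] sub[OF hi uv(1) vb] by (auto simp: has_integral_iff)
        have 3: "(k has_integral (integral {a..v} k - integral {a..u} k)) {u..v}"
          using comb[OF ki uv(1,2) vb] sub[OF ki uv(1) vb] by (auto simp: has_integral_iff)
        have 4: "((\<lambda>s. (f s * G v + F u * g s) - h s) has_integral (\<phi> v - \<phi> u)) {u..v}"
          using has_integral_diff[OF 1 2] by (simp add: \<phi>_def algebra_simps)
        have 5: "norm ((f s * G v + F u * g s) - h s) \<le> e * k s" if s: "s \<in> {u..v}" for s
        proof -
          have "\<bar>G v - G s\<bar> \<le> e" "\<bar>F u - F s\<bar> \<le> e"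
            using d(4)[of v s] d(3)[of u s] uv vb s by (auto intro!: less_imp_le)
          then have "\<bar>f s * (G v - G s)\<bar> + \<bar>(F u - F s) * g s\<bar> \<le> \<bar>f s\<bar> * e + e * \<bar>g s\<bar>"
            unfolding abs_mult by (intro add_mono mult_left_mono mult_right_mono) auto
          moreover have "(f s * G v + F u * g s) - h s = f s * (G v - G s) + (F u - F s) * g s"
            by (simp add: h_def algebra_simps)
          ultimately show ?thesis by (simp add: k_def algebra_simps)
        qed
        have "norm (integral {u..v} (\<lambda>s. (f s * G v + F u * g s) - h s)) \<le> integral {u..v} (\<lambda>s. e * k s)"
          using 4 has_integral_mult_right[OF 3, of e] 5 by (intro integral_norm_bound_integral) (auto simp: has_integral_iff)
        then show "\<bar>\<phi> v - \<phi> u\<bar> \<le> e * (integral {a..v} k - integral {a..u} k)"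
          unfolding integral_unique[OF 4] integral_unique[OF has_integral_mult_right[OF 3, of e]] by simp
      qed (use d in auto)
    qed
    then show ?thesis by (simp add: \<phi>_def)
  qed
  then have "ac a b (\<lambda>x. F x * G x) h" by (rule acI_primitive[OF hi])
  then show ?thesis by (simp add: h_def[abs_def] mult.commute)
qed

lemma ac_has_derivative:
  assumes "ac a b F f" "continuous_on {a..b} f" "x \<in> {a..b}"
  shows "(F has_real_derivative f x) (at x within {a..b})"
proof -
  have "((\<lambda>u. integral {a..u} f) has_vector_derivative f x) (at x within {a..b})"
    by (rule integral_has_vector_derivative) (use assms in auto)
  then have "((\<lambda>u. F a + integral {a..u} f) has_real_derivative f x) (at x within {a..b})"
    by (auto simp: has_real_derivative_iff_has_vector_derivative intro!: derivative_eq_intros)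
  then show ?thesis
  proof (rule has_field_derivative_transform_within[of _ _ _ _ 1])
    show "F a + integral {a..u} f = F u" if "u \<in> {a..b}" for u
      using assms(1) that by (auto simp: ac_def dest!: bspec[of _ _ u] integral_unique)
  qed (use assms in auto)
qed

lemma negligible_diff_dense:
  assumes "negligible N" "a < b" "x \<in> {a..b}" "e > 0"
  obtains y where "y \<in> {a<..<b} - N" "\<bar>y - x\<bar> < (e::real)"
proof -
  have "a < b" "a < x + e" "x - e < b" "x - e < x + e" using assms by auto
  then have "max a (x - e) < min b (x + e)" by (simp only: max_less_iff_conj min_less_iff_conj)
  then have "{max a (x - e)<..<min b (x + e)} \<noteq> {}"
    by (simp only: greaterThanLessThan_empty_iff not_le not_False_eq_True)
  then have "\<not> negligible {max a (x - e)<..<min b (x + e)}"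
    by (intro open_not_negligible) auto
  then have "\<not> {max a (x - e)<..<min b (x + e)} \<subseteq> N" using assms(1) negligible_subset by blast
  then obtain y where "y \<in> {max a (x - e)<..<min b (x + e)}" "y \<notin> N" by blast
  then show ?thesis by (intro that[of y]) (auto simp: abs_less_iff)
qed

lemma continuous_AE_eq:
  fixes F G :: "real \<Rightarrow> real"
  assumes "a < b" "continuous_on {a..b} F" "continuous_on {a..b} G"
    and "AE x in Leb a b. F x = G x" "x \<in> {a..b}"
  shows "F x = G x"
proof -
  obtain N where N: "negligible N" "\<forall>x\<in>{a<..<b} - N. F x = G x"
    using assms(4) unfolding AE_interval_iff by blast
  have "\<exists>y. y \<in> {a<..<b} - N \<and> \<bar>y - x\<bar> < 1 / real (Suc n)" for n
  proof -
    have "1 / real (Suc n) > 0" by simp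
    then obtain z where "z \<in> {a<..<b} - N" "\<bar>z - x\<bar> < 1 / real (Suc n)"
      by (rule negligible_diff_dense[OF N(1) assms(1,5)])
    then show ?thesis by blast
  qed
  then obtain y where y: "\<And>n. y n \<in> {a<..<b} - N" "\<And>n. \<bar>y n - x\<bar> < 1 / real (Suc n)" by metis
  have lim: "y \<longlonglongrightarrow> x"
  proof (rule LIM_zero_cancel, rule Lim_null_comparison)
    show "(\<lambda>n. 1 / real (Suc n)) \<longlonglongrightarrow> 0" using LIMSEQ_inverse_real_of_nat by (simp add: inverse_eq_divide)
    show "\<forall>\<^sub>F n in sequentially. norm (y n - x) \<le> 1 / real (Suc n)"
      using y(2) by (auto intro!: always_eventually less_imp_le simp del: of_nat_Suc)
  qed
  have yin: "y n \<in> {a..b}" for n using y(1)[of n] by auto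
  have "(\<lambda>n. F (y n)) \<longlonglongrightarrow> F x" "(\<lambda>n. G (y n)) \<longlonglongrightarrow> G x"
    by (rule continuous_on_tendsto_compose[OF assms(2) lim assms(5)] continuous_on_tendsto_compose[OF assms(3) lim assms(5)],
        intro always_eventually allI yin)+
  moreover have "F (y n) = G (y n)" for n using y N by auto
  ultimately show ?thesis using LIMSEQ_unique[of "\<lambda>n. F (y n)" "F x" "G x"] by auto
qed

section \<open>The fundamental lemma of the calculus of variations\<close>

text \<open>By the Lebesgue differentiation theorem the value at almost every point is a limit of means over
  intervals to the right of the point.\<close>

lemma AE_nonneg_of_interval_integrals:
  fixes f :: "real \<Rightarrow> real"
  assumes "f absolutely_integrable_on {c..d}"
    and "\<And>u v. c < u \<Longrightarrow> u < v \<Longrightarrow> v < d \<Longrightarrow> integral {u..v} f \<ge> 0"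
  shows "AE x in Leb c d. f x \<ge> 0"
proof -
  define h where "h x = (if x \<in> {c..d} then f x else 0)" for x
  have "h integrable_on cbox u v" for u v
  proof -
    have "f integrable_on {c..d}" using assms(1) abs_integrable_on by blast
    then have "h integrable_on UNIV" unfolding h_def integrable_restrict_UNIV .
    then show ?thesis using integrable_on_subcbox by blast
  qed
  from integrable_ccontinuous_explicit[OF this] obtain N where N: "negligible N"
    "\<And>x e. x \<notin> N \<Longrightarrow> 0 < e \<Longrightarrow> \<exists>d>0. \<forall>k. 0 < k \<and> k < d \<longrightarrow> norm (integral (cbox x (x + k *\<^sub>R One)) h /\<^sub>R k ^ DIM(real) - h x) < e"
    by metis
  have "f x \<ge> 0" if x: "x \<in> {c<..<d} - N" for x
  proof (rule ccontr)
    assume neg: "\<not> f x \<ge> 0"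
    then obtain k0 where k0: "k0 > 0" "\<forall>k. 0 < k \<and> k < k0 \<longrightarrow> norm (integral (cbox x (x + k *\<^sub>R One)) h /\<^sub>R k ^ DIM(real) - h x) < - f x"
      using N(2)[of x "- f x"] x by auto
    define k where "k = min (k0 / 2) ((d - x) / 2)"
    have k: "0 < k" "k < k0" "x + k < d" using k0 x by (auto simp: k_def min_def field_simps)
    have "integral {x..x + k} h = integral {x..x + k} f"
      by (rule integral_cong) (use x k in \<open>auto simp: h_def\<close>)
    moreover have "integral {x..x + k} f \<ge> 0" using assms(2)[of x "x + k"] x k by auto
    ultimately have "inverse k * integral {x..x + k} h \<ge> 0" using k by simp
    then have "- f x \<le> \<bar>inverse k * integral {x..x + k} h - f x\<bar>" using neg by linarith
    then have "norm (integral (cbox x (x + k *\<^sub>R One)) h /\<^sub>R k ^ DIM(real) - h x) \<ge> - f x"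
      using k x by (simp add: h_def)
    then show False using k0(2) k by force
  qed
  then show ?thesis unfolding AE_interval_iff using N(1) by blast
qed

lemma AE_zero_of_interval_integrals:
  fixes f :: "real \<Rightarrow> real"
  assumes "f absolutely_integrable_on {c..d}"
    and "\<And>u v. c < u \<Longrightarrow> u < v \<Longrightarrow> v < d \<Longrightarrow> integral {u..v} f = 0"
  shows "AE x in Leb c d. f x = 0"
proof -
  have "AE x in Leb c d. f x \<ge> 0"
    by (rule AE_nonneg_of_interval_integrals[OF assms(1)]) (use assms(2) in auto)
  moreover have "AE x in Leb c d. - f x \<ge> 0"
  proof (rule AE_nonneg_of_interval_integrals)
    show "(\<lambda>x. - f x) absolutely_integrable_on {c..d}"
      using absolutely_integrable_scaleR_left[OF assms(1), of "-1"] by simp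
  qed (use assms(2) in auto)
  ultimately show ?thesis by eventually_elim auto
qed

lemma locally_integrable_mult_cont:
  assumes "locally_integrable a b g" "\<psi> \<in> test_fun a b"
  shows "(\<lambda>x. g x * \<psi> x) absolutely_integrable_on {a..b}"
proof -
  obtain c d where cd: "a < c" "d < b" "\<forall>x. x \<notin> {c..d} \<longrightarrow> \<psi> x = 0"
    using test_fun_supp[OF assms(2)] by blast
  have "integrable (lebesgue_on {c..d}) g" using assms(1) cd by (simp add: locally_integrable_def)
  then have "g absolutely_integrable_on {c..d}"
    by (simp add: integrable_restrict_space set_integrable_def)
  then have "(\<lambda>x. \<psi> x * g x) absolutely_integrable_on {c..d}"
    by (rule absolutely_integrable_cont_mult) (intro smooth_continuous test_fun_smooth[OF assms(2)])
  moreover have "(\<lambda>x. if x \<in> {c..d} then \<psi> x * g x else 0) = (\<lambda>x. if x \<in> {a..b} then \<psi> x * g x else 0)"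
  proof
    show "(if x \<in> {c..d} then \<psi> x * g x else 0) = (if x \<in> {a..b} then \<psi> x * g x else 0)" for x
    proof (cases "x \<in> {c..d}")
      case True
      then have "x \<in> {a..b}" using cd by auto
      then show ?thesis using True by (simp only: if_True)
    next
      case False
      then have "\<psi> x = 0" using cd by blast
      then show ?thesis by simp
    qed
  qed
  ultimately have "(\<lambda>x. \<psi> x * g x) absolutely_integrable_on {a..b}"
    unfolding absolutely_integrable_restrict_UNIV[symmetric, of "{a..b}"]
      absolutely_integrable_restrict_UNIV[symmetric, of "{c..d}"] by (simp only:)
  then show ?thesis by (simp add: mult.commute)
qed

lemma locally_integrableI: "g absolutely_integrable_on {a..b} \<Longrightarrow> locally_integrable a b g"
  unfolding locally_integrable_def
  by (intro allI impI absolutely_integrable_imp_integrable)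
     (auto intro: absolutely_integrable_on_subinterval)

lemma interval_integral_of_bumps:
  assumes l: "locally_integrable a b g" and uv: "a < u" "u < v" "v < b"
    and zero: "\<And>n. (LINT x|Leb a b. g x * bump n u v x) = 0"
  shows "integral {u..v} g = 0"
proof -
  have gi: "g absolutely_integrable_on {u..v}"
    using l uv by (auto simp: locally_integrable_def integrable_restrict_space set_integrable_def)
  let ?M = "Leb u v"
  have gi': "integrable ?M g" using gi integrable_lebesgue_on_interval by blast
  have "(\<lambda>n. LINT x|?M. g x * bump n u v x) \<longlonglongrightarrow> (LINT x|?M. g x * 1)"
  proof (rule integral_dominated_convergence[where w="\<lambda>x. \<bar>g x\<bar>"])
    have [measurable]: "g \<in> borel_measurable ?M" using gi' by auto
    have [measurable]: "bump n u v \<in> borel_measurable ?M" for n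
      by (intro continuous_imp_measurable_on_sets_lebesgue smooth_continuous smooth_bump) auto
    show "(\<lambda>x. g x * bump n u v x) \<in> borel_measurable ?M" for n by measurable
    show "AE x in ?M. (\<lambda>n. g x * bump n u v x) \<longlonglongrightarrow> g x * 1"
    proof (rule AE_I2)
      fix x assume "x \<in> space ?M"
      then have "u < x \<and> x < v" by simp
      then have "(\<lambda>n. bump n u v x) \<longlonglongrightarrow> 1" using bump_limit[of u v x] by simp
      then show "(\<lambda>n. g x * bump n u v x) \<longlonglongrightarrow> g x * 1" by (intro tendsto_intros)
    qed
    show "AE x in ?M. norm (g x * bump n u v x) \<le> \<bar>g x\<bar>" for n
      using bump_bounds[of n u v] by (auto simp: abs_mult intro!: mult_left_le)
    show "integrable ?M (\<lambda>x. \<bar>g x\<bar>)" using gi' by auto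
  qed (use gi' in auto)
  moreover have "(LINT x|?M. g x * bump n u v x) = 0" for n
  proof -
    have "(LINT x|Leb a b. g x * bump n u v x) = (LINT x|?M. g x * bump n u v x)"
      by (subst (1 2) integral_restrict_space)
         (use uv bump_outside[of _ u v n] in \<open>auto intro!: LINT_cong simp: indicator_def\<close>)
    then show ?thesis using zero[of n] by simp
  qed
  ultimately have "(LINT x|?M. g x) = 0" by (simp add: LIMSEQ_const_iff)
  then show ?thesis using LINT_interval[OF gi] by simp
qed

text \<open>Testing with bumps shows that all interval integrals vanish. Because integrability is only local, this is done on
  an exhausting sequence of subintervals.\<close>

lemma fundamental_lemma:
  assumes "locally_integrable a b g"
    and zero: "\<And>\<psi>. \<psi> \<in> test_fun a b \<Longrightarrow> (LINT x|Leb a b. g x * \<psi> x) = 0"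
  shows "AE x in Leb a b. g x = 0"
proof -
  have int0: "integral {u..v} g = 0" if uv: "a < u" "u < v" "v < b" for u v
    by (rule interval_integral_of_bumps[OF assms(1) uv zero[OF bump_test_fun[OF uv(1,3)]]])
  have "AE x in lebesgue_on {a + 1 / Suc n<..<b - 1 / Suc n}. g x = 0" for n
  proof (rule AE_zero_of_interval_integrals)
    have "integrable (lebesgue_on {a + 1 / Suc n..b - 1 / Suc n}) g"
      using assms(1) by (auto simp: locally_integrable_def)
    then show "g absolutely_integrable_on {a + 1 / Suc n..b - 1 / Suc n}"
      by (simp add: integrable_restrict_space set_integrable_def)
    fix u v assume "a + 1 / Suc n < u" "u < v" "v < b - 1 / Suc n"
    moreover have "1 / real (Suc n) > 0" by simp
    ultimately show "integral {u..v} g = 0" by (intro int0) linarith+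
  qed
  then have "\<forall>n. \<exists>N. negligible N \<and> (\<forall>x\<in>{a + 1 / Suc n<..<b - 1 / Suc n} - N. g x = 0)"
    unfolding AE_interval_iff by blast
  then obtain N where N: "\<And>n. negligible (N n)" "\<And>n. \<forall>x\<in>{a + 1 / Suc n<..<b - 1 / Suc n} - N n. g x = 0"
    by metis
  have "g x = 0" if x: "x \<in> {a<..<b} - (\<Union>n. N n)" for x
  proof -
    obtain n where "1 / real (Suc n) < min (x - a) (b - x)"
      using x nat_approx_posE[of "min (x - a) (b - x)"] by auto
    then show ?thesis using N(2)[of n] x by auto
  qed
  moreover have "negligible (\<Union>n. N n)" using N(1) by (intro negligible_Union_nat) 
  ultimately show ?thesis unfolding AE_interval_iff by blast
qed

section \<open>Square integrable functions\<close>

lemma L2_measurable: "f \<in> L2 S \<Longrightarrow> f \<in> borel_measurable (lebesgue_on S)"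
  and L2_square_integrable: "f \<in> L2 S \<Longrightarrow> integrable (lebesgue_on S) (\<lambda>p. (f p)\<^sup>2)"
  by (auto simp: L2_def)

lemma L2_bound:
  assumes "g \<in> L2 S" "f \<in> borel_measurable (lebesgue_on S)" "AE p in lebesgue_on S. \<bar>f p\<bar> \<le> \<bar>g p\<bar>"
  shows "f \<in> L2 S"
proof -
  have "integrable (lebesgue_on S) (\<lambda>p. (f p)\<^sup>2)"
  proof (rule LINT_integrable_bound[OF L2_square_integrable[OF assms(1)]])
    show "(\<lambda>p. (f p)\<^sup>2) \<in> borel_measurable (lebesgue_on S)" using assms(2) by measurable
    show "AE p in lebesgue_on S. norm ((f p)\<^sup>2) \<le> norm ((g p)\<^sup>2)"
      using assms(3) by eventually_elim (simp add: abs_le_square_iff)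
  qed
  then show ?thesis using assms(2) by (simp add: L2_def)
qed

lemma L2_mult_integrable:
  assumes "f \<in> L2 S" "g \<in> L2 S"
  shows "integrable (lebesgue_on S) (\<lambda>p. f p * g p)"
proof (rule LINT_integrable_bound)
  show "integrable (lebesgue_on S) (\<lambda>p. (f p)\<^sup>2 + (g p)\<^sup>2)"
    using assms by (intro LINT_integrable_add L2_square_integrable)
  show "(\<lambda>p. f p * g p) \<in> borel_measurable (lebesgue_on S)"
    using assms L2_measurable by (intro borel_measurable_times) auto
  have "\<bar>x * y\<bar> \<le> x\<^sup>2 + y\<^sup>2" for x y :: real
  proof -
    have "2 * \<bar>x * y\<bar> \<le> x\<^sup>2 + y\<^sup>2"
      using sum_squares_bound[of "\<bar>x\<bar>" "\<bar>y\<bar>"] by (simp add: abs_mult mult.assoc)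
    then show ?thesis using abs_ge_zero[of "x * y"] by linarith
  qed
  then show "AE p in lebesgue_on S. norm (f p * g p) \<le> norm ((f p)\<^sup>2 + (g p)\<^sup>2)" by auto
qed

lemma L2_add: assumes "f \<in> L2 S" "g \<in> L2 S" shows "(\<lambda>p. f p + g p) \<in> L2 S"
proof -
  have "integrable (lebesgue_on S) (\<lambda>p. (f p)\<^sup>2 + (g p)\<^sup>2 + 2 * (f p * g p))"
    using assms by (intro LINT_integrable_add L2_square_integrable
        integrable_mult_right L2_mult_integrable)
  then show ?thesis
    using assms by (auto simp: L2_def power2_sum mult.assoc)
qed

lemma L2_cmult: "f \<in> L2 S \<Longrightarrow> (\<lambda>p. c * f p) \<in> L2 S"
  by (auto simp: L2_def power_mult_distrib)

lemma L2_uminus: "f \<in> L2 S \<Longrightarrow> (\<lambda>p. - f p) \<in> L2 S"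
  using L2_cmult[of f S "-1"] by simp

lemma L2_diff: "f \<in> L2 S \<Longrightarrow> g \<in> L2 S \<Longrightarrow> (\<lambda>p. f p - g p) \<in> L2 S"
  using L2_add[of f S "\<lambda>p. - g p"] L2_uminus[of g S] by simp

lemma L2_bounded_mult:
  assumes "f \<in> L2 S" "g \<in> borel_measurable (lebesgue_on S)" "AE p in lebesgue_on S. \<bar>g p\<bar> \<le> K"
  shows "(\<lambda>p. g p * f p) \<in> L2 S"
proof (rule L2_bound[OF L2_cmult[OF assms(1), of K]])
  show "(\<lambda>p. g p * f p) \<in> borel_measurable (lebesgue_on S)"
    using assms(2) L2_measurable[OF assms(1)] by (intro borel_measurable_times)
  show "AE p in lebesgue_on S. \<bar>g p * f p\<bar> \<le> \<bar>K * f p\<bar>"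
    using assms(3) by eventually_elim (auto simp: abs_mult intro!: mult_right_mono)
qed

lemma borel_measurable_lebesgue_on_AE:
  fixes f g :: "'a::euclidean_space \<Rightarrow> real"
  assumes "f \<in> borel_measurable (lebesgue_on S)" "AE x in lebesgue_on S. f x = g x" "S \<in> sets lebesgue"
  shows "g \<in> borel_measurable (lebesgue_on S)"
proof -
  have "(\<lambda>x. if x \<in> S then f x else 0) \<in> borel_measurable lebesgue"
    using assms(1) by (simp only: borel_measurable_if[OF assms(3)])
  moreover have "AE x in lebesgue. (if x \<in> S then f x else 0) = (if x \<in> S then g x else 0)"
    using assms(2,3) by (auto simp: AE_restrict_space_iff elim!: eventually_mono)
  ultimately have "(\<lambda>x. if x \<in> S then g x else 0) \<in> borel_measurable lebesgue"
    by (rule borel_measurable_AE)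
  then show ?thesis by (simp only: borel_measurable_if[OF assms(3)])
qed

lemma L2_cong_AE:
  assumes "f \<in> L2 S" "AE x in lebesgue_on S. f x = g x" "S \<in> sets lebesgue"
  shows "g \<in> L2 S"
  by (rule L2_bound[OF assms(1) borel_measurable_lebesgue_on_AE[OF L2_measurable[OF assms(1)] assms(2,3)]])
     (use assms(2) in eventually_elim, simp)

lemma integral_lebesgue_on_cong_AE:
  fixes f g :: "'a::euclidean_space \<Rightarrow> real"
  assumes "AE x in lebesgue_on S. f x = g x" "S \<in> sets lebesgue"
  shows "integral\<^sup>L (lebesgue_on S) f = integral\<^sup>L (lebesgue_on S) g"
proof (cases "f \<in> borel_measurable (lebesgue_on S)")
  case True
  then show ?thesis
    using borel_measurable_lebesgue_on_AE[OF True assms] assms(1) by (intro integral_cong_AE) auto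
next
  case False
  have "AE x in lebesgue_on S. g x = f x" using assms(1) by eventually_elim simp
  then have "g \<notin> borel_measurable (lebesgue_on S)"
    using False borel_measurable_lebesgue_on_AE[of g S f] assms(2) by blast
  then have "\<not> integrable (lebesgue_on S) f" "\<not> integrable (lebesgue_on S) g"
    using False borel_measurable_integrable by blast+
  then show ?thesis by (simp add: not_integrable_integral_eq)
qed

lemma inner_L2_cong_AE:
  assumes "AE x in lebesgue_on S. f x = f' x" "AE x in lebesgue_on S. g x = g' x" "S \<in> sets lebesgue"
  shows "inner_L2 S f g = inner_L2 S f' g'"
  unfolding inner_L2_def
  by (rule integral_lebesgue_on_cong_AE[OF _ assms(3)]) (use assms(1,2) in eventually_elim, simp)

lemma L2_integrable:
  assumes "f \<in> L2 S" "S \<in> lmeasurable"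
  shows "integrable (lebesgue_on S) f"
proof -
  interpret finite_measure "lebesgue_on S" using assms(2) by (rule finite_measure_lebesgue_on)
  have "integrable (lebesgue_on S) (\<lambda>x. 1 + (f x)\<^sup>2)"
    using L2_square_integrable[OF assms(1)] by (intro LINT_integrable_add) auto
  then show ?thesis
  proof (rule LINT_integrable_bound)
    have "\<bar>x\<bar> \<le> 1 + x\<^sup>2" for x :: real
      using sum_squares_bound[of "\<bar>x\<bar>" 1] abs_ge_zero[of x] by simp
    then show "AE x in lebesgue_on S. norm (f x) \<le> norm (1 + (f x)\<^sup>2)" by (intro AE_I2) (simp add: abs_of_nonneg)
  qed (rule L2_measurable[OF assms(1)])
qed

lemma L2_const: assumes "S \<in> lmeasurable" shows "(\<lambda>x. c) \<in> L2 S"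
proof -
  interpret finite_measure "lebesgue_on S" using assms by (rule finite_measure_lebesgue_on)
  show ?thesis by (simp add: L2_def)
qed

lemma L2_bounded:
  assumes "S \<in> lmeasurable" "f \<in> borel_measurable (lebesgue_on S)" "AE p in lebesgue_on S. \<bar>f p\<bar> \<le> K"
  shows "f \<in> L2 S"
  using L2_bounded_mult[OF L2_const[OF assms(1), of 1] assms(2,3)] by simp

lemma square_sum_le: "(x + y)\<^sup>2 \<le> 2 * x\<^sup>2 + 2 * (y::real)\<^sup>2"
  using zero_le_power2[of "x - y"] by (simp add: power2_sum power2_diff)

lemma LINT_square_triangle:
  assumes "f \<in> L2 S" "g \<in> L2 S" "h \<in> L2 S"
  shows "(LINT x|lebesgue_on S. (f x - h x)\<^sup>2) \<le> 2 * (LINT x|lebesgue_on S. (f x - g x)\<^sup>2) + 2 * (LINT x|lebesgue_on S. (g x - h x)\<^sup>2)"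
proof -
  have i: "integrable (lebesgue_on S) (\<lambda>x. 2 * (f x - g x)\<^sup>2)" "integrable (lebesgue_on S) (\<lambda>x. 2 * (g x - h x)\<^sup>2)"
    "integrable (lebesgue_on S) (\<lambda>x. (f x - h x)\<^sup>2)"
    using assms by (auto intro!: integrable_mult_right L2_square_integrable L2_diff)
  have "(LINT x|lebesgue_on S. (f x - h x)\<^sup>2) \<le> (LINT x|lebesgue_on S. 2 * (f x - g x)\<^sup>2 + 2 * (g x - h x)\<^sup>2)"
  proof (rule integral_mono[OF i(3) LINT_integrable_add[OF i(1,2)]])
    show "(f x - h x)\<^sup>2 \<le> 2 * (f x - g x)\<^sup>2 + 2 * (g x - h x)\<^sup>2" for x
      using square_sum_le[of "f x - g x" "g x - h x"] by simp
  qed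
  also have "\<dots> = 2 * (LINT x|lebesgue_on S. (f x - g x)\<^sup>2) + 2 * (LINT x|lebesgue_on S. (g x - h x)\<^sup>2)"
    using i by (subst LINT_add) auto
  finally show ?thesis .
qed

section \<open>Density of test functions\<close>

definition approximable :: "real \<Rightarrow> real \<Rightarrow> (real \<Rightarrow> real) \<Rightarrow> bool" where
  "approximable a b f \<longleftrightarrow>
     (\<forall>\<delta>>0. \<exists>\<eta>\<in>test_fun a b. (LINT x|Leb a b. (f x - \<eta> x)\<^sup>2) < \<delta>)"

lemma interval_lmeasurable: "{a<..<b} \<in> lmeasurable" for a b :: real
  by simp

lemma smooth_measurable: "smooth f \<Longrightarrow> f \<in> borel_measurable (Leb a b)"
  by (intro continuous_imp_measurable_on_sets_lebesgue smooth_continuous) auto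

lemma test_fun_L2: assumes "\<psi> \<in> test_fun a b" shows "\<psi> \<in> L2 {c<..<d}"
proof -
  obtain K where "\<And>x. \<bar>\<psi> x\<bar> \<le> K" using test_fun_bounded[OF assms] by blast
  then show ?thesis
    by (intro L2_bounded[OF interval_lmeasurable smooth_measurable[OF test_fun_smooth[OF assms]], where K=K] AE_I2) blast
qed

text \<open>The approximable functions are closed under dominated convergence; from here on density is a chain of limits, from
  test functions to smooth, continuous, bounded and finally square integrable functions.\<close>

lemma approximable_limit:
  assumes f: "f \<in> L2 {a<..<b}" and g: "\<And>n. g n \<in> borel_measurable (Leb a b)"
    and ap: "\<And>n. approximable a b (g n)"
    and lim: "AE x in Leb a b. (\<lambda>n. g n x) \<longlonglongrightarrow> f x"
    and w: "w \<in> L2 {a<..<b}" "\<And>n. AE x in Leb a b. \<bar>f x - g n x\<bar> \<le> w x"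
  shows "approximable a b f"
  unfolding approximable_def
proof (intro allI impI)
  fix \<delta> :: real assume d: "\<delta> > 0"
  let ?M = "Leb a b"
  have dL2: "(\<lambda>x. f x - g n x) \<in> L2 {a<..<b}" for n
    by (rule L2_bound[OF w(1)]) (use L2_measurable[OF f] g w(2)[of n] in auto)
  have gL2: "g n \<in> L2 {a<..<b}" for n using L2_diff[OF f dL2[of n]] by simp
  have "(\<lambda>n. LINT x|?M. (f x - g n x)\<^sup>2) \<longlonglongrightarrow> (LINT x|?M. 0)"
  proof (rule integral_dominated_convergence[where w="\<lambda>x. (w x)\<^sup>2"])
    show "(\<lambda>x. (f x - g n x)\<^sup>2) \<in> borel_measurable ?M" for n
      using L2_square_integrable[OF dL2] by blast
    show "integrable ?M (\<lambda>x. (w x)\<^sup>2)" by (rule L2_square_integrable[OF w(1)])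
    show "AE x in ?M. (\<lambda>n. (f x - g n x)\<^sup>2) \<longlonglongrightarrow> 0" using lim
    proof eventually_elim
      case (elim x)
      have "(\<lambda>n. (f x - g n x)\<^sup>2) \<longlonglongrightarrow> (f x - f x)\<^sup>2" by (intro tendsto_intros elim)
      then show ?case by simp
    qed
    show "AE x in ?M. norm ((f x - g n x)\<^sup>2) \<le> (w x)\<^sup>2" for n
      using w(2)[of n]
    proof eventually_elim
      case (elim x)
      then show ?case using power_mono[OF elim, of 2] by simp
    qed
  qed simp
  then have "\<forall>\<^sub>F n in sequentially. (LINT x|?M. (f x - g n x)\<^sup>2) < \<delta> / 4"
    using d by (intro order_tendstoD(2)) auto
  then obtain n where n: "(LINT x|?M. (f x - g n x)\<^sup>2) < \<delta> / 4"
    by (auto simp: eventually_sequentially)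
  have "\<delta> / 4 > 0" using d by simp
  then obtain \<eta> where \<eta>: "\<eta> \<in> test_fun a b" "(LINT x|?M. (g n x - \<eta> x)\<^sup>2) < \<delta> / 4"
    using ap[of n] unfolding approximable_def by blast
  have "(LINT x|?M. (f x - \<eta> x)\<^sup>2) < \<delta>"
    using LINT_square_triangle[OF f gL2[of n] test_fun_L2[OF \<eta>(1)]] n \<eta>(2) by linarith
  then show "\<exists>\<eta>\<in>test_fun a b. (LINT x|?M. (f x - \<eta> x)\<^sup>2) < \<delta>" using \<eta>(1) by blast
qed

lemma approximable_test_fun:
  assumes "\<eta> \<in> test_fun a b" shows "approximable a b \<eta>"
  unfolding approximable_def
proof (intro allI impI)
  fix \<delta> :: real assume "\<delta> > 0"
  then show "\<exists>\<eta>'\<in>test_fun a b. (LINT x|Leb a b. (\<eta> x - \<eta>' x)\<^sup>2) < \<delta>"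
    using assms by (intro bexI[of _ \<eta>]) auto
qed

lemma flat0_at_top: "(flat 0 \<longlongrightarrow> 1) at_top"
proof -
  have "((\<lambda>s::real. exp (- inverse s)) \<longlongrightarrow> exp (- 0)) at_top"
    by (intro tendsto_exp tendsto_minus tendsto_inverse_0_at_top filterlim_ident)
  then have "((\<lambda>s::real. exp (- inverse s)) \<longlongrightarrow> 1) at_top" by simp
  then show ?thesis
  proof (rule Lim_transform_eventually)
    show "\<forall>\<^sub>F s in at_top. exp (- inverse s) = flat 0 s"
      using eventually_gt_at_top[of 0] by eventually_elim (simp add: flat_def inverse_eq_divide)
  qed
qed

lemma growing_bump_limit:
  assumes "a < x" "x < b"
  shows "(\<lambda>n. bump n (a + 1 / real (Suc n)) (b - 1 / real (Suc n)) x) \<longlonglongrightarrow> 1"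
proof -
  have lim: "filterlim (\<lambda>n. c * real n - real n / real (Suc n)) at_top sequentially" if "c > 0" for c
  proof (rule filterlim_at_top_mono)
    show "filterlim (\<lambda>n. - 1 + c * real n) at_top sequentially"
      by (intro filterlim_tendsto_add_at_top[OF tendsto_const] filterlim_tendsto_pos_mult_at_top[OF tendsto_const]
          filterlim_real_sequentially that)
    have "real n / real (Suc n) \<le> 1" for n by simp
    then show "\<forall>\<^sub>F n in sequentially. - 1 + c * real n \<le> c * real n - real n / real (Suc n)"
      by (intro always_eventually allI) (simp add: algebra_simps)
  qed
  have "(\<lambda>n. flat 0 ((x - a) * real n - real n / real (Suc n)) * flat 0 ((b - x) * real n - real n / real (Suc n))) \<longlonglongrightarrow> 1 * 1"
    using assms by (intro tendsto_mult filterlim_compose[OF flat0_at_top] lim) auto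
  moreover have "flat 0 ((x - a) * real n - real n / real (Suc n)) * flat 0 ((b - x) * real n - real n / real (Suc n))
      = bump n (a + 1 / real (Suc n)) (b - 1 / real (Suc n)) x" for n
    unfolding bump_def by (intro arg_cong2[where f="(*)"] arg_cong[where f="flat 0"]) (simp_all add: algebra_simps)
  ultimately show ?thesis by simp
qed

text \<open>Cutting off with bumps that fill out the interval.\<close>

lemma approximable_smooth:
  assumes "smooth p" shows "approximable a b p"
proof -
  let ?B = "\<lambda>n. bump n (a + 1 / real (Suc n)) (b - 1 / real (Suc n))"
  have "bounded (p ` {a..b})"
    by (intro compact_imp_bounded compact_continuous_image smooth_continuous assms) auto
  then obtain K where K: "\<forall>x\<in>{a..b}. \<bar>p x\<bar> \<le> K" by (auto simp: bounded_iff)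
  have "p \<in> L2 {a<..<b}"
    by (rule L2_bounded[OF interval_lmeasurable smooth_measurable[OF assms], where K=K])
       (use K in \<open>auto intro!: AE_I2\<close>)
  then show ?thesis
  proof (rule approximable_limit[where g="\<lambda>n x. p x * ?B n x" and w="\<lambda>x. 2 * K"])
    show "(\<lambda>x. p x * ?B n x) \<in> borel_measurable (Leb a b)" for n
      by (intro smooth_measurable smooth_mult assms smooth_bump)
    have pos: "1 / real (Suc n) > 0" for n by simp
    show "approximable a b (\<lambda>x. p x * ?B n x)" for n
      by (intro approximable_test_fun test_fun_smooth_mult assms bump_test_fun) (use pos[of n] in linarith)+
    show "AE x in Leb a b. (\<lambda>n. p x * ?B n x) \<longlonglongrightarrow> p x"
    proof (rule AE_I2)
      fix x assume "x \<in> space (Leb a b)"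
      then have "(\<lambda>n. ?B n x) \<longlonglongrightarrow> 1" using growing_bump_limit by simp
      from tendsto_mult[OF tendsto_const this, of "p x"] show "(\<lambda>n. p x * ?B n x) \<longlonglongrightarrow> p x" by simp
    qed
    show "(\<lambda>x. 2 * K) \<in> L2 {a<..<b}" by (rule L2_const[OF interval_lmeasurable])
    show "AE x in Leb a b. \<bar>p x - p x * ?B n x\<bar> \<le> 2 * K" for n
    proof (rule AE_I2)
      fix x assume "x \<in> space (Leb a b)"
      then have k: "\<bar>p x\<bar> \<le> K" using K by auto
      have "\<bar>p x * (1 - ?B n x)\<bar> \<le> K * 1"
        unfolding abs_mult using k bump_bounds[of n "a + 1 / real (Suc n)" "b - 1 / real (Suc n)" x]
        by (intro mult_mono) auto
      then show "\<bar>p x - p x * ?B n x\<bar> \<le> 2 * K" using k by (simp add: algebra_simps)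
    qed
  qed
qed

lemma smooth_polynomial: "real_polynomial_function p \<Longrightarrow> smooth (p :: real \<Rightarrow> real)"
proof (induction rule: real_polynomial_function.induct)
  case (linear f)
  have "f x = f 1 * x" for x
    using linear_scale[OF bounded_linear.linear[OF linear], of x 1] by (simp add: mult.commute)
  then have "f = (\<lambda>x. f 1 * x)" by (rule ext)
  then show ?case using smooth_cmult[OF smooth_ident, of "f 1"] by metis
qed (auto intro: smooth_const smooth_add smooth_mult)

lemma approximable_continuous:
  fixes g :: "real \<Rightarrow> real"
  assumes "continuous_on UNIV g" shows "approximable a b g"
proof -
  have c: "continuous_on {a..b} g" using assms continuous_on_subset by blast
  have ex: "\<exists>p. smooth p \<and> (\<forall>x\<in>{a..b}. \<bar>g x - p x\<bar> < 1 / real (Suc n))" for n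
  proof -
    have "1 / real (Suc n) > 0" by simp
    then obtain p where "real_polynomial_function p" "\<And>x. x \<in> {a..b} \<Longrightarrow> \<bar>g x - p x\<bar> < 1 / real (Suc n)"
      using Stone_Weierstrass_real_polynomial_function[OF compact_Icc c] by blast
    then show ?thesis using smooth_polynomial by blast
  qed
  define p where "p n = (SOME p. smooth p \<and> (\<forall>x\<in>{a..b}. \<bar>g x - p x\<bar> < 1 / real (Suc n)))" for n
  have p: "smooth (p n)" "\<forall>x\<in>{a..b}. \<bar>g x - p n x\<bar> < 1 / real (Suc n)" for n
    using someI_ex[OF ex[of n]] unfolding p_def by blast+
  have gm: "g \<in> borel_measurable (Leb a b)"
    using continuous_on_subset[OF assms] by (intro continuous_imp_measurable_on_sets_lebesgue) auto
  have "bounded (g ` {a..b})"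
    by (intro compact_imp_bounded compact_continuous_image c) auto
  then obtain K where K: "\<forall>x\<in>{a..b}. \<bar>g x\<bar> \<le> K" by (auto simp: bounded_iff)
  have "g \<in> L2 {a<..<b}"
    by (rule L2_bounded[OF interval_lmeasurable gm, where K=K]) (use K in \<open>auto intro!: AE_I2\<close>)
  then show ?thesis
  proof (rule approximable_limit[where g=p and w="\<lambda>x. 1"])
    show "p n \<in> borel_measurable (Leb a b)" for n by (rule smooth_measurable[OF p(1)])
    show "approximable a b (p n)" for n by (rule approximable_smooth[OF p(1)])
    show "AE x in Leb a b. (\<lambda>n. p n x) \<longlonglongrightarrow> g x"
    proof (rule AE_I2)
      fix x assume "x \<in> space (Leb a b)"
      then have x: "x \<in> {a..b}" by auto
      show "(\<lambda>n. p n x) \<longlonglongrightarrow> g x"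
      proof (rule LIM_zero_cancel, rule Lim_null_comparison)
        show "(\<lambda>n. 1 / real (Suc n)) \<longlonglongrightarrow> 0" using LIMSEQ_inverse_real_of_nat by (simp add: inverse_eq_divide)
        have "norm (p n x - g x) \<le> 1 / real (Suc n)" for n
          using bspec[OF p(2)[of n] x] by (simp add: abs_minus_commute)
        then show "\<forall>\<^sub>F n in sequentially. norm (p n x - g x) \<le> 1 / real (Suc n)" by simp
      qed
    qed
    show "(\<lambda>x. 1) \<in> L2 {a<..<b}" by (rule L2_const[OF interval_lmeasurable])
    show "AE x in Leb a b. \<bar>g x - p n x\<bar> \<le> 1" for n
    proof (rule AE_I2)
      fix x assume "x \<in> space (Leb a b)"
      then have "\<bar>g x - p n x\<bar> < 1 / real (Suc n)" using p(2)[of n] by auto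
      also have "\<dots> \<le> 1" by simp
      finally show "\<bar>g x - p n x\<bar> \<le> 1" by simp
    qed
  qed
qed

definition clamp_real :: "real \<Rightarrow> real \<Rightarrow> real" where "clamp_real K s = max (- K) (min K s)"

lemma clamp_real_bounds: "K \<ge> 0 \<Longrightarrow> \<bar>clamp_real K s\<bar> \<le> K" "K \<ge> 0 \<Longrightarrow> \<bar>s - clamp_real K s\<bar> \<le> \<bar>s\<bar>"
  by (auto simp: clamp_real_def max_def min_def abs_if)

lemma clamp_real_id: "\<bar>s\<bar> \<le> K \<Longrightarrow> clamp_real K s = s"
  by (simp add: clamp_real_def min_absorb2 max_absorb2 abs_le_iff)

lemma clamp_real_measurable[measurable]: "f \<in> borel_measurable M \<Longrightarrow> (\<lambda>x. clamp_real K (f x)) \<in> borel_measurable M"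
  unfolding clamp_real_def by (intro borel_measurable_max borel_measurable_min borel_measurable_const)

lemma approximable_bounded:
  assumes m: "f \<in> borel_measurable (Leb a b)" and K: "K \<ge> 0" "\<And>x. \<bar>f x\<bar> \<le> K"
  shows "approximable a b f"
proof -
  have "f measurable_on {a<..<b}" using m measurable_on_iff_borel_measurable[of "{a<..<b}" f] by simp
  then obtain N g where N: "negligible N" and g: "\<And>n. continuous_on UNIV (g n)"
    "\<And>x. x \<notin> N \<Longrightarrow> (\<lambda>n. g n x) \<longlonglongrightarrow> (if x \<in> {a<..<b} then f x else 0)"
    unfolding measurable_on_def by metis
  have cg: "continuous_on UNIV (\<lambda>x. clamp_real K (g n x))" for n
    unfolding clamp_real_def by (intro continuous_intros g)
  show ?thesis
  proof (rule approximable_limit[where g="\<lambda>n x. clamp_real K (g n x)" and w="\<lambda>x. 2 * K"])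
    show "f \<in> L2 {a<..<b}" by (rule L2_bounded[OF interval_lmeasurable m, where K=K]) (use K in auto)
    show "(\<lambda>x. clamp_real K (g n x)) \<in> borel_measurable (Leb a b)" for n
      using continuous_on_subset[OF cg] by (intro continuous_imp_measurable_on_sets_lebesgue) auto
    show "approximable a b (\<lambda>x. clamp_real K (g n x))" for n by (rule approximable_continuous[OF cg])
    show "AE x in Leb a b. (\<lambda>n. clamp_real K (g n x)) \<longlonglongrightarrow> f x"
      unfolding AE_interval_iff
    proof (intro exI[of _ N] conjI ballI N)
      fix x assume x: "x \<in> {a<..<b} - N"
      have "(\<lambda>n. g n x) \<longlonglongrightarrow> f x" using g(2)[of x] x by simp
      then have "(\<lambda>n. clamp_real K (g n x)) \<longlonglongrightarrow> clamp_real K (f x)"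
        unfolding clamp_real_def by (intro tendsto_intros)
      then show "(\<lambda>n. clamp_real K (g n x)) \<longlonglongrightarrow> f x" using clamp_real_id[OF K(2)] by simp
    qed
    show "(\<lambda>x. 2 * K) \<in> L2 {a<..<b}" by (rule L2_const[OF interval_lmeasurable])
    show "AE x in Leb a b. \<bar>f x - clamp_real K (g n x)\<bar> \<le> 2 * K" for n
    proof (rule AE_I2)
      fix x
      show "\<bar>f x - clamp_real K (g n x)\<bar> \<le> 2 * K"
        using K(2)[of x] clamp_real_bounds(1)[OF K(1), of "g n x"] by linarith
    qed
  qed
qed

lemma approximable_L2:
  assumes f: "f \<in> L2 {a<..<b}" shows "approximable a b f"
proof (rule approximable_limit[where g="\<lambda>n x. clamp_real (real n) (f x)" and w="\<lambda>x. \<bar>f x\<bar>", OF f])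
  show m: "(\<lambda>x. clamp_real (real n) (f x)) \<in> borel_measurable (Leb a b)" for n
    using L2_measurable[OF f] by measurable
  show "approximable a b (\<lambda>x. clamp_real (real n) (f x))" for n
    by (rule approximable_bounded[OF m, of "real n"]) (auto simp: clamp_real_bounds)
  show "AE x in Leb a b. (\<lambda>n. clamp_real (real n) (f x)) \<longlonglongrightarrow> f x"
  proof (rule AE_I2)
    fix x
    obtain N where N: "\<bar>f x\<bar> \<le> real N" using real_arch_simple by blast
    show "(\<lambda>n. clamp_real (real n) (f x)) \<longlonglongrightarrow> f x"
    proof (rule tendsto_eventually, unfold eventually_sequentially, intro exI[of _ N] allI impI)
      fix n assume "N \<le> n"
      then show "clamp_real (real n) (f x) = f x" using N by (intro clamp_real_id) linarith
    qed
  qed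
  show "(\<lambda>x. \<bar>f x\<bar>) \<in> L2 {a<..<b}"
    by (rule L2_bound[OF f]) (use L2_measurable[OF f] in auto)
  show "AE x in Leb a b. \<bar>f x - clamp_real (real n) (f x)\<bar> \<le> \<bar>f x\<bar>" for n
    by (rule AE_I2) (simp add: clamp_real_bounds)
qed

section \<open>Weak derivatives and jets\<close>

lemma open_subset_closed_interval: "{a<..<b} \<subseteq> {a..b::real}"
  by auto

lemma locally_integrable_cong_AE:
  assumes "locally_integrable a b f" "AE x in Leb a b. f x = g x"
  shows "locally_integrable a b g"
  unfolding locally_integrable_def
proof (intro allI impI)
  fix c d assume cd: "a < c" "d < b"
  have f: "f absolutely_integrable_on {c..d}"
    using assms(1) cd by (simp add: locally_integrable_def integrable_restrict_space set_integrable_def)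
  have "AE x in Leb c d. f x = g x"
    using assms(2) cd unfolding AE_interval_iff by fastforce
  then show "integrable (lebesgue_on {c..d}) g"
    using absolutely_integrable_cong_AE[OF f] by (simp add: integrable_restrict_space set_integrable_def)
qed

lemma LINT_test:
  assumes "locally_integrable a b f" "\<psi> \<in> test_fun a b"
  shows "(LINT x|Leb a b. f x * \<psi> x) = integral {a..b} (\<lambda>x. f x * \<psi> x)"
    and "integrable (Leb a b) (\<lambda>x. f x * \<psi> x)"
  using LINT_interval[OF locally_integrable_mult_cont[OF assms]] locally_integrable_mult_cont[OF assms]
  by (simp_all only: integrable_lebesgue_on_interval)

lemma weak_deriv_cong_AE:
  assumes "weak_deriv a b k f g" "AE x in Leb a b. f x = f' x" "AE x in Leb a b. g x = g' x"
  shows "weak_deriv a b k f' g'"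
  unfolding weak_deriv_def
proof (intro conjI ballI)
  show "locally_integrable a b f'" "locally_integrable a b g'"
    using assms locally_integrable_cong_AE unfolding weak_deriv_def by blast+
  fix \<psi> assume \<psi>: "\<psi> \<in> test_fun a b"
  have "(LINT x|Leb a b. f x * (deriv ^^ k) \<psi> x) = (LINT x|Leb a b. f' x * (deriv ^^ k) \<psi> x)"
    by (rule integral_lebesgue_on_cong_AE) (use assms(2) in \<open>eventually_elim, auto\<close>)
  moreover have "(LINT x|Leb a b. g x * \<psi> x) = (LINT x|Leb a b. g' x * \<psi> x)"
    by (rule integral_lebesgue_on_cong_AE) (use assms(3) in \<open>eventually_elim, auto\<close>)
  ultimately show "(LINT x|Leb a b. f' x * (deriv ^^ k) \<psi> x) = (- 1) ^ k * (LINT x|Leb a b. g' x * \<psi> x)"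
    using assms(1) \<psi> unfolding weak_deriv_def by auto
qed

lemma weak_deriv_unique:
  assumes "weak_deriv a b k f g" "weak_deriv a b k f h"
  shows "AE x in Leb a b. g x = h x"
proof -
  have l: "locally_integrable a b g" "locally_integrable a b h" using assms by (auto simp: weak_deriv_def)
  have "AE x in Leb a b. g x - h x = 0"
  proof (rule fundamental_lemma)
    show "locally_integrable a b (\<lambda>x. g x - h x)"
      using l by (auto simp: locally_integrable_def)
    fix \<psi> assume p: "\<psi> \<in> test_fun a b"
    have "(-1) ^ k * (LINT x|Leb a b. g x * \<psi> x) = (-1) ^ k * (LINT x|Leb a b. h x * \<psi> x)"
      using assms p by (auto simp: weak_deriv_def)
    then show "(LINT x|Leb a b. (g x - h x) * \<psi> x) = 0"
      using LINT_test(2)[OF l(1) p] LINT_test(2)[OF l(2) p] by (simp add: left_diff_distrib)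
  qed
  then show ?thesis by eventually_elim simp
qed

lemma weak_deriv_0: "locally_integrable a b f \<Longrightarrow> weak_deriv a b 0 f f"
  by (simp add: weak_deriv_def)

text \<open>Derivatives of test functions are test functions, so a weak derivative of order \<open>k + 1\<close> differentiates the one of
  order \<open>k\<close>. This reduces higher derivatives to chains of first ones.\<close>

lemma weak_deriv_step:
  assumes "weak_deriv a b k f g" "weak_deriv a b (Suc k) f h"
  shows "weak_deriv a b 1 g h"
  unfolding weak_deriv_def
proof (intro conjI ballI)
  show "locally_integrable a b g" "locally_integrable a b h" using assms by (auto simp: weak_deriv_def)
  fix \<psi> assume p: "\<psi> \<in> test_fun a b"
  have "(-1) ^ k * (LINT x|Leb a b. g x * deriv \<psi> x) = (LINT x|Leb a b. f x * (deriv ^^ k) (deriv \<psi>) x)"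
    using assms(1) test_fun_deriv[OF p] by (simp add: weak_deriv_def)
  also have "(deriv ^^ k) (deriv \<psi>) = (deriv ^^ Suc k) \<psi>" by (simp add: funpow_swap1)
  also have "(LINT x|Leb a b. f x * (deriv ^^ Suc k) \<psi> x) = (-1) ^ Suc k * (LINT x|Leb a b. h x * \<psi> x)"
    using assms(2) p by (simp only: weak_deriv_def)
  finally have "(-1) ^ k * (LINT x|Leb a b. g x * deriv \<psi> x) = (-1) ^ k * (- (LINT x|Leb a b. h x * \<psi> x))"
    by simp
  then have "(LINT x|Leb a b. g x * deriv \<psi> x) = - (LINT x|Leb a b. h x * \<psi> x)"
    by (subst (asm) mult_left_cancel) simp
  then show "(LINT x|Leb a b. g x * (deriv ^^ 1) \<psi> x) = (-1) ^ 1 * (LINT x|Leb a b. h x * \<psi> x)"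
    by simp
qed

lemma weak_deriv_Suc:
  assumes "weak_deriv a b k f g" "weak_deriv a b 1 g h"
  shows "weak_deriv a b (Suc k) f h"
  unfolding weak_deriv_def
proof (intro conjI ballI)
  show "locally_integrable a b f" "locally_integrable a b h" using assms by (auto simp: weak_deriv_def)
  fix \<psi> assume p: "\<psi> \<in> test_fun a b"
  have "(deriv ^^ Suc k) \<psi> = (deriv ^^ k) (deriv \<psi>)" by (simp add: funpow_swap1)
  then have "(LINT x|Leb a b. f x * (deriv ^^ Suc k) \<psi> x) = (-1) ^ k * (LINT x|Leb a b. g x * deriv \<psi> x)"
    using assms(1) test_fun_deriv[OF p] by (simp add: weak_deriv_def)
  also have "(LINT x|Leb a b. g x * deriv \<psi> x) = - (LINT x|Leb a b. h x * \<psi> x)"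
    using assms(2) p by (simp add: weak_deriv_def)
  finally show "(LINT x|Leb a b. f x * (deriv ^^ Suc k) \<psi> x) = (-1) ^ Suc k * (LINT x|Leb a b. h x * \<psi> x)"
    by simp
qed

lemma continuous_absolutely_integrable: "continuous_on {a..b} F \<Longrightarrow> F absolutely_integrable_on {a..b}" for F :: "real \<Rightarrow> real"
  by (rule absolutely_integrable_continuous_real)

lemma ac_weak_deriv:
  assumes "a < b" "ac a b F f" shows "weak_deriv a b 1 F f"
  unfolding weak_deriv_def
proof (intro conjI ballI)
  have Fi: "F absolutely_integrable_on {a..b}" by (rule continuous_absolutely_integrable[OF ac_continuous[OF assms(2)]])
  have fi: "f absolutely_integrable_on {a..b}" by (rule acD_integrable[OF assms(2)])
  show l: "locally_integrable a b F" "locally_integrable a b f" using Fi fi by (auto intro: locally_integrableI)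
  fix \<psi> assume p: "\<psi> \<in> test_fun a b"
  have "ac a b (\<lambda>x. F x * \<psi> x) (\<lambda>x. f x * \<psi> x + F x * deriv \<psi> x)"
    by (rule ac_mult[OF assms(2) ac_smooth[OF test_fun_smooth[OF p]]])
  from ac_integral[OF this, of a b] have "((\<lambda>x. f x * \<psi> x + F x * deriv \<psi> x) has_integral 0) {a..b}"
    using assms(1) test_fun_zero[OF p] by simp
  then have "integral {a..b} (\<lambda>x. f x * \<psi> x + F x * deriv \<psi> x) = 0" by (rule integral_unique)
  moreover have "integral {a..b} (\<lambda>x. f x * \<psi> x + F x * deriv \<psi> x) = integral {a..b} (\<lambda>x. f x * \<psi> x) + integral {a..b} (\<lambda>x. F x * deriv \<psi> x)"
    using locally_integrable_mult_cont[OF l(2) p] locally_integrable_mult_cont[OF l(1) test_fun_deriv[OF p]]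
    by (intro HK_add abs_integrable_on)
  ultimately show "(LINT x|Leb a b. F x * (deriv ^^ 1) \<psi> x) = (-1) ^ 1 * (LINT x|Leb a b. f x * \<psi> x)"
    by (simp add: LINT_test(1)[OF l(1) test_fun_deriv[OF p]] LINT_test(1)[OF l(2) p])
qed

lemma unit_mass_test_fun:
  assumes "a < b" obtains \<rho> where "\<rho> \<in> test_fun a b" "(\<rho> has_integral 1) {a..b}"
proof -
  define c d where "c = (2 * a + b) / 3" and "d = (a + 2 * b) / 3"
  have cd: "a < c" "c < d" "d < b" using assms by (auto simp: c_def d_def)
  let ?\<rho> = "bump 1 c d"
  have t: "?\<rho> \<in> test_fun a b" using cd by (intro bump_test_fun)
  have c: "continuous_on {a..b} ?\<rho>" by (intro smooth_continuous smooth_bump)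
  have "integral {a..b} ?\<rho> \<noteq> 0"
  proof
    assume 0: "integral {a..b} ?\<rho> = 0"
    have "?\<rho> ((c + d) / 2) = 0"
    proof (rule has_integral_0_cbox_imp_0[where f="?\<rho>" and a=a and b=b])
      show "(?\<rho> has_integral 0) (cbox a b)"
        using integrable_integral[OF integrable_continuous_real[OF c]] 0 by simp
    qed (use cd c bump_bounds in auto)
    then show False using bump_pos[of c "(c + d) / 2" d 1] cd by auto
  qed
  then have "((\<lambda>x. inverse (integral {a..b} ?\<rho>) * ?\<rho> x) has_integral 1) {a..b}"
    using has_integral_mult_right[OF integrable_integral[OF integrable_continuous_real[OF c]], of "inverse (integral {a..b} ?\<rho>)"]
    by simp
  then show ?thesis using that test_fun_cmult[OF t] by blast
qed

text \<open>The test functions \<open>\<integral> (\<eta> - (\<integral>\<eta>) \<rho>)\<close>, where \<open>\<eta>\<close> runs through the bumps on rational intervals and \<open>\<rho>\<close> has unit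
  mass. A countable family is needed because for functions of two variables the exceptional null set may depend
  on the test function.\<close>

definition unit_mass :: "real \<Rightarrow> real \<Rightarrow> real \<Rightarrow> real" where
  "unit_mass a b = (SOME \<rho>. \<rho> \<in> test_fun a b \<and> (\<rho> has_integral 1) {a..b})"

definition rational_bumps :: "real \<Rightarrow> real \<Rightarrow> (real \<Rightarrow> real) set" where
  "rational_bumps a b = {bump n c d | n c d. c \<in> \<rat> \<and> d \<in> \<rat> \<and> a < c \<and> c < d \<and> d < b}"

definition mean_free :: "real \<Rightarrow> real \<Rightarrow> (real \<Rightarrow> real) \<Rightarrow> real \<Rightarrow> real" where
  "mean_free a b \<eta> x = \<eta> x + (- integral {a..b} \<eta>) * unit_mass a b x"

definition countable_tests :: "real \<Rightarrow> real \<Rightarrow> (real \<Rightarrow> real) set" where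
  "countable_tests a b = (\<lambda>\<eta> x. integral {a..x} (mean_free a b \<eta>)) ` rational_bumps a b"

lemma unit_mass:
  assumes "a < b" shows "unit_mass a b \<in> test_fun a b" "(unit_mass a b has_integral 1) {a..b}"
proof -
  have "\<exists>\<rho>. \<rho> \<in> test_fun a b \<and> (\<rho> has_integral 1) {a..b}"
    using unit_mass_test_fun[OF assms] by blast
  from someI_ex[OF this] show "unit_mass a b \<in> test_fun a b" "(unit_mass a b has_integral 1) {a..b}"
    unfolding unit_mass_def by blast+
qed

lemma mean_free_primitive:
  assumes "a < b" "\<eta> \<in> test_fun a b"
  shows "(\<lambda>x. integral {a..x} (mean_free a b \<eta>)) \<in> test_fun a b"
    and "deriv (\<lambda>x. integral {a..x} (mean_free a b \<eta>)) = mean_free a b \<eta>"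
    and "mean_free a b \<eta> \<in> test_fun a b" and "(mean_free a b \<eta> has_integral 0) {a..b}"
proof -
  define c where "c = integral {a..b} \<eta>"
  have mf: "mean_free a b \<eta> = (\<lambda>x. \<eta> x + (- c) * unit_mass a b x)" by (simp add: mean_free_def[abs_def] c_def)
  have ei: "(\<eta> has_integral c) {a..b}"
    unfolding c_def by (intro integrable_integral integrable_continuous_real smooth_continuous test_fun_smooth[OF assms(2)])
  show \<theta>: "mean_free a b \<eta> \<in> test_fun a b"
    unfolding mf by (intro test_fun_add test_fun_cmult assms(2) unit_mass(1)[OF assms(1)])
  have "(mean_free a b \<eta> has_integral c + (- c) * 1) {a..b}"
    unfolding mf by (intro has_integral_add ei has_integral_mult_right unit_mass(2)[OF assms(1)])
  then show \<theta>0: "(mean_free a b \<eta> has_integral 0) {a..b}" by simp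
  show "(\<lambda>x. integral {a..x} (mean_free a b \<eta>)) \<in> test_fun a b"
    "deriv (\<lambda>x. integral {a..x} (mean_free a b \<eta>)) = mean_free a b \<eta>"
    using test_fun_primitive[OF assms(1) \<theta> \<theta>0] by blast+
qed

lemma rational_bumps_test_fun: "\<eta> \<in> rational_bumps a b \<Longrightarrow> \<eta> \<in> test_fun a b"
  unfolding rational_bumps_def using bump_test_fun by blast

lemma countable_tests_subset: "a < b \<Longrightarrow> countable_tests a b \<subseteq> test_fun a b"
  unfolding countable_tests_def using mean_free_primitive(1) rational_bumps_test_fun by blast

lemma countable_countable_tests: "countable (countable_tests a b)"
proof -
  have "rational_bumps a b \<subseteq> (\<lambda>(n, c, d). bump n c d) ` (UNIV \<times> \<rat> \<times> \<rat>)"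
    unfolding rational_bumps_def by force
  moreover have "countable ((\<lambda>(n, c, d). bump n c d) ` (UNIV \<times> \<rat> \<times> \<rat>))"
    using countable_rat by (intro countable_image countable_SIGMA) auto
  ultimately show ?thesis unfolding countable_tests_def using countable_subset countable_image by blast
qed

text \<open>The primitive \<open>G\<close> takes equal values at rational points, hence is constant by continuity.\<close>

lemma zero_of_rational_bumps:
  assumes ab: "a < b" and g: "g absolutely_integrable_on {a..b}"
    and z: "\<And>\<eta>. \<eta> \<in> rational_bumps a b \<Longrightarrow> integral {a..b} (\<lambda>x. g x * \<eta> x) = 0"
  shows "AE x in Leb a b. g x = 0"
proof (rule AE_zero_of_interval_integrals[OF g])
  have gl: "locally_integrable a b g" by (rule locally_integrableI[OF g])
  define G where "G x = integral {a..x} g" for x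
  have G: "ac a b G g" by (rule acI_primitive[OF g, of _ 0]) (simp add: G_def)
  have rat: "G c = G d" if cd: "c \<in> \<rat>" "d \<in> \<rat>" "a < c" "c < d" "d < b" for c d
  proof -
    have "integral {c..d} g = 0"
    proof (rule interval_integral_of_bumps[OF gl cd(3-5)])
      fix n
      have t: "bump n c d \<in> rational_bumps a b" unfolding rational_bumps_def using cd by blast
      show "(LINT x|Leb a b. g x * bump n c d x) = 0"
        using z[OF t] LINT_test(1)[OF gl rational_bumps_test_fun[OF t]] by simp
    qed
    then show ?thesis using ac_integral[OF G, of c d] cd by (simp add: integral_unique)
  qed
  fix u v assume uv: "a < u" "u < v" "v < b"
  define m where "m = (u + v) / 2"
  have near: "\<exists>c. c \<in> \<rat> \<and> a < c \<and> c < b \<and> \<bar>c - w\<bar> < e \<and> (w = u \<longrightarrow> c < m) \<and> (w = v \<longrightarrow> m < c)"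
    if w: "w = u \<or> w = v" and e: "e > 0" for w e
  proof (cases "w = u")
    case True
    obtain c where "c \<in> \<rat>" "u < c" "c < min m (u + e)"
      using Rats_dense_in_real[of u "min m (u + e)"] uv e by (auto simp: m_def)
    then show ?thesis using True uv by (intro exI[of _ c]) (auto simp: m_def)
  next
    case False
    then have wv: "w = v" using w by simp
    have "max m (v - e) < v" using uv e by (auto simp: m_def)
    then obtain c where "c \<in> \<rat>" "max m (v - e) < c" "c < v"
      using Rats_dense_in_real by blast
    then show ?thesis using wv uv by (intro exI[of _ c]) (auto simp: m_def)
  qed
  have cG: "continuous_on {a..b} G" by (rule ac_continuous[OF G])
  have "G u = G v"
  proof (rule ccontr)
    assume ne: "G u \<noteq> G v"
    define e where "e = \<bar>G u - G v\<bar> / 2"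
    have e: "e > 0" using ne by (simp add: e_def)
    have "\<exists>d>0. \<forall>x\<in>{a..b}. dist x u < d \<longrightarrow> dist (G x) (G u) < e"
      using cG e uv unfolding continuous_on_iff by auto
    then obtain d1 where d1: "d1 > 0" "\<And>x. x \<in> {a..b} \<Longrightarrow> \<bar>x - u\<bar> < d1 \<Longrightarrow> \<bar>G x - G u\<bar> < e"
      unfolding dist_real_def by blast
    have "\<exists>d>0. \<forall>x\<in>{a..b}. dist x v < d \<longrightarrow> dist (G x) (G v) < e"
      using cG e uv unfolding continuous_on_iff by auto
    then obtain d2 where d2: "d2 > 0" "\<And>x. x \<in> {a..b} \<Longrightarrow> \<bar>x - v\<bar> < d2 \<Longrightarrow> \<bar>G x - G v\<bar> < e"
      unfolding dist_real_def by blast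
    obtain c where c: "c \<in> \<rat>" "a < c" "c < b" "\<bar>c - u\<bar> < d1" "c < m" using near[of u d1] d1(1) by auto
    obtain d where d: "d \<in> \<rat>" "a < d" "d < b" "\<bar>d - v\<bar> < d2" "m < d" using near[of v d2] d2(1) by auto
    have "\<bar>G c - G u\<bar> < e" "\<bar>G d - G v\<bar> < e" using d1(2)[of c] d2(2)[of d] c d by auto
    moreover have "G c = G d" using rat[of c d] c d by auto
    ultimately show False unfolding e_def by (simp add: abs_if split: if_splits)
  qed
  then show "integral {u..v} g = 0" using ac_integral[OF G, of u v] uv by (simp add: integral_unique)
qed

text \<open>Subtracting the primitive \<open>G\<close> of \<open>g\<close> leaves \<open>D = f - G\<close>, which is orthogonal to the derivatives of all test functions in
  the countable family. These derivatives are the bumps made mean free, so \<open>D\<close> minus a constant is orthogonal to the bumps.\<close>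

lemma ac_of_countable_tests:
  assumes ab: "a < b" and f: "f absolutely_integrable_on {a..b}" and g: "g absolutely_integrable_on {a..b}"
    and w: "\<And>\<psi>. \<psi> \<in> countable_tests a b \<Longrightarrow>
      (LINT x|Leb a b. f x * deriv \<psi> x) = - (LINT x|Leb a b. g x * \<psi> x)"
  shows "\<exists>F. ac a b F g \<and> (AE x in Leb a b. F x = f x)"
proof -
  define G where "G x = integral {a..x} g" for x
  have G: "ac a b G g" by (rule acI_primitive[OF g, of _ 0]) (simp add: G_def)
  have Gi: "G absolutely_integrable_on {a..b}" by (rule continuous_absolutely_integrable[OF ac_continuous[OF G]])
  define D where "D x = f x - G x" for x
  have Di: "D absolutely_integrable_on {a..b}" unfolding D_def by (rule set_integral_diff(1)[OF f Gi])
  define \<kappa> where "\<kappa> = integral {a..b} (\<lambda>x. D x * unit_mass a b x)"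
  have Dk: "(\<lambda>x. D x - \<kappa>) absolutely_integrable_on {a..b}"
    by (intro set_integral_diff(1) Di continuous_absolutely_integrable[OF continuous_on_const])
  have li: "locally_integrable a b f" "locally_integrable a b G" "locally_integrable a b D"
    by (intro locally_integrableI f Gi Di)+
  have tint: "(\<lambda>x. h x * \<psi> x) integrable_on {a..b}" if "locally_integrable a b h" "\<psi> \<in> test_fun a b" for h \<psi>
    by (rule abs_integrable_on[OF locally_integrable_mult_cont[OF that]])
  have D0: "integral {a..b} (\<lambda>x. D x * deriv \<psi> x) = 0" if pc: "\<psi> \<in> countable_tests a b" for \<psi>
  proof -
    have p: "\<psi> \<in> test_fun a b" using pc countable_tests_subset[OF ab] by blast
    have 1: "weak_deriv a b 1 G g" by (rule ac_weak_deriv[OF ab G])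
    have "integral {a..b} (\<lambda>x. f x * deriv \<psi> x) = integral {a..b} (\<lambda>x. G x * deriv \<psi> x)"
      using w[OF pc] 1 p LINT_test(1)[OF li(1) test_fun_deriv[OF p]] LINT_test(1)[OF li(2) test_fun_deriv[OF p]]
      by (simp add: weak_deriv_def)
    then show ?thesis
      using tint[OF li(1) test_fun_deriv[OF p]] tint[OF li(2) test_fun_deriv[OF p]]
      by (simp add: D_def left_diff_distrib HK_diff)
  qed
  have "AE x in Leb a b. D x - \<kappa> = 0"
  proof (rule zero_of_rational_bumps[OF ab Dk])
    fix \<eta> assume \<eta>r: "\<eta> \<in> rational_bumps a b"
    then have \<eta>: "\<eta> \<in> test_fun a b" by (rule rational_bumps_test_fun)
    define c where "c = integral {a..b} \<eta>"
    have ei: "(\<eta> has_integral c) {a..b}"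
      unfolding c_def by (intro integrable_integral integrable_continuous_real smooth_continuous test_fun_smooth[OF \<eta>])
    have "0 = integral {a..b} (\<lambda>x. D x * mean_free a b \<eta> x)"
      using D0[unfolded countable_tests_def, OF imageI[OF \<eta>r]] mean_free_primitive(2)[OF ab \<eta>] by simp
    also have "\<dots> = integral {a..b} (\<lambda>x. D x * \<eta> x + (- c) * (D x * unit_mass a b x))"
      by (simp add: mean_free_def c_def algebra_simps)
    also have "\<dots> = integral {a..b} (\<lambda>x. D x * \<eta> x) + integral {a..b} (\<lambda>x. (- c) * (D x * unit_mass a b x))"
      by (intro HK_add tint[OF li(3) \<eta>]
          integrable_on_mult_right[OF tint[OF li(3) unit_mass(1)[OF ab]]])
    also have "integral {a..b} (\<lambda>x. (- c) * (D x * unit_mass a b x)) = (- c) * \<kappa>"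
      unfolding \<kappa>_def by (rule integral_mult_right)
    finally have e: "integral {a..b} (\<lambda>x. D x * \<eta> x) = c * \<kappa>" by simp
    have "integral {a..b} (\<lambda>x. (D x - \<kappa>) * \<eta> x) = integral {a..b} (\<lambda>x. D x * \<eta> x + (- \<kappa>) * \<eta> x)"
      by (simp add: algebra_simps)
    also have "\<dots> = integral {a..b} (\<lambda>x. D x * \<eta> x) + integral {a..b} (\<lambda>x. (- \<kappa>) * \<eta> x)"
      by (intro HK_add tint[OF li(3) \<eta>] integrable_on_mult_right[OF has_integral_integrable[OF ei]])
    also have "integral {a..b} (\<lambda>x. (- \<kappa>) * \<eta> x) = (- \<kappa>) * c"
      unfolding c_def by (rule integral_mult_right)
    finally show "integral {a..b} (\<lambda>x. (D x - \<kappa>) * \<eta> x) = 0" using e by simp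
  qed
  then have "AE x in Leb a b. G x + \<kappa> = f x"
    by eventually_elim (simp add: D_def)
  moreover have "ac a b (\<lambda>x. G x + \<kappa>) g" using ac_add[OF G ac_const[of a b \<kappa>]] by simp
  ultimately show ?thesis by blast
qed

lemma weak_deriv_imp_ac:
  assumes ab: "a < b" and w: "weak_deriv a b 1 f g" and f: "f absolutely_integrable_on {a..b}" and g: "g absolutely_integrable_on {a..b}"
  obtains F where "ac a b F g" "AE x in Leb a b. F x = f x"
proof -
  have "(LINT x|Leb a b. f x * deriv \<psi> x) = - (LINT x|Leb a b. g x * \<psi> x)"
    if "\<psi> \<in> countable_tests a b" for \<psi>
  proof -
    have "\<psi> \<in> test_fun a b" using that countable_tests_subset[OF ab] by blast
    then show ?thesis using w by (simp add: weak_deriv_def)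
  qed
  then show ?thesis using ac_of_countable_tests[OF ab f g] that by blast
qed

text \<open>An \<open>m\<close> times differentiable function together with its derivatives, \<open>F 0\<close> to \<open>F m\<close>; all but the last are absolutely
  continuous.\<close>

definition jet :: "real \<Rightarrow> real \<Rightarrow> nat \<Rightarrow> (nat \<Rightarrow> real \<Rightarrow> real) \<Rightarrow> bool" where
  "jet a b m F \<longleftrightarrow> (\<forall>k<m. ac a b (F k) (F (Suc k)))"

lemma jet_exists:
  assumes ab: "a < b" and w: "\<And>k. k \<le> m \<Longrightarrow> weak_deriv a b k f (g k)"
    and i: "\<And>k. k \<le> m \<Longrightarrow> g k absolutely_integrable_on {a..b}"
  shows "\<exists>F. jet a b m F \<and> (\<forall>k\<le>m. AE x in Leb a b. F k x = g k x)"
proof -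
  have "\<exists>F. ac a b F (g (Suc k)) \<and> (AE x in Leb a b. F x = g k x)" if "k < m" for k
  proof -
    have "weak_deriv a b 1 (g k) (g (Suc k))"
      by (rule weak_deriv_step[OF w w]) (use that in auto)
    then show ?thesis
      by (rule weak_deriv_imp_ac[OF ab, of "g k" "g (Suc k)"]) (use that in \<open>auto intro!: i\<close>)
  qed
  then have "\<forall>k. \<exists>F. k < m \<longrightarrow> ac a b F (g (Suc k)) \<and> (AE x in Leb a b. F x = g k x)" by blast
  from choice[OF this] obtain F where
    F: "\<And>k. k < m \<Longrightarrow> ac a b (F k) (g (Suc k)) \<and> (AE x in Leb a b. F k x = g k x)" by blast
  define F' where "F' k = (if k < m then F k else g k)" for k
  have e: "AE x in Leb a b. F' k x = g k x" for k
    using F[of k] by (cases "k < m") (simp_all add: F'_def)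
  have "ac a b (F' k) (F' (Suc k))" if "k < m" for k
  proof (rule ac_cong)
    show "ac a b (F k) (g (Suc k))" using F[OF that] by blast
    show "F k x = F' k x" for x using that by (simp add: F'_def)
    show "AE x in Leb a b. g (Suc k) x = F' (Suc k) x" using e[of "Suc k"] by eventually_elim simp
  qed
  then show ?thesis using e unfolding jet_def by blast
qed

lemma jet_weak_deriv:
  assumes "a < b" "jet a b m F" "k \<le> m" "0 < m"
  shows "weak_deriv a b k (F 0) (F k)"
  using assms(3)
proof (induction k)
  case 0
  have "continuous_on {a..b} (F 0)" using assms(2,4) ac_continuous unfolding jet_def by blast
  then show ?case by (intro weak_deriv_0 locally_integrableI continuous_absolutely_integrable)
next
  case (Suc k)
  then show ?case
    using assms(2) by (intro weak_deriv_Suc[of a b k "F 0" "F k"] ac_weak_deriv[OF assms(1)]) (auto simp: jet_def)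
qed

section \<open>The space \<open>H\<^sup>1\<^sub>0\<close>\<close>

lemma wderiv_AE:
  assumes "weak_deriv a b k f g" shows "AE x in Leb a b. wderiv a b k f x = g x"
proof -
  have "weak_deriv a b k f (wderiv a b k f)" unfolding wderiv_def by (rule someI[where P="weak_deriv a b k f", OF assms])
  from weak_deriv_unique[OF this assms] show ?thesis .
qed

lemma norm_H1:
  assumes "weak_deriv a b 1 f g" "f \<in> L2 {a<..<b}" "g \<in> L2 {a<..<b}"
  shows "norm_H a b 1 f = sqrt ((LINT x|Leb a b. (f x)\<^sup>2) + (LINT x|Leb a b. (g x)\<^sup>2))"
proof -
  have 0: "weak_deriv a b 0 f f" using assms(1) by (intro weak_deriv_0) (simp add: weak_deriv_def)
  have "inner_L2 {a<..<b} (wderiv a b 0 f) (wderiv a b 0 f) = inner_L2 {a<..<b} f f"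
    "inner_L2 {a<..<b} (wderiv a b 1 f) (wderiv a b 1 f) = inner_L2 {a<..<b} g g"
    using wderiv_AE[OF 0] wderiv_AE[OF assms(1)] by (auto intro!: inner_L2_cong_AE)
  then show ?thesis by (simp add: norm_H_def inner_L2_def power2_eq_square)
qed

lemma L2_absolutely_integrable: "f \<in> L2 {a<..<b} \<Longrightarrow> f absolutely_integrable_on {a..b}" for f :: "real \<Rightarrow> real"
  using L2_integrable[OF _ interval_lmeasurable] integrable_lebesgue_on_interval by blast

lemma LINT_const_interval: "a < b \<Longrightarrow> (LINT x|Leb a b. c) = (b - a) * (c::real)"
  by (simp add: measure_restrict_space)

lemma integral_abs_bound_abs:
  fixes h :: "real \<Rightarrow> real"
  assumes "h absolutely_integrable_on {c..d}"
  shows "\<bar>integral {c..d} h\<bar> \<le> integral {c..d} (\<lambda>x. \<bar>h x\<bar>)"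
proof -
  have "norm (integral {c..d} h) \<le> integral {c..d} (\<lambda>x. \<bar>h x\<bar>)"
    by (rule HK_norm_bound)
       (use assms in \<open>auto intro: abs_integrable_on set_integrable_abs\<close>)
  then show ?thesis by simp
qed

text \<open>The Cauchy-Schwarz inequality against the constant function, from \<open>(h - m)\<^sup>2 \<ge> 0\<close> with the mean \<open>m\<close>.\<close>

lemma integral_square_le:
  fixes h :: "real \<Rightarrow> real"
  assumes cd: "c < d" and h: "h integrable_on {c..d}" and h2: "(\<lambda>x. (h x)\<^sup>2) integrable_on {c..d}"
  shows "(integral {c..d} h)\<^sup>2 \<le> (d - c) * integral {c..d} (\<lambda>x. (h x)\<^sup>2)"
proof -
  define m where "m = integral {c..d} h / (d - c)"
  have "((\<lambda>x. (h x)\<^sup>2 + ((- 2 * m) * h x + m\<^sup>2)) has_integral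
      (integral {c..d} (\<lambda>x. (h x)\<^sup>2) + ((- 2 * m) * integral {c..d} h + (d - c) *\<^sub>R m\<^sup>2))) {c..d}"
    using cd by (intro has_integral_add integrable_integral h h2 has_integral_mult_right has_integral_const_real[where a=c and b=d, simplified])
       (use has_integral_const_real[of "m\<^sup>2" c d] in simp)
  moreover have "(h x)\<^sup>2 + ((- 2 * m) * h x + m\<^sup>2) \<ge> 0" for x
    using zero_le_power2[of "h x - m"] by (simp add: power2_diff algebra_simps)
  ultimately have "0 \<le> integral {c..d} (\<lambda>x. (h x)\<^sup>2) + ((- 2 * m) * integral {c..d} h + (d - c) *\<^sub>R m\<^sup>2)"
    by (rule has_integral_nonneg)
  also have "\<dots> = integral {c..d} (\<lambda>x. (h x)\<^sup>2) - (integral {c..d} h)\<^sup>2 / (d - c)"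
  proof -
    have "(d - c) * m\<^sup>2 = m * integral {c..d} h" "(integral {c..d} h)\<^sup>2 / (d - c) = m * integral {c..d} h"
      using cd by (simp_all add: m_def power2_eq_square)
    then show ?thesis by simp
  qed
  finally have "(integral {c..d} h)\<^sup>2 / (d - c) \<le> integral {c..d} (\<lambda>x. (h x)\<^sup>2)" by simp
  then show ?thesis using cd by (simp add: pos_divide_le_eq mult.commute)
qed

lemma integral_abs_square_le:
  fixes h :: "real \<Rightarrow> real"
  assumes ab: "a < b" and h: "h \<in> L2 {a<..<b}"
  shows "(integral {a..b} (\<lambda>x. \<bar>h x\<bar>))\<^sup>2 \<le> (b - a) * (LINT x|Leb a b. (h x)\<^sup>2)"
proof -
  have i: "h absolutely_integrable_on {a..b}" by (rule L2_absolutely_integrable[OF h])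
  have i2: "(\<lambda>x. (h x)\<^sup>2) absolutely_integrable_on {a..b}"
    using L2_square_integrable[OF h] integrable_lebesgue_on_interval by blast
  have "(integral {a..b} (\<lambda>x. \<bar>h x\<bar>))\<^sup>2 \<le> (b - a) * integral {a..b} (\<lambda>x. \<bar>h x\<bar>\<^sup>2)"
    using abs_integrable_on[OF set_integrable_abs[OF i]] abs_integrable_on[OF i2]
    by (intro integral_square_le[OF ab]) auto
  then show ?thesis using LINT_interval[OF i2] by simp
qed

text \<open>Functions in \<open>H\<^sup>1\<^sub>0\<close> are limits of test functions, whose derivatives integrate to zero.\<close>

lemma H10_integral_zero:
  assumes ab: "a < b" and v: "v \<in> H10 a b" and g: "weak_deriv a b 1 v g" "g \<in> L2 {a<..<b}"
  shows "integral {a..b} g = 0"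
proof -
  have vH: "v \<in> H a b 1" using v by (simp add: H10_def)
  obtain v0 where v0: "v0 \<in> L2 {a<..<b}" "weak_deriv a b 0 v v0" using vH by (force simp: H_def)
  have "locally_integrable a b v" using g(1) by (simp add: weak_deriv_def)
  then have "AE x in Leb a b. v0 x = v x" using weak_deriv_unique[OF v0(2) weak_deriv_0] by blast
  then have vL: "v \<in> L2 {a<..<b}" using L2_cong_AE[OF v0(1)] by auto
  have gi: "g absolutely_integrable_on {a..b}" by (rule L2_absolutely_integrable[OF g(2)])
  have small: "\<bar>integral {a..b} g\<bar> \<le> (b - a + 1) * e" if e: "e > 0" for e
  proof -
    obtain \<psi> where p: "\<psi> \<in> test_fun a b" "norm_H a b 1 (\<lambda>x. v x - \<psi> x) < e"
      using v e by (auto simp: H10_def)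
    note p' = test_fun_deriv[OF p(1)]
    have pi: "deriv \<psi> absolutely_integrable_on {a..b}" by (rule L2_absolutely_integrable[OF test_fun_L2[OF p']])
    have acp: "ac a b \<psi> (deriv \<psi>)" by (rule ac_smooth[OF test_fun_smooth[OF p(1)]])
    have wp: "weak_deriv a b 1 \<psi> (deriv \<psi>)" by (rule ac_weak_deriv[OF ab acp])
    have w: "weak_deriv a b 1 (\<lambda>x. v x - \<psi> x) (\<lambda>x. g x - deriv \<psi> x)"
      unfolding weak_deriv_def
    proof (intro conjI ballI)
      show l: "locally_integrable a b (\<lambda>x. v x - \<psi> x)" "locally_integrable a b (\<lambda>x. g x - deriv \<psi> x)"
        using g(1) wp by (auto simp: weak_deriv_def locally_integrable_def)
      fix \<eta> assume \<eta>: "\<eta> \<in> test_fun a b"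
      have "locally_integrable a b v" "locally_integrable a b g" "locally_integrable a b \<psi>" "locally_integrable a b (deriv \<psi>)"
        using g(1) wp by (auto simp: weak_deriv_def)
      note i = LINT_test(2)[OF this(1) test_fun_deriv[OF \<eta>]] LINT_test(2)[OF this(2) \<eta>]
        LINT_test(2)[OF this(3) test_fun_deriv[OF \<eta>]] LINT_test(2)[OF this(4) \<eta>]
      show "(LINT x|Leb a b. (v x - \<psi> x) * (deriv ^^ 1) \<eta> x)
          = (-1) ^ 1 * (LINT x|Leb a b. (g x - deriv \<psi> x) * \<eta> x)"
        using g(1) wp \<eta> i by (simp add: weak_deriv_def left_diff_distrib)
    qed
    have L: "(\<lambda>x. v x - \<psi> x) \<in> L2 {a<..<b}" "(\<lambda>x. g x - deriv \<psi> x) \<in> L2 {a<..<b}"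
      by (rule L2_diff[OF vL test_fun_L2[OF p(1)]], rule L2_diff[OF g(2) test_fun_L2[OF p']])
    let ?I = "LINT x|Leb a b. (g x - deriv \<psi> x)\<^sup>2"
    let ?J = "LINT x|Leb a b. (v x - \<psi> x)\<^sup>2"
    have sq: "sqrt (?J + ?I) < e" using p(2) unfolding norm_H1[OF w L] .
    have JI: "?J \<ge> 0" "?I \<ge> 0" by (auto intro: LINT_nonneg)
    have "(sqrt (?J + ?I))\<^sup>2 < e\<^sup>2" using sq JI by (intro power_strict_mono) auto
    moreover have "(sqrt (?J + ?I))\<^sup>2 = ?J + ?I" using JI by (intro real_sqrt_pow2) linarith
    ultimately have "?I < e\<^sup>2" using JI by linarith
    then have "(b - a) * ?I \<le> (b - a) * e\<^sup>2" using ab by (intro mult_left_mono) auto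
    also have "\<dots> \<le> (b - a + 1)\<^sup>2 * e\<^sup>2"
      using ab mult_nonneg_nonneg[of "b - a" "b - a"] by (intro mult_right_mono) (auto simp: power2_eq_square algebra_simps)
    also have "\<dots> = ((b - a + 1) * e)\<^sup>2" by (simp add: power_mult_distrib)
    finally have "(integral {a..b} (\<lambda>x. \<bar>g x - deriv \<psi> x\<bar>))\<^sup>2 \<le> ((b - a + 1) * e)\<^sup>2"
      using integral_abs_square_le[OF ab L(2)] by linarith
    then have A: "integral {a..b} (\<lambda>x. \<bar>g x - deriv \<psi> x\<bar>) \<le> (b - a + 1) * e"
      by (rule power2_le_imp_le) (use ab e in auto)
    have "integral {a..b} (deriv \<psi>) = 0"
      using ac_integral[OF acp, of a b] ab test_fun_zero[OF p(1)] by (simp add: integral_unique)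
    then have "integral {a..b} g = integral {a..b} (\<lambda>x. g x - deriv \<psi> x)"
      using gi pi by (simp add: HK_diff abs_integrable_on)
    also have "\<bar>\<dots>\<bar> \<le> integral {a..b} (\<lambda>x. \<bar>g x - deriv \<psi> x\<bar>)"
      by (rule integral_abs_bound_abs[OF set_integral_diff(1)[OF gi pi]])
    finally show ?thesis using A by linarith
  qed
  show ?thesis
  proof (rule ccontr)
    assume n: "integral {a..b} g \<noteq> 0"
    define c where "c = \<bar>integral {a..b} g\<bar>"
    have "c > 0" using n by (simp add: c_def)
    define k where "k = b - a + 1"
    have k: "k > 0" using ab by (simp add: k_def)
    have "c \<le> k * (c / (2 * k))" unfolding c_def k_def
      by (rule small) (use n ab in auto)
    also have "\<dots> = c / 2" using k by simp
    finally show False using \<open>c > 0\<close> by simp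
  qed
qed


text \<open>The approximation is built on derivatives: \<open>\<eta>\<close> approximates \<open>f\<close> in \<open>L\<^sup>2\<close>, its mean is removed, and the primitive of the
  result is a test function. Since \<open>\<integral> f = 0\<close>, removing the mean costs at most a constant times the approximation
  error.\<close>

lemma H10I:
  assumes ab: "a < b" and F: "ac a b F f" and f: "f \<in> L2 {a<..<b}" and 0: "F a = 0" "F b = 0"
  shows "F \<in> H10 a b"
proof -
  let ?M = "Leb a b"
  have cL: "F \<in> L2 {a<..<b}" if "continuous_on {a..b} F" for F
  proof -
    have "bounded (F ` {a..b})" by (intro compact_imp_bounded compact_continuous_image that) auto
    then obtain K where K: "\<forall>x\<in>{a..b}. \<bar>F x\<bar> \<le> K" by (auto simp: bounded_iff)
    have "F \<in> borel_measurable ?M"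
      using continuous_on_subset[OF that open_subset_closed_interval] by (intro continuous_imp_measurable_on_sets_lebesgue) auto
    then show ?thesis by (rule L2_bounded[OF interval_lmeasurable, where K=K]) (use K in \<open>auto intro!: AE_I2\<close>)
  qed
  have FL: "F \<in> L2 {a<..<b}" by (rule cL[OF ac_continuous[OF F]])
  have wF: "weak_deriv a b 1 F f" by (rule ac_weak_deriv[OF ab F])
  have "F \<in> H a b 1"
    unfolding H_def
  proof (intro CollectI allI impI)
    fix k :: nat assume "k \<le> 1"
    then consider "k = 0" | "k = 1" by linarith
    then show "\<exists>g\<in>L2 {a<..<b}. weak_deriv a b k F g"
    proof cases
      case 1
      have "weak_deriv a b 0 F F" using wF by (intro weak_deriv_0) (simp add: weak_deriv_def)
      then show ?thesis using FL 1 by blast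
    qed (use f wF in blast)
  qed
  moreover have "\<exists>\<psi>\<in>test_fun a b. norm_H a b 1 (\<lambda>x. F x - \<psi> x) < e" if e: "e > 0" for e
  proof -
    define R where "R = (LINT x|?M. (unit_mass a b x)\<^sup>2)"
    have R: "R \<ge> 0" unfolding R_def by (auto intro: LINT_nonneg)
    define L where "L = b - a"
    have L: "L > 0" using ab by (simp add: L_def)
    define C where "C = (2 + 2 * L * R) * (1 + L * L)"
    have C: "C > 0" unfolding C_def using L R by (intro mult_pos_pos add_pos_nonneg) auto
    \<comment> \<open>with this choice the final estimate is \<open>C \<delta> = e\<^sup>2/2\<close>\<close>
    define \<delta> where "\<delta> = e\<^sup>2 / (2 * C)"
    have \<delta>: "\<delta> > 0" using e C by (simp add: \<delta>_def)
    have absL2: "\<bar>integral {a..x} h\<bar>\<^sup>2 \<le> L * (LINT x|?M. (h x)\<^sup>2)" if h: "h \<in> L2 {a<..<b}" and x: "x \<in> {a..b}" for h x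
    proof -
      have hi: "h absolutely_integrable_on {a..b}" by (rule L2_absolutely_integrable[OF h])
      have hx: "h absolutely_integrable_on {a..x}" using absolutely_integrable_on_subinterval[OF hi, of a x] x by auto
      have "\<bar>integral {a..x} h\<bar> \<le> integral {a..x} (\<lambda>x. \<bar>h x\<bar>)" by (rule integral_abs_bound_abs[OF hx])
      also have "\<dots> \<le> integral {a..b} (\<lambda>x. \<bar>h x\<bar>)"
        using hx hi x by (intro integral_subset_le) (auto intro: abs_integrable_on set_integrable_abs)
      finally have "\<bar>integral {a..x} h\<bar>\<^sup>2 \<le> (integral {a..b} (\<lambda>x. \<bar>h x\<bar>))\<^sup>2" by (intro power_mono) auto
      also have "\<dots> \<le> L * (LINT x|?M. (h x)\<^sup>2)" unfolding L_def by (rule integral_abs_square_le[OF ab h])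
      finally show ?thesis .
    qed
    obtain \<eta> where \<eta>: "\<eta> \<in> test_fun a b" "(LINT x|?M. (f x - \<eta> x)\<^sup>2) < \<delta>"
      using approximable_L2[OF f] \<delta> unfolding approximable_def by blast
    define c where "c = integral {a..b} \<eta>"
    define \<theta> where "\<theta> = mean_free a b \<eta>"
    define \<psi> where "\<psi> x = integral {a..x} \<theta>" for x
    have ei: "(\<eta> has_integral c) {a..b}"
      unfolding c_def by (intro integrable_integral integrable_continuous_real smooth_continuous test_fun_smooth[OF \<eta>(1)])
    note mf = mean_free_primitive[OF ab \<eta>(1), folded \<theta>_def]
    have \<theta>: "\<theta> \<in> test_fun a b" by (rule mf(3))
    have \<psi>: "\<psi> \<in> test_fun a b" and d\<psi>: "deriv \<psi> = \<theta>" using mf(1,2) by (simp_all add: \<psi>_def[abs_def])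
    have ac\<psi>: "ac a b \<psi> \<theta>" using ac_smooth[OF test_fun_smooth[OF \<psi>], of a b] by (simp add: d\<psi>)
    have acD: "ac a b (\<lambda>x. F x - \<psi> x) (\<lambda>x. f x - \<theta> x)" by (rule ac_diff[OF F ac\<psi>])
    have hL: "(\<lambda>x. f x - \<theta> x) \<in> L2 {a<..<b}" by (rule L2_diff[OF f test_fun_L2[OF \<theta>]])
    have feL: "(\<lambda>x. f x - \<eta> x) \<in> L2 {a<..<b}" by (rule L2_diff[OF f test_fun_L2[OF \<eta>(1)]])
    define Q where "Q = (LINT x|?M. (f x - \<theta> x)\<^sup>2)"
    have f0: "integral {a..b} f = 0" using ac_integral[OF F, of a b] ab 0 by (simp add: integral_unique)
    have "integral {a..b} (\<lambda>x. f x - \<eta> x) = - c"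
      using f0 ei acD_integrable[OF F]
      by (subst HK_diff) (auto simp: c_def has_integral_iff intro: abs_integrable_on)
    then have "c\<^sup>2 \<le> L * (LINT x|?M. (f x - \<eta> x)\<^sup>2)" using absL2[OF feL, of b] ab by simp
    also have "\<dots> \<le> L * \<delta>" using \<eta>(2) L by (intro mult_left_mono) auto
    finally have c2: "c\<^sup>2 \<le> L * \<delta>" .
    have "Q \<le> 2 * (LINT x|?M. (f x - \<eta> x)\<^sup>2) + 2 * (LINT x|?M. (\<eta> x - \<theta> x)\<^sup>2)"
      unfolding Q_def by (rule LINT_square_triangle[OF f test_fun_L2[OF \<eta>(1)] test_fun_L2[OF \<theta>]])
    also have "(LINT x|?M. (\<eta> x - \<theta> x)\<^sup>2) = c\<^sup>2 * R"
      by (simp add: \<theta>_def mean_free_def c_def R_def power_mult_distrib)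
    also have "2 * (LINT x|?M. (f x - \<eta> x)\<^sup>2) + 2 * (c\<^sup>2 * R) \<le> 2 * \<delta> + 2 * (L * \<delta> * R)"
      using \<eta>(2) mult_right_mono[OF c2 R] by linarith
    finally have Q: "Q \<le> (2 + 2 * L * R) * \<delta>" by (simp add: algebra_simps)
    have Q0: "Q \<ge> 0" unfolding Q_def by (auto intro: LINT_nonneg)
    have pt: "(F x - \<psi> x)\<^sup>2 \<le> L * Q" if x: "x \<in> {a..b}" for x
    proof -
      have "integral {a..x} (\<lambda>x. f x - \<theta> x) = (F x - \<psi> x) - (F a - \<psi> a)"
        using acD x by (auto simp: ac_def intro!: integral_unique)
      also have "\<dots> = F x - \<psi> x" using 0 test_fun_zero[OF \<psi>, of a] by simp
      finally show ?thesis using absL2[OF hL x] by (simp add: Q_def)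
    qed
    have DL: "(\<lambda>x. F x - \<psi> x) \<in> L2 {a<..<b}" by (rule cL[OF ac_continuous[OF acD]])
    have "(LINT x|?M. (F x - \<psi> x)\<^sup>2) \<le> (LINT x|?M. L * Q)"
      by (rule integral_mono_AE[OF L2_square_integrable[OF DL]])
         (use L2_integrable[OF L2_const[OF interval_lmeasurable] interval_lmeasurable] pt in \<open>auto intro!: AE_I2\<close>)
    also have "\<dots> = L * L * Q" by (simp only: LINT_const_interval[OF ab] L_def mult.assoc)
    finally have "(LINT x|?M. (F x - \<psi> x)\<^sup>2) + Q \<le> (1 + L * L) * Q" by (simp add: algebra_simps)
    also have "\<dots> \<le> (1 + L * L) * ((2 + 2 * L * R) * \<delta>)" using Q L by (intro mult_left_mono) auto
    also have "\<dots> = C * \<delta>" by (simp add: C_def)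
    also have "\<dots> = e\<^sup>2 / 2" using C by (simp add: \<delta>_def)
    also have "\<dots> < e\<^sup>2" using e by simp
    finally have "sqrt ((LINT x|?M. (F x - \<psi> x)\<^sup>2) + Q) < sqrt (e\<^sup>2)" by (rule real_sqrt_less_mono)
    then have "norm_H a b 1 (\<lambda>x. F x - \<psi> x) < e"
      unfolding norm_H1[OF ac_weak_deriv[OF ab acD] DL hL] using e by (simp add: Q_def)
    then show ?thesis using \<psi> by blast
  qed
  ultimately show ?thesis by (simp add: H10_def)
qed

section \<open>Measurability and slices on the space-time cylinder\<close>

lemma cyl_box: "cyl T a b = box (0, a) (T, b)"
  by (auto simp: cyl_def mem_box Basis_prod_def)

lemma cyl_borel[measurable]: "cyl T a b \<in> sets borel"
  by (simp add: cyl_box)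

lemma cyl_sets[simp]: "cyl T a b \<in> sets lebesgue"
  by (simp add: cyl_box)

lemma cyl_lmeasurable: "cyl T a b \<in> lmeasurable"
  by (simp add: cyl_box)

lemma mem_cyl: "(t, x) \<in> cyl T a b \<longleftrightarrow> t \<in> {0<..<T} \<and> x \<in> {a<..<b}"
  by (simp add: cyl_def)

text \<open>Borel functions vanishing off \<open>S\<close>. Every Lebesgue measurable function on \<open>S\<close> agrees almost everywhere with one, and
  product measurability and the Fubini theorem of the product measure apply to them directly.\<close>

definition zrep :: "'a::euclidean_space set \<Rightarrow> ('a \<Rightarrow> real) \<Rightarrow> bool" where
  "zrep S f \<longleftrightarrow> f \<in> borel_measurable borel \<and> (\<forall>p. p \<notin> S \<longrightarrow> f p = 0)"

lemma AE_lebesgue_on_iff: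
  assumes "S \<in> sets borel"
  shows "(AE p in lebesgue_on S. P p) \<longleftrightarrow> (AE p in lborel. p \<in> S \<longrightarrow> P p)"
  using assms by (simp add: AE_restrict_space_iff AE_completion_iff)

lemma zrep_exists:
  assumes f: "f \<in> borel_measurable (lebesgue_on S)" and S: "S \<in> sets borel"
  obtains g where "zrep S g" "AE p in lebesgue_on S. f p = g p"
proof -
  have "(\<lambda>p. if p \<in> S then f p else 0) \<in> borel_measurable lebesgue"
    using f S by (simp add: borel_measurable_if)
  then obtain h where h: "h \<in> borel_measurable lborel" "AE p in lborel. (if p \<in> S then f p else 0) = h p"
    using completion_ex_borel_measurable_real by blast
  have "zrep S (\<lambda>p. indicator S p * h p)"
    using h(1) S by (auto simp: zrep_def)
  moreover have "AE p in lebesgue_on S. f p = indicator S p * h p"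
    unfolding AE_lebesgue_on_iff[OF S] using h(2) by eventually_elim auto
  ultimately show ?thesis using that by blast
qed

lemma zrep_lebesgue_on:
  assumes "zrep S f" "S \<in> sets borel"
  shows "f \<in> borel_measurable (lebesgue_on S)"
    and "integrable (lebesgue_on S) f \<longleftrightarrow> integrable lborel f"
    and "integral\<^sup>L (lebesgue_on S) f = integral\<^sup>L lborel f"
proof -
  have m: "f \<in> borel_measurable lborel" using assms(1) by (simp add: zrep_def)
  then have ml: "f \<in> borel_measurable lebesgue" by (rule measurable_completion)
  then show "f \<in> borel_measurable (lebesgue_on S)" by (rule measurable_restrict_space1)
  have z: "indicator S p *\<^sub>R f p = f p" for p using assms(1) by (auto simp: zrep_def indicator_def)
  show "integrable (lebesgue_on S) f \<longleftrightarrow> integrable lborel f"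
    using assms(2) m by (simp add: integrable_restrict_space z integrable_completion del: real_scaleR_def)
  show "integral\<^sup>L (lebesgue_on S) f = integral\<^sup>L lborel f"
    using assms(2) m by (simp add: integral_restrict_space z integral_completion del: real_scaleR_def)
qed

lemma zrep_slice:
  assumes "zrep (cyl T a b) f"
  shows "zrep {a<..<b} (\<lambda>x. f (t, x))" "zrep {0<..<T} (\<lambda>t. f (t, x))"
  using assms unfolding zrep_def by (auto simp: mem_cyl)

lemma zrep_slice_outside: "zrep (cyl T a b) f \<Longrightarrow> t \<notin> {0<..<T} \<Longrightarrow> f (t, x) = 0"
  "zrep (cyl T a b) f \<Longrightarrow> x \<notin> {a<..<b} \<Longrightarrow> f (t, x) = 0"
  unfolding zrep_def by (auto simp: cyl_def)

lemma AE_cyl_slices: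
  assumes "AE p in Leb2 T a b. P p"
  shows "AE t in Leb 0 T. AE x in Leb a b. P (t, x)"
    and "AE x in Leb a b. AE t in Leb 0 T. P (t, x)"
proof -
  have ae: "AE p in (lborel \<Otimes>\<^sub>M lborel). p \<in> cyl T a b \<longrightarrow> P p"
    using assms unfolding AE_lebesgue_on_iff[OF cyl_borel] lborel_prod .
  have "AE t in lborel. AE x in lborel. (t, x) \<in> cyl T a b \<longrightarrow> P (t, x)"
    by (rule lborel_pair.AE_pair[OF ae])
  then show "AE t in Leb 0 T. AE x in Leb a b. P (t, x)"
    by (auto simp: AE_lebesgue_on_iff mem_cyl elim!: eventually_mono)
  have ae': "AE p in (lborel \<Otimes>\<^sub>M lborel). case p of (x, t) \<Rightarrow> (t, x) \<in> cyl T a b \<longrightarrow> P (t, x)"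
  proof -
    have "AE p in distr (lborel \<Otimes>\<^sub>M lborel) (lborel \<Otimes>\<^sub>M lborel) (\<lambda>(x, y). (y, x)). p \<in> cyl T a b \<longrightarrow> P p"
      by (subst lborel_pair.distr_pair_swap[symmetric]) (rule ae)
    then have "AE p in (lborel \<Otimes>\<^sub>M lborel). (case p of (x, y) \<Rightarrow> (y, x)) \<in> cyl T a b \<longrightarrow> P (case p of (x, y) \<Rightarrow> (y, x))"
      by (rule AE_distrD[rotated]) measurable
    then show ?thesis by eventually_elim auto
  qed
  have "AE x in lborel. AE t in lborel. (t, x) \<in> cyl T a b \<longrightarrow> P (t, x)"
    using lborel_pair.AE_pair[OF ae'] by simp
  then show "AE x in Leb a b. AE t in Leb 0 T. P (t, x)"
    by (auto simp: AE_lebesgue_on_iff mem_cyl elim!: eventually_mono)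
qed

lemma AE_cylI_zrep:
  assumes P: "{p. P p} \<in> sets borel"
    and "AE t in Leb 0 T. AE x in Leb a b. P (t, x)"
  shows "AE p in Leb2 T a b. P p"
proof -
  have "AE t in lborel. AE x in lborel. (t, x) \<in> cyl T a b \<longrightarrow> P (t, x)"
    using assms(2) by (auto simp: AE_lebesgue_on_iff mem_cyl elim!: eventually_mono)
  moreover have "{p \<in> space (lborel \<Otimes>\<^sub>M lborel). p \<in> cyl T a b \<longrightarrow> P p} \<in> sets (lborel \<Otimes>\<^sub>M (lborel :: real measure) :: (real \<times> real) measure)"
  proof -
    have "{p. p \<in> cyl T a b \<longrightarrow> P p} = (- cyl T a b) \<union> {p. P p}" by auto
    also have "\<dots> \<in> sets borel" using P by (intro sets.Un) auto
    finally show ?thesis unfolding lborel_prod by simp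
  qed
  ultimately have "AE p in (lborel \<Otimes>\<^sub>M lborel). p \<in> cyl T a b \<longrightarrow> P p"
    by (intro lborel_pair.AE_pair_measure)
  then show ?thesis unfolding AE_lebesgue_on_iff[OF cyl_borel] lborel_prod .
qed

text \<open>Passing from almost every slice to almost every point requires a measurable exceptional set, here that of two
  measurable functions.\<close>

lemma AE_cyl_eqI:
  fixes f g :: "real \<times> real \<Rightarrow> real"
  assumes f: "f \<in> borel_measurable (Leb2 T a b)" and g: "g \<in> borel_measurable (Leb2 T a b)"
    and "AE t in Leb 0 T. AE x in Leb a b. f (t, x) = g (t, x)"
  shows "AE p in Leb2 T a b. f p = g p"
proof -
  obtain f' where f': "zrep (cyl T a b) f'" "AE p in Leb2 T a b. f p = f' p"
    using zrep_exists[OF f cyl_borel] by blast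
  obtain g' where g': "zrep (cyl T a b) g'" "AE p in Leb2 T a b. g p = g' p"
    using zrep_exists[OF g cyl_borel] by blast
  have "AE p in Leb2 T a b. f' p = g' p"
  proof (rule AE_cylI_zrep)
    have [measurable]: "f' \<in> borel_measurable borel" "g' \<in> borel_measurable borel" using f'(1) g'(1) by (auto simp: zrep_def)
    show "{p. f' p = g' p} \<in> sets borel" by measurable
    show "AE t in Leb 0 T. AE x in Leb a b. f' (t, x) = g' (t, x)"
      using assms(3) AE_cyl_slices(1)[OF f'(2)] AE_cyl_slices(1)[OF g'(2)]
    proof eventually_elim
      case (elim t)
      then show ?case by eventually_elim simp
    qed
  qed
  then show ?thesis using f'(2) g'(2) by eventually_elim simp
qed

lemma AE_cyl_leI:
  fixes f g :: "real \<times> real \<Rightarrow> real"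
  assumes f: "f \<in> borel_measurable (Leb2 T a b)" and g: "g \<in> borel_measurable (Leb2 T a b)"
    and "AE t in Leb 0 T. AE x in Leb a b. f (t, x) \<le> g (t, x)"
  shows "AE p in Leb2 T a b. f p \<le> g p"
proof -
  have m: "(\<lambda>p. min (f p) (g p)) \<in> borel_measurable (Leb2 T a b)"
    by (intro borel_measurable_min f g)
  have "AE t in Leb 0 T. AE x in Leb a b. f (t, x) = min (f (t, x)) (g (t, x))"
    using assms(3)
  proof eventually_elim
    case (elim t)
    then show ?case by eventually_elim (simp add: min_def)
  qed
  then have "AE p in Leb2 T a b. f p = min (f p) (g p)"
    by (rule AE_cyl_eqI[OF f m])
  then show ?thesis by eventually_elim (simp add: min_def split: if_splits)
qed

text \<open>Fubini for Lebesgue measure on the cylinder: a Lebesgue measurable function may have non-measurable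
  slices on a null set, so all statements about slices hold almost everywhere.\<close>

lemma cyl_Fubini:
  fixes f :: "real \<times> real \<Rightarrow> real"
  assumes f: "integrable (Leb2 T a b) f"
  shows "AE t in Leb 0 T. integrable (Leb a b) (\<lambda>x. f (t, x))"
    and "integrable (Leb 0 T) (\<lambda>t. LINT x|Leb a b. f (t, x))"
    and "(LINT t|Leb 0 T. LINT x|Leb a b. f (t, x)) = integral\<^sup>L (Leb2 T a b) f"
    and "AE x in Leb a b. integrable (Leb 0 T) (\<lambda>t. f (t, x))"
    and "integrable (Leb a b) (\<lambda>x. LINT t|Leb 0 T. f (t, x))"
    and "(LINT x|Leb a b. LINT t|Leb 0 T. f (t, x)) = integral\<^sup>L (Leb2 T a b) f"
proof -
  obtain g where g: "zrep (cyl T a b) g" "AE p in Leb2 T a b. f p = g p"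
    using zrep_exists[OF borel_measurable_integrable[OF f] cyl_borel] by blast
  have gm: "g \<in> borel_measurable (Leb2 T a b)" by (rule zrep_lebesgue_on(1)[OF g(1) cyl_borel])
  have "integrable (Leb2 T a b) g"
    using f g(2) gm integrable_cong_AE[of f "Leb2 T a b" g] by auto
  then have gi: "integrable lborel g" using zrep_lebesgue_on(2)[OF g(1) cyl_borel] by simp
  then have gi': "integrable (lborel \<Otimes>\<^sub>M lborel) g" by (simp add: lborel_prod)
  have eq: "integral\<^sup>L (Leb2 T a b) f = integral\<^sup>L (lborel \<Otimes>\<^sub>M lborel) g"
    using integral_lebesgue_on_cong_AE[OF g(2)] zrep_lebesgue_on(3)[OF g(1) cyl_borel] by (simp add: lborel_prod)
  have sl: "integrable (Leb a b) (\<lambda>x. g (t, x)) \<longleftrightarrow> integrable lborel (\<lambda>x. g (t, x))"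
    "(LINT x|Leb a b. g (t, x)) = (LINT x|lborel. g (t, x))" for t
    using zrep_lebesgue_on(2,3)[OF zrep_slice(1)[OF g(1)]] by auto
  have sr: "integrable (Leb 0 T) (\<lambda>t. g (t, x)) \<longleftrightarrow> integrable lborel (\<lambda>t. g (t, x))"
    "(LINT t|Leb 0 T. g (t, x)) = (LINT t|lborel. g (t, x))" for x
    using zrep_lebesgue_on(2,3)[OF zrep_slice(2)[OF g(1)]] by auto
  have gc: "integrable (lborel \<Otimes>\<^sub>M lborel) (\<lambda>(x, y). g (x, y))" using gi' by simp
  have z1: "zrep {0<..<T} (\<lambda>t. LINT x|lborel. g (t, x))"
    using lborel_pair.integrable_fst'[OF gi'] zrep_slice_outside(1)[OF g(1)] by (auto simp: zrep_def)
  have z2: "zrep {a<..<b} (\<lambda>x. LINT t|lborel. g (t, x))"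
    using lborel_pair.integrable_snd[OF gc] zrep_slice_outside(2)[OF g(1)] by (auto simp: zrep_def)
  have e1: "AE t in Leb 0 T. (LINT x|lborel. g (t, x)) = (LINT x|Leb a b. f (t, x))"
    using AE_cyl_slices(1)[OF g(2)]
    by eventually_elim (use integral_lebesgue_on_cong_AE in \<open>auto simp: sl(2)[symmetric] elim!: eventually_mono intro!: integral_lebesgue_on_cong_AE\<close>)
  have e2: "AE x in Leb a b. (LINT t|lborel. g (t, x)) = (LINT t|Leb 0 T. f (t, x))"
    using AE_cyl_slices(2)[OF g(2)]
    by eventually_elim (auto simp: sr(2)[symmetric] elim!: eventually_mono intro!: integral_lebesgue_on_cong_AE)
  have cong: "integrable (lebesgue_on S) h" if "integrable (lebesgue_on S) k" "AE x in lebesgue_on S. k x = h x" "S \<in> sets lebesgue"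
    for S :: "real set" and h k :: "real \<Rightarrow> real"
    using that borel_measurable_lebesgue_on_AE[OF borel_measurable_integrable[OF that(1)] that(2,3)]
      integrable_cong_AE[of k "lebesgue_on S" h] by auto
  show "AE t in Leb 0 T. integrable (Leb a b) (\<lambda>x. f (t, x))"
  proof -
    have "AE t in Leb 0 T. integrable lborel (\<lambda>x. g (t, x))"
      using lborel_pair.AE_integrable_fst'[OF gi'] by (auto simp: AE_lebesgue_on_iff elim!: eventually_mono)
    then show ?thesis using AE_cyl_slices(1)[OF g(2)]
    proof eventually_elim
      case (elim t)
      show ?case by (rule cong[of _ "\<lambda>x. g (t, x)"]) (use elim sl(1) in \<open>auto elim!: eventually_mono\<close>)
    qed
  qed
  show "AE x in Leb a b. integrable (Leb 0 T) (\<lambda>t. f (t, x))"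
  proof -
    have "AE x in Leb a b. integrable lborel (\<lambda>t. g (t, x))"
      using lborel_pair.AE_integrable_snd[OF gc] by (auto simp: AE_lebesgue_on_iff elim!: eventually_mono)
    then show ?thesis using AE_cyl_slices(2)[OF g(2)]
    proof eventually_elim
      case (elim x)
      show ?case by (rule cong[of _ "\<lambda>t. g (t, x)"]) (use elim sr(1) in \<open>auto elim!: eventually_mono\<close>)
    qed
  qed
  have i1: "integrable (Leb 0 T) (\<lambda>t. LINT x|lborel. g (t, x))"
    using lborel_pair.integrable_fst'[OF gi'] zrep_lebesgue_on(2)[OF z1] by simp
  have i2: "integrable (Leb a b) (\<lambda>x. LINT t|lborel. g (t, x))"
    using lborel_pair.integrable_snd[OF gc] zrep_lebesgue_on(2)[OF z2] by simp
  show "integrable (Leb 0 T) (\<lambda>t. LINT x|Leb a b. f (t, x))"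
    by (rule cong[OF i1 e1]) simp
  show "integrable (Leb a b) (\<lambda>x. LINT t|Leb 0 T. f (t, x))"
    by (rule cong[OF i2 e2]) simp
  have "(LINT t|Leb 0 T. LINT x|Leb a b. f (t, x)) = (LINT t|Leb 0 T. LINT x|lborel. g (t, x))"
    using integral_lebesgue_on_cong_AE[OF e1] by simp
  also have "\<dots> = (LINT t|lborel. LINT x|lborel. g (t, x))" using zrep_lebesgue_on(3)[OF z1] by simp
  also have "\<dots> = integral\<^sup>L (Leb2 T a b) f" using lborel_pair.integral_fst'[OF gi'] eq by simp
  finally show "(LINT t|Leb 0 T. LINT x|Leb a b. f (t, x)) = integral\<^sup>L (Leb2 T a b) f" .
  have "(LINT x|Leb a b. LINT t|Leb 0 T. f (t, x)) = (LINT x|Leb a b. LINT t|lborel. g (t, x))"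
    using integral_lebesgue_on_cong_AE[OF e2] by simp
  also have "\<dots> = (LINT x|lborel. LINT t|lborel. g (t, x))" using zrep_lebesgue_on(3)[OF z2] by simp
  also have "\<dots> = integral\<^sup>L (Leb2 T a b) f" using lborel_pair.integral_snd[OF gc] eq by simp
  finally show "(LINT x|Leb a b. LINT t|Leb 0 T. f (t, x)) = integral\<^sup>L (Leb2 T a b) f" .
qed

lemma cyl_slice_measurable:
  fixes f :: "real \<times> real \<Rightarrow> real"
  assumes f: "f \<in> borel_measurable (Leb2 T a b)"
  shows "AE t in Leb 0 T. (\<lambda>x. f (t, x)) \<in> borel_measurable (Leb a b)"
    and "AE x in Leb a b. (\<lambda>t. f (t, x)) \<in> borel_measurable (Leb 0 T)"
proof -
  obtain g where g: "zrep (cyl T a b) g" "AE p in Leb2 T a b. f p = g p"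
    using zrep_exists[OF f cyl_borel] by blast
  show "AE t in Leb 0 T. (\<lambda>x. f (t, x)) \<in> borel_measurable (Leb a b)"
    using AE_cyl_slices(1)[OF g(2)]
  proof eventually_elim
    case (elim t)
    show ?case
      by (rule borel_measurable_lebesgue_on_AE[OF zrep_lebesgue_on(1)[OF zrep_slice(1)[OF g(1), of t]]])
         (use elim in \<open>auto elim!: eventually_mono\<close>)
  qed
  show "AE x in Leb a b. (\<lambda>t. f (t, x)) \<in> borel_measurable (Leb 0 T)"
    using AE_cyl_slices(2)[OF g(2)]
  proof eventually_elim
    case (elim x)
    show ?case
      by (rule borel_measurable_lebesgue_on_AE[OF zrep_lebesgue_on(1)[OF zrep_slice(2)[OF g(1), of x]]])
         (use elim in \<open>auto elim!: eventually_mono\<close>)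
  qed
qed

lemma L2_slices:
  assumes f: "f \<in> L2 (cyl T a b)"
  shows "AE t in Leb 0 T. (\<lambda>x. f (t, x)) \<in> L2 {a<..<b}"
    and "AE x in Leb a b. (\<lambda>t. f (t, x)) \<in> L2 {0<..<T}"
  using cyl_slice_measurable[OF L2_measurable[OF f]] cyl_Fubini(1,4)[OF L2_square_integrable[OF f]]
  by (auto simp: L2_def elim!: eventually_elim2)

lemma weak_dx_unique:
  assumes "weak_dx T a b k f g" "weak_dx T a b k f h"
  shows "AE p in Leb2 T a b. g p = h p"
proof (rule AE_cyl_eqI)
  show "g \<in> borel_measurable (Leb2 T a b)" "h \<in> borel_measurable (Leb2 T a b)"
    using assms by (auto simp: weak_dx_def)
  have "AE t in Leb 0 T. weak_deriv a b k (\<lambda>x. f (t, x)) (\<lambda>x. g (t, x))"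
    "AE t in Leb 0 T. weak_deriv a b k (\<lambda>x. f (t, x)) (\<lambda>x. h (t, x))"
    using assms by (auto simp: weak_dx_def)
  then show "AE t in Leb 0 T. AE x in Leb a b. g (t, x) = h (t, x)"
    by eventually_elim (rule weak_deriv_unique)
qed

lemma weak_dx_Dx: "weak_dx T a b k f g \<Longrightarrow> weak_dx T a b k f (Dx T a b k f)"
  unfolding Dx_def by (rule someI[where P="weak_dx T a b k f"])

lemma Dx_AE: "weak_dx T a b k f g \<Longrightarrow> AE p in Leb2 T a b. Dx T a b k f p = g p"
  by (rule weak_dx_unique[OF weak_dx_Dx])

text \<open>Almost every slice in time has an absolutely continuous representative; this is the working form of the weak
  time derivative.\<close>

definition time_ac :: "real \<Rightarrow> real \<Rightarrow> real \<Rightarrow> (real \<times> real \<Rightarrow> real) \<Rightarrow> (real \<times> real \<Rightarrow> real) \<Rightarrow> bool" where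
  "time_ac T a b f g \<longleftrightarrow> (AE x in Leb a b.
     \<exists>F. ac 0 T F (\<lambda>t. g (t, x)) \<and> (AE t in Leb 0 T. F t = f (t, x)))"

text \<open>The null set of \<open>x\<close> in \<open>weak_dt\<close> depends on the test function. Restricting to the countable family of
  \<open>countable_tests\<close> makes it uniform, and the one-dimensional theory applies to each remaining slice.\<close>

lemma weak_dt_iff_time_ac:
  assumes T: "0 < T"
  shows "weak_dt T a b f g \<longleftrightarrow> f \<in> L2 (cyl T a b) \<and> g \<in> L2 (cyl T a b) \<and> time_ac T a b f g"
proof
  assume w: "weak_dt T a b f g"
  then have f: "f \<in> L2 (cyl T a b)" and g: "g \<in> L2 (cyl T a b)" by (auto simp: weak_dt_def)
  have "AE x in Leb a b. \<forall>\<psi>\<in>countable_tests 0 T.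
      (LINT t|Leb 0 T. f (t, x) * deriv \<psi> t) = - (LINT t|Leb 0 T. g (t, x) * \<psi> t)"
    unfolding AE_ball_countable[OF countable_countable_tests]
    using w countable_tests_subset[OF T] by (auto simp: weak_dt_def)
  then have "time_ac T a b f g"
    unfolding time_ac_def using L2_slices(2)[OF f] L2_slices(2)[OF g]
  proof eventually_elim
    case (elim x)
    show ?case
      by (rule ac_of_countable_tests[OF T L2_absolutely_integrable[OF elim(2)] L2_absolutely_integrable[OF elim(3)]])
         (use elim(1) in blast)
  qed
  then show "f \<in> L2 (cyl T a b) \<and> g \<in> L2 (cyl T a b) \<and> time_ac T a b f g" using f g by blast
next
  assume r: "f \<in> L2 (cyl T a b) \<and> g \<in> L2 (cyl T a b) \<and> time_ac T a b f g"
  have "AE x in Leb a b. (LINT t|Leb 0 T. f (t, x) * deriv \<psi> t) = - (LINT t|Leb 0 T. g (t, x) * \<psi> t)"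
    if p: "\<psi> \<in> test_fun 0 T" for \<psi>
    using r[unfolded time_ac_def, THEN conjunct2, THEN conjunct2]
  proof eventually_elim
    case (elim x)
    then obtain F where F: "ac 0 T F (\<lambda>t. g (t, x))" "AE t in Leb 0 T. F t = f (t, x)" by blast
    have "(LINT t|Leb 0 T. F t * deriv \<psi> t) = - (LINT t|Leb 0 T. g (t, x) * \<psi> t)"
      using ac_weak_deriv[OF T F(1)] p by (simp add: weak_deriv_def)
    moreover have "(LINT t|Leb 0 T. F t * deriv \<psi> t) = (LINT t|Leb 0 T. f (t, x) * deriv \<psi> t)"
      by (rule integral_lebesgue_on_cong_AE) (use F(2) in \<open>auto elim!: eventually_mono\<close>)
    ultimately show ?case by simp
  qed
  then show "weak_dt T a b f g" using r by (simp add: weak_dt_def)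
qed

lemma ac_unique_derivative:
  assumes ab: "a < b" and F: "ac a b F f" and G: "ac a b G g" and e: "AE x in Leb a b. F x = G x"
  shows "AE x in Leb a b. f x = g x"
  by (rule weak_deriv_unique[OF ac_weak_deriv[OF ab F]])
     (rule weak_deriv_cong_AE[OF ac_weak_deriv[OF ab G]], use e in \<open>auto elim!: eventually_mono\<close>)

lemma weak_dt_unique:
  assumes T: "0 < T" and g: "weak_dt T a b f g" and h: "weak_dt T a b f h"
  shows "AE p in Leb2 T a b. g p = h p"
proof -
  have r: "g \<in> L2 (cyl T a b)" "time_ac T a b f g" "h \<in> L2 (cyl T a b)" "time_ac T a b f h"
    using g h by (auto simp: weak_dt_iff_time_ac[OF T])
  have ae: "AE x in Leb a b. AE t in Leb 0 T. g (t, x) = h (t, x)"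
    using r(2,4)[unfolded time_ac_def]
  proof eventually_elim
    case (elim x)
    then obtain F H where F: "ac 0 T F (\<lambda>t. g (t, x))" "AE t in Leb 0 T. F t = f (t, x)"
      and H: "ac 0 T H (\<lambda>t. h (t, x))" "AE t in Leb 0 T. H t = f (t, x)" by blast
    have "AE t in Leb 0 T. F t = H t" using F(2) H(2) by eventually_elim simp
    then show ?case by (rule ac_unique_derivative[OF T F(1) H(1)])
  qed
  have i: "integrable (Leb2 T a b) (\<lambda>p. (g p - h p)\<^sup>2)"
    by (rule L2_square_integrable[OF L2_diff[OF r(1,3)]])
  have "AE x in Leb a b. (LINT t|Leb 0 T. (g (t, x) - h (t, x))\<^sup>2) = 0"
    using ae
  proof eventually_elim
    case (elim x)
    have "(LINT t|Leb 0 T. (g (t, x) - h (t, x))\<^sup>2) = (LINT t|Leb 0 T. 0)"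
      by (rule integral_lebesgue_on_cong_AE) (use elim in \<open>auto elim!: eventually_mono\<close>)
    then show ?case by simp
  qed
  then have "(LINT x|Leb a b. LINT t|Leb 0 T. (g (t, x) - h (t, x))\<^sup>2) = (LINT x|Leb a b. 0)"
    by (rule integral_lebesgue_on_cong_AE) simp
  then have "(LINT p|Leb2 T a b. (g p - h p)\<^sup>2) = 0"
    using cyl_Fubini(6)[OF i] by simp
  then have "AE p in Leb2 T a b. (g p - h p)\<^sup>2 = 0"
    using i by (subst (asm) integral_nonneg_eq_0_iff_AE) auto
  then show ?thesis by eventually_elim simp
qed

lemma Dt_AE:
  assumes "0 < T" "weak_dt T a b f g"
  shows "AE p in Leb2 T a b. Dt T a b f p = g p" "weak_dt T a b f (Dt T a b f)"
proof -
  show w: "weak_dt T a b f (Dt T a b f)" unfolding Dt_def by (rule someI[where P="weak_dt T a b f", OF assms(2)])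
  show "AE p in Leb2 T a b. Dt T a b f p = g p" by (rule weak_dt_unique[OF assms(1) w assms(2)])
qed

text \<open>\<open>D k\<close> represents the \<open>k\<close>-th derivative on the cylinder; on the slice at time \<open>t\<close> it is the jet \<open>F\<close> almost everywhere.\<close>

definition slice_jet :: "real \<Rightarrow> real \<Rightarrow> nat \<Rightarrow> (nat \<Rightarrow> real \<times> real \<Rightarrow> real) \<Rightarrow> real \<Rightarrow> (nat \<Rightarrow> real \<Rightarrow> real) \<Rightarrow> bool" where
  "slice_jet a b m D t F \<longleftrightarrow> jet a b m F \<and> (\<forall>k\<le>m. AE x in Leb a b. F k x = D k (t, x))"

text \<open>A function of \<open>X\<close> together with representatives of its derivatives: \<open>D k\<close> for \<open>\<partial>\<^sub>x^k f\<close> and \<open>g\<close> for \<open>f\<^sub>t\<close>.\<close>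

definition xrep :: "real \<Rightarrow> real \<Rightarrow> real \<Rightarrow> (nat \<Rightarrow> real \<times> real \<Rightarrow> real) \<Rightarrow> (real \<times> real \<Rightarrow> real) \<Rightarrow> bool" where
  "xrep T a b D g \<longleftrightarrow> (\<forall>k\<le>4. D k \<in> L2 (cyl T a b)) \<and> g \<in> L2 (cyl T a b) \<and>
     (AE t in Leb 0 T. \<exists>F. slice_jet a b 4 D t F) \<and> time_ac T a b (D 0) g"

lemma X_imp_xrep:
  assumes T: "0 < T" and ab: "a < b" and f: "f \<in> X T a b"
  obtains D g where "xrep T a b D g" "D 0 = f"
proof -
  have "\<forall>k. \<exists>g. k \<le> 4 \<longrightarrow> g \<in> L2 (cyl T a b) \<and> weak_dx T a b k f g"
    using f by (auto simp: X_def L2H_def)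
  from choice[OF this] obtain D' where D': "\<And>k. k \<le> 4 \<Longrightarrow> D' k \<in> L2 (cyl T a b) \<and> weak_dx T a b k f (D' k)" by blast
  have fL: "f \<in> L2 (cyl T a b)" using f by (auto simp: X_def L2H_def)
  obtain g where g: "weak_dt T a b f g" using f by (auto simp: X_def H1L2_def)
  define D where "D k = (if k = 0 then f else D' k)" for k :: nat
  have DL: "D k \<in> L2 (cyl T a b)" if "k \<le> 4" for k using D'[OF that] fL by (simp add: D_def)
  have wd: "AE t in Leb 0 T. weak_deriv a b k (\<lambda>x. f (t, x)) (\<lambda>x. D k (t, x))" if k: "k \<le> 4" for k
  proof (cases "k = 0")
    case True
    show ?thesis using L2_slices(1)[OF fL]
      by eventually_elim (simp add: True D_def weak_deriv_0 locally_integrableI L2_absolutely_integrable)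
  next
    case False
    then show ?thesis using D'[OF k] by (simp add: D_def weak_dx_def)
  qed
  have "AE t in Leb 0 T. \<forall>k\<in>{..4}. weak_deriv a b k (\<lambda>x. f (t, x)) (\<lambda>x. D k (t, x)) \<and> (\<lambda>x. D k (t, x)) \<in> L2 {a<..<b}"
    using wd L2_slices(1)[OF DL] by (subst AE_ball_countable) (auto elim!: eventually_elim2)
  then have "AE t in Leb 0 T. \<exists>F. slice_jet a b 4 D t F"
  proof eventually_elim
    case (elim t)
    show ?case unfolding slice_jet_def
      by (rule jet_exists[OF ab, of 4 "\<lambda>x. f (t, x)" "\<lambda>k x. D k (t, x)"])
         (use elim L2_absolutely_integrable in auto)
  qed
  then have "xrep T a b D g"
    using DL g unfolding xrep_def weak_dt_iff_time_ac[OF T] by (simp add: D_def)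
  then show ?thesis using that by (simp add: D_def)
qed

lemma slice_jet_weak_deriv:
  assumes "a < b" "slice_jet a b m D t F" "0 < m" "k \<le> m"
  shows "weak_deriv a b k (\<lambda>x. D 0 (t, x)) (\<lambda>x. D k (t, x))"
  by (rule weak_deriv_cong_AE[OF jet_weak_deriv[OF assms(1) _ assms(4,3)]])
     (use assms in \<open>auto simp: slice_jet_def\<close>)

lemma xrep_X:
  assumes T: "0 < T" and ab: "a < b" and x: "xrep T a b D g"
  shows "D 0 \<in> X T a b" and "k \<le> 4 \<Longrightarrow> weak_dx T a b k (D 0) (D k)" and "weak_dt T a b (D 0) g"
    and "k \<le> 4 \<Longrightarrow> AE p in Leb2 T a b. Dx T a b k (D 0) p = D k p"
    and "AE p in Leb2 T a b. Dt T a b (D 0) p = g p"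
proof -
  have wd: "weak_dx T a b k (D 0) (D k)" if k: "k \<le> 4" for k
    unfolding weak_dx_def
  proof
    show "D k \<in> borel_measurable (Leb2 T a b)" using x k by (auto simp: xrep_def L2_def)
    show "AE t in Leb 0 T. weak_deriv a b k (\<lambda>x. D 0 (t, x)) (\<lambda>x. D k (t, x))"
      using x[unfolded xrep_def, THEN conjunct2, THEN conjunct2, THEN conjunct1]
      by eventually_elim (use slice_jet_weak_deriv[OF ab _ _ k] in force)
  qed
  then show "k \<le> 4 \<Longrightarrow> weak_dx T a b k (D 0) (D k)" .
  then show "k \<le> 4 \<Longrightarrow> AE p in Leb2 T a b. Dx T a b k (D 0) p = D k p" by (rule Dx_AE)
  show w: "weak_dt T a b (D 0) g" using x by (auto simp: xrep_def weak_dt_iff_time_ac[OF T])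
  show "AE p in Leb2 T a b. Dt T a b (D 0) p = g p" by (rule Dt_AE(1)[OF T w])
  show "D 0 \<in> X T a b"
    unfolding X_def L2H_def H1L2_def using x wd w by (auto simp: xrep_def)
qed

section \<open>Energy estimate in time\<close>

lemma AE_cyl_swap:
  fixes P :: "real \<times> real \<Rightarrow> bool" and T a b :: real
  assumes P: "{p. P p} \<in> sets borel"
    and "AE x in Leb a b. AE t in Leb 0 T. P (t, x)"
  shows "AE t in Leb 0 T. AE x in Leb a b. P (t, x)"
proof -
  let ?P = "\<lambda>t x. (t, x) \<in> cyl T a b \<longrightarrow> P (t, x)"
  have "AE x in lborel. AE t in lborel. ?P t x"
    using assms(2) by (auto simp: AE_lebesgue_on_iff mem_cyl elim!: eventually_mono)
  moreover have "{p \<in> space (lborel \<Otimes>\<^sub>M lborel). ?P (fst p) (snd p)} \<in> sets (lborel \<Otimes>\<^sub>M (lborel :: real measure) :: (real \<times> real) measure)"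
  proof -
    have "{p. p \<in> cyl T a b \<longrightarrow> P p} = (- cyl T a b) \<union> {p. P p}" by auto
    also have "\<dots> \<in> sets borel" using P by (intro sets.Un) auto
    finally show ?thesis unfolding lborel_prod by simp
  qed
  ultimately have "AE t in lborel. AE x in lborel. ?P t x"
    by (subst lborel_pair.AE_commute)
  then show ?thesis by (auto simp: AE_lebesgue_on_iff mem_cyl elim!: eventually_mono)
qed

lemma LINT_indicator_interval:
  assumes "G absolutely_integrable_on {t..t'}" "c \<le> t" "t' \<le> d"
  shows "(LINT s|Leb c d. indicator {t<..<t'} s * G s) = integral {t..t'} (G :: real \<Rightarrow> real)"
proof -
  have "(LINT s|Leb c d. indicator {t<..<t'} s * G s) = (LINT s|Leb t t'. G s)"
    by (subst (1 2) integral_restrict_space)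
       (use assms in \<open>auto intro!: LINT_cong simp: indicator_def\<close>)
  then show ?thesis using LINT_interval[OF assms(1)] by simp
qed

lemma zrep_integral_interval:
  fixes G :: "real \<Rightarrow> real"
  assumes "zrep {c<..<d} G" "integrable (Leb c d) G" "c \<le> t" "t' \<le> d"
  shows "(LINT s|lborel. indicator {t<..<t'} s * G s) = integral {t..t'} G"
proof -
  have z: "zrep {c<..<d} (\<lambda>s. indicator {t<..<t'} s * G s)"
  proof -
    have "{t<..<t'} \<in> sets borel" by (rule borel_open) simp
    then show ?thesis using assms(1) unfolding zrep_def by (auto intro!: borel_measurable_times borel_measurable_indicator)
  qed
  have "G absolutely_integrable_on {c..d}" using assms(2) integrable_lebesgue_on_interval by blast
  then have "G absolutely_integrable_on {t..t'}" using assms(3,4) by (intro absolutely_integrable_on_subinterval) auto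
  then show ?thesis
    using zrep_lebesgue_on(3)[OF z] LINT_indicator_interval[where G=G and t=t and t'=t' and c=c and d=d] assms(3,4) by simp
qed

text \<open>The primitive in the first variable of a Borel function is Borel in both variables together.\<close>

lemma primitive_borel:
  fixes g :: "real \<times> real \<Rightarrow> real"
  assumes g: "g \<in> borel_measurable borel"
  shows "(\<lambda>p :: real \<times> real. LINT s|lborel. indicator {l<..<fst p} s * g (s, snd p)) \<in> borel_measurable borel"
proof -
  let ?B = "(borel :: (real \<times> real) measure) \<Otimes>\<^sub>M (lborel :: real measure)"
  have "(\<lambda>(p, s). indicator {l<..<fst p} s * g (s, snd p)) = (\<lambda>q :: (real \<times> real) \<times> real.
      (if l < snd q \<and> snd q < fst (fst q) then 1 else 0) * g (snd q, snd (fst q)))"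
    by (auto simp: fun_eq_iff indicator_def)
  also have "\<dots> \<in> borel_measurable ?B"
  proof (intro borel_measurable_times measurable_compose[OF _ g])
    show "(\<lambda>q. if l < snd q \<and> snd q < fst (fst q) then 1 else 0) \<in> borel_measurable ?B"
    proof -
      have "fst \<in> borel_measurable (borel :: (real \<times> real) measure)" by (intro borel_measurable_continuous_onI continuous_on_fst continuous_on_id)
      then have [measurable]: "(\<lambda>q. fst (fst q)) \<in> borel_measurable ?B"
        by (rule measurable_compose[OF measurable_fst])
      have [measurable]: "snd \<in> borel_measurable ?B"
        using measurable_snd[of "borel :: (real \<times> real) measure" "lborel :: real measure"] by simp
      show ?thesis by measurable
    qed
    show "(\<lambda>q. (snd q, snd (fst q))) \<in> measurable ?B borel"
    proof (rule borel_measurable_Pair)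
      show "snd \<in> borel_measurable ?B"
        using measurable_snd[of "borel :: (real \<times> real) measure" "lborel :: real measure"] by simp
      have "snd \<in> borel_measurable (borel :: (real \<times> real) measure)" by (intro borel_measurable_continuous_onI continuous_on_snd continuous_on_id)
      then show "(\<lambda>q. snd (fst q)) \<in> borel_measurable ?B"
        by (rule measurable_compose[OF measurable_fst])
    qed
  qed
  finally show ?thesis by (rule lborel.borel_measurable_lebesgue_integral)
qed

text \<open>For almost all \<open>x\<close> the identity holds for almost all \<open>t\<close>, with a constant \<open>c x\<close> depending on \<open>x\<close>. Writing \<open>c\<close> as a
  time average makes it measurable, so that the order of the two quantifiers can be exchanged.\<close>

lemma time_ac_good_times:
  assumes T: "0 < T" and f: "f \<in> L2 (cyl T a b)" and g: "g \<in> L2 (cyl T a b)" and ac: "time_ac T a b f g"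
  obtains c where "AE t in Leb 0 T. AE x in Leb a b.
      f (t, x) = c x + integral {0..t} (\<lambda>s. g (s, x))"
    and "AE x in Leb a b. AE t in Leb 0 T.
      f (t, x) = c x + integral {0..t} (\<lambda>s. g (s, x))"
proof -
  obtain f' where f': "zrep (cyl T a b) f'" "AE p in Leb2 T a b. f p = f' p"
    using zrep_exists[OF L2_measurable[OF f] cyl_borel] by blast
  obtain g' where g': "zrep (cyl T a b) g'" "AE p in Leb2 T a b. g p = g' p"
    using zrep_exists[OF L2_measurable[OF g] cyl_borel] by blast
  have m[measurable]: "f' \<in> borel_measurable borel" "g' \<in> borel_measurable borel" using f'(1) g'(1) by (auto simp: zrep_def)
  define I where "I p = (LINT s|lborel. indicator {0<..<fst p} s * g' (s, snd p))" for p :: "real \<times> real"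
  have I[measurable]: "I \<in> borel_measurable borel" unfolding I_def[abs_def] by (rule primitive_borel[OF m(2)])
  define H where "H p = f' p - I p" for p
  have H[measurable]: "H \<in> borel_measurable borel" unfolding H_def[abs_def] by measurable
  define c where "c x = (LINT t|lborel. indicator {0<..<T} t * H (t, x)) / T" for x
  have c[measurable]: "c \<in> borel_measurable borel"
  proof -
    have "(\<lambda>(x, t). indicator {0<..<T} t * H (t, x)) \<in> borel_measurable (borel \<Otimes>\<^sub>M (lborel :: real measure))"
    proof -
      have "(\<lambda>q. (snd q, fst q)) \<in> measurable ((borel :: real measure) \<Otimes>\<^sub>M (lborel :: real measure)) borel"
        using measurable_snd[of "borel :: real measure" "lborel :: real measure"]
          measurable_fst[of "borel :: real measure" "lborel :: real measure"]
        by (intro borel_measurable_Pair) auto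
      from measurable_compose[OF this H]
      have "(\<lambda>q. H (snd q, fst q)) \<in> borel_measurable ((borel :: real measure) \<Otimes>\<^sub>M (lborel :: real measure))" .
      moreover have "(\<lambda>q. indicator {0<..<T} (snd q) :: real) \<in> borel_measurable ((borel :: real measure) \<Otimes>\<^sub>M (lborel :: real measure))"
        by (rule measurable_compose[OF measurable_snd]) (auto intro: borel_measurable_indicator)
      ultimately show ?thesis unfolding split_beta' by (rule borel_measurable_times[rotated])
    qed
    then have "(\<lambda>x. LINT t|lborel. indicator {0<..<T} t * H (t, x)) \<in> borel_measurable borel"
      by (rule lborel.borel_measurable_lebesgue_integral)
    then show ?thesis unfolding c_def[abs_def] by measurable
  qed
  have Iint: "I (t, x) = integral {0..t} (\<lambda>s. g' (s, x))" if "integrable (Leb 0 T) (\<lambda>s. g' (s, x))" "t \<in> {0<..<T}" for t x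
    unfolding I_def using zrep_integral_interval[OF zrep_slice(2)[OF g'(1)] that(1), of 0 t] that(2) by simp
  have g'i: "AE x in Leb a b. integrable (Leb 0 T) (\<lambda>s. g' (s, x))"
  proof (rule cyl_Fubini(4))
    have "g' \<in> L2 (cyl T a b)" by (rule L2_cong_AE[OF g g'(2)]) simp
    then show "integrable (Leb2 T a b) g'" by (rule L2_integrable[OF _ cyl_lmeasurable])
  qed
  have Hc: "AE x in Leb a b. AE t in Leb 0 T. H (t, x) = c x"
    using ac[unfolded time_ac_def] AE_cyl_slices(2)[OF f'(2)] AE_cyl_slices(2)[OF g'(2)] g'i
  proof eventually_elim
    case (elim x)
    obtain F where F: "ac 0 T F (\<lambda>t. g (t, x))" "AE t in Leb 0 T. F t = f (t, x)" using elim(1) by blast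
    have h: "AE t in Leb 0 T. H (t, x) = F 0"
      using F(2) elim(2) AE_space
    proof eventually_elim
      case (elim t)
      then have t: "t \<in> {0<..<T}" by simp
      have "integral {0..t} (\<lambda>s. g (s, x)) = F t - F 0"
        using F(1) t unfolding ac_def by (auto intro!: integral_unique)
      moreover have "integral {0..t} (\<lambda>s. g (s, x)) = integral {0..t} (\<lambda>s. g' (s, x))"
        using t by (intro integral_cong_AE_interval[OF \<open>AE t in Leb 0 T. g (t, x) = g' (t, x)\<close>]) auto
      ultimately show ?case using elim Iint[OF \<open>integrable (Leb 0 T) (\<lambda>s. g' (s, x))\<close> t] by (simp add: H_def)
    qed
    have "(LINT t|lborel. indicator {0<..<T} t * H (t, x)) = (LINT t|Leb 0 T. indicator {0<..<T} t * H (t, x))"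
    proof (rule zrep_lebesgue_on(3)[symmetric])
      show "zrep {0<..<T} (\<lambda>t. indicator {0<..<T} t * H (t, x))" by (simp add: zrep_def)
    qed simp
    also have "\<dots> = (LINT t|Leb 0 T. F 0)"
    proof (rule integral_lebesgue_on_cong_AE)
      show "AE t in Leb 0 T. indicator {0<..<T} t * H (t, x) = F 0"
        using h AE_space by eventually_elim simp
    qed simp
    also have "\<dots> = T * F 0" using LINT_const_interval[OF T, of "F 0"] by simp
    finally have "c x = F 0" using T by (simp add: c_def)
    then show ?case using h by simp
  qed
  have "AE t in Leb 0 T. AE x in Leb a b. H (t, x) = c x"
  proof -
    have "(\<lambda>p. c (snd p)) \<in> borel_measurable (borel :: (real \<times> real) measure)"
    proof -
      have "snd \<in> borel_measurable (borel :: (real \<times> real) measure)" by (intro borel_measurable_continuous_onI continuous_on_snd continuous_on_id)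
      then show ?thesis by (rule measurable_compose[OF _ c])
    qed
    then have "{p. H p = c (snd p)} \<in> sets borel" by measurable
    from AE_cyl_swap[OF this, where T=T and a=a and b=b] Hc show ?thesis by simp
  qed
  then have 1: "AE t in Leb 0 T. AE x in Leb a b. f (t, x) = c x + integral {0..t} (\<lambda>s. g (s, x))"
    using AE_cyl_slices(1)[OF f'(2)] AE_space
  proof eventually_elim
    case (elim t)
    then have t: "t \<in> {0<..<T}" by simp
    show ?case using elim(1,2) g'i AE_cyl_slices(2)[OF g'(2)]
    proof eventually_elim
      case (elim x)
      have "integral {0..t} (\<lambda>s. g (s, x)) = integral {0..t} (\<lambda>s. g' (s, x))"
        using t by (intro integral_cong_AE_interval[OF elim(4)]) auto
      then show ?case using elim(1,2) Iint[OF elim(3) t] by (simp add: H_def)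
    qed
  qed
  have "AE x in Leb a b. AE t in Leb 0 T. f (t, x) = c x + integral {0..t} (\<lambda>s. g (s, x))"
    using Hc AE_cyl_slices(2)[OF f'(2)] AE_cyl_slices(2)[OF g'(2)] g'i
  proof eventually_elim
    case (elim x)
    show ?case using elim(1,2) AE_space
    proof eventually_elim
      case (elim t)
      then have t: "t \<in> {0<..<T}" by simp
      have "integral {0..t} (\<lambda>s. g (s, x)) = integral {0..t} (\<lambda>s. g' (s, x))"
        using t by (intro integral_cong_AE_interval[OF \<open>AE t in Leb 0 T. g (t, x) = g' (t, x)\<close>]) auto
      then show ?case using elim Iint[OF \<open>integrable (Leb 0 T) (\<lambda>s. g' (s, x))\<close> t] by (simp add: H_def)
    qed
  qed
  with 1 show ?thesis using that by blast
qed

text \<open>Cauchy-Schwarz in time for \<open>f(t') - f(t) = \<integral> g\<close>, integrated over \<open>x\<close>.\<close>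

lemma slice_difference_le:
  assumes g: "g \<in> L2 (cyl T a b)" and t: "0 < t" "t < t'" "t' < T"
    and 1: "AE x in Leb a b. f (t, x) = c x + integral {0..t} (\<lambda>s. g (s, x))"
    and 2: "AE x in Leb a b. f (t', x) = c x + integral {0..t'} (\<lambda>s. g (s, x))"
    and L: "(\<lambda>x. f (t, x)) \<in> L2 {a<..<b}" "(\<lambda>x. f (t', x)) \<in> L2 {a<..<b}"
  shows "(LINT x|Leb a b. (f (t', x) - f (t, x))\<^sup>2)
    \<le> (t' - t) * integral {t..t'} (\<lambda>s. LINT x|Leb a b. (g (s, x))\<^sup>2)"
proof -
  let ?k = "\<lambda>p. indicator {t<..<t'} (fst p) * (g p)\<^sup>2"
  have ki: "integrable (Leb2 T a b) ?k"
  proof (rule LINT_integrable_bound[OF L2_square_integrable[OF g]])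
    have "(\<lambda>p::real \<times> real. indicator {t<..<t'} (fst p) :: real) \<in> borel_measurable borel"
      by (rule measurable_compose[of fst borel borel]) (auto intro!: borel_measurable_continuous_onI continuous_on_fst continuous_on_id)
    then have "(\<lambda>p::real \<times> real. indicator {t<..<t'} (fst p) :: real) \<in> borel_measurable (Leb2 T a b)"
      by (intro measurable_restrict_space1 measurable_completion) simp
    then show "?k \<in> borel_measurable (Leb2 T a b)"
      using borel_measurable_integrable[OF L2_square_integrable[OF g]] by (rule borel_measurable_times)
    show "AE p in Leb2 T a b. norm (?k p) \<le> norm ((g p)\<^sup>2)" by (auto simp: indicator_def)
  qed
  have gs: "AE x in Leb a b. (\<lambda>s. g (s, x)) \<in> L2 {0<..<T}" by (rule L2_slices(2)[OF g])
  have e: "AE x in Leb a b. (f (t', x) - f (t, x))\<^sup>2 \<le> (t' - t) * (LINT s|Leb 0 T. ?k (s, x))"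
    using 1 2 gs
  proof eventually_elim
    case (elim x)
    have gi: "(\<lambda>s. g (s, x)) absolutely_integrable_on {0..T}" by (rule L2_absolutely_integrable[OF elim(3)])
    have gi2: "(\<lambda>s. (g (s, x))\<^sup>2) absolutely_integrable_on {0..T}"
      using L2_square_integrable[OF elim(3)] integrable_lebesgue_on_interval by blast
    have sub: "h absolutely_integrable_on {u..v}" if "h absolutely_integrable_on {0..T}" "0 \<le> u" "v \<le> T" for h :: "real \<Rightarrow> real" and u v
      using that by (intro absolutely_integrable_on_subinterval[OF that(1)]) auto
    have "integral {0..t} (\<lambda>s. g (s, x)) + integral {t..t'} (\<lambda>s. g (s, x)) = integral {0..t'} (\<lambda>s. g (s, x))"
      using t abs_integrable_on[OF sub[OF gi, of 0 t']] by (intro HK_combine) auto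
    then have "f (t', x) - f (t, x) = integral {t..t'} (\<lambda>s. g (s, x))" using elim(1,2) by simp
    moreover have "(integral {t..t'} (\<lambda>s. g (s, x)))\<^sup>2 \<le> (t' - t) * integral {t..t'} (\<lambda>s. (g (s, x))\<^sup>2)"
      using t abs_integrable_on[OF sub[OF gi, of t t']] abs_integrable_on[OF sub[OF gi2, of t t']]
      by (intro integral_square_le) auto
    moreover have "(LINT s|Leb 0 T. ?k (s, x)) = integral {t..t'} (\<lambda>s. (g (s, x))\<^sup>2)"
      using LINT_indicator_interval[where G="\<lambda>s. (g (s, x))\<^sup>2" and t=t and t'=t' and c=0 and d=T] sub[OF gi2, of t t'] t by simp
    ultimately show ?case by simp
  qed
  have "(LINT x|Leb a b. (f (t', x) - f (t, x))\<^sup>2) \<le> (LINT x|Leb a b. (t' - t) * (LINT s|Leb 0 T. ?k (s, x)))"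
    by (rule integral_mono_AE[OF L2_square_integrable[OF L2_diff[OF L(2,1)]] integrable_mult_right[OF cyl_Fubini(5)[OF ki]] e])
  also have "\<dots> = (t' - t) * (LINT x|Leb a b. (LINT s|Leb 0 T. ?k (s, x)))" by simp
  also have "(LINT x|Leb a b. (LINT s|Leb 0 T. ?k (s, x))) = (LINT s|Leb 0 T. LINT x|Leb a b. ?k (s, x))"
    using cyl_Fubini(3,6)[OF ki] by simp
  also have "\<dots> = (LINT s|Leb 0 T. indicator {t<..<t'} s * (LINT x|Leb a b. (g (s, x))\<^sup>2))" by simp
  also have "\<dots> = integral {t..t'} (\<lambda>s. LINT x|Leb a b. (g (s, x))\<^sup>2)"
  proof (rule LINT_indicator_interval)
    have "(\<lambda>s. LINT x|Leb a b. (g (s, x))\<^sup>2) absolutely_integrable_on {0..T}"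
      using cyl_Fubini(2)[OF L2_square_integrable[OF g]] integrable_lebesgue_on_interval by blast
    then show "(\<lambda>s. LINT x|Leb a b. (g (s, x))\<^sup>2) absolutely_integrable_on {t..t'}"
      using t by (intro absolutely_integrable_on_subinterval) auto
  qed (use t in auto)
  finally show ?thesis .
qed

text \<open>Steps between neighbouring points of the grids \<open>jT/n\<close> reach arbitrarily close to any two points; continuity does the
  rest.\<close>

lemma monotone_of_tiles:
  fixes R :: "real \<Rightarrow> real"
  assumes T: "0 < T" and c: "continuous_on {0..T} R"
    and step: "\<And>n j. 0 < n \<Longrightarrow> j < n \<Longrightarrow> R (real j * (T / real n)) \<le> R (real (Suc j) * (T / real n))"
    and uv: "0 \<le> u" "u \<le> v" "v \<le> T"
  shows "R u \<le> R v"
proof (rule field_le_epsilon)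
  fix e :: real assume e: "e > 0"
  have "uniformly_continuous_on {0..T} R" by (rule compact_uniformly_continuous[OF c]) simp
  moreover have "e / 2 > 0" using e by simp
  ultimately obtain d where d: "d > 0" "\<forall>x\<in>{0..T}. \<forall>y\<in>{0..T}. dist y x < d \<longrightarrow> dist (R y) (R x) < e / 2"
    unfolding uniformly_continuous_on_def by blast
  obtain n where n: "real n * d > T" using reals_Archimedean3[OF d(1)] by blast
  have n0: "n > 0" using n T by (cases n) auto
  define h where "h = T / real n"
  have h: "h > 0" "h < d" "real n * h = T" using n n0 T by (auto simp: h_def field_simps)
  have floor: "\<exists>i. real i * h \<le> w \<and> w < real (Suc i) * h" if "w \<ge> 0" for w
  proof -
    have "real (nat \<lfloor>w / h\<rfloor>) \<le> w / h" "w / h < real (nat \<lfloor>w / h\<rfloor>) + 1" using that h(1) by (auto simp: floor_less_iff)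
    then show ?thesis using h(1) by (intro exI[of _ "nat \<lfloor>w / h\<rfloor>"]) (simp add: field_simps)
  qed
  obtain i where i: "real i * h \<le> u" "u < real (Suc i) * h" using floor uv(1) by blast
  obtain j where j: "real j * h \<le> v" "v < real (Suc j) * h" using floor[of v] uv by auto
  have "real i * h < real (Suc j) * h" using i j uv by linarith
  then have ij: "i \<le> j" using h(1) by simp
  have "real j * h \<le> real n * h" using j(1) uv(3) h(3) by linarith
  then have jn: "j \<le> n" using h(1) by simp
  have mono: "k \<le> n - i \<Longrightarrow> i \<le> n \<Longrightarrow> R (real i * h) \<le> R (real (i + k) * h)" for k
  proof (induction k)
    case (Suc k)
    then have "R (real (i + k) * h) \<le> R (real (Suc (i + k)) * h)" unfolding h_def by (intro step n0) auto
    then show ?case using Suc by simp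
  qed simp
  have "R (real i * h) \<le> R (real j * h)" using mono[of "j - i"] ij jn by simp
  moreover have "\<bar>R u - R (real i * h)\<bar> < e / 2"
  proof -
    have "dist u (real i * h) < d" using i h(2) by (simp add: dist_real_def algebra_simps)
    moreover have "real i * h \<in> {0..T}" using i uv h(1) by auto
    moreover have "u \<in> {0..T}" using uv by simp
    ultimately have "dist (R u) (R (real i * h)) < e / 2" using d(2) by blast
    then show ?thesis by (simp add: dist_real_def)
  qed
  moreover have "\<bar>R v - R (real j * h)\<bar> < e / 2"
  proof -
    have "dist v (real j * h) < d" using j h(2) by (simp add: dist_real_def algebra_simps)
    moreover have "real j * h \<in> {0..T}" using j uv h(1) by auto
    moreover have "v \<in> {0..T}" using uv by simp
    ultimately have "dist (R v) (R (real j * h)) < e / 2" using d(2) by blast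
    then show ?thesis by (simp add: dist_real_def)
  qed
  ultimately show "R u \<le> R v + e" by linarith
qed


text \<open>The relation \<open>\<langle>f(s), P(t)\<rangle> = \<langle>Q(s), Q(t)\<rangle>\<close> gives
  \<open>\<parallel>Q(t')\<parallel>\<^sup>2 - \<parallel>Q(t)\<parallel>\<^sup>2 = \<langle>f(t') - f(t), P(t) + P(t')\<rangle>\<close>, where the mixed terms cancel. The first factor is of
  size \<open>sqrt (t' - t)\<close> in \<open>L\<^sup>2\<close>, and the product is split so that each part is of size \<open>t' - t\<close> after integration.\<close>

lemma energy_increment:
  assumes g: "g \<in> L2 (cyl T a b)" and t: "0 < t" "t < t'" "t' < T"
    and 1: "AE x in Leb a b. f (t, x) = c x + integral {0..t} (\<lambda>s. g (s, x))"
    and 2: "AE x in Leb a b. f (t', x) = c x + integral {0..t'} (\<lambda>s. g (s, x))"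
    and L: "\<And>s. s \<in> {t, t'} \<Longrightarrow> (\<lambda>x. f (s, x)) \<in> L2 {a<..<b} \<and> (\<lambda>x. P (s, x)) \<in> L2 {a<..<b} \<and> (\<lambda>x. Q (s, x)) \<in> L2 {a<..<b}"
    and sym: "\<And>s s'. s \<in> {t, t'} \<Longrightarrow> s' \<in> {t, t'} \<Longrightarrow>
      (LINT x|Leb a b. f (s, x) * P (s', x)) = (LINT x|Leb a b. Q (s, x) * Q (s', x))"
  shows "\<bar>(LINT x|Leb a b. (Q (t', x))\<^sup>2) - (LINT x|Leb a b. (Q (t, x))\<^sup>2)\<bar>
    \<le> integral {t..t'} (\<lambda>s. LINT x|Leb a b. (g (s, x))\<^sup>2) / 2
      + (t' - t) * (LINT x|Leb a b. (P (t, x))\<^sup>2) + (t' - t) * (LINT x|Leb a b. (P (t', x))\<^sup>2)"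
proof -
  let ?M = "Leb a b"
  define h where "h = t' - t"
  have h: "h > 0" using t by (simp add: h_def)
  have Lf: "(\<lambda>x. f (t, x)) \<in> L2 {a<..<b}" "(\<lambda>x. f (t', x)) \<in> L2 {a<..<b}"
    and LP: "(\<lambda>x. P (t, x)) \<in> L2 {a<..<b}" "(\<lambda>x. P (t', x)) \<in> L2 {a<..<b}"
    and LQ: "(\<lambda>x. Q (t, x)) \<in> L2 {a<..<b}" "(\<lambda>x. Q (t', x)) \<in> L2 {a<..<b}"
    using L by auto
  let ?D = "\<lambda>x. f (t', x) - f (t, x)" and ?R = "\<lambda>x. P (t, x) + P (t', x)"
  have LD: "?D \<in> L2 {a<..<b}" "?R \<in> L2 {a<..<b}" by (rule L2_diff[OF Lf(2,1)], rule L2_add[OF LP])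
  note i = L2_mult_integrable[OF Lf(2) LP(1)] L2_mult_integrable[OF Lf(2) LP(2)]
    L2_mult_integrable[OF Lf(1) LP(1)] L2_mult_integrable[OF Lf(1) LP(2)]
  have "(LINT x|?M. ?D x * ?R x) = (LINT x|?M. f (t', x) * P (t, x)) + (LINT x|?M. f (t', x) * P (t', x))
      - (LINT x|?M. f (t, x) * P (t, x)) - (LINT x|?M. f (t, x) * P (t', x))"
    using i by (simp add: algebra_simps)
  also have "\<dots> = (LINT x|?M. Q (t', x) * Q (t, x)) + (LINT x|?M. (Q (t', x))\<^sup>2)
      - (LINT x|?M. (Q (t, x))\<^sup>2) - (LINT x|?M. Q (t, x) * Q (t', x))"
    using sym[of t' t] sym[of t' t'] sym[of t t] sym[of t t'] by (simp add: power2_eq_square)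
  also have "(LINT x|?M. Q (t', x) * Q (t, x)) = (LINT x|?M. Q (t, x) * Q (t', x))" by (simp add: mult.commute)
  finally have e: "(LINT x|?M. (Q (t', x))\<^sup>2) - (LINT x|?M. (Q (t, x))\<^sup>2) = (LINT x|?M. ?D x * ?R x)" by simp
  have iD: "integrable ?M (\<lambda>x. (?D x)\<^sup>2 / (2 * h))" using L2_square_integrable[OF LD(1)] by auto
  have iP: "integrable ?M (\<lambda>x. h * (P (t, x))\<^sup>2)" "integrable ?M (\<lambda>x. h * (P (t', x))\<^sup>2)"
    using L2_square_integrable[OF LP(1)] L2_square_integrable[OF LP(2)] by auto
  have "\<bar>LINT x|?M. ?D x * ?R x\<bar> \<le> (LINT x|?M. \<bar>?D x * ?R x\<bar>)"
    using integral_norm_bound[of ?M "\<lambda>x. ?D x * ?R x"] by simp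
  also have "\<dots> \<le> (LINT x|?M. ((?D x)\<^sup>2 / (2 * h) + h * (P (t, x))\<^sup>2) + h * (P (t', x))\<^sup>2)"
  proof (rule integral_mono)
    show "integrable ?M (\<lambda>x. \<bar>?D x * ?R x\<bar>)" using L2_mult_integrable[OF LD] by auto
    show "integrable ?M (\<lambda>x. ((?D x)\<^sup>2 / (2 * h) + h * (P (t, x))\<^sup>2) + h * (P (t', x))\<^sup>2)"
      by (intro LINT_integrable_add iD iP)
    fix x
    have "\<bar>d * r\<bar> \<le> d\<^sup>2 / (2 * h) + h / 2 * r\<^sup>2" for d r :: real
    proof -
      have "2 * \<bar>d\<bar> * (h * \<bar>r\<bar>) \<le> d\<^sup>2 + (h * r)\<^sup>2" using sum_squares_bound[of "\<bar>d\<bar>" "h * \<bar>r\<bar>"] h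
        by (simp add: power_mult_distrib)
      then have "(2 * \<bar>d\<bar> * (h * \<bar>r\<bar>)) / (2 * h) \<le> (d\<^sup>2 + (h * r)\<^sup>2) / (2 * h)" using h by (intro divide_right_mono) auto
      moreover have "(2 * \<bar>d\<bar> * (h * \<bar>r\<bar>)) / (2 * h) = \<bar>d * r\<bar>" using h by (simp add: abs_mult)
      moreover have "(d\<^sup>2 + (h * r)\<^sup>2) / (2 * h) = d\<^sup>2 / (2 * h) + h / 2 * r\<^sup>2"
        using h by (simp add: add_divide_distrib power_mult_distrib power2_eq_square)
      ultimately show ?thesis by simp
    qed
    from this[of "?D x" "?R x"]
    have "\<bar>?D x * ?R x\<bar> \<le> (?D x)\<^sup>2 / (2 * h) + h / 2 * (?R x)\<^sup>2" .
    also have "h / 2 * (?R x)\<^sup>2 \<le> h / 2 * (2 * (P (t, x))\<^sup>2 + 2 * (P (t', x))\<^sup>2)"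
      using h by (intro mult_left_mono square_sum_le) auto
    finally show "\<bar>?D x * ?R x\<bar> \<le> ((?D x)\<^sup>2 / (2 * h) + h * (P (t, x))\<^sup>2) + h * (P (t', x))\<^sup>2"
      by (simp add: algebra_simps)
  qed
  also have "\<dots> = (LINT x|?M. (?D x)\<^sup>2) / (2 * h) + h * (LINT x|?M. (P (t, x))\<^sup>2) + h * (LINT x|?M. (P (t', x))\<^sup>2)"
    using iD iP by simp
  also have "(LINT x|?M. (?D x)\<^sup>2) / (2 * h) \<le> (h * integral {t..t'} (\<lambda>s. LINT x|?M. (g (s, x))\<^sup>2)) / (2 * h)"
    using slice_difference_le[OF g t 1 2 Lf] h by (intro divide_right_mono) (auto simp: h_def)
  also have "(h * integral {t..t'} (\<lambda>s. LINT x|?M. (g (s, x))\<^sup>2)) / (2 * h) = integral {t..t'} (\<lambda>s. LINT x|?M. (g (s, x))\<^sup>2) / 2"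
    using h by simp
  finally show ?thesis unfolding e by (simp add: h_def)
qed

text \<open>Summation over the tiles \<open>[jT/n, (j+1)T/n]\<close>. With \<open>B = 1/2 \<integral>\<gamma> + \<integral>\<pi>\<close>, the means of \<open>E\<close> over any two tiles differ by at most
  \<open>2B\<close>: neighbouring means differ by an increment of a monotone function with total variation \<open>B\<close>, which is counted twice.
  So every mean over a tile is at most the overall mean plus \<open>2B\<close>, and shrinking the tiles bounds \<open>E\<close> itself.\<close>

lemma bounded_of_increments:
  fixes E \<gamma> \<pi> :: "real \<Rightarrow> real"
  assumes T: "0 < T" and N: "negligible N"
    and Ei: "E absolutely_integrable_on {0..T}" and gi: "\<gamma> absolutely_integrable_on {0..T}" and pi: "\<pi> absolutely_integrable_on {0..T}"
    and nn: "\<And>t. \<gamma> t \<ge> 0" "\<And>t. \<pi> t \<ge> 0"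
    and inc: "\<And>t t'. 0 < t \<Longrightarrow> t < t' \<Longrightarrow> t' < T \<Longrightarrow> t \<notin> N \<Longrightarrow> t' \<notin> N \<Longrightarrow>
      \<bar>E t' - E t\<bar> \<le> integral {t..t'} \<gamma> / 2 + (t' - t) * \<pi> t + (t' - t) * \<pi> t'"
  shows "AE t in Leb 0 T. E t \<le> integral {0..T} E / T + integral {0..T} \<gamma> + 2 * integral {0..T} \<pi>"
proof -
  have sub: "q integrable_on {u..v}" if "q absolutely_integrable_on {0..T}" "0 \<le> u" "v \<le> T" for q :: "real \<Rightarrow> real" and u v
    using that by (intro abs_integrable_on absolutely_integrable_on_subinterval[OF that(1)]) auto
  have comb: "integral {u..w} q = integral {u..v} q + integral {v..w} q"
    if "q absolutely_integrable_on {0..T}" "0 \<le> u" "u \<le> v" "v \<le> w" "w \<le> T" for q :: "real \<Rightarrow> real" and u v w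
    using HK_combine[OF that(3,4) sub[OF that(1,2,5)]] by simp
  define b where "b t = integral {0..t} \<gamma> / 2 + integral {0..t} \<pi>" for t
  have bmono: "b u \<le> b v" if "0 \<le> u" "u \<le> v" "v \<le> T" for u v
  proof -
    have "integral {0..v} \<gamma> = integral {0..u} \<gamma> + integral {u..v} \<gamma>" "integral {0..v} \<pi> = integral {0..u} \<pi> + integral {u..v} \<pi>"
      using that by (auto intro!: comb gi pi)
    moreover have "integral {u..v} \<gamma> \<ge> 0" "integral {u..v} \<pi> \<ge> 0"
      using nn that by (auto intro!: integral_nonneg sub gi pi)
    ultimately show ?thesis unfolding b_def by linarith
  qed
  have b0: "b 0 = 0" by (simp add: b_def)
  define A where "A h u = integral {u..u + h} E" for h u
  have shift: "\<bar>A h (u + h) - A h u\<bar> \<le> h * (b (u + 2 * h) - b u)" if h: "h > 0" and u: "0 \<le> u" "u + 2 * h \<le> T" for h u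
  proof -
    have sh: "((\<lambda>t. q (t + h)) has_integral integral {u + h..u + 2 * h} q) {u..u + h}" if "q absolutely_integrable_on {0..T}" for q :: "real \<Rightarrow> real"
      using has_integral_shift_real_ivl[OF integrable_integral[OF sub[OF that, of "u + h" "u + 2 * h"]], of h] u h by (simp add: add.commute)
    define G where "G = integral {u..u + 2 * h} \<gamma>"
    have 1: "((\<lambda>t. E (t + h) - E t) has_integral (A h (u + h) - A h u)) {u..u + h}"
      using has_integral_diff[OF sh[OF Ei] integrable_integral[OF sub[OF Ei, of u "u + h"]]] u h by (simp add: A_def add.assoc)
    have 2: "((\<lambda>t. G / 2 + (h * \<pi> t + h * \<pi> (t + h))) has_integral
        (h * (G / 2) + (h * integral {u..u + h} \<pi> + h * integral {u + h..u + 2 * h} \<pi>))) {u..u + h}"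
    proof (intro has_integral_add has_integral_mult_right sh[OF pi])
      show "((\<lambda>t. G / 2) has_integral h * (G / 2)) {u..u + h}"
        using has_integral_const_real[of "G / 2" u "u + h"] h by simp
      show "(\<pi> has_integral integral {u..u + h} \<pi>) {u..u + h}" using sub[OF pi, of u "u + h"] u h by (intro integrable_integral) auto
    qed
    \<comment> \<open>both \<open>t\<close> and \<open>t + h\<close> have to avoid the exceptional set\<close>
    define N' where "N' = N \<union> (+) (- h) ` N \<union> {u, u + h}"
    have N': "negligible N'" unfolding N'_def by (intro negligible_Un N negligible_translation) auto
    have pt: "\<bar>E (t + h) - E t\<bar> \<le> G / 2 + (h * \<pi> t + h * \<pi> (t + h))" if t: "t \<in> {u..u + h} - N'" for t
    proof -
      have tt: "u < t" "t < u + h" "t \<notin> N" using t by (auto simp: N'_def)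
      have th: "t + h \<notin> N"
      proof
        assume "t + h \<in> N"
        then have "- h + (t + h) \<in> (+) (- h) ` N" by (rule imageI)
        then show False using t by (simp add: N'_def)
      qed
      have "integral {t..t + h} \<gamma> \<le> G"
        unfolding G_def using tt u h nn by (intro integral_subset_le sub[OF gi]) auto
      then show ?thesis using inc[of t "t + h"] tt th u h by simp
    qed
    have z: "((\<lambda>t. if t \<in> N' then 0 else E (t + h) - E t) has_integral (A h (u + h) - A h u)) {u..u + h}"
      by (rule has_integral_spike[OF N' _ 1]) simp
    have z2: "((\<lambda>t. if t \<in> N' then 0 else G / 2 + (h * \<pi> t + h * \<pi> (t + h))) has_integral
        (h * (G / 2) + (h * integral {u..u + h} \<pi> + h * integral {u + h..u + 2 * h} \<pi>))) {u..u + h}"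
      by (rule has_integral_spike[OF N' _ 2]) simp
    have "norm (integral {u..u + h} (\<lambda>t. if t \<in> N' then 0 else E (t + h) - E t))
        \<le> integral {u..u + h} (\<lambda>t. if t \<in> N' then 0 else G / 2 + (h * \<pi> t + h * \<pi> (t + h)))"
      using pt by (intro HK_norm_bound has_integral_integrable[OF z] has_integral_integrable[OF z2]) auto
    then have "\<bar>A h (u + h) - A h u\<bar> \<le> h * (G / 2) + (h * integral {u..u + h} \<pi> + h * integral {u + h..u + 2 * h} \<pi>)"
      unfolding integral_unique[OF z] integral_unique[OF z2] by simp
    also have "\<dots> = h * (b (u + 2 * h) - b u)"
      using comb[OF gi, of 0 u "u + 2 * h"] comb[OF pi, of 0 u "u + 2 * h"] comb[OF pi, of u "u + h" "u + 2 * h"] u h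
      by (simp add: b_def G_def algebra_simps)
    finally show ?thesis .
  qed
  define K where "K = integral {0..T} E / T + 2 * b T"
  have tile: "A (T / real n) (real j * (T / real n)) \<le> (T / real n) * K" if n: "n > 0" and j: "j < n" for n j
  proof -
    define h where "h = T / real n"
    have h: "h > 0" "real n * h = T" using T n by (auto simp: h_def)
    define \<alpha> where "\<alpha> i = A h (real i * h)" for i
    have le: "real i * h \<le> T" if "i \<le> n" for i
      using mult_right_mono[of "real i" "real n" h] that h by simp
    have step: "\<bar>\<alpha> (Suc i) - \<alpha> i\<bar> \<le> h * (b (real (Suc (Suc i)) * h) - b (real i * h))" if i: "Suc i < n" for i
    proof -
      have "real (Suc (Suc i)) * h \<le> T" using i by (intro le) simp
      then have "\<bar>A h (real i * h + h) - A h (real i * h)\<bar> \<le> h * (b (real i * h + 2 * h) - b (real i * h))"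
        using h by (intro shift) (auto simp: algebra_simps)
      then show ?thesis by (simp add: \<alpha>_def algebra_simps)
    qed
    have tele: "i + k < n \<Longrightarrow> \<bar>\<alpha> (i + k) - \<alpha> i\<bar> \<le> h * (b (real (Suc (i + k)) * h) + b (real (i + k) * h) - b (real (Suc i) * h) - b (real i * h))" for i k
    proof (induction k)
      case (Suc k)
      have s: "\<bar>\<alpha> (Suc (i + k)) - \<alpha> (i + k)\<bar> \<le> h * (b (real (Suc (Suc (i + k))) * h) - b (real (i + k) * h))"
        using Suc.prems by (intro step) simp
      have ih: "\<bar>\<alpha> (i + k) - \<alpha> i\<bar> \<le> h * (b (real (Suc (i + k)) * h) + b (real (i + k) * h) - b (real (Suc i) * h) - b (real i * h))"
        using Suc by simp
      have "\<bar>\<alpha> (Suc (i + k)) - \<alpha> i\<bar> \<le> \<bar>\<alpha> (Suc (i + k)) - \<alpha> (i + k)\<bar> + \<bar>\<alpha> (i + k) - \<alpha> i\<bar>" by simp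
      also have "\<dots> \<le> h * (b (real (Suc (Suc (i + k))) * h) - b (real (i + k) * h))
          + h * (b (real (Suc (i + k)) * h) + b (real (i + k) * h) - b (real (Suc i) * h) - b (real i * h))"
        using s ih by linarith
      also have "\<dots> = h * (b (real (Suc (Suc (i + k))) * h) + b (real (Suc (i + k)) * h) - b (real (Suc i) * h) - b (real i * h))"
        by (simp only: algebra_simps)
      finally show ?case by simp
    qed simp
    have bb: "0 \<le> b (real i * h)" "b (real i * h) \<le> b T" if "i \<le> n" for i
      using bmono[of 0 "real i * h"] bmono[of "real i * h" T] le[OF that] b0 h(1) T by auto
    have diff: "\<bar>\<alpha> (i + k) - \<alpha> i\<bar> \<le> h * (2 * b T)" if "i + k < n" for i k
    proof -
      have "b (real (Suc (i + k)) * h) + b (real (i + k) * h) - b (real (Suc i) * h) - b (real i * h) \<le> 2 * b T"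
        using bb[of "Suc (i + k)"] bb[of "i + k"] bb[of "Suc i"] bb[of i] that by linarith
      then have "h * (b (real (Suc (i + k)) * h) + b (real (i + k) * h) - b (real (Suc i) * h) - b (real i * h)) \<le> h * (2 * b T)"
        using h(1) by (intro mult_left_mono) auto
      then show ?thesis using tele[OF that] by linarith
    qed
    have any: "\<alpha> j \<le> \<alpha> i + h * (2 * b T)" if i: "i < n" for i
    proof (cases "i \<le> j")
      case True
      then show ?thesis using diff[of i "j - i"] j by simp
    next
      case False
      then show ?thesis using diff[of j "i - j"] i by simp
    qed
    have sum: "m \<le> n \<Longrightarrow> (\<Sum>i<m. \<alpha> i) = integral {0..real m * h} E" for m
    proof (induction m)
      case (Suc m)
      have "real (Suc m) * h \<le> T" using Suc.prems by (intro le)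
      then have "integral {0..real (Suc m) * h} E = integral {0..real m * h} E + integral {real m * h..real (Suc m) * h} E"
        using h(1) by (intro comb[OF Ei]) (auto simp: algebra_simps)
      then show ?case using Suc by (simp add: \<alpha>_def A_def algebra_simps)
    qed simp
    have "real n * \<alpha> j = (\<Sum>i<n. \<alpha> j)" by simp
    also have "\<dots> \<le> (\<Sum>i<n. \<alpha> i + h * (2 * b T))" using any by (intro sum_mono) auto
    also have "\<dots> = integral {0..T} E + T * (2 * b T)"
      using sum[of n] h(2) by (simp add: sum.distrib mult.assoc[symmetric])
    also have "\<dots> = T * K" using T by (simp add: K_def distrib_left)
    finally have "\<alpha> j \<le> T * K / real n" using n by (simp add: pos_le_divide_eq mult.commute)
    then show ?thesis by (simp add: \<alpha>_def h_def)
  qed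
  define R where "R t = K * t - integral {0..t} E" for t
  have cR: "continuous_on {0..T} R"
    unfolding R_def by (intro continuous_intros indefinite_integral_continuous_1 sub[OF Ei]) auto
  have mono: "R u \<le> R v" if uv: "0 \<le> u" "u \<le> v" "v \<le> T" for u v
  proof (rule monotone_of_tiles[OF T cR _ uv])
    fix n j :: nat assume nj: "0 < n" "j < n"
    define h where "h = T / real n"
    have h: "h > 0" "real n * h = T" using T nj by (auto simp: h_def)
    have "real (Suc j) * h \<le> T" using mult_right_mono[of "real (Suc j)" "real n" h] nj h by simp
    then have "integral {0..real (Suc j) * h} E = integral {0..real j * h} E + integral {real j * h..real (Suc j) * h} E"
      using h(1) by (intro comb[OF Ei]) (auto simp: algebra_simps)
    moreover have "integral {real j * h..real (Suc j) * h} E \<le> h * K"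
      using tile[OF nj] by (simp add: A_def h_def[symmetric] algebra_simps)
    ultimately show "R (real j * (T / real n)) \<le> R (real (Suc j) * (T / real n))"
      by (simp add: R_def h_def[symmetric] algebra_simps)
  qed
  have KEi: "(\<lambda>t. K - E t) absolutely_integrable_on {0..T}"
    by (intro set_integral_diff(1) Ei continuous_absolutely_integrable[OF continuous_on_const])
  have "AE t in Leb 0 T. 0 \<le> K - E t"
  proof (rule AE_nonneg_of_interval_integrals[OF KEi])
    fix u v assume uv: "0 < u" "u < v" "v < T"
    have "integral {u..v} (\<lambda>t. K - E t) = integral {u..v} (\<lambda>t. K) - integral {u..v} E"
      using sub[OF Ei, of u v] uv by (intro HK_diff) auto
    also have "\<dots> = R v - R u"
      using comb[OF Ei, of 0 u v] uv by (simp add: R_def algebra_simps)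
    finally show "0 \<le> integral {u..v} (\<lambda>t. K - E t)" using mono[of u v] uv by simp
  qed
  then show ?thesis
    by eventually_elim (simp add: K_def b_def algebra_simps)
qed

text \<open>By \<open>energy_increment\<close> at almost all times, \<open>bounded_of_increments\<close> applies to \<open>E(t) = \<parallel>Q(t)\<parallel>\<^sup>2\<close>.\<close>

lemma energy_bound:
  assumes T: "0 < T" and f: "f \<in> L2 (cyl T a b)" and g: "g \<in> L2 (cyl T a b)" and P: "P \<in> L2 (cyl T a b)" and Q: "Q \<in> L2 (cyl T a b)"
    and ac: "time_ac T a b f g"
    and S: "AE t in Leb 0 T. t \<in> S"
    and sym: "\<And>s t. s \<in> S \<Longrightarrow> t \<in> S \<Longrightarrow>
      (LINT x|Leb a b. f (s, x) * P (t, x)) = (LINT x|Leb a b. Q (s, x) * Q (t, x))"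
  shows "AE t in Leb 0 T. (LINT x|Leb a b. (Q (t, x))\<^sup>2) \<le>
    (LINT p|Leb2 T a b. (Q p)\<^sup>2) / T + (LINT p|Leb2 T a b. (g p)\<^sup>2) + 2 * (LINT p|Leb2 T a b. (P p)\<^sup>2)"
proof -
  obtain c where c: "AE t in Leb 0 T. AE x in Leb a b.
      f (t, x) = c x + integral {0..t} (\<lambda>s. g (s, x))"
    using time_ac_good_times[OF T f g ac] by blast
  let ?good = "\<lambda>t. t \<in> S \<and> (AE x in Leb a b. f (t, x) = c x + integral {0..t} (\<lambda>s. g (s, x)))
    \<and> (\<lambda>x. f (t, x)) \<in> L2 {a<..<b} \<and> (\<lambda>x. P (t, x)) \<in> L2 {a<..<b} \<and> (\<lambda>x. Q (t, x)) \<in> L2 {a<..<b}"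
  have "AE t in Leb 0 T. ?good t"
    using S c L2_slices(1)[OF f] L2_slices(1)[OF P] L2_slices(1)[OF Q] by eventually_elim blast
  then obtain N where N: "negligible N" "\<forall>t\<in>{0<..<T} - N. ?good t" unfolding AE_interval_iff by blast
  let ?n = "\<lambda>q t. LINT x|Leb a b. (q (t, x))\<^sup>2"
  have int: "?n q absolutely_integrable_on {0..T}" "integral {0..T} (?n q) = (LINT p|Leb2 T a b. (q p)\<^sup>2)"
    if "q \<in> L2 (cyl T a b)" for q
  proof -
    show i: "?n q absolutely_integrable_on {0..T}"
      using cyl_Fubini(2)[OF L2_square_integrable[OF that]] integrable_lebesgue_on_interval by blast
    show "integral {0..T} (?n q) = (LINT p|Leb2 T a b. (q p)\<^sup>2)"
      using LINT_interval[OF i] cyl_Fubini(3)[OF L2_square_integrable[OF that]] by simp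
  qed
  have "AE t in Leb 0 T. ?n Q t \<le> integral {0..T} (?n Q) / T + integral {0..T} (?n g) + 2 * integral {0..T} (?n P)"
  proof (rule bounded_of_increments[OF T N(1) int(1)[OF Q] int(1)[OF g] int(1)[OF P]])
    show "?n g t \<ge> 0" "?n P t \<ge> 0" for t by (auto intro: LINT_nonneg)
    fix t t' assume t: "0 < t" "t < t'" "t' < T" "t \<notin> N" "t' \<notin> N"
    have G: "?good t" "?good t'" using N(2) t by auto
    show "\<bar>?n Q t' - ?n Q t\<bar> \<le> integral {t..t'} (?n g) / 2 + (t' - t) * ?n P t + (t' - t) * ?n P t'"
      by (rule energy_increment[OF g t(1-3)]) (use G sym in auto)
  qed
  then show ?thesis unfolding int(2)[OF Q] int(2)[OF g] int(2)[OF P] .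
qed

section \<open>Embedding of \<open>X\<close> into the bounded functions\<close>

lemma jet_ac: "jet a b m F \<Longrightarrow> k < m \<Longrightarrow> ac a b (F k) (F (Suc k))"
  by (simp add: jet_def)

lemma jet4_ac:
  assumes "jet a b 4 F"
  shows "ac a b (F 0) (F 1)" "ac a b (F 1) (F 2)" "ac a b (F 2) (F 3)" "ac a b (F 3) (F 4)"
  using jet_ac[OF assms, of 0] jet_ac[OF assms, of 1] jet_ac[OF assms, of 2] jet_ac[OF assms, of 3]
  by (simp_all add: numeral_eq_Suc)

lemma double_integration_by_parts:
  assumes F: "ac a b F0 F1" "ac a b F1 F2" and V: "ac a b V0 V1" "ac a b V1 V2"
    and cd: "a \<le> c" "c \<le> d" "d \<le> b"
  shows "((\<lambda>x. F0 x * V2 x - F2 x * V0 x) has_integral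
    ((F0 d * V1 d - F1 d * V0 d) - (F0 c * V1 c - F1 c * V0 c))) {c..d}"
  using ac_integral[OF ac_diff[OF ac_mult[OF F(1) V(2)] ac_mult[OF F(2) V(1)]] cd] by (simp add: algebra_simps)

lemma L2_continuous_mult:
  fixes f G :: "real \<Rightarrow> real"
  assumes "f \<in> L2 {a<..<b}" "continuous_on {a..b} G" shows "(\<lambda>x. G x * f x) \<in> L2 {a<..<b}"
proof -
  have "bounded (G ` {a..b})" by (intro compact_imp_bounded compact_continuous_image assms) auto
  then obtain K where K: "\<forall>x\<in>{a..b}. \<bar>G x\<bar> \<le> K" by (auto simp: bounded_iff)
  have "G \<in> borel_measurable (Leb a b)"
    using continuous_on_subset[OF assms(2) open_subset_closed_interval] by (intro continuous_imp_measurable_on_sets_lebesgue) auto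
  then show ?thesis by (rule L2_bounded_mult[OF assms(1), of _ K]) (use K in \<open>auto intro!: AE_I2\<close>)
qed

text \<open>The weight \<open>(x - a)(b - x)\<close> makes boundary terms vanish. That it still controls point values up to the
  boundary is seen by testing \<open>F''\<close> with a kernel \<open>s (1 - s/l)\<^sup>2\<close>, \<open>s = \<bar>x - x\<^sub>0\<bar>\<close>, which is dominated by the weight.\<close>

lemma point_value_bound:
  assumes ab: "a < b" and F: "ac a b F0 F1" "ac a b F1 F2" and x0: "x0 \<in> {a..b}"
    and l: "l = (b - a) / 2"
  shows "\<bar>F0 x0\<bar> \<le> integral {a..b} (\<lambda>x. \<bar>(x - a) * (b - x) * F2 x\<bar>) / l + 4 / l * integral {a..b} (\<lambda>x. \<bar>F0 x\<bar>)"
proof -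
  have l0: "l > 0" using ab l by simp
  let ?w = "\<lambda>x. \<bar>(x - a) * (b - x) * F2 x\<bar> / l + 4 / l * \<bar>F0 x\<bar>"
  have F2i: "F2 absolutely_integrable_on {a..b}" by (rule acD_integrable[OF F(2)])
  have F0i: "F0 absolutely_integrable_on {a..b}" by (rule continuous_absolutely_integrable[OF ac_continuous[OF F(1)]])
  have wF: "(\<lambda>x. (x - a) * (b - x) * F2 x) absolutely_integrable_on {a..b}"
    by (rule absolutely_integrable_cont_mult[OF F2i]) (intro continuous_intros)
  have wi1: "((\<lambda>x. \<bar>(x - a) * (b - x) * F2 x\<bar> / l) has_integral integral {a..b} (\<lambda>x. \<bar>(x - a) * (b - x) * F2 x\<bar>) / l) {a..b}"
    by (intro has_integral_divide integrable_integral abs_integrable_on[OF set_integrable_abs[OF wF]])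
  have wi2: "((\<lambda>x. 4 / l * \<bar>F0 x\<bar>) has_integral 4 / l * integral {a..b} (\<lambda>x. \<bar>F0 x\<bar>)) {a..b}"
    by (intro has_integral_mult_right integrable_integral abs_integrable_on[OF set_integrable_abs[OF F0i]])
  note wi = has_integral_add[OF wi1 wi2]
  have main: "\<bar>F0 x0\<bar> \<le> integral {a..b} ?w"
    if k: "\<And>x. (k has_real_derivative k1 x) (at x)" "\<And>x. (k1 has_real_derivative k2 x) (at x)"
      "continuous_on UNIV k2" and cd: "a \<le> c" "c \<le> d" "d \<le> b"
      and bd: "\<bar>(F0 d * k1 d - F1 d * k d) - (F0 c * k1 c - F1 c * k c)\<bar> = \<bar>F0 x0\<bar>"
      and kb: "\<And>x. x \<in> {c..d} \<Longrightarrow> \<bar>k x\<bar> \<le> (x - a) * (b - x) / l" "\<And>x. x \<in> {c..d} \<Longrightarrow> \<bar>k2 x\<bar> \<le> 4 / l"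
    for k k1 k2 c d
  proof -
    have k1c: "continuous_on {a..b} k1" using k(2) by (intro DERIV_continuous_on) (auto intro: has_field_derivative_at_within)
    have V: "ac a b k k1" "ac a b k1 k2"
      using k k1c continuous_on_subset[OF k(3)] by (auto intro!: ac_C1 intro: has_field_derivative_at_within)
    note p = double_integration_by_parts[OF F V cd]
    have wsub: "?w integrable_on {c..d}" using has_integral_integrable[OF wi] cd integrable_on_subinterval by fastforce
    have "norm (integral {c..d} (\<lambda>x. F0 x * k2 x - F2 x * k x)) \<le> integral {c..d} ?w"
    proof (rule HK_norm_bound[OF has_integral_integrable[OF p] wsub])
      fix x assume x: "x \<in> {c..d}"
      then have nn: "(x - a) * (b - x) \<ge> 0" using cd by auto
      have "\<bar>F0 x * k2 x - F2 x * k x\<bar> \<le> \<bar>F0 x\<bar> * \<bar>k2 x\<bar> + \<bar>F2 x\<bar> * \<bar>k x\<bar>"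
        by (metis abs_mult abs_triangle_ineq4)
      also have "\<dots> \<le> \<bar>F0 x\<bar> * (4 / l) + \<bar>F2 x\<bar> * ((x - a) * (b - x) / l)"
        using kb[OF x] by (intro add_mono mult_left_mono) auto
      also have "\<dots> = ?w x"
      proof -
        have "\<bar>(x - a) * (b - x) * F2 x\<bar> = (x - a) * (b - x) * \<bar>F2 x\<bar>"
          by (simp only: abs_mult[of "(x - a) * (b - x)"] abs_of_nonneg[OF nn])
        then show ?thesis by (simp add: mult.commute)
      qed
      finally show "norm (F0 x * k2 x - F2 x * k x) \<le> ?w x" by simp
    qed
    then have "\<bar>F0 x0\<bar> \<le> integral {c..d} ?w" unfolding integral_unique[OF p] using bd by simp
    also have "\<dots> \<le> integral {a..b} ?w"
      using cd l0 by (intro integral_subset_le wsub has_integral_integrable[OF wi]) auto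
    finally show ?thesis .
  qed
  have poly: "\<bar>s * (1 - s / l)\<^sup>2\<bar> \<le> s * (l - s) / l" "\<bar>(- 4 + 6 * s / l) / l\<bar> \<le> 4 / l" if s: "0 \<le> s" "s \<le> l" for s
  proof -
    have q: "0 \<le> 1 - s / l" "1 - s / l \<le> 1" using s l0 by auto
    have "(1 - s / l)\<^sup>2 \<le> 1 - s / l" unfolding power2_eq_square using q by (intro mult_left_le) auto
    then have "s * (1 - s / l)\<^sup>2 \<le> s * (1 - s / l)" using s by (intro mult_left_mono) auto
    also have "\<dots> = s * (l - s) / l" using l0 by (simp add: field_simps)
    finally show "\<bar>s * (1 - s / l)\<^sup>2\<bar> \<le> s * (l - s) / l" using s by (simp add: abs_of_nonneg)
    have "\<bar>- 4 + 6 * s / l\<bar> \<le> 4" using s l0 by (auto simp: abs_le_iff field_simps)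
    then show "\<bar>(- 4 + 6 * s / l) / l\<bar> \<le> 4 / l" using l0 by (simp add: abs_divide divide_right_mono)
  qed
  have wpoly: "s * (l - s) / l \<le> (x - a) * (b - x) / l" if "0 \<le> s" "s \<le> l" "s \<le> x - a \<and> l - s \<le> b - x \<or> s \<le> b - x \<and> l - s \<le> x - a" for s x
  proof -
    have "s * (l - s) \<le> (x - a) * (b - x)"
      using that(3)
    proof
      assume "s \<le> x - a \<and> l - s \<le> b - x"
      then show ?thesis using that(1,2) by (intro mult_mono) auto
    next
      assume "s \<le> b - x \<and> l - s \<le> x - a"
      then have "s * (l - s) \<le> (b - x) * (x - a)" using that(1,2) by (intro mult_mono) auto
      then show ?thesis by (simp add: mult.commute)
    qed
    then show ?thesis using l0 by (intro divide_right_mono) auto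
  qed
  have "\<bar>F0 x0\<bar> \<le> integral {a..b} ?w"
  proof (cases "x0 \<le> a + l")
    case True
    show ?thesis
    proof (rule main[of "\<lambda>x. (x - x0) * (1 - (x - x0) / l)\<^sup>2" "\<lambda>x. (1 - (x - x0) / l) * (1 - 3 * (x - x0) / l)"
          "\<lambda>x. (- 4 + 6 * (x - x0) / l) / l" x0 "x0 + l"])
      show "((\<lambda>x. (x - x0) * (1 - (x - x0) / l)\<^sup>2) has_real_derivative (1 - (x - x0) / l) * (1 - 3 * (x - x0) / l)) (at x)" for x
        using l0 by (auto intro!: derivative_eq_intros simp: power2_eq_square algebra_simps add_divide_distrib diff_divide_distrib)
      show "((\<lambda>x. (1 - (x - x0) / l) * (1 - 3 * (x - x0) / l)) has_real_derivative (- 4 + 6 * (x - x0) / l) / l) (at x)" for x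
        using l0 by (auto intro!: derivative_eq_intros simp: algebra_simps add_divide_distrib diff_divide_distrib)
      show "continuous_on UNIV (\<lambda>x. (- 4 + 6 * (x - x0) / l) / l)" using l0 by (intro continuous_intros) auto
      fix x assume x: "x \<in> {x0..x0 + l}"
      then have s: "0 \<le> x - x0" "x - x0 \<le> l" by auto
      show "\<bar>(- 4 + 6 * (x - x0) / l) / l\<bar> \<le> 4 / l" by (rule poly(2)[OF s])
      have "x - x0 \<le> x - a \<and> l - (x - x0) \<le> b - x" using x0 True l by (auto simp: field_simps)
      then show "\<bar>(x - x0) * (1 - (x - x0) / l)\<^sup>2\<bar> \<le> (x - a) * (b - x) / l"
        using poly(1)[OF s] wpoly[OF s, of x] by linarith
    qed (use x0 True l l0 in \<open>auto simp: field_simps\<close>)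
  next
    case False
    show ?thesis
    proof (rule main[of "\<lambda>x. (x0 - x) * (1 - (x0 - x) / l)\<^sup>2" "\<lambda>x. - ((1 - (x0 - x) / l) * (1 - 3 * (x0 - x) / l))"
          "\<lambda>x. (- 4 + 6 * (x0 - x) / l) / l" "x0 - l" x0])
      show "((\<lambda>x. (x0 - x) * (1 - (x0 - x) / l)\<^sup>2) has_real_derivative - ((1 - (x0 - x) / l) * (1 - 3 * (x0 - x) / l))) (at x)" for x
        using l0 by (auto intro!: derivative_eq_intros simp: power2_eq_square algebra_simps add_divide_distrib diff_divide_distrib)
      show "((\<lambda>x. - ((1 - (x0 - x) / l) * (1 - 3 * (x0 - x) / l))) has_real_derivative (- 4 + 6 * (x0 - x) / l) / l) (at x)" for x
        using l0 by (auto intro!: derivative_eq_intros simp: algebra_simps add_divide_distrib diff_divide_distrib)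
      show "continuous_on UNIV (\<lambda>x. (- 4 + 6 * (x0 - x) / l) / l)" using l0 by (intro continuous_intros) auto
      fix x assume x: "x \<in> {x0 - l..x0}"
      then have s: "0 \<le> x0 - x" "x0 - x \<le> l" by auto
      show "\<bar>(- 4 + 6 * (x0 - x) / l) / l\<bar> \<le> 4 / l" by (rule poly(2)[OF s])
      have "x0 - x \<le> b - x \<and> l - (x0 - x) \<le> x - a" using x0 False l by (auto simp: field_simps)
      then show "\<bar>(x0 - x) * (1 - (x0 - x) / l)\<^sup>2\<bar> \<le> (x - a) * (b - x) / l"
        using poly(1)[OF s] wpoly[OF s, of x] by linarith
    qed (use x0 False l l0 in \<open>auto simp: field_simps\<close>)
  qed
  then show ?thesis unfolding integral_unique[OF wi] .
qed

lemma point_value_square_bound: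
  assumes ab: "a < b" and F: "ac a b F0 F1" "ac a b F1 F2" and F2: "F2 \<in> L2 {a<..<b}" and x0: "x0 \<in> {a..b}"
  shows "(F0 x0)\<^sup>2 \<le> 128 / (b - a) * ((LINT x|Leb a b. ((x - a) * (b - x) * F2 x)\<^sup>2) + (LINT x|Leb a b. (F0 x)\<^sup>2))"
proof -
  define l where "l = (b - a) / 2"
  have l0: "l > 0" using ab by (simp add: l_def)
  define A B where "A = integral {a..b} (\<lambda>x. \<bar>(x - a) * (b - x) * F2 x\<bar>)" and "B = integral {a..b} (\<lambda>x. \<bar>F0 x\<bar>)"
  define P Q where "P = (LINT x|Leb a b. ((x - a) * (b - x) * F2 x)\<^sup>2)" and "Q = (LINT x|Leb a b. (F0 x)\<^sup>2)"
  have wF2: "(\<lambda>x. (x - a) * (b - x) * F2 x) \<in> L2 {a<..<b}"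
    by (rule L2_continuous_mult[OF F2]) (intro continuous_intros)
  have F0L: "F0 \<in> L2 {a<..<b}"
  proof -
    have "(\<lambda>x. 1) \<in> L2 {a<..<b}" by (rule L2_const[OF interval_lmeasurable])
    from L2_continuous_mult[OF this ac_continuous[OF F(1)]] show ?thesis by simp
  qed
  have l2: "2 * l = b - a" by (simp add: l_def)
  have A2: "A\<^sup>2 \<le> 2 * l * P" unfolding A_def P_def l2 by (rule integral_abs_square_le[OF ab wF2])
  have B2: "B\<^sup>2 \<le> 2 * l * Q" unfolding B_def Q_def l2 by (rule integral_abs_square_le[OF ab F0L])
  have PQ: "P \<ge> 0" "Q \<ge> 0" unfolding P_def Q_def by (auto intro: LINT_nonneg)
  have "\<bar>F0 x0\<bar> \<le> A / l + 4 / l * B" using point_value_bound[OF ab F x0 l_def] by (simp add: A_def B_def)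
  then have "(F0 x0)\<^sup>2 \<le> (A / l + 4 / l * B)\<^sup>2" using power_mono[of "\<bar>F0 x0\<bar>" _ 2] by simp
  also have "\<dots> \<le> 2 * (A / l)\<^sup>2 + 2 * (4 / l * B)\<^sup>2" by (rule square_sum_le)
  also have "\<dots> = (2 * A\<^sup>2 + 32 * B\<^sup>2) / l\<^sup>2" by (simp add: power_divide power_mult_distrib add_divide_distrib)
  also have "\<dots> \<le> (2 * (2 * l * P) + 32 * (2 * l * Q)) / l\<^sup>2"
    using A2 B2 by (intro divide_right_mono add_mono mult_left_mono) auto
  also have "\<dots> = (4 * P + 64 * Q) / l" using l0 by (simp add: power2_eq_square field_simps)
  also have "\<dots> \<le> (64 * (P + Q)) / l" using PQ l0 by (intro divide_right_mono) auto
  also have "\<dots> = 128 / (b - a) * (P + Q)" by (simp add: l_def)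
  finally show ?thesis by (simp add: P_def Q_def)
qed

lemma continuous_snd_measurable:
  fixes G :: "real \<Rightarrow> real"
  assumes "continuous_on UNIV G" shows "(\<lambda>p. G (snd p)) \<in> borel_measurable (Leb2 T a b)"
proof -
  have "(\<lambda>p :: real \<times> real. G (snd p) :: real) \<in> borel_measurable borel"
    by (intro borel_measurable_continuous_onI continuous_on_compose2[OF assms] continuous_on_snd continuous_on_id) auto
  then show ?thesis by (intro measurable_restrict_space1 measurable_completion) simp
qed

lemma continuous_fst_measurable:
  fixes G :: "real \<Rightarrow> real"
  assumes "continuous_on UNIV G" shows "(\<lambda>p. G (fst p)) \<in> borel_measurable (Leb2 T a b)"
proof -
  have "(\<lambda>p :: real \<times> real. G (fst p) :: real) \<in> borel_measurable borel"
    by (intro borel_measurable_continuous_onI continuous_on_compose2[OF assms] continuous_on_fst continuous_on_id) auto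
  then show ?thesis by (intro measurable_restrict_space1 measurable_completion) simp
qed

lemma weighted_L2:
  assumes f: "f \<in> L2 (cyl T a b)" and G: "continuous_on UNIV G" "\<And>x. x \<in> {a..b} \<Longrightarrow> \<bar>G x\<bar> \<le> K"
  shows "(\<lambda>p. G (snd p) * f p) \<in> L2 (cyl T a b)"
    and "(LINT p|Leb2 T a b. (G (snd p) * f p)\<^sup>2) \<le> K\<^sup>2 * (LINT p|Leb2 T a b. (f p)\<^sup>2)"
proof -
  have bd: "\<bar>G (snd p)\<bar> \<le> K" if "p \<in> space (Leb2 T a b)" for p
    using that G(2)[of "snd p"] by (auto simp: cyl_def)
  show L: "(\<lambda>p. G (snd p) * f p) \<in> L2 (cyl T a b)"
    by (rule L2_bounded_mult[OF f continuous_snd_measurable[OF G(1)] AE_I2[OF bd]])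
  have "(LINT p|Leb2 T a b. (G (snd p) * f p)\<^sup>2) \<le> (LINT p|Leb2 T a b. K\<^sup>2 * (f p)\<^sup>2)"
  proof (rule integral_mono[OF L2_square_integrable[OF L] integrable_mult_right[OF L2_square_integrable[OF f]]])
    fix p assume "p \<in> space (Leb2 T a b)"
    from power_mono[OF bd[OF this], of 2] show "(G (snd p) * f p)\<^sup>2 \<le> K\<^sup>2 * (f p)\<^sup>2"
      by (simp add: power_mult_distrib mult_right_mono)
  qed
  then show "(LINT p|Leb2 T a b. (G (snd p) * f p)\<^sup>2) \<le> K\<^sup>2 * (LINT p|Leb2 T a b. (f p)\<^sup>2)" by simp
qed

lemma slice_jet_L2:
  assumes "slice_jet a b m D t F" "k \<le> m" "(\<lambda>x. D k (t, x)) \<in> L2 {a<..<b}"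
  shows "F k \<in> L2 {a<..<b}"
proof (rule L2_cong_AE[OF assms(3)])
  have "AE x in Leb a b. F k x = D k (t, x)" using assms(1,2) by (simp add: slice_jet_def)
  then show "AE x in Leb a b. D k (t, x) = F k x" by eventually_elim simp
qed simp

definition graph_norm2 :: "real \<Rightarrow> real \<Rightarrow> real \<Rightarrow> (nat \<Rightarrow> real \<times> real \<Rightarrow> real) \<Rightarrow> (real \<times> real \<Rightarrow> real) \<Rightarrow> real" where
  "graph_norm2 T a b D g = (\<Sum>k\<le>4. LINT p|Leb2 T a b. (D k p)\<^sup>2) + (LINT p|Leb2 T a b. (g p)\<^sup>2)"

lemma graph_norm2_ge:
  "(LINT p|Leb2 T a b. (g p)\<^sup>2) \<le> graph_norm2 T a b D g"
  "k \<le> 4 \<Longrightarrow> (LINT p|Leb2 T a b. (D k p)\<^sup>2) \<le> graph_norm2 T a b D g" "0 \<le> graph_norm2 T a b D g"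
proof -
  have nn: "0 \<le> (LINT p|Leb2 T a b. (h p)\<^sup>2)" for h :: "real \<times> real \<Rightarrow> real"
    by (rule LINT_nonneg) simp
  have s: "0 \<le> (\<Sum>k\<le>4. LINT p|Leb2 T a b. (D k p)\<^sup>2)" using nn by (intro sum_nonneg) auto
  then show "(LINT p|Leb2 T a b. (g p)\<^sup>2) \<le> graph_norm2 T a b D g" "0 \<le> graph_norm2 T a b D g"
    using nn[of g] by (auto simp: graph_norm2_def)
  assume k: "k \<le> 4"
  have "(LINT p|Leb2 T a b. (D k p)\<^sup>2) \<le> (\<Sum>k\<le>4. LINT p|Leb2 T a b. (D k p)\<^sup>2)"
    using k nn by (intro member_le_sum) auto
  then show "(LINT p|Leb2 T a b. (D k p)\<^sup>2) \<le> graph_norm2 T a b D g"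
    using nn[of g] unfolding graph_norm2_def by linarith
qed

lemma slice_sym:
  assumes ab: "a < b" and sF: "slice_jet a b 4 D s F"
    and V: "ac a b V0 V1" "ac a b V1 V2" and L: "F 2 \<in> L2 {a<..<b}" "V2 \<in> L2 {a<..<b}"
    and bd: "F 0 b * V1 b - F 1 b * V0 b = 0" "F 0 a * V1 a - F 1 a * V0 a = 0"
  shows "(LINT x|Leb a b. F 0 x * V2 x) = (LINT x|Leb a b. F 2 x * V0 x)"
proof -
  have j: "jet a b 4 F" using sF by (simp add: slice_jet_def)
  note F = jet4_ac[OF j]
  have 1: "(\<lambda>x. F 0 x * V2 x) absolutely_integrable_on {a..b}"
    by (rule absolutely_integrable_cont_mult[OF L2_absolutely_integrable[OF L(2)] ac_continuous[OF F(1)]])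
  have "(\<lambda>x. V0 x * F 2 x) absolutely_integrable_on {a..b}"
    by (rule absolutely_integrable_cont_mult[OF L2_absolutely_integrable[OF L(1)] ac_continuous[OF V(1)]])
  then have 2: "(\<lambda>x. F 2 x * V0 x) absolutely_integrable_on {a..b}" by (simp add: mult.commute)
  have "integral {a..b} (\<lambda>x. F 0 x * V2 x - F 2 x * V0 x) = 0"
    using integral_unique[OF double_integration_by_parts[OF F(1,2) V, of a b]] ab bd by simp
  moreover have "integral {a..b} (\<lambda>x. F 0 x * V2 x - F 2 x * V0 x) = integral {a..b} (\<lambda>x. F 0 x * V2 x) - integral {a..b} (\<lambda>x. F 2 x * V0 x)"
    by (intro HK_diff abs_integrable_on 1 2)
  ultimately show ?thesis using LINT_interval[OF 1] LINT_interval[OF 2] by simp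
qed

lemma LINT_cong_slice:
  fixes f g f' g' :: "real \<Rightarrow> real"
  assumes "AE x in Leb a b. f x = f' x" "AE x in Leb a b. g x = g' x"
  shows "(LINT x|Leb a b. f x * g x) = (LINT x|lebesgue_on {a<..<(b::real)}. f' x * g' x)"
  by (rule integral_lebesgue_on_cong_AE) (use assms in \<open>eventually_elim, simp\<close>, simp)

definition weight :: "real \<Rightarrow> real \<Rightarrow> real \<Rightarrow> real" where
  "weight a b x = (x - a) * (b - x)"

definition weight' :: "real \<Rightarrow> real \<Rightarrow> real \<Rightarrow> real" where
  "weight' a b x = 2 * weight a b x * (a + b - 2 * x)"

definition weight'' :: "real \<Rightarrow> real \<Rightarrow> real \<Rightarrow> real" where
  "weight'' a b x = 2 * (a + b - 2 * x)\<^sup>2 - 4 * weight a b x"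

lemma weight_deriv:
  "((\<lambda>x. (weight a b x)\<^sup>2) has_real_derivative weight' a b x) (at x)"
  "(weight' a b has_real_derivative weight'' a b x) (at x)"
  unfolding weight'_def[abs_def] weight''_def weight_def
  by (auto intro!: derivative_eq_intros simp: power2_eq_square algebra_simps)

lemma weight_continuous: "continuous_on S (weight a b)" "continuous_on S (weight' a b)" "continuous_on S (weight'' a b)"
  unfolding weight_def[abs_def] weight'_def[abs_def] weight''_def[abs_def] by (intro continuous_intros)+

lemma weight_ac: "ac a b (\<lambda>x. (weight a b x)\<^sup>2) (weight' a b)" "ac a b (weight' a b) (weight'' a b)"
  by (intro ac_C1 has_field_derivative_at_within[OF weight_deriv(1)] has_field_derivative_at_within[OF weight_deriv(2)] weight_continuous)+

lemma continuous_bound: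
  fixes G :: "real \<Rightarrow> real"
  assumes "continuous_on {a..b} G" obtains K where "K \<ge> 0" "\<And>x. x \<in> {a..b} \<Longrightarrow> \<bar>G x\<bar> \<le> K"
proof -
  have "bounded (G ` {a..b})" by (intro compact_imp_bounded compact_continuous_image assms) auto
  then obtain K where K: "\<forall>x\<in>{a..b}. \<bar>G x\<bar> \<le> K" by (auto simp: bounded_iff)
  show ?thesis
    by (rule that[of "max K 0"]) (use K in \<open>auto simp: le_max_iff_disj\<close>)
qed

text \<open>The energy estimate is used twice: with \<open>Q = P = f\<close>, and with \<open>Q = w f\<^sub>x\<^sub>x\<close>, \<open>P = (w\<^sup>2 f\<^sub>x\<^sub>x)\<^sub>x\<^sub>x\<close> for the weight
  \<open>w = (x - a)(b - x)\<close>, which makes all boundary terms vanish. By \<open>point_value_square_bound\<close> the two bounds together control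
  point values.\<close>

lemma X_bounded:
  assumes T: "0 < T" and ab: "a < b"
  shows "\<exists>K\<ge>0. \<forall>D g. xrep T a b D g \<longrightarrow> (AE p in Leb2 T a b. (D 0 p)\<^sup>2 \<le> K * graph_norm2 T a b D g)"
proof -
  obtain K0 where K0: "K0 \<ge> 0" "\<And>x. x \<in> {a..b} \<Longrightarrow> \<bar>weight a b x\<bar> \<le> K0"
    using continuous_bound[OF weight_continuous(1)] by blast
  obtain K1 where K1: "K1 \<ge> 0" "\<And>x. x \<in> {a..b} \<Longrightarrow> \<bar>weight' a b x\<bar> \<le> K1"
    using continuous_bound[OF weight_continuous(2)] by blast
  obtain K2 where K2: "K2 \<ge> 0" "\<And>x. x \<in> {a..b} \<Longrightarrow> \<bar>weight'' a b x\<bar> \<le> K2"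
    using continuous_bound[OF weight_continuous(3)] by blast
  \<comment> \<open>\<open>P\<close> has three terms; \<open>(p + q)\<^sup>2 \<le> 2 p\<^sup>2 + 2 q\<^sup>2\<close> is applied twice\<close>
  define C where "C = (2 * (2 * ((K0\<^sup>2)\<^sup>2 + (2 * K1)\<^sup>2) + K2\<^sup>2))"
  have C0: "C \<ge> 0" by (simp add: C_def)
  define K where "K = 128 / (b - a) * ((K0\<^sup>2 / T + 1 + 2 * C) + (1 / T + 1 + 2))"
  have "K \<ge> 0" unfolding K_def using C0 T ab by (intro mult_nonneg_nonneg add_nonneg_nonneg) auto
  moreover have "AE p in Leb2 T a b. (D 0 p)\<^sup>2 \<le> K * graph_norm2 T a b D g" if xr: "xrep T a b D g" for D g
  proof -
    define n where "n = graph_norm2 T a b D g"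
    have n: "n \<ge> 0" "(LINT p|Leb2 T a b. (g p)\<^sup>2) \<le> n" "\<And>k. k \<le> 4 \<Longrightarrow> (LINT p|Leb2 T a b. (D k p)\<^sup>2) \<le> n"
      using graph_norm2_ge[where T=T and a=a and b=b and D=D and g=g] by (auto simp: n_def)
    have DL: "\<And>k. k \<le> 4 \<Longrightarrow> D k \<in> L2 (cyl T a b)" and gL: "g \<in> L2 (cyl T a b)" and ta: "time_ac T a b (D 0) g"
      and sj: "AE t in Leb 0 T. \<exists>F. slice_jet a b 4 D t F"
      using xr by (auto simp: xrep_def)
    let ?w = "weight a b" and ?w1 = "weight' a b" and ?w2 = "weight'' a b"
    have cW: "continuous_on UNIV (\<lambda>x. (?w x)\<^sup>2)" by (intro continuous_intros weight_continuous)
    have cW1: "continuous_on UNIV (\<lambda>x. 2 * ?w1 x)" by (intro continuous_intros weight_continuous)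
    have bW: "\<bar>(?w x)\<^sup>2\<bar> \<le> K0\<^sup>2" if "x \<in> {a..b}" for x using power_mono[OF K0(2)[OF that], of 2] by simp
    have bW1: "\<bar>2 * ?w1 x\<bar> \<le> 2 * K1" if "x \<in> {a..b}" for x using K1(2)[OF that] by simp
    note L4 = weighted_L2[OF DL[of 4, simplified] cW bW] and L3 = weighted_L2[OF DL[of 3, simplified] cW1 bW1]
      and L2' = weighted_L2[OF DL[of 2, simplified] weight_continuous(3) K2(2)]
      and LQ = weighted_L2[OF DL[of 2, simplified] weight_continuous(1) K0(2)]
    define P where "P p = ((?w (snd p))\<^sup>2 * D 4 p + 2 * ?w1 (snd p) * D 3 p) + ?w2 (snd p) * D 2 p" for p
    define Q where "Q p = ?w (snd p) * D 2 p" for p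
    have PL: "P \<in> L2 (cyl T a b)" unfolding P_def[abs_def] by (intro L2_add L4(1) L3(1) L2'(1))
    have QL: "Q \<in> L2 (cyl T a b)" unfolding Q_def[abs_def] by (rule LQ(1))
    have Pn: "(LINT p|Leb2 T a b. (P p)\<^sup>2) \<le> C * n"
    proof -
      have add: "(LINT p|Leb2 T a b. (q p + r p)\<^sup>2) \<le> 2 * (LINT p|Leb2 T a b. (q p)\<^sup>2) + 2 * (LINT p|Leb2 T a b. (r p)\<^sup>2)"
        if "q \<in> L2 (cyl T a b)" "r \<in> L2 (cyl T a b)" for q r
        using LINT_square_triangle[OF that(1) L2_const[OF cyl_lmeasurable, of 0] L2_uminus[OF that(2)]] by simp
      have m: "K * (LINT p|Leb2 T a b. (D k p)\<^sup>2) \<le> K * n" if "K \<ge> 0" "k \<le> 4" for K k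
        using n(3)[OF that(2)] that(1) by (intro mult_left_mono) auto
      have "(LINT p|Leb2 T a b. (P p)\<^sup>2) \<le> 2 * (2 * ((K0\<^sup>2)\<^sup>2 * n + (2 * K1)\<^sup>2 * n) + K2\<^sup>2 * n)"
        using add[OF L2_add[OF L4(1) L3(1)] L2'(1)] add[OF L4(1) L3(1)] L4(2) L3(2) L2'(2)
          m[of "(K0\<^sup>2)\<^sup>2" 4] m[of "(2 * K1)\<^sup>2" 3] m[of "K2\<^sup>2" 2]
        unfolding P_def[abs_def] by (simp del: power_mult_distrib)
      then show ?thesis by (simp add: C_def algebra_simps)
    qed
    let ?S = "{t. (\<exists>F. slice_jet a b 4 D t F) \<and> (\<forall>k\<in>{..4}. (\<lambda>x. D k (t, x)) \<in> L2 {a<..<b})}"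
    have Lk: "AE t in Leb 0 T. \<forall>k\<in>{..4}. (\<lambda>x. D k (t, x)) \<in> L2 {a<..<b}"
      by (subst AE_ball_countable) (auto intro!: L2_slices(1) DL)
    have S: "AE t in Leb 0 T. t \<in> ?S" using sj Lk by eventually_elim simp
    have sym: "(LINT x|Leb a b. D 0 (s, x) * P (t, x)) = (LINT x|Leb a b. Q (s, x) * Q (t, x))"
      if s: "s \<in> ?S" and t: "t \<in> ?S" for s t
    proof -
      obtain F where F: "slice_jet a b 4 D s F" using s by blast
      obtain G where G: "slice_jet a b 4 D t G" using t by blast
      have jG: "jet a b 4 G" using G by (simp add: slice_jet_def)
      note Ga = jet4_ac[OF jG]
      have FL: "F k \<in> L2 {a<..<b}" if "k \<le> 4" for k using slice_jet_L2[OF F that] s that by auto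
      have GL: "G k \<in> L2 {a<..<b}" if "k \<le> 4" for k using slice_jet_L2[OF G that] t that by auto
      have V: "ac a b (\<lambda>x. (?w x)\<^sup>2 * G 2 x) (\<lambda>x. ?w1 x * G 2 x + (?w x)\<^sup>2 * G 3 x)"
        by (rule ac_mult[OF weight_ac(1) Ga(3)])
      have V': "ac a b (\<lambda>x. ?w1 x * G 2 x + (?w x)\<^sup>2 * G 3 x) (\<lambda>x. (?w2 x * G 2 x + ?w1 x * G 3 x) + (?w1 x * G 3 x + (?w x)\<^sup>2 * G 4 x))"
        by (intro ac_add ac_mult weight_ac Ga(3) Ga(4))
      have end0: "?w a = 0" "?w b = 0" "?w1 a = 0" "?w1 b = 0" by (simp_all add: weight_def weight'_def)
      have V2L: "(\<lambda>x. (?w2 x * G 2 x + ?w1 x * G 3 x) + (?w1 x * G 3 x + (?w x)\<^sup>2 * G 4 x)) \<in> L2 {a<..<b}"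
        by (intro L2_add L2_continuous_mult GL weight_continuous continuous_on_power) auto
      have "(LINT x|Leb a b. D 0 (s, x) * P (t, x)) = (LINT x|Leb a b. F 0 x * ((?w2 x * G 2 x + ?w1 x * G 3 x) + (?w1 x * G 3 x + (?w x)\<^sup>2 * G 4 x)))"
      proof (rule LINT_cong_slice)
        have "AE x in Leb a b. F 0 x = D 0 (s, x)" using F by (simp add: slice_jet_def)
        then show "AE x in Leb a b. D 0 (s, x) = F 0 x" by eventually_elim simp
        have "AE x in Leb a b. G 2 x = D 2 (t, x)" "AE x in Leb a b. G 3 x = D 3 (t, x)"
          "AE x in Leb a b. G 4 x = D 4 (t, x)" using G by (auto simp: slice_jet_def)
        then show "AE x in Leb a b. P (t, x) = (?w2 x * G 2 x + ?w1 x * G 3 x) + (?w1 x * G 3 x + (?w x)\<^sup>2 * G 4 x)"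
          by eventually_elim (simp add: P_def)
      qed
      also have "\<dots> = (LINT x|Leb a b. F 2 x * ((?w x)\<^sup>2 * G 2 x))"
        by (rule slice_sym[OF ab F V V' FL V2L]) (simp_all add: end0)
      also have "\<dots> = (LINT x|Leb a b. (?w x * F 2 x) * (?w x * G 2 x))"
        by (simp add: power2_eq_square mult_ac)
      also have "\<dots> = (LINT x|Leb a b. Q (s, x) * Q (t, x))"
      proof (rule LINT_cong_slice)
        have "AE x in Leb a b. F 2 x = D 2 (s, x)" using F by (auto simp: slice_jet_def)
        then show "AE x in Leb a b. ?w x * F 2 x = Q (s, x)" by eventually_elim (simp add: Q_def)
        have "AE x in Leb a b. G 2 x = D 2 (t, x)" using G by (auto simp: slice_jet_def)
        then show "AE x in Leb a b. ?w x * G 2 x = Q (t, x)" by eventually_elim (simp add: Q_def)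
      qed
      finally show ?thesis .
    qed
    have e1: "AE t in Leb 0 T. (LINT x|Leb a b. (Q (t, x))\<^sup>2) \<le>
        (LINT p|Leb2 T a b. (Q p)\<^sup>2) / T + (LINT p|Leb2 T a b. (g p)\<^sup>2) + 2 * (LINT p|Leb2 T a b. (P p)\<^sup>2)"
      by (rule energy_bound[OF T DL gL PL QL ta S sym]) simp
    have e2: "AE t in Leb 0 T. (LINT x|Leb a b. (D 0 (t, x))\<^sup>2) \<le>
        (LINT p|Leb2 T a b. (D 0 p)\<^sup>2) / T + (LINT p|Leb2 T a b. (g p)\<^sup>2) + 2 * (LINT p|Leb2 T a b. (D 0 p)\<^sup>2)"
      by (rule energy_bound[OF T DL gL DL DL ta, where S=UNIV]) auto
    have Qn: "(LINT p|Leb2 T a b. (Q p)\<^sup>2) \<le> K0\<^sup>2 * n"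
      using LQ(2) mult_left_mono[OF n(3)[of 2], of "K0\<^sup>2"] by (simp add: Q_def)
    have "AE t in Leb 0 T. AE x in Leb a b. (D 0 (t, x))\<^sup>2 \<le> K * n"
      using e1 e2 S
    proof eventually_elim
      case (elim t)
      obtain F where F: "slice_jet a b 4 D t F" using elim(3) by blast
      have jF: "jet a b 4 F" using F by (simp add: slice_jet_def)
      have FL: "F k \<in> L2 {a<..<b}" if "k \<le> 4" for k using slice_jet_L2[OF F that] elim(3) that by auto
      have D02: "AE x in Leb a b. F 0 x = D 0 (t, x)" "AE x in Leb a b. F 2 x = D 2 (t, x)"
        using F by (auto simp: slice_jet_def)
      have q1: "(LINT x|Leb a b. ((x - a) * (b - x) * F 2 x)\<^sup>2) = (LINT x|Leb a b. (Q (t, x))\<^sup>2)"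
        by (rule integral_lebesgue_on_cong_AE) (use D02(2) in \<open>eventually_elim, simp add: Q_def weight_def\<close>, simp)
      have q2: "(LINT x|Leb a b. (F 0 x)\<^sup>2) = (LINT x|Leb a b. (D 0 (t, x))\<^sup>2)"
        by (rule integral_lebesgue_on_cong_AE) (use D02(1) in \<open>eventually_elim, simp\<close>, simp)
      have Q1: "(LINT x|Leb a b. (Q (t, x))\<^sup>2) \<le> (K0\<^sup>2 / T + 1 + 2 * C) * n"
        using elim(1) n(2) Pn divide_right_mono[OF Qn, of T] T by (simp add: algebra_simps)
      have Q2: "(LINT x|Leb a b. (D 0 (t, x))\<^sup>2) \<le> (1 / T + 1 + 2) * n"
        using elim(2) n(2) n(3)[of 0] divide_right_mono[OF n(3)[of 0], of T] T by (simp add: algebra_simps)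
      have pt: "(F 0 x)\<^sup>2 \<le> K * n" if x: "x \<in> {a<..<b}" for x
      proof -
        have "(F 0 x)\<^sup>2 \<le> 128 / (b - a) * ((LINT x|Leb a b. (Q (t, x))\<^sup>2) + (LINT x|Leb a b. (D 0 (t, x))\<^sup>2))"
          using point_value_square_bound[OF ab jet4_ac(1,2)[OF jF] FL, of x] x unfolding q1 q2 by simp
        also have "\<dots> \<le> 128 / (b - a) * ((K0\<^sup>2 / T + 1 + 2 * C) * n + (1 / T + 1 + 2) * n)"
          using Q1 Q2 ab by (intro mult_left_mono add_mono) auto
        also have "\<dots> = K * n" unfolding K_def by (simp only: distrib_right[symmetric] mult.assoc)
        finally show ?thesis .
      qed
      show ?case using D02(1) AE_space
      proof eventually_elim
        case (elim x)
        then show ?case using pt[of x] by simp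
      qed
    qed
    then show ?thesis unfolding n_def[symmetric]
      by (intro AE_cyl_leI borel_measurable_integrable[OF L2_square_integrable[OF DL]]) auto
  qed
  ultimately show ?thesis by blast
qed

text \<open>The boundary conditions \<open>F\<^sub>x = F\<^sub>x\<^sub>x\<^sub>x = 0\<close> of the problem.\<close>

definition neumann :: "real \<Rightarrow> real \<Rightarrow> (nat \<Rightarrow> real \<Rightarrow> real) \<Rightarrow> bool" where
  "neumann a b F \<longleftrightarrow> F 1 a = 0 \<and> F 1 b = 0 \<and> F 3 a = 0 \<and> F 3 b = 0"

definition xrepN :: "real \<Rightarrow> real \<Rightarrow> real \<Rightarrow> (nat \<Rightarrow> real \<times> real \<Rightarrow> real) \<Rightarrow> (real \<times> real \<Rightarrow> real) \<Rightarrow> bool" where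
  "xrepN T a b D g \<longleftrightarrow> xrep T a b D g \<and> (AE t in Leb 0 T. \<exists>F. slice_jet a b 4 D t F \<and> neumann a b F)"

text \<open>Under the boundary conditions \<open>\<langle>f(s), f\<^sub>x\<^sub>x\<^sub>x\<^sub>x(t)\<rangle> = \<langle>f\<^sub>x\<^sub>x(s), f\<^sub>x\<^sub>x(t)\<rangle>\<close>, so the energy estimate bounds \<open>\<parallel>f\<^sub>x\<^sub>x(t)\<parallel>\<close>; then
  \<open>f\<^sub>x\<close> is bounded because it vanishes at \<open>a\<close>.\<close>

lemma xrepN_Dx_bounded:
  assumes T: "0 < T" and ab: "a < b" and xr: "xrepN T a b D g"
  shows "\<exists>K. AE p in Leb2 T a b. \<bar>D 1 p\<bar> \<le> K"
proof -
  have DL: "\<And>k. k \<le> 4 \<Longrightarrow> D k \<in> L2 (cyl T a b)" and gL: "g \<in> L2 (cyl T a b)" and ta: "time_ac T a b (D 0) g"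
    and sj: "AE t in Leb 0 T. \<exists>F. slice_jet a b 4 D t F \<and> neumann a b F"
    using xr by (auto simp: xrep_def xrepN_def)
  let ?S = "{t. (\<exists>F. slice_jet a b 4 D t F \<and> neumann a b F) \<and> (\<forall>k\<in>{..4}. (\<lambda>x. D k (t, x)) \<in> L2 {a<..<b})}"
  have Lk: "AE t in Leb 0 T. \<forall>k\<in>{..4}. (\<lambda>x. D k (t, x)) \<in> L2 {a<..<b}"
    by (subst AE_ball_countable) (auto intro!: L2_slices(1) DL)
  have S: "AE t in Leb 0 T. t \<in> ?S" using sj Lk by eventually_elim simp
  have sym: "(LINT x|Leb a b. D 0 (s, x) * D 4 (t, x)) = (LINT x|Leb a b. D 2 (s, x) * D 2 (t, x))"
    if s: "s \<in> ?S" and t: "t \<in> ?S" for s t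
  proof -
    obtain F where F: "slice_jet a b 4 D s F" "neumann a b F" using s by blast
    obtain G where G: "slice_jet a b 4 D t G" "neumann a b G" using t by blast
    have jG: "jet a b 4 G" using G by (simp add: slice_jet_def)
    have FL: "F k \<in> L2 {a<..<b}" if "k \<le> 4" for k using slice_jet_L2[OF F(1) that] s that by auto
    have GL: "G k \<in> L2 {a<..<b}" if "k \<le> 4" for k using slice_jet_L2[OF G(1) that] t that by auto
    have DF: "AE x in Leb a b. D k (s, x) = F k x" if "k \<le> 4" for k
    proof -
      have "AE x in Leb a b. F k x = D k (s, x)" using F that by (auto simp: slice_jet_def)
      then show ?thesis by eventually_elim simp
    qed
    have DG: "AE x in Leb a b. D k (t, x) = G k x" if "k \<le> 4" for k
    proof -
      have "AE x in Leb a b. G k x = D k (t, x)" using G that by (auto simp: slice_jet_def)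
      then show ?thesis by eventually_elim simp
    qed
    have "(LINT x|Leb a b. D 0 (s, x) * D 4 (t, x)) = (LINT x|Leb a b. F 0 x * G 4 x)"
      by (rule LINT_cong_slice[OF DF DG]) auto
    also have "\<dots> = (LINT x|Leb a b. F 2 x * G 2 x)"
      by (rule slice_sym[OF ab F(1) jet4_ac(3,4)[OF jG] FL GL]) (use F(2) G(2) in \<open>auto simp: neumann_def\<close>)
    also have "\<dots> = (LINT x|Leb a b. D 2 (s, x) * D 2 (t, x))"
      by (rule LINT_cong_slice[symmetric, OF DF DG]) auto
    finally show ?thesis .
  qed
  define n where "n = (LINT p|Leb2 T a b. (D 2 p)\<^sup>2) / T + (LINT p|Leb2 T a b. (g p)\<^sup>2) + 2 * (LINT p|Leb2 T a b. (D 4 p)\<^sup>2)"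
  have e: "AE t in Leb 0 T. (LINT x|Leb a b. (D 2 (t, x))\<^sup>2) \<le> n"
    unfolding n_def by (rule energy_bound[OF T DL gL DL DL ta S sym]) auto
  have "AE t in Leb 0 T. AE x in Leb a b. \<bar>D 1 (t, x)\<bar> \<le> sqrt ((b - a) * n)"
    using e S
  proof eventually_elim
    case (elim t)
    obtain F where F: "slice_jet a b 4 D t F" "neumann a b F" using elim(2) by blast
    have jF: "jet a b 4 F" using F by (simp add: slice_jet_def)
    have F2L: "F 2 \<in> L2 {a<..<b}" by (rule slice_jet_L2[OF F(1)]) (use elim(2) in auto)
    have D12: "AE x in Leb a b. F 1 x = D 1 (t, x)" "AE x in Leb a b. F 2 x = D 2 (t, x)"
      using F by (auto simp: slice_jet_def)
    have q: "(LINT x|Leb a b. (F 2 x)\<^sup>2) = (LINT x|Leb a b. (D 2 (t, x))\<^sup>2)"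
      by (rule integral_lebesgue_on_cong_AE) (use D12(2) in \<open>eventually_elim, simp\<close>, simp)
    have F2i: "F 2 absolutely_integrable_on {a..b}" by (rule L2_absolutely_integrable[OF F2L])
    have pt: "\<bar>F 1 x\<bar> \<le> sqrt ((b - a) * n)" if x: "x \<in> {a<..<b}" for x
    proof -
      have F2x: "F 2 absolutely_integrable_on {a..x}" using x by (intro absolutely_integrable_on_subinterval[OF F2i]) auto
      have "F 1 x = integral {a..x} (F 2)"
        using ac_integral[OF jet4_ac(2)[OF jF], of a x] x F(2) by (simp add: integral_unique neumann_def)
      then have "\<bar>F 1 x\<bar> \<le> integral {a..x} (\<lambda>x. \<bar>F 2 x\<bar>)" using integral_abs_bound_abs[OF F2x] by simp
      also have "\<dots> \<le> integral {a..b} (\<lambda>x. \<bar>F 2 x\<bar>)"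
        using x by (intro integral_subset_le abs_integrable_on set_integrable_abs F2x F2i) auto
      finally have "\<bar>F 1 x\<bar>\<^sup>2 \<le> (integral {a..b} (\<lambda>x. \<bar>F 2 x\<bar>))\<^sup>2" by (intro power_mono) auto
      also have "\<dots> \<le> (b - a) * (LINT x|Leb a b. (F 2 x)\<^sup>2)" by (rule integral_abs_square_le[OF ab F2L])
      also have "\<dots> \<le> (b - a) * n" using elim(1) ab unfolding q by (intro mult_left_mono) auto
      finally show ?thesis by (rule real_le_rsqrt)
    qed
    show ?case using D12(1) AE_space
    proof eventually_elim
      case (elim x)
      then show ?case using pt[of x] by simp
    qed
  qed
  then have "AE p in Leb2 T a b. \<bar>D 1 p\<bar> \<le> sqrt ((b - a) * n)"
    using L2_measurable[OF DL[of 1]] by (intro AE_cyl_leI) auto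
  then show ?thesis by blast
qed

section \<open>Extension of positive functionals\<close>

definition function_space :: "('a \<Rightarrow> real) set \<Rightarrow> bool" where
  "function_space E \<longleftrightarrow> (\<lambda>_. 0) \<in> E \<and> (\<forall>f\<in>E. \<forall>g\<in>E. (\<lambda>p. f p + g p) \<in> E) \<and> (\<forall>c. \<forall>f\<in>E. (\<lambda>p. c * f p) \<in> E)"

lemma function_spaceD:
  assumes "function_space E"
  shows "(\<lambda>_. 0) \<in> E" "f \<in> E \<Longrightarrow> g \<in> E \<Longrightarrow> (\<lambda>p. f p + g p) \<in> E" "f \<in> E \<Longrightarrow> (\<lambda>p. c * f p) \<in> E"
  using assms by (simp_all add: function_space_def)

text \<open>Linear functionals on subspaces are handled as graphs, so that extension is inclusion.\<close>

definition linear_graph :: "(('a \<Rightarrow> real) \<times> real) set \<Rightarrow> bool" where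
  "linear_graph G \<longleftrightarrow> ((\<lambda>_. 0), 0) \<in> G \<and>
     (\<forall>f r g s. (f, r) \<in> G \<longrightarrow> (g, s) \<in> G \<longrightarrow> ((\<lambda>p. f p + g p), r + s) \<in> G) \<and>
     (\<forall>c f r. (f, r) \<in> G \<longrightarrow> ((\<lambda>p. c * f p), c * r) \<in> G)"

lemma linear_graphD:
  assumes "linear_graph G"
  shows "((\<lambda>_. 0), 0) \<in> G" "(f, r) \<in> G \<Longrightarrow> (g, s) \<in> G \<Longrightarrow> ((\<lambda>p. f p + g p), r + s) \<in> G"
    "(f, r) \<in> G \<Longrightarrow> ((\<lambda>p. c * f p), c * r) \<in> G"
    "(f, r) \<in> G \<Longrightarrow> (g, s) \<in> G \<Longrightarrow> ((\<lambda>p. f p - g p), r - s) \<in> G"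
proof -
  show "((\<lambda>_. 0), 0) \<in> G" and a: "(f, r) \<in> G \<Longrightarrow> (g, s) \<in> G \<Longrightarrow> ((\<lambda>p. f p + g p), r + s) \<in> G" for f r g s
    using assms by (auto simp: linear_graph_def)
  show m: "(f, r) \<in> G \<Longrightarrow> ((\<lambda>p. c * f p), c * r) \<in> G" for c f r
    using assms by (auto simp: linear_graph_def)
  show "(f, r) \<in> G \<Longrightarrow> (g, s) \<in> G \<Longrightarrow> ((\<lambda>p. f p - g p), r - s) \<in> G"
    using a[of f r "\<lambda>p. -1 * g p" "-1 * s"] m[of g s "-1"] by simp
qed

text \<open>The missing function \<open>f0\<close> may be given any value between the lower bounds coming from the \<open>w\<close> with \<open>f0 - w\<close> positive and the
  upper bounds coming from the \<open>w\<close> with \<open>w - f0\<close> positive.\<close>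

lemma one_step_extension:
  fixes P :: "('a \<Rightarrow> real) \<Rightarrow> bool"
  assumes Padd: "\<And>f g. P f \<Longrightarrow> P g \<Longrightarrow> P (\<lambda>p. f p + g p)" and Pscale: "\<And>c f. c \<ge> 0 \<Longrightarrow> P f \<Longrightarrow> P (\<lambda>p. c * f p)"
    and G: "linear_graph G" and pos: "\<And>f r. (f, r) \<in> G \<Longrightarrow> P f \<Longrightarrow> r \<ge> 0"
    and lower: "(w1, r1) \<in> G" "P (\<lambda>p. f0 p - w1 p)" and upper: "(w2, r2) \<in> G" "P (\<lambda>p. w2 p - f0 p)"
  shows "\<exists>G'. linear_graph G' \<and> G \<subseteq> G' \<and> (\<exists>c. (f0, c) \<in> G') \<and> (\<forall>f r. (f, r) \<in> G' \<longrightarrow> P f \<longrightarrow> r \<ge> 0) \<and>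
    (\<forall>f r. (f, r) \<in> G' \<longrightarrow> (\<exists>w r' s. (w, r') \<in> G \<and> f = (\<lambda>p. w p + s * f0 p)))"
proof -
  define A where "A = {r. \<exists>w. (w, r) \<in> G \<and> P (\<lambda>p. f0 p - w p)}"
  define B where "B = {r. \<exists>w. (w, r) \<in> G \<and> P (\<lambda>p. w p - f0 p)}"
  have AB: "r \<le> r'" if A: "r \<in> A" and B: "r' \<in> B" for r r'
  proof -
    obtain w where w: "(w, r) \<in> G" "P (\<lambda>p. f0 p - w p)" using A by (auto simp: A_def)
    obtain w' where w': "(w', r') \<in> G" "P (\<lambda>p. w' p - f0 p)" using B by (auto simp: B_def)
    have "P (\<lambda>p. w' p - w p)" using Padd[OF w(2) w'(2)] by simp
    then show ?thesis using pos[OF linear_graphD(4)[OF G w'(1) w(1)]] by simp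
  qed
  have r1: "r1 \<in> A" and r2: "r2 \<in> B" using lower upper by (auto simp: A_def B_def)
  define c where "c = Sup A"
  have bdd: "bdd_above A" using AB[OF _ r2] by (auto simp: bdd_above_def)
  have cA: "r \<le> c" if "r \<in> A" for r unfolding c_def by (rule cSup_upper[OF that bdd])
  have cB: "c \<le> r" if "r \<in> B" for r unfolding c_def by (rule cSup_least) (use r1 AB that in auto)
  define G' where "G' = {((\<lambda>p. w p + s * f0 p), r + s * c) | w r s. (w, r) \<in> G}"
  have mem: "((\<lambda>p. w p + s * f0 p), r + s * c) \<in> G'" if "(w, r) \<in> G" for w r s
    using that by (auto simp: G'_def)
  have "linear_graph G'"
    unfolding linear_graph_def
  proof (intro conjI allI impI)
    show "((\<lambda>_. 0), 0) \<in> G'" using mem[OF linear_graphD(1)[OF G], of 0] by simp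
  next
    fix f r g s assume "(f, r) \<in> G'" "(g, s) \<in> G'"
    then obtain w1 r1 s1 w2 r2 s2 where 1: "(w1, r1) \<in> G" "f = (\<lambda>p. w1 p + s1 * f0 p)" "r = r1 + s1 * c"
      and 2: "(w2, r2) \<in> G" "g = (\<lambda>p. w2 p + s2 * f0 p)" "s = r2 + s2 * c" by (auto simp: G'_def)
    have "((\<lambda>p. (w1 p + w2 p) + (s1 + s2) * f0 p), (r1 + r2) + (s1 + s2) * c) \<in> G'"
      by (rule mem[OF linear_graphD(2)[OF G 1(1) 2(1)]])
    then show "((\<lambda>p. f p + g p), r + s) \<in> G'" by (simp add: 1 2 algebra_simps)
  next
    fix k f r assume "(f, r) \<in> G'"
    then obtain w1 r1 s1 where 1: "(w1, r1) \<in> G" "f = (\<lambda>p. w1 p + s1 * f0 p)" "r = r1 + s1 * c" by (auto simp: G'_def)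
    have "((\<lambda>p. k * w1 p + (k * s1) * f0 p), k * r1 + (k * s1) * c) \<in> G'"
      by (rule mem[OF linear_graphD(3)[OF G 1(1)]])
    then show "((\<lambda>p. k * f p), k * r) \<in> G'" by (simp add: 1 algebra_simps)
  qed
  moreover have "G \<subseteq> G'"
  proof
    fix x assume "x \<in> G"
    then show "x \<in> G'" using mem[of "fst x" "snd x" 0] by simp
  qed
  moreover have "(f0, c) \<in> G'" using mem[OF linear_graphD(1)[OF G], of 1] by simp
  moreover have "r \<ge> 0" if r: "(f, r) \<in> G'" "P f" for f r
  proof -
    obtain w q s where w: "(w, q) \<in> G" "f = (\<lambda>p. w p + s * f0 p)" "r = q + s * c" using r(1) by (auto simp: G'_def)
    consider "s = 0" | "s > 0" | "s < 0" by linarith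
    then show ?thesis
    proof cases
      case 1
      then show ?thesis using pos[OF w(1)] r(2) w by simp
    next
      case 2
      have "P (\<lambda>p. 1 / s * f p)" using 2 by (intro Pscale r(2)) simp
      also have "(\<lambda>p. 1 / s * f p) = (\<lambda>p. f0 p - (- (1 / s)) * w p)" using 2 by (auto simp: w(2) field_simps)
      finally have "- (1 / s) * q \<in> A" using linear_graphD(3)[OF G w(1), of "- (1 / s)"] unfolding A_def by blast
      then have "- (1 / s) * q \<le> c" by (rule cA)
      then show ?thesis using 2 by (simp add: w(3) field_simps)
    next
      case 3
      have "P (\<lambda>p. - (1 / s) * f p)" using 3 by (intro Pscale r(2)) simp
      also have "(\<lambda>p. - (1 / s) * f p) = (\<lambda>p. (- (1 / s)) * w p - f0 p)" using 3 by (auto simp: w(2) field_simps)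
      finally have "- (1 / s) * q \<in> B" using linear_graphD(3)[OF G w(1), of "- (1 / s)"] unfolding B_def by blast
      then have "c \<le> - (1 / s) * q" by (rule cB)
      then have "(- s) * c \<le> (- s) * (- (1 / s) * q)" using 3 by (intro mult_left_mono) auto
      then show ?thesis using 3 by (simp add: w(3))
    qed
  qed
  moreover have "\<exists>w r' s. (w, r') \<in> G \<and> f = (\<lambda>p. w p + s * f0 p)" if "(f, r) \<in> G'" for f r
    using that by (auto simp: G'_def)
  ultimately show ?thesis by blast
qed

text \<open>The M. Riesz extension theorem. A maximal positive linear graph has full domain by \<open>one_step_extension\<close>; the order unit
  \<open>e\<close> supplies a lower and an upper bound there. That the graph is single-valued also follows from positivity.\<close>

lemma positive_extension:
  fixes P :: "('a \<Rightarrow> real) \<Rightarrow> bool"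
  assumes Padd: "\<And>f g. P f \<Longrightarrow> P g \<Longrightarrow> P (\<lambda>p. f p + g p)" and Pscale: "\<And>c f. c \<ge> 0 \<Longrightarrow> P f \<Longrightarrow> P (\<lambda>p. c * f p)"
    and P0: "P (\<lambda>_. 0)"
    and E: "function_space E" and G0: "linear_graph G0" "\<And>f r. (f, r) \<in> G0 \<Longrightarrow> f \<in> E"
    and pos: "\<And>f r. (f, r) \<in> G0 \<Longrightarrow> P f \<Longrightarrow> r \<ge> 0"
    and unit: "(e, re) \<in> G0" "\<And>f. f \<in> E \<Longrightarrow> \<exists>c. P (\<lambda>p. c * e p - f p)"
  obtains \<nu> where "\<And>f g. f \<in> E \<Longrightarrow> g \<in> E \<Longrightarrow> \<nu> (\<lambda>p. f p + g p) = \<nu> f + \<nu> g"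
    "\<And>c f. f \<in> E \<Longrightarrow> \<nu> (\<lambda>p. c * f p) = c * \<nu> f"
    "\<And>f r. (f, r) \<in> G0 \<Longrightarrow> \<nu> f = r" "\<And>f. f \<in> E \<Longrightarrow> P f \<Longrightarrow> \<nu> f \<ge> 0"
proof -
  define S where "S = {G. linear_graph G \<and> G0 \<subseteq> G \<and> (\<forall>f r. (f, r) \<in> G \<longrightarrow> f \<in> E) \<and> (\<forall>f r. (f, r) \<in> G \<longrightarrow> P f \<longrightarrow> r \<ge> 0)}"
  have "G0 \<in> S" using G0 pos by (auto simp: S_def)
  have "\<exists>M\<in>S. \<forall>X\<in>S. M \<subseteq> X \<longrightarrow> X = M"
  proof (rule subset_Zorn_nonempty)
    show "S \<noteq> {}" using \<open>G0 \<in> S\<close> by blast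
    fix C assume C: "C \<noteq> {}" "subset.chain S C"
    then have CS: "C \<subseteq> S" and ch: "\<And>X Y. X \<in> C \<Longrightarrow> Y \<in> C \<Longrightarrow> X \<subseteq> Y \<or> Y \<subseteq> X"
      by (auto simp: subset_chain_def)
    have lin: "linear_graph X" if "X \<in> C" for X using that CS by (auto simp: S_def)
    have "linear_graph (\<Union>C)"
      unfolding linear_graph_def
    proof (intro conjI allI impI)
      obtain X where X: "X \<in> C" using C(1) by blast
      show "((\<lambda>_. 0), 0) \<in> \<Union>C" using linear_graphD(1)[OF lin[OF X]] X by blast
    next
      fix f r g s assume "(f, r) \<in> \<Union>C" "(g, s) \<in> \<Union>C"
      then obtain X Y where XY: "X \<in> C" "(f, r) \<in> X" "Y \<in> C" "(g, s) \<in> Y" by blast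
      show "((\<lambda>p. f p + g p), r + s) \<in> \<Union>C"
      proof (cases "X \<subseteq> Y")
        case True
        then show ?thesis using linear_graphD(2)[OF lin[OF XY(3)], of f r g s] XY by blast
      next
        case False
        then have "Y \<subseteq> X" using ch XY by blast
        then show ?thesis using linear_graphD(2)[OF lin[OF XY(1)], of f r g s] XY by blast
      qed
    next
      fix c f r assume "(f, r) \<in> \<Union>C"
      then obtain X where X: "X \<in> C" "(f, r) \<in> X" by blast
      show "((\<lambda>p. c * f p), c * r) \<in> \<Union>C" using linear_graphD(3)[OF lin[OF X(1)] X(2)] X(1) by blast
    qed
    moreover have "G0 \<subseteq> \<Union>C"
    proof -
      obtain X where X: "X \<in> C" using C(1) by blast
      then have "X \<in> S" using CS by blast
      then have "G0 \<subseteq> X" by (simp add: S_def)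
      then show ?thesis using X by blast
    qed
    moreover have "f \<in> E" "P f \<longrightarrow> r \<ge> 0" if m: "(f, r) \<in> \<Union>C" for f r
    proof -
      obtain X where X: "X \<in> C" "(f, r) \<in> X" using m by blast
      then have "X \<in> S" using CS by blast
      then show "f \<in> E" "P f \<longrightarrow> r \<ge> 0" using X(2) by (simp_all add: S_def, blast+)
    qed
    ultimately show "\<Union>C \<in> S" unfolding S_def by blast
  qed
  then obtain M where M: "M \<in> S" "\<And>X. X \<in> S \<Longrightarrow> M \<subseteq> X \<Longrightarrow> X = M" by blast
  have lM: "linear_graph M" and G0M: "G0 \<subseteq> M" and ME: "\<And>f r. (f, r) \<in> M \<Longrightarrow> f \<in> E" and Mpos: "\<And>f r. (f, r) \<in> M \<Longrightarrow> P f \<Longrightarrow> r \<ge> 0"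
    using M(1) by (auto simp: S_def)
  have dom: "\<exists>r. (f, r) \<in> M" if f: "f \<in> E" for f
  proof -
    obtain c2 where c2: "P (\<lambda>p. c2 * e p - f p)" using unit(2)[OF f] by blast
    have "(\<lambda>p. -1 * f p) \<in> E" by (rule function_spaceD(3)[OF E f])
    from unit(2)[OF this] obtain c1 where c1: "P (\<lambda>p. c1 * e p - -1 * f p)" by blast
    have eM: "(e, re) \<in> M" using unit(1) G0M by blast
    have low: "P (\<lambda>p. f p - (- c1) * e p)" using c1 by (simp add: algebra_simps)
    have "\<exists>G'. linear_graph G' \<and> M \<subseteq> G' \<and> (\<exists>c. (f, c) \<in> G') \<and> (\<forall>f r. (f, r) \<in> G' \<longrightarrow> P f \<longrightarrow> r \<ge> 0) \<and>
        (\<forall>h r. (h, r) \<in> G' \<longrightarrow> (\<exists>w r' s. (w, r') \<in> M \<and> h = (\<lambda>p. w p + s * f p)))"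
    proof (rule one_step_extension[where P=P and G=M])
      show "P (\<lambda>p. f p + g p)" if "P f" "P g" for f g by (rule Padd[OF that])
      show "P (\<lambda>p. c * f p)" if "c \<ge> 0" "P f" for c f by (rule Pscale[OF that])
      show "r \<ge> 0" if "(f, r) \<in> M" "P f" for f r by (rule Mpos[OF that])
    qed (fact lM linear_graphD(3)[OF lM eM] low c2)+
    then obtain G' where G': "linear_graph G'" "M \<subseteq> G'" "\<exists>c. (f, c) \<in> G'" "\<forall>f r. (f, r) \<in> G' \<longrightarrow> P f \<longrightarrow> r \<ge> 0"
      "\<forall>h r. (h, r) \<in> G' \<longrightarrow> (\<exists>w r' s. (w, r') \<in> M \<and> h = (\<lambda>p. w p + s * f p))" by blast
    have "h \<in> E" if m: "(h, r) \<in> G'" for h r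
    proof -
      obtain w r' s where w: "(w, r') \<in> M" "h = (\<lambda>p. w p + s * f p)" using G'(5) m by blast
      show ?thesis unfolding w(2)
        by (rule function_spaceD(2)[OF E ME[OF w(1)] function_spaceD(3)[OF E f]])
    qed
    then have "G' \<in> S" unfolding S_def using G' G0M by blast
    then have "G' = M" using M(2) G'(2) by blast
    then show ?thesis using G'(3) by blast
  qed
  have uniq: "r = s" if "(f, r) \<in> M" "(f, s) \<in> M" for f r s
  proof -
    have "r - s \<ge> 0" using Mpos[OF linear_graphD(4)[OF lM that]] P0 by simp
    moreover have "s - r \<ge> 0" using Mpos[OF linear_graphD(4)[OF lM that(2,1)]] P0 by simp
    ultimately show ?thesis by simp
  qed
  define \<nu> where "\<nu> f = (SOME r. (f, r) \<in> M)" for f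
  have \<nu>: "(f, \<nu> f) \<in> M" if "f \<in> E" for f using someI_ex[OF dom[OF that]] by (simp add: \<nu>_def)
  have \<nu>eq: "\<nu> f = r" if "(f, r) \<in> M" for f r by (rule uniq[OF \<nu>[OF ME[OF that]] that])
  show ?thesis
  proof (rule that[of \<nu>])
    show "\<nu> (\<lambda>p. f p + g p) = \<nu> f + \<nu> g" if "f \<in> E" "g \<in> E" for f g
      by (rule \<nu>eq[OF linear_graphD(2)[OF lM \<nu>[OF that(1)] \<nu>[OF that(2)]]])
    show "\<nu> (\<lambda>p. c * f p) = c * \<nu> f" if "f \<in> E" for c f
      by (rule \<nu>eq[OF linear_graphD(3)[OF lM \<nu>[OF that]]])
    show "\<nu> f = r" if "(f, r) \<in> G0" for f r using \<nu>eq that G0M by blast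
    show "\<nu> f \<ge> 0" if "f \<in> E" "P f" for f using Mpos[OF \<nu>[OF that(1)] that(2)] .
  qed
qed

section \<open>Linear operations on functions with jets\<close>

lemma jet_add: "jet a b m F \<Longrightarrow> jet a b m G \<Longrightarrow> jet a b m (\<lambda>k x. F k x + G k x)"
  unfolding jet_def by (auto intro: ac_add)

lemma jet_cmult: "jet a b m F \<Longrightarrow> jet a b m (\<lambda>k x. c * F k x)"
  unfolding jet_def by (auto intro: ac_cmult)

lemma slice_jet_add:
  assumes "slice_jet a b m D t F" "slice_jet a b m E t G"
  shows "slice_jet a b m (\<lambda>k p. D k p + E k p) t (\<lambda>k x. F k x + G k x)"
  unfolding slice_jet_def
proof (intro conjI allI impI)
  show "jet a b m (\<lambda>k x. F k x + G k x)" using assms by (auto simp: slice_jet_def intro: jet_add)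
  fix k assume "k \<le> m"
  then have "AE x in Leb a b. F k x = D k (t, x)" "AE x in Leb a b. G k x = E k (t, x)"
    using assms by (auto simp: slice_jet_def)
  then show "AE x in Leb a b. F k x + G k x = D k (t, x) + E k (t, x)" by eventually_elim simp
qed

lemma slice_jet_time_mult:
  assumes "slice_jet a b m D t F"
  shows "slice_jet a b m (\<lambda>k p. \<theta> (fst p) * D k p) t (\<lambda>k x. \<theta> t * F k x)"
  unfolding slice_jet_def
proof (intro conjI allI impI)
  show "jet a b m (\<lambda>k x. \<theta> t * F k x)" using assms by (auto simp: slice_jet_def intro: jet_cmult)
  fix k assume "k \<le> m"
  then have "AE x in Leb a b. F k x = D k (t, x)" using assms by (auto simp: slice_jet_def)
  then show "AE x in Leb a b. \<theta> t * F k x = \<theta> (fst (t, x)) * D k (t, x)" by eventually_elim simp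
qed

lemma time_ac_add:
  assumes "time_ac T a b f g" "time_ac T a b f' g'"
  shows "time_ac T a b (\<lambda>p. f p + f' p) (\<lambda>p. g p + g' p)"
  using assms unfolding time_ac_def
proof eventually_elim
  case (elim x)
  then obtain F G where F: "ac 0 T F (\<lambda>t. g (t, x))" "AE t in Leb 0 T. F t = f (t, x)"
    and G: "ac 0 T G (\<lambda>t. g' (t, x))" "AE t in Leb 0 T. G t = f' (t, x)" by blast
  have "AE t in Leb 0 T. F t + G t = f (t, x) + f' (t, x)" using F(2) G(2) by eventually_elim simp
  then show ?case using ac_add[OF F(1) G(1)] by blast
qed

lemma time_ac_time_mult:
  assumes "time_ac T a b f g" and \<theta>: "ac 0 T \<theta> \<theta>'"
  shows "time_ac T a b (\<lambda>p. \<theta> (fst p) * f p) (\<lambda>p. \<theta>' (fst p) * f p + \<theta> (fst p) * g p)"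
  using assms(1) unfolding time_ac_def
proof eventually_elim
  case (elim x)
  then obtain F where F: "ac 0 T F (\<lambda>t. g (t, x))" "AE t in Leb 0 T. F t = f (t, x)" by blast
  have "ac 0 T (\<lambda>t. \<theta> t * F t) (\<lambda>t. \<theta>' (fst (t, x)) * f (t, x) + \<theta> (fst (t, x)) * g (t, x))"
    by (rule ac_cong[OF ac_mult[OF \<theta> F(1)]]) (use F(2) in \<open>auto elim!: eventually_mono\<close>)
  moreover have "AE t in Leb 0 T. \<theta> t * F t = \<theta> (fst (t, x)) * f (t, x)"
    using F(2) by eventually_elim simp
  ultimately show ?case by blast
qed

lemma xrepN_add:
  assumes "xrepN T a b D g" "xrepN T a b E h"
  shows "xrepN T a b (\<lambda>k p. D k p + E k p) (\<lambda>p. g p + h p)"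
proof -
  have n: "AE t in Leb 0 T. \<exists>F. slice_jet a b 4 (\<lambda>k p. D k p + E k p) t F \<and> neumann a b F"
    using assms[unfolded xrepN_def, THEN conjunct2]
  proof eventually_elim
    case (elim t)
    then obtain F G where "slice_jet a b 4 D t F" "neumann a b F" "slice_jet a b 4 E t G" "neumann a b G" by blast
    then show ?case by (intro exI[of _ "\<lambda>k x. F k x + G k x"] conjI slice_jet_add) (auto simp: neumann_def)
  qed
  then have "AE t in Leb 0 T. \<exists>F. slice_jet a b 4 (\<lambda>k p. D k p + E k p) t F" by eventually_elim blast
  then show ?thesis
    using n assms by (auto simp: xrepN_def xrep_def intro!: L2_add time_ac_add)
qed

lemma xrepN_time_mult:
  assumes x: "xrepN T a b D g" and \<theta>: "ac 0 T \<theta> \<theta>'" "continuous_on UNIV \<theta>" "continuous_on UNIV \<theta>'"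
  shows "xrepN T a b (\<lambda>k p. \<theta> (fst p) * D k p) (\<lambda>p. \<theta>' (fst p) * D 0 p + \<theta> (fst p) * g p)"
proof -
  have n: "AE t in Leb 0 T. \<exists>F. slice_jet a b 4 (\<lambda>k p. \<theta> (fst p) * D k p) t F \<and> neumann a b F"
    using x[unfolded xrepN_def, THEN conjunct2]
  proof eventually_elim
    case (elim t)
    then obtain F where "slice_jet a b 4 D t F" "neumann a b F" by blast
    then show ?case by (intro exI[of _ "\<lambda>k x. \<theta> t * F k x"] conjI slice_jet_time_mult) (auto simp: neumann_def)
  qed
  then have n': "AE t in Leb 0 T. \<exists>F. slice_jet a b 4 (\<lambda>k p. \<theta> (fst p) * D k p) t F" by eventually_elim blast
  have L: "(\<lambda>p. \<eta> (fst p) * f p) \<in> L2 (cyl T a b)" if f: "f \<in> L2 (cyl T a b)" and \<eta>: "continuous_on UNIV \<eta>" for f \<eta>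
  proof -
    obtain K where K: "K \<ge> 0" "\<And>t. t \<in> {0..T} \<Longrightarrow> \<bar>\<eta> t\<bar> \<le> K"
      using continuous_bound[OF continuous_on_subset[OF \<eta>, of "{0..T}"]] by auto
    show ?thesis
      by (rule L2_bounded_mult[OF f continuous_fst_measurable[OF \<eta>], of K])
         (use K(2) in \<open>auto intro!: AE_I2 simp: cyl_def\<close>)
  qed
  show ?thesis
    using n n' x \<theta> unfolding xrepN_def xrep_def by (auto intro!: L2_add L time_ac_time_mult)
qed

lemma xrepN_cmult:
  assumes "xrepN T a b D g" shows "xrepN T a b (\<lambda>k p. c * D k p) (\<lambda>p. c * g p)"
  using xrepN_time_mult[OF assms ac_const, of c] by simp

lemma L2_of_time:
  assumes q: "zrep {0<..<T} q" "q \<in> L2 {0<..<T}" and ab: "a < b"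
  shows "(\<lambda>p. q (fst p)) \<in> L2 (cyl T a b)"
proof -
  have qm: "q \<in> borel_measurable borel" using q(1) by (simp add: zrep_def)
  have fm: "fst \<in> borel_measurable (borel :: (real \<times> real) measure)"
    by (intro borel_measurable_continuous_onI continuous_on_fst continuous_on_id)
  have m: "(\<lambda>p :: real \<times> real. q (fst p)) \<in> borel_measurable borel" by (rule measurable_compose[OF fm qm])
  have z: "zrep (cyl T a b) (\<lambda>p. indicator (cyl T a b) p * (q (fst p))\<^sup>2)"
    using m by (auto simp: zrep_def)
  have z1: "zrep {0<..<T} (\<lambda>t. (q t)\<^sup>2)" using q(1) by (auto simp: zrep_def)
  have i1: "integrable lborel (\<lambda>t. (q t)\<^sup>2)"
    using L2_square_integrable[OF q(2)] zrep_lebesgue_on(2)[OF z1] by simp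
  have sl: "indicator (cyl T a b) (t, x) * (q t)\<^sup>2 = (q t)\<^sup>2 * indicator {a<..<b} x" for t x
  proof (cases "t \<in> {0<..<T}")
    case False
    then have "q t = 0" using q(1) by (auto simp: zrep_def)
    then show ?thesis by simp
  qed (auto simp: indicator_def mem_cyl)
  have "integrable (lborel \<Otimes>\<^sub>M lborel) (\<lambda>p. indicator (cyl T a b) p * (q (fst p))\<^sup>2)"
  proof (rule lborel_pair.Fubini_integrable)
    show "(\<lambda>p. indicator (cyl T a b) p * (q (fst p))\<^sup>2) \<in> borel_measurable (lborel \<Otimes>\<^sub>M lborel)"
      using z unfolding lborel_prod by (simp add: zrep_def)
    have ind: "integrable lborel (\<lambda>x. (q t)\<^sup>2 * indicator {a<..<b} x)" for t
      using ab by (intro integrable_mult_right) (auto simp: integrable_indicator_iff)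
    show "AE t in lborel. integrable lborel (\<lambda>x. indicator (cyl T a b) (t, x) * (q (fst (t, x)))\<^sup>2)"
      using ind by (intro AE_I2) (simp add: sl)
    have eq: "(LINT x|lborel. norm (indicator (cyl T a b) (t, x) * (q (fst (t, x)))\<^sup>2)) = (b - a) * (q t)\<^sup>2" for t
    proof -
      have "(LINT x|lborel. norm (indicator (cyl T a b) (t, x) * (q (fst (t, x)))\<^sup>2)) = (LINT x|lborel. (q t)\<^sup>2 * indicator {a<..<b} x)"
        by (intro LINT_cong) (auto simp: sl abs_mult)
      also have "\<dots> = (q t)\<^sup>2 * (b - a)" using ab by simp
      finally show ?thesis by (simp add: mult.commute)
    qed
    show "integrable lborel (\<lambda>t. LINT x|lborel. norm (indicator (cyl T a b) (t, x) * (q (fst (t, x)))\<^sup>2))"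
      by (simp only: eq) (rule integrable_mult_right[OF i1])
  qed
  then have "integrable (Leb2 T a b) (\<lambda>p. indicator (cyl T a b) p * (q (fst p))\<^sup>2)"
    using zrep_lebesgue_on(2)[OF z cyl_borel] by (simp add: lborel_prod)
  then have "integrable (Leb2 T a b) (\<lambda>p. (q (fst p))\<^sup>2)"
    by (rule Bochner_Integration.integrable_cong[THEN iffD1, rotated 2]) (auto simp: indicator_def)
  moreover have "(\<lambda>p. q (fst p)) \<in> borel_measurable (Leb2 T a b)"
    using m by (intro measurable_restrict_space1 measurable_completion) simp
  ultimately show ?thesis by (simp add: L2_def)
qed

lemma xrepN_time:
  assumes T: "0 < T" and ab: "a < b" and m: "ac 0 T m q" and q: "zrep {0<..<T} q" "q \<in> L2 {0<..<T}"
  shows "xrepN T a b (\<lambda>k p. if k = 0 then m (fst p) else 0) (\<lambda>p. q (fst p))"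
proof -
  have cm: "continuous_on {0..T} m" by (rule ac_continuous[OF m])
  obtain K where K: "\<And>t. t \<in> {0..T} \<Longrightarrow> \<bar>m t\<bar> \<le> K" using continuous_bound[OF cm] by blast
  have "(\<lambda>p. m (fst p)) \<in> borel_measurable (Leb2 T a b)"
  proof (rule continuous_imp_measurable_on_sets_lebesgue[OF _ cyl_sets])
    show "continuous_on (cyl T a b) (\<lambda>p. m (fst p))"
      by (intro continuous_on_compose2[OF cm] continuous_on_fst continuous_on_id) (auto simp: cyl_def)
  qed
  then have mL: "(\<lambda>p. m (fst p)) \<in> L2 (cyl T a b)"
    by (rule L2_bounded[OF cyl_lmeasurable, where K=K]) (use K in \<open>auto intro!: AE_I2 simp: cyl_def\<close>)
  have "slice_jet a b 4 (\<lambda>k p. if k = 0 then m (fst p) else 0) t (\<lambda>k x. if k = 0 then m t else 0)" for t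
    unfolding slice_jet_def jet_def using ac_const[of a b] by (auto split: if_splits)
  moreover have "neumann a b (\<lambda>k x. if k = 0 then m t else 0)" for t by (simp add: neumann_def)
  ultimately have n: "\<exists>F. slice_jet a b 4 (\<lambda>k p. if k = 0 then m (fst p) else 0) t F \<and> neumann a b F" for t by blast
  have "time_ac T a b (\<lambda>p. m (fst p)) (\<lambda>p. q (fst p))"
    unfolding time_ac_def using m by (intro AE_I2 exI[of _ m]) simp
  moreover have "(\<lambda>p. if k = 0 then m (fst p) else 0) \<in> L2 (cyl T a b)" for k :: nat
    using mL L2_const[OF cyl_lmeasurable[of T a b], of 0] by (cases "k = 0") simp_all
  ultimately show ?thesis
    unfolding xrepN_def xrep_def
    using n mL L2_of_time[OF q ab] by (auto intro!: AE_I2)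
qed

lemma xrepN_xrep: "xrepN T a b D g \<Longrightarrow> xrep T a b D g"
  by (simp add: xrepN_def)

lemma xrepN_L2: "xrepN T a b D g \<Longrightarrow> k \<le> 4 \<Longrightarrow> D k \<in> L2 (cyl T a b)" "xrepN T a b D g \<Longrightarrow> g \<in> L2 (cyl T a b)"
  by (auto simp: xrepN_def xrep_def)

lemma zero_at_ends_continuous:
  assumes ab: "a < b" and "zero_at_ends a b f" and F: "continuous_on {a..b} F" "AE x in Leb a b. F x = f x"
  shows "F a = 0" "F b = 0"
proof -
  obtain G where G: "continuous_on {a..b} G" "AE x in Leb a b. G x = f x" "G a = 0" "G b = 0"
    using assms(2) by (auto simp: zero_at_ends_def)
  have "AE x in Leb a b. F x = G x" using F(2) G(2) by eventually_elim simp
  from continuous_AE_eq[OF ab F(1) G(1) this] show "F a = 0" "F b = 0" using G ab by auto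
qed

lemma X_imp_xrepN:
  assumes T: "0 < T" and ab: "a < b" and f: "f \<in> X T a b" and bc: "dx_zero_bdry T a b 1 f" "dx_zero_bdry T a b 3 f"
  obtains D g where "xrepN T a b D g" "D 0 = f"
proof -
  obtain D g where x: "xrep T a b D g" and D0: "D 0 = f" using X_imp_xrep[OF T ab f] by blast
  have Dx: "AE t in Leb 0 T. AE x in Leb a b. Dx T a b k f (t, x) = D k (t, x)" if "k \<le> 4" for k
    using AE_cyl_slices(1)[OF xrep_X(4)[OF T ab x that]] D0 by simp
  have "AE t in Leb 0 T. \<exists>F. slice_jet a b 4 D t F \<and> neumann a b F"
    using x[unfolded xrep_def, THEN conjunct2, THEN conjunct2, THEN conjunct1]
      Dx[of 1, simplified] Dx[of 3, simplified] bc[unfolded dx_zero_bdry_def]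
  proof eventually_elim
    case (elim t)
    obtain F where F: "slice_jet a b 4 D t F" using elim(1) by blast
    then have jF: "jet a b 4 F" by (simp add: slice_jet_def)
    have e1: "AE x in Leb a b. F 1 x = Dx T a b 1 f (t, x)"
    proof -
      have "AE x in Leb a b. F 1 x = D 1 (t, x)" using F by (auto simp: slice_jet_def)
      then show ?thesis using elim(2) by eventually_elim simp
    qed
    have e3: "AE x in Leb a b. F 3 x = Dx T a b 3 f (t, x)"
    proof -
      have "AE x in Leb a b. F 3 x = D 3 (t, x)" using F by (auto simp: slice_jet_def)
      then show ?thesis using elim(3) by eventually_elim simp
    qed
    have "neumann a b F"
      using zero_at_ends_continuous[OF ab elim(4) ac_continuous[OF jet4_ac(2)[OF jF]] e1]
        zero_at_ends_continuous[OF ab elim(5) ac_continuous[OF jet4_ac(4)[OF jF]] e3]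
      by (simp add: neumann_def)
    then show ?case using F by blast
  qed
  then show ?thesis using that[of D g] x D0 by (simp add: xrepN_def)
qed

lemma xrepN_dx_zero_bdry:
  assumes T: "0 < T" and ab: "a < b" and x: "xrepN T a b D g" and k: "k = 1 \<or> k = 3"
  shows "dx_zero_bdry T a b k (D 0)"
proof -
  have k4: "k \<le> 4" using k by auto
  show ?thesis
    unfolding dx_zero_bdry_def
    using x[unfolded xrepN_def, THEN conjunct2] AE_cyl_slices(1)[OF xrep_X(4)[OF T ab xrepN_xrep[OF x] k4]]
  proof eventually_elim
    case (elim t)
    obtain F where F: "slice_jet a b 4 D t F" "neumann a b F" using elim(1) by blast
    have jF: "jet a b 4 F" using F(1) by (simp add: slice_jet_def)
    have "AE x in Leb a b. F k x = D k (t, x)" using F(1) k4 by (simp add: slice_jet_def)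
    then have "AE x in Leb a b. F k x = Dx T a b k (D 0) (t, x)" using elim(2) by eventually_elim simp
    moreover have "continuous_on {a..b} (F k)"
      using k ac_continuous[OF jet4_ac(2)[OF jF]] ac_continuous[OF jet4_ac(4)[OF jF]] by auto
    moreover have "F k a = 0" "F k b = 0" using F(2) k by (auto simp: neumann_def)
    ultimately show ?case unfolding zero_at_ends_def by blast
  qed
qed

section \<open>The differential operators of the equation\<close>

text \<open>The \<open>x\<close>-derivative of \<open>(lam y^\<beta> + \<epsilon>) \<phi>\<^sub>x\<^sub>x\<^sub>x\<close>, computed on jets.\<close>

definition flux_dx :: "real \<Rightarrow> real \<Rightarrow> real \<Rightarrow> (nat \<Rightarrow> real) \<Rightarrow> (nat \<Rightarrow> real) \<Rightarrow> real" where
  "flux_dx lam \<beta> \<epsilon> Y \<Phi> = (lam * Y 0 powr \<beta> + \<epsilon>) * \<Phi> 4 + lam * \<beta> * Y 0 powr (\<beta> - 1) * Y 1 * \<Phi> 3"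

text \<open>The \<open>x\<close>-derivative of \<open>\<beta> lam y^(\<beta>-1) y\<^sub>x\<^sub>x\<^sub>x \<phi>\<close>, computed on jets.\<close>

definition reaction_dx :: "real \<Rightarrow> real \<Rightarrow> (nat \<Rightarrow> real) \<Rightarrow> (nat \<Rightarrow> real) \<Rightarrow> real" where
  "reaction_dx lam \<beta> Y \<Phi> = \<beta> * lam * ((\<beta> - 1) * Y 0 powr (\<beta> - 2) * Y 1 * Y 3 * \<Phi> 0
     + Y 0 powr (\<beta> - 1) * Y 4 * \<Phi> 0 + Y 0 powr (\<beta> - 1) * Y 3 * \<Phi> 1)"

lemma ac_powr:
  assumes Y: "ac a b Y Y'" "continuous_on {a..b} Y'" and pos: "\<And>x. x \<in> {a..b} \<Longrightarrow> Y x > 0"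
  shows "ac a b (\<lambda>x. Y x powr q) (\<lambda>x. q * Y x powr (q - 1) * Y' x)"
proof (rule ac_C1)
  fix x assume x: "x \<in> {a..b}"
  show "((\<lambda>x. Y x powr q) has_real_derivative q * Y x powr (q - 1) * Y' x) (at x within {a..b})"
    by (rule DERIV_chain2[OF has_real_derivative_powr[OF pos[OF x]] ac_has_derivative[OF Y x]])
next
  have "\<And>x. x \<in> {a..b} \<Longrightarrow> Y x \<noteq> 0" using pos by force
  then show "continuous_on {a..b} (\<lambda>x. q * Y x powr (q - 1) * Y' x)"
    by (intro continuous_intros Y(2) ac_continuous[OF Y(1)]) auto
qed

text \<open>The factor \<open>\<bar>y\<bar>^\<beta>\<close> of the equation is \<open>y^\<beta>\<close> because \<open>y\<close> is positive.\<close>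

lemma ac_flux:
  assumes Y: "jet a b 4 Y" and F: "jet a b 4 \<Phi>" and pos: "\<And>x. x \<in> {a..b} \<Longrightarrow> Y 0 x > 0"
  shows "ac a b (\<lambda>x. (lam * \<bar>Y 0 x\<bar> powr \<beta> + \<epsilon>) * \<Phi> 3 x) (\<lambda>x. flux_dx lam \<beta> \<epsilon> (\<lambda>k. Y k x) (\<lambda>k. \<Phi> k x))"
proof -
  have "ac a b (\<lambda>x. Y 0 x powr \<beta>) (\<lambda>x. \<beta> * Y 0 x powr (\<beta> - 1) * Y 1 x)"
    by (rule ac_powr[OF jet4_ac(1)[OF Y] ac_continuous[OF jet4_ac(2)[OF Y]] pos])
  from ac_mult[OF ac_add[OF ac_cmult[OF this, of lam] ac_const[of a b \<epsilon>]] jet4_ac(4)[OF F]]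
  show ?thesis
    by (rule ac_cong) (use pos in \<open>auto simp: flux_dx_def abs_of_pos mult_ac\<close>)
qed

lemma ac_reaction:
  assumes Y: "jet a b 4 Y" and F: "jet a b 4 \<Phi>" and pos: "\<And>x. x \<in> {a..b} \<Longrightarrow> Y 0 x > 0"
  shows "ac a b (\<lambda>x. \<beta> * lam * Y 0 x powr (\<beta> - 1) * Y 3 x * \<Phi> 0 x) (\<lambda>x. reaction_dx lam \<beta> (\<lambda>k. Y k x) (\<lambda>k. \<Phi> k x))"
proof -
  have "ac a b (\<lambda>x. Y 0 x powr (\<beta> - 1)) (\<lambda>x. (\<beta> - 1) * Y 0 x powr (\<beta> - 1 - 1) * Y 1 x)"
    by (rule ac_powr[OF jet4_ac(1)[OF Y] ac_continuous[OF jet4_ac(2)[OF Y]] pos])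
  from ac_mult[OF ac_mult[OF ac_cmult[OF this, of "\<beta> * lam"] jet4_ac(4)[OF Y]] jet4_ac(1)[OF F]]
  show ?thesis
    by (rule ac_cong) (auto simp: reaction_dx_def algebra_simps)
qed

lemma continuous_AE_ge:
  fixes F :: "real \<Rightarrow> real"
  assumes ab: "a < b" and F: "continuous_on {a..b} F" and ge: "AE x in Leb a b. F x \<ge> (C :: real)" and x: "x \<in> {a..b}"
  shows "F x \<ge> C"
proof -
  have ae: "AE x in Leb a b. F x = max (F x) C" using ge by eventually_elim simp
  have c: "continuous_on {a..b} (\<lambda>x. max (F x) C)" by (intro continuous_on_max F continuous_on_const)
  have "F x = max (F x) C" by (rule continuous_AE_eq[OF ab F c ae x])
  then show ?thesis by simp
qed

definition essentially_bounded :: "real \<Rightarrow> real \<Rightarrow> real \<Rightarrow> (real \<times> real \<Rightarrow> real) \<Rightarrow> bool" where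
  "essentially_bounded T a b f \<longleftrightarrow> f \<in> borel_measurable (Leb2 T a b) \<and>
     (\<exists>K. AE p in Leb2 T a b. \<bar>f p\<bar> \<le> K)"

lemma essentially_bounded_mult:
  assumes "essentially_bounded T a b f" "essentially_bounded T a b g"
  shows "essentially_bounded T a b (\<lambda>p. f p * g p)"
proof -
  obtain K L where K: "AE p in Leb2 T a b. \<bar>f p\<bar> \<le> K" and L: "AE p in Leb2 T a b. \<bar>g p\<bar> \<le> L"
    using assms by (auto simp: essentially_bounded_def)
  have "AE p in Leb2 T a b. \<bar>f p * g p\<bar> \<le> \<bar>K\<bar> * \<bar>L\<bar>" using K L
    by eventually_elim (auto simp: abs_mult intro!: mult_mono)
  then show ?thesis using assms by (auto simp: essentially_bounded_def intro!: borel_measurable_times)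
qed

lemma essentially_bounded_add:
  assumes "essentially_bounded T a b f" "essentially_bounded T a b g"
  shows "essentially_bounded T a b (\<lambda>p. f p + g p)"
proof -
  obtain K L where K: "AE p in Leb2 T a b. \<bar>f p\<bar> \<le> K" and L: "AE p in Leb2 T a b. \<bar>g p\<bar> \<le> L"
    using assms by (auto simp: essentially_bounded_def)
  have "AE p in Leb2 T a b. \<bar>f p + g p\<bar> \<le> K + L" using K L
    by eventually_elim (meson abs_triangle_ineq add_mono order_trans)
  then show ?thesis using assms by (auto simp: essentially_bounded_def intro!: borel_measurable_add)
qed

lemma essentially_bounded_const: "essentially_bounded T a b (\<lambda>p. c)"
  by (auto simp: essentially_bounded_def)

lemma L2_essentially_bounded_mult:
  assumes "essentially_bounded T a b g" "f \<in> L2 (cyl T a b)" shows "(\<lambda>p. g p * f p) \<in> L2 (cyl T a b)"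
proof -
  obtain K where "AE p in Leb2 T a b. \<bar>g p\<bar> \<le> K" using assms(1) by (auto simp: essentially_bounded_def)
  then show ?thesis using assms by (intro L2_bounded_mult) (auto simp: essentially_bounded_def)
qed

lemma xrep_bounded:
  assumes T: "0 < T" and ab: "a < b" and x: "xrep T a b D g"
  shows "essentially_bounded T a b (D 0)"
proof -
  obtain K where "\<forall>D g. xrep T a b D g \<longrightarrow> (AE p in Leb2 T a b. (D 0 p)\<^sup>2 \<le> K * graph_norm2 T a b D g)"
    using X_bounded[OF T ab] by blast
  then have "AE p in Leb2 T a b. (D 0 p)\<^sup>2 \<le> K * graph_norm2 T a b D g" using x by blast
  then have "AE p in Leb2 T a b. \<bar>D 0 p\<bar> \<le> sqrt (K * graph_norm2 T a b D g)"
    by eventually_elim (rule real_le_rsqrt, simp)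
  moreover have "D 0 \<in> borel_measurable (Leb2 T a b)" using x by (intro L2_measurable) (simp add: xrep_def)
  ultimately show ?thesis by (auto simp: essentially_bounded_def)
qed

lemma xrepN_bounded:
  assumes T: "0 < T" and ab: "a < b" and x: "xrepN T a b D g"
  shows "essentially_bounded T a b (D 0)" "essentially_bounded T a b (D 1)"
proof -
  show "essentially_bounded T a b (D 0)" by (rule xrep_bounded[OF T ab xrepN_xrep[OF x]])
  show "essentially_bounded T a b (D 1)"
    unfolding essentially_bounded_def
    using xrepN_Dx_bounded[OF T ab x] L2_measurable[OF xrepN_L2(1)[OF x, of 1]] by auto
qed

lemma powr_bound:
  assumes "0 < c" "c \<le> y" "y \<le> (M::real)" shows "\<bar>y powr q\<bar> \<le> c powr q + M powr q"
proof (cases "q \<ge> 0")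
  case True
  then have "y powr q \<le> M powr q" using assms by (intro powr_mono2) auto
  then show ?thesis by (simp add: add_increasing)
next
  case False
  then have "y powr q \<le> c powr q" using assms by (intro powr_mono2') auto
  then show ?thesis by (simp add: add_increasing2)
qed

lemma essentially_bounded_powr:
  assumes f: "essentially_bounded T a b f" and c: "0 < c" "AE p in Leb2 T a b. f p \<ge> c"
  shows "essentially_bounded T a b (\<lambda>p. f p powr q)"
proof -
  obtain K where K: "AE p in Leb2 T a b. \<bar>f p\<bar> \<le> K" using f by (auto simp: essentially_bounded_def)
  have "AE p in Leb2 T a b. \<bar>f p powr q\<bar> \<le> c powr q + K powr q" using K c(2)
    by eventually_elim (rule powr_bound[OF c(1)], auto)
  then show ?thesis using f by (auto simp: essentially_bounded_def)
qed

text \<open>Each term is a product of bounded factors \<open>y\<close>, \<open>y\<^sub>x\<close>, \<open>\<phi>\<close>, \<open>\<phi>\<^sub>x\<close> and powers of \<open>y \<ge> C0\<close> with one factor in \<open>L\<^sup>2\<close>.\<close>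

lemma flux_L2:
  assumes T: "0 < T" and ab: "a < b" and Y: "xrepN T a b Y g" and F: "xrepN T a b \<Phi> h"
    and c: "0 < C0" "AE p in Leb2 T a b. Y 0 p \<ge> C0"
  shows "(\<lambda>p. flux_dx lam \<beta> \<epsilon> (\<lambda>k. Y k p) (\<lambda>k. \<Phi> k p)) \<in> L2 (cyl T a b)"
    and "(\<lambda>p. reaction_dx lam \<beta> (\<lambda>k. Y k p) (\<lambda>k. \<Phi> k p)) \<in> L2 (cyl T a b)"
proof -
  note bY = xrepN_bounded[OF T ab Y] and bF = xrepN_bounded[OF T ab F]
  note pw = essentially_bounded_powr[OF bY(1) c]
  note ebs = essentially_bounded_mult essentially_bounded_add essentially_bounded_const pw bY bF
  have "(\<lambda>p. (lam * Y 0 p powr \<beta> + \<epsilon>) * \<Phi> 4 p + (lam * \<beta> * Y 0 p powr (\<beta> - 1) * Y 1 p) * \<Phi> 3 p) \<in> L2 (cyl T a b)"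
    by (intro L2_add L2_essentially_bounded_mult ebs xrepN_L2(1)[OF F]) auto
  then show "(\<lambda>p. flux_dx lam \<beta> \<epsilon> (\<lambda>k. Y k p) (\<lambda>k. \<Phi> k p)) \<in> L2 (cyl T a b)" by (simp add: flux_dx_def mult.assoc)
  have "(\<lambda>p. (\<beta> * lam) * (((\<beta> - 1) * Y 0 p powr (\<beta> - 2) * Y 1 p * \<Phi> 0 p) * Y 3 p
      + (Y 0 p powr (\<beta> - 1) * \<Phi> 0 p) * Y 4 p + (Y 0 p powr (\<beta> - 1) * \<Phi> 1 p) * Y 3 p)) \<in> L2 (cyl T a b)"
    by (intro L2_cmult L2_add L2_essentially_bounded_mult ebs xrepN_L2(1)[OF Y]) auto
  then show "(\<lambda>p. reaction_dx lam \<beta> (\<lambda>k. Y k p) (\<lambda>k. \<Phi> k p)) \<in> L2 (cyl T a b)"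
    by (simp add: reaction_dx_def mult_ac)
qed

lemma weak_dx_cong:
  assumes "weak_dx T a b k f g" "AE p in Leb2 T a b. f p = f' p"
  shows "weak_dx T a b k f' g"
  unfolding weak_dx_def
proof
  show "g \<in> borel_measurable (Leb2 T a b)" using assms(1) by (simp add: weak_dx_def)
  show "AE t in Leb 0 T. weak_deriv a b k (\<lambda>x. f' (t, x)) (\<lambda>x. g (t, x))"
    using assms(1)[unfolded weak_dx_def, THEN conjunct2] AE_cyl_slices(1)[OF assms(2)]
    by eventually_elim (rule weak_deriv_cong_AE, auto)
qed

text \<open>Both operators have the form \<open>\<partial>\<^sub>x(\<dots>)\<close> with an argument that vanishes at the lateral boundary.\<close>

lemma flux_slices:
  assumes ab: "a < b" and Y: "xrepN T a b Y g" and F: "xrepN T a b \<Phi> h"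
    and c: "0 < C0" "AE p in Leb2 T a b. Y 0 p \<ge> C0"
  shows "AE t in Leb 0 T. \<exists>y \<phi>. slice_jet a b 4 Y t y \<and> slice_jet a b 4 \<Phi> t \<phi> \<and> neumann a b y \<and> neumann a b \<phi> \<and>
    ac a b (\<lambda>x. (lam * \<bar>y 0 x\<bar> powr \<beta> + \<epsilon>) * \<phi> 3 x) (\<lambda>x. flux_dx lam \<beta> \<epsilon> (\<lambda>k. Y k (t, x)) (\<lambda>k. \<Phi> k (t, x))) \<and>
    ac a b (\<lambda>x. \<beta> * lam * y 0 x powr (\<beta> - 1) * y 3 x * \<phi> 0 x) (\<lambda>x. reaction_dx lam \<beta> (\<lambda>k. Y k (t, x)) (\<lambda>k. \<Phi> k (t, x)))"
  using Y[unfolded xrepN_def, THEN conjunct2] F[unfolded xrepN_def, THEN conjunct2] AE_cyl_slices(1)[OF c(2)]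
proof eventually_elim
  case (elim t)
  obtain y where y: "slice_jet a b 4 Y t y" "neumann a b y" using elim(1) by blast
  obtain \<phi> where \<phi>: "slice_jet a b 4 \<Phi> t \<phi>" "neumann a b \<phi>" using elim(2) by blast
  have jy: "jet a b 4 y" and j\<phi>: "jet a b 4 \<phi>" using y(1) \<phi>(1) by (auto simp: slice_jet_def)
  have ey: "AE x in Leb a b. y k x = Y k (t, x)" if "k \<le> 4" for k using y(1) that by (simp add: slice_jet_def)
  have e\<phi>: "AE x in Leb a b. \<phi> k x = \<Phi> k (t, x)" if "k \<le> 4" for k using \<phi>(1) that by (simp add: slice_jet_def)
  have "AE x in Leb a b. y 0 x \<ge> C0" using ey[of 0, simplified] elim(3) by eventually_elim simp
  then have "y 0 x \<ge> C0" if "x \<in> {a..b}" for x by (rule continuous_AE_ge[OF ab ac_continuous[OF jet4_ac(1)[OF jy]] _ that])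
  then have pos: "y 0 x > 0" if "x \<in> {a..b}" for x using c(1) that by fastforce
  have fa: "ac a b (\<lambda>x. (lam * \<bar>y 0 x\<bar> powr \<beta> + \<epsilon>) * \<phi> 3 x) (\<lambda>x. flux_dx lam \<beta> \<epsilon> (\<lambda>k. y k x) (\<lambda>k. \<phi> k x))"
    by (rule ac_flux[OF jy j\<phi> pos])
  have ra: "ac a b (\<lambda>x. \<beta> * lam * y 0 x powr (\<beta> - 1) * y 3 x * \<phi> 0 x) (\<lambda>x. reaction_dx lam \<beta> (\<lambda>k. y k x) (\<lambda>k. \<phi> k x))"
    by (rule ac_reaction[OF jy j\<phi> pos])
  have "AE x in Leb a b. flux_dx lam \<beta> \<epsilon> (\<lambda>k. y k x) (\<lambda>k. \<phi> k x) = flux_dx lam \<beta> \<epsilon> (\<lambda>k. Y k (t, x)) (\<lambda>k. \<Phi> k (t, x))"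
    using ey[of 0, simplified] ey[of 1, simplified] e\<phi>[of 3, simplified] e\<phi>[of 4, simplified]
    by eventually_elim (simp add: flux_dx_def)
  then have 1: "ac a b (\<lambda>x. (lam * \<bar>y 0 x\<bar> powr \<beta> + \<epsilon>) * \<phi> 3 x) (\<lambda>x. flux_dx lam \<beta> \<epsilon> (\<lambda>k. Y k (t, x)) (\<lambda>k. \<Phi> k (t, x)))"
    by (rule ac_cong[OF fa refl])
  have "AE x in Leb a b. reaction_dx lam \<beta> (\<lambda>k. y k x) (\<lambda>k. \<phi> k x) = reaction_dx lam \<beta> (\<lambda>k. Y k (t, x)) (\<lambda>k. \<Phi> k (t, x))"
    using ey[of 0, simplified] ey[of 1, simplified] ey[of 3, simplified] ey[of 4, simplified] e\<phi>[of 0, simplified] e\<phi>[of 1, simplified]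
    by eventually_elim (simp add: reaction_dx_def)
  then have 2: "ac a b (\<lambda>x. \<beta> * lam * y 0 x powr (\<beta> - 1) * y 3 x * \<phi> 0 x) (\<lambda>x. reaction_dx lam \<beta> (\<lambda>k. Y k (t, x)) (\<lambda>k. \<Phi> k (t, x)))"
    by (rule ac_cong[OF ra refl])
  show ?case using y \<phi> 1 2 by blast
qed

lemma LINT_ac:
  assumes "a < b" "ac a b F f" "F a = F b" shows "(LINT x|Leb a b. f x) = 0"
  using LINT_interval[OF acD_integrable[OF assms(2)]] integral_unique[OF ac_integral[OF assms(2), of a b]] assms by simp

lemma flux_weak_dx:
  assumes T: "0 < T" and ab: "a < b" and Y: "xrepN T a b Y g" and F: "xrepN T a b \<Phi> h"
    and c: "0 < C0" "AE p in Leb2 T a b. Y 0 p \<ge> C0"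
  shows "weak_dx T a b 1 (\<lambda>p. (lam * \<bar>Y 0 p\<bar> powr \<beta> + \<epsilon>) * \<Phi> 3 p) (\<lambda>p. flux_dx lam \<beta> \<epsilon> (\<lambda>k. Y k p) (\<lambda>k. \<Phi> k p))"
    and "weak_dx T a b 1 (\<lambda>p. \<beta> * lam * Y 0 p powr (\<beta> - 1) * Y 3 p * \<Phi> 0 p) (\<lambda>p. reaction_dx lam \<beta> (\<lambda>k. Y k p) (\<lambda>k. \<Phi> k p))"
    and "AE t in Leb 0 T. (LINT x|Leb a b. flux_dx lam \<beta> \<epsilon> (\<lambda>k. Y k (t, x)) (\<lambda>k. \<Phi> k (t, x))) = 0"
    and "AE t in Leb 0 T. (LINT x|Leb a b. reaction_dx lam \<beta> (\<lambda>k. Y k (t, x)) (\<lambda>k. \<Phi> k (t, x))) = 0"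
proof -
  note fs = flux_slices[OF ab Y F c, of lam \<beta> \<epsilon>]
  show "weak_dx T a b 1 (\<lambda>p. (lam * \<bar>Y 0 p\<bar> powr \<beta> + \<epsilon>) * \<Phi> 3 p) (\<lambda>p. flux_dx lam \<beta> \<epsilon> (\<lambda>k. Y k p) (\<lambda>k. \<Phi> k p))"
    unfolding weak_dx_def
  proof
    show "(\<lambda>p. flux_dx lam \<beta> \<epsilon> (\<lambda>k. Y k p) (\<lambda>k. \<Phi> k p)) \<in> borel_measurable (Leb2 T a b)"
      by (rule L2_measurable[OF flux_L2(1)[OF T ab Y F c]])
    show "AE t in Leb 0 T. weak_deriv a b 1 (\<lambda>x. (lam * \<bar>Y 0 (t, x)\<bar> powr \<beta> + \<epsilon>) * \<Phi> 3 (t, x)) (\<lambda>x. flux_dx lam \<beta> \<epsilon> (\<lambda>k. Y k (t, x)) (\<lambda>k. \<Phi> k (t, x)))"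
      using fs
    proof eventually_elim
      case (elim t)
      then obtain y \<phi> where j: "slice_jet a b 4 Y t y" "slice_jet a b 4 \<Phi> t \<phi>"
        and ac: "ac a b (\<lambda>x. (lam * \<bar>y 0 x\<bar> powr \<beta> + \<epsilon>) * \<phi> 3 x) (\<lambda>x. flux_dx lam \<beta> \<epsilon> (\<lambda>k. Y k (t, x)) (\<lambda>k. \<Phi> k (t, x)))" by blast
      have "AE x in Leb a b. y 0 x = Y 0 (t, x)" "AE x in Leb a b. \<phi> 3 x = \<Phi> 3 (t, x)"
        using j by (auto simp: slice_jet_def)
      then have "AE x in Leb a b. (lam * \<bar>y 0 x\<bar> powr \<beta> + \<epsilon>) * \<phi> 3 x = (lam * \<bar>Y 0 (t, x)\<bar> powr \<beta> + \<epsilon>) * \<Phi> 3 (t, x)"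
        by eventually_elim simp
      then show ?case by (rule weak_deriv_cong_AE[OF ac_weak_deriv[OF ab ac]]) simp
    qed
  qed
  show "weak_dx T a b 1 (\<lambda>p. \<beta> * lam * Y 0 p powr (\<beta> - 1) * Y 3 p * \<Phi> 0 p) (\<lambda>p. reaction_dx lam \<beta> (\<lambda>k. Y k p) (\<lambda>k. \<Phi> k p))"
    unfolding weak_dx_def
  proof
    show "(\<lambda>p. reaction_dx lam \<beta> (\<lambda>k. Y k p) (\<lambda>k. \<Phi> k p)) \<in> borel_measurable (Leb2 T a b)"
      by (rule L2_measurable[OF flux_L2(2)[OF T ab Y F c]])
    show "AE t in Leb 0 T. weak_deriv a b 1 (\<lambda>x. \<beta> * lam * Y 0 (t, x) powr (\<beta> - 1) * Y 3 (t, x) * \<Phi> 0 (t, x)) (\<lambda>x. reaction_dx lam \<beta> (\<lambda>k. Y k (t, x)) (\<lambda>k. \<Phi> k (t, x)))"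
      using fs
    proof eventually_elim
      case (elim t)
      then obtain y \<phi> where j: "slice_jet a b 4 Y t y" "slice_jet a b 4 \<Phi> t \<phi>"
        and ac: "ac a b (\<lambda>x. \<beta> * lam * y 0 x powr (\<beta> - 1) * y 3 x * \<phi> 0 x) (\<lambda>x. reaction_dx lam \<beta> (\<lambda>k. Y k (t, x)) (\<lambda>k. \<Phi> k (t, x)))" by blast
      have "AE x in Leb a b. y 0 x = Y 0 (t, x)" "AE x in Leb a b. y 3 x = Y 3 (t, x)"
        "AE x in Leb a b. \<phi> 0 x = \<Phi> 0 (t, x)"
        using j by (auto simp: slice_jet_def)
      then have "AE x in Leb a b. \<beta> * lam * y 0 x powr (\<beta> - 1) * y 3 x * \<phi> 0 x = \<beta> * lam * Y 0 (t, x) powr (\<beta> - 1) * Y 3 (t, x) * \<Phi> 0 (t, x)"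
        by eventually_elim simp
      then show ?case by (rule weak_deriv_cong_AE[OF ac_weak_deriv[OF ab ac]]) simp
    qed
  qed
  show "AE t in Leb 0 T. (LINT x|Leb a b. flux_dx lam \<beta> \<epsilon> (\<lambda>k. Y k (t, x)) (\<lambda>k. \<Phi> k (t, x))) = 0"
    using fs by eventually_elim (auto simp: neumann_def intro: LINT_ac[OF ab])
  show "AE t in Leb 0 T. (LINT x|Leb a b. reaction_dx lam \<beta> (\<lambda>k. Y k (t, x)) (\<lambda>k. \<Phi> k (t, x))) = 0"
    using fs by eventually_elim (auto simp: neumann_def intro: LINT_ac[OF ab])
qed

section \<open>Every mass-conserving state is controllable\<close>

text \<open>The operator \<open>N(v) = v\<^sub>t + ([lam v^\<beta> + \<epsilon>] v\<^sub>x\<^sub>x\<^sub>x)\<^sub>x\<close> on representatives; the equation reads \<open>u\<^sub>x = N(y)\<close>.\<close>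

definition state_op :: "real \<Rightarrow> real \<Rightarrow> real \<Rightarrow> (nat \<Rightarrow> real \<times> real \<Rightarrow> real) \<Rightarrow> (real \<times> real \<Rightarrow> real) \<Rightarrow> real \<times> real \<Rightarrow> real" where
  "state_op lam \<beta> \<epsilon> V g p = g p + flux_dx lam \<beta> \<epsilon> (\<lambda>k. V k p) (\<lambda>k. V k p)"

lemma state_op_L2:
  assumes "0 < T" "a < b" "xrepN T a b V g" "0 < C0" "AE p in Leb2 T a b. V 0 p \<ge> C0"
  shows "state_op lam \<beta> \<epsilon> V g \<in> L2 (cyl T a b)"
  unfolding state_op_def[abs_def] by (intro L2_add xrepN_L2(2)[OF assms(3)] flux_L2(1)[OF assms(1-3,3-5)])

text \<open>The primitive is taken of a Borel representative, which makes it jointly measurable.\<close>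

lemma space_primitive:
  assumes ab: "a < b" and N: "N \<in> L2 (cyl T a b)"
  obtains u where "u \<in> L2 (cyl T a b)"
    "AE t in Leb 0 T. ac a b (\<lambda>x. u (t, x)) (\<lambda>x. N (t, x)) \<and> u (t, a) = 0 \<and> u (t, b) = (LINT x|Leb a b. N (t, x))"
proof -
  obtain N' where N': "zrep (cyl T a b) N'" "AE p in Leb2 T a b. N p = N' p"
    using zrep_exists[OF L2_measurable[OF N] cyl_borel] by blast
  have N'L: "N' \<in> L2 (cyl T a b)" by (rule L2_cong_AE[OF N N'(2)]) simp
  have N'm: "N' \<in> borel_measurable borel" using N'(1) by (simp add: zrep_def)
  have swap: "(\<lambda>p :: real \<times> real. (snd p, fst p)) \<in> measurable borel borel"
    by (intro borel_measurable_continuous_onI continuous_intros)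
  define u where "u p = (LINT s|lborel. indicator {a<..<snd p} s * N' (fst p, s))" for p
  have "(\<lambda>p :: real \<times> real. LINT s|lborel. indicator {a<..<fst p} s * N' (snd p, s)) \<in> borel_measurable borel"
    using primitive_borel[OF measurable_compose[OF swap N'm], of a] by simp
  from measurable_compose[OF swap this] have um: "u \<in> borel_measurable borel" by (simp add: u_def[abs_def])
  then have uml: "u \<in> borel_measurable (Leb2 T a b)"
    by (intro measurable_restrict_space1 measurable_completion) simp
  have ueq: "u (t, x) = integral {a..x} (\<lambda>s. N' (t, s))"
    if "integrable (Leb a b) (\<lambda>s. N' (t, s))" "x \<in> {a..b}" for t x
    using zrep_integral_interval[OF zrep_slice(1)[OF N'(1)] that(1), of a x] that(2) by (simp add: u_def)
  have N's: "AE t in Leb 0 T. (\<lambda>x. N' (t, x)) \<in> L2 {a<..<b}" by (rule L2_slices(1)[OF N'L])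
  have slices: "AE t in Leb 0 T. ac a b (\<lambda>x. u (t, x)) (\<lambda>x. N (t, x)) \<and> u (t, a) = 0 \<and> u (t, b) = (LINT x|Leb a b. N (t, x))"
    using N's AE_cyl_slices(1)[OF N'(2)]
  proof eventually_elim
    case (elim t)
    have i: "integrable (Leb a b) (\<lambda>s. N' (t, s))" by (rule L2_integrable[OF elim(1) interval_lmeasurable])
    have ai: "(\<lambda>s. N' (t, s)) absolutely_integrable_on {a..b}" by (rule L2_absolutely_integrable[OF elim(1)])
    have "ac a b (\<lambda>x. u (t, x)) (\<lambda>x. N' (t, x))"
      by (rule acI_primitive[OF ai, of _ 0]) (simp add: ueq[OF i])
    then have "ac a b (\<lambda>x. u (t, x)) (\<lambda>x. N (t, x))"
      by (rule ac_cong[OF _ refl]) (use elim(2) in \<open>auto elim!: eventually_mono\<close>)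
    moreover have "u (t, a) = 0" using ueq[OF i, of a] ab by simp
    moreover have "u (t, b) = (LINT x|Leb a b. N (t, x))"
    proof -
      have "u (t, b) = (LINT x|Leb a b. N' (t, x))" using ueq[OF i, of b] ab LINT_interval[OF ai] by simp
      also have "\<dots> = (LINT x|Leb a b. N (t, x))"
        by (rule integral_lebesgue_on_cong_AE) (use elim(2) in \<open>auto elim!: eventually_mono\<close>)
      finally show ?thesis .
    qed
    ultimately show ?case by blast
  qed
  define n where "n t = (LINT s|lborel. (N' (t, s))\<^sup>2)" for t
  have N'2: "integrable (Leb2 T a b) (\<lambda>p. (N' p)\<^sup>2)" by (rule L2_square_integrable[OF N'L])
  have zN'2: "zrep (cyl T a b) (\<lambda>p. (N' p)\<^sup>2)" using N'(1) by (auto simp: zrep_def)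
  have i2: "integrable (lborel \<Otimes>\<^sub>M lborel) (\<lambda>p. (N' p)\<^sup>2)"
    using N'2 zrep_lebesgue_on(2)[OF zN'2 cyl_borel] by (simp add: lborel_prod)
  have ni: "integrable lborel n" using lborel_pair.integrable_fst'[OF i2] by (simp add: n_def[abs_def])
  have n0: "n t \<ge> 0" for t unfolding n_def by (rule LINT_nonneg) simp
  have nz: "n t = 0" if "t \<notin> {0<..<T}" for t using zrep_slice_outside(1)[OF N'(1) that] by (simp add: n_def)
  \<comment> \<open>\<open>q\<close> bounds the primitive on the slice at time \<open>t\<close> and is square integrable\<close>
  define q where "q t = sqrt ((b - a) * n t)" for t
  have "n \<in> borel_measurable borel" using ni by simp
  then have "q \<in> borel_measurable borel" unfolding q_def[abs_def] by measurable
  then have qz: "zrep {0<..<T} q" using nz by (auto simp: zrep_def q_def)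
  have zq2: "zrep {0<..<T} (\<lambda>t. (q t)\<^sup>2)" using qz by (auto simp: zrep_def)
  have Tb: "{0<..<T} \<in> sets (borel :: real measure)" by simp
  have "integrable lborel (\<lambda>t. (q t)\<^sup>2)" using ni n0 ab by (simp add: q_def)
  then have "integrable (Leb 0 T) (\<lambda>t. (q t)\<^sup>2)" using zrep_lebesgue_on(2)[OF zq2 Tb] by simp
  then have qL: "q \<in> L2 {0<..<T}" using zrep_lebesgue_on(1)[OF qz Tb] by (simp add: L2_def)
  have wL: "(\<lambda>p. q (fst p)) \<in> L2 (cyl T a b)" by (rule L2_of_time[OF qz qL ab])
  have "AE t in Leb 0 T. AE x in Leb a b. \<bar>u (t, x)\<bar> \<le> q (fst (t, x))"
    using N's
  proof eventually_elim
    case (elim t)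
    have i: "integrable (Leb a b) (\<lambda>s. N' (t, s))" by (rule L2_integrable[OF elim interval_lmeasurable])
    have ai: "(\<lambda>s. N' (t, s)) absolutely_integrable_on {a..b}" by (rule L2_absolutely_integrable[OF elim])
    have nt: "n t = (LINT x|Leb a b. (N' (t, x))\<^sup>2)"
      unfolding n_def by (rule zrep_lebesgue_on(3)[symmetric, OF zrep_slice(1)[OF zN'2]]) simp
    show ?case
    proof (rule AE_I2)
      fix x assume "x \<in> space (Leb a b)"
      then have x: "x \<in> {a..b}" by auto
      have ax: "(\<lambda>s. N' (t, s)) absolutely_integrable_on {a..x}" using x by (intro absolutely_integrable_on_subinterval[OF ai]) auto
      have "\<bar>u (t, x)\<bar> \<le> integral {a..x} (\<lambda>s. \<bar>N' (t, s)\<bar>)" unfolding ueq[OF i x] by (rule integral_abs_bound_abs[OF ax])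
      also have "\<dots> \<le> integral {a..b} (\<lambda>s. \<bar>N' (t, s)\<bar>)"
        using x by (intro integral_subset_le abs_integrable_on set_integrable_abs ax ai) auto
      finally have "\<bar>u (t, x)\<bar>\<^sup>2 \<le> (integral {a..b} (\<lambda>s. \<bar>N' (t, s)\<bar>))\<^sup>2" by (intro power_mono) auto
      also have "\<dots> \<le> (b - a) * n t" unfolding nt by (rule integral_abs_square_le[OF ab elim])
      finally show "\<bar>u (t, x)\<bar> \<le> q (fst (t, x))" by (simp add: q_def real_le_rsqrt)
    qed
  qed
  then have "AE p in Leb2 T a b. \<bar>u p\<bar> \<le> q (fst p)"
    using uml L2_measurable[OF wL] by (intro AE_cyl_leI) auto
  then have "AE p in Leb2 T a b. \<bar>u p\<bar> \<le> \<bar>q (fst p)\<bar>" by eventually_elim linarith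
  then have "u \<in> L2 (cyl T a b)" by (rule L2_bound[OF wL uml])
  then show ?thesis using slices that by blast
qed

text \<open>The equation determines \<open>u\<^sub>x = N(y)\<close>. The primitive of \<open>N(y)\<close> vanishes at both ends exactly when \<open>N(y)\<close> has mean zero, which is
  conservation of mass because the flux vanishes at the boundary.\<close>

lemma admissible_of_state:
  assumes T: "0 < T" and ab: "a < b" and V: "xrepN T a b V g" and c: "0 < C0" "AE p in Leb2 T a b. V 0 p \<ge> C0"
    and iv: "initial_value T a b (V 0) y0" and mass: "AE t in Leb 0 T. (LINT x|Leb a b. g (t, x)) = 0"
  obtains u where "admissible T a b lam \<beta> \<epsilon> y0 C0 (V 0) u" "AE p in Leb2 T a b. Dx T a b 1 u p = state_op lam \<beta> \<epsilon> V g p"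
proof -
  let ?N = "state_op lam \<beta> \<epsilon> V g"
  have NL: "?N \<in> L2 (cyl T a b)" by (rule state_op_L2[OF T ab V c])
  obtain u where u: "u \<in> L2 (cyl T a b)"
    "AE t in Leb 0 T. ac a b (\<lambda>x. u (t, x)) (\<lambda>x. ?N (t, x)) \<and> u (t, a) = 0 \<and> u (t, b) = (LINT x|Leb a b. ?N (t, x))"
    using space_primitive[OF ab NL] by blast
  let ?A = "\<lambda>p. flux_dx lam \<beta> \<epsilon> (\<lambda>k. V k p) (\<lambda>k. V k p)"
  have AL: "?A \<in> L2 (cyl T a b)" by (rule flux_L2(1)[OF T ab V V c])
  have N0: "AE t in Leb 0 T. (LINT x|Leb a b. ?N (t, x)) = 0"
    using mass flux_weak_dx(3)[OF T ab V V c, of lam \<beta> \<epsilon>] L2_slices(1)[OF AL] L2_slices(1)[OF xrepN_L2(2)[OF V]]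
  proof eventually_elim
    case (elim t)
    show ?case unfolding state_op_def
      using elim L2_integrable[OF elim(3) interval_lmeasurable] L2_integrable[OF elim(4) interval_lmeasurable] by simp
  qed
  have w: "weak_dx T a b 1 u ?N"
    unfolding weak_dx_def
  proof
    show "?N \<in> borel_measurable (Leb2 T a b)" by (rule L2_measurable[OF NL])
    show "AE t in Leb 0 T. weak_deriv a b 1 (\<lambda>x. u (t, x)) (\<lambda>x. ?N (t, x))"
      using u(2) by eventually_elim (auto intro: ac_weak_deriv[OF ab, simplified])
  qed
  have Dxu: "AE p in Leb2 T a b. Dx T a b 1 u p = ?N p" by (rule Dx_AE[OF w])
  have w0: "weak_dx T a b 0 u u"
    unfolding weak_dx_def
  proof
    show "u \<in> borel_measurable (Leb2 T a b)" by (rule L2_measurable[OF u(1)])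
    show "AE t in Leb 0 T. weak_deriv a b 0 (\<lambda>x. u (t, x)) (\<lambda>x. u (t, x))"
      using L2_slices(1)[OF u(1)] by eventually_elim (intro weak_deriv_0 locally_integrableI L2_absolutely_integrable)
  qed
  have "u \<in> L2H T a b 1"
    unfolding L2H_def
  proof (intro CollectI conjI allI impI u(1))
    fix k :: nat assume "k \<le> 1"
    then consider "k = 0" | "k = 1" by linarith
    then show "\<exists>g\<in>L2 (cyl T a b). weak_dx T a b k u g" using w0 u(1) w NL by cases blast+
  qed
  moreover have "AE t in Leb 0 T. (\<lambda>x. u (t, x)) \<in> H10 a b"
    using u(2) N0 L2_slices(1)[OF NL] by eventually_elim (auto intro: H10I[OF ab])
  ultimately have uH: "u \<in> L2H10 T a b" by (simp add: L2H10_def)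
  note X = xrep_X[OF T ab xrepN_xrep[OF V]]
  have D3: "AE p in Leb2 T a b. V 3 p = Dx T a b 3 (V 0) p" using X(4)[of 3] by (auto elim!: eventually_mono)
  have "weak_dx T a b 1 (\<lambda>p. (lam * \<bar>V 0 p\<bar> powr \<beta> + \<epsilon>) * Dx T a b 3 (V 0) p) ?A"
    by (rule weak_dx_cong[OF flux_weak_dx(1)[OF T ab V V c]]) (use D3 in \<open>eventually_elim, simp\<close>)
  moreover have "AE p in Leb2 T a b. Dt T a b (V 0) p = - ?A p + Dx T a b 1 u p"
    using X(5) Dxu by eventually_elim (simp add: state_op_def)
  ultimately have "state_equation T a b lam \<beta> \<epsilon> (V 0) u" unfolding state_equation_def by blast
  then have "admissible T a b lam \<beta> \<epsilon> y0 C0 (V 0) u"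
    unfolding admissible_def
    using X(1) uH iv c(2) xrepN_dx_zero_bdry[OF T ab V] by blast
  then show ?thesis using Dxu that by blast
qed

text \<open>The converse: \<open>u\<close> in \<open>H\<^sup>1\<^sub>0\<close> makes \<open>u\<^sub>x = N(y)\<close>, hence also \<open>y\<^sub>t\<close>, of mean zero.\<close>

lemma admissible_state:
  assumes T: "0 < T" and ab: "a < b" and c0: "0 < C0" and adm: "admissible T a b lam \<beta> \<epsilon> y0 C0 y u"
  obtains Y g where "xrepN T a b Y g" "Y 0 = y" "AE p in Leb2 T a b. Dx T a b 1 u p = state_op lam \<beta> \<epsilon> Y g p"
    "AE t in Leb 0 T. (LINT x|Leb a b. state_op lam \<beta> \<epsilon> Y g (t, x)) = 0"
    "AE t in Leb 0 T. (LINT x|Leb a b. g (t, x)) = 0"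
proof -
  have yX: "y \<in> X T a b" and uH: "u \<in> L2H10 T a b" and se: "state_equation T a b lam \<beta> \<epsilon> y u"
    and bc: "dx_zero_bdry T a b 1 y" "dx_zero_bdry T a b 3 y" and ge: "AE p in Leb2 T a b. y p \<ge> C0"
    using adm by (simp_all add: admissible_def)
  obtain Y g where Y: "xrepN T a b Y g" and Y0: "Y 0 = y" using X_imp_xrepN[OF T ab yX bc] by blast
  note X = xrep_X[OF T ab xrepN_xrep[OF Y]]
  have c: "AE p in Leb2 T a b. Y 0 p \<ge> C0" using ge Y0 by simp
  let ?A = "\<lambda>p. flux_dx lam \<beta> \<epsilon> (\<lambda>k. Y k p) (\<lambda>k. Y k p)"
  have AL: "?A \<in> L2 (cyl T a b)" by (rule flux_L2(1)[OF T ab Y Y c0 c])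
  have D3: "AE p in Leb2 T a b. Y 3 p = Dx T a b 3 y p" using X(4)[of 3] Y0 by (auto elim!: eventually_mono)
  obtain G where G: "weak_dx T a b 1 (\<lambda>p. (lam * \<bar>y p\<bar> powr \<beta> + \<epsilon>) * Dx T a b 3 y p) G"
    "AE p in Leb2 T a b. Dt T a b y p = - G p + Dx T a b 1 u p" using se by (auto simp: state_equation_def)
  have "weak_dx T a b 1 (\<lambda>p. (lam * \<bar>y p\<bar> powr \<beta> + \<epsilon>) * Dx T a b 3 y p) ?A"
    by (rule weak_dx_cong[OF flux_weak_dx(1)[OF T ab Y Y c0 c]]) (use D3 in \<open>eventually_elim, simp add: Y0\<close>)
  from weak_dx_unique[OF G(1) this] have GA: "AE p in Leb2 T a b. G p = ?A p" .
  have Dxu: "AE p in Leb2 T a b. Dx T a b 1 u p = state_op lam \<beta> \<epsilon> Y g p"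
    using G(2) GA X(5) by eventually_elim (simp add: state_op_def Y0)
  obtain v where v: "v \<in> L2 (cyl T a b)" "weak_dx T a b 1 u v" using uH by (auto simp: L2H10_def L2H_def)
  have vN: "AE p in Leb2 T a b. v p = state_op lam \<beta> \<epsilon> Y g p"
    using Dx_AE[OF v(2)] Dxu by eventually_elim simp
  have uh: "AE t in Leb 0 T. (\<lambda>x. u (t, x)) \<in> H10 a b" using uH by (simp add: L2H10_def)
  have N0: "AE t in Leb 0 T. (LINT x|Leb a b. state_op lam \<beta> \<epsilon> Y g (t, x)) = 0"
    using uh v(2)[unfolded weak_dx_def, THEN conjunct2] L2_slices(1)[OF v(1)] AE_cyl_slices(1)[OF vN]
  proof eventually_elim
    case (elim t)
    have "integral {a..b} (\<lambda>x. v (t, x)) = 0" by (rule H10_integral_zero[OF ab elim(1,2,3)])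
    then have "(LINT x|Leb a b. v (t, x)) = 0" using LINT_interval[OF L2_absolutely_integrable[OF elim(3)]] by simp
    moreover have "(LINT x|Leb a b. v (t, x)) = (LINT x|Leb a b. state_op lam \<beta> \<epsilon> Y g (t, x))"
      by (rule integral_lebesgue_on_cong_AE[OF elim(4)]) simp
    ultimately show ?case by simp
  qed
  have "AE t in Leb 0 T. (LINT x|Leb a b. g (t, x)) = 0"
    using N0 flux_weak_dx(3)[OF T ab Y Y c0 c, of lam \<beta> \<epsilon>] L2_slices(1)[OF AL] L2_slices(1)[OF xrepN_L2(2)[OF Y]]
  proof eventually_elim
    case (elim t)
    have "(LINT x|Leb a b. state_op lam \<beta> \<epsilon> Y g (t, x)) = (LINT x|Leb a b. g (t, x)) + (LINT x|Leb a b. ?A (t, x))"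
      unfolding state_op_def
      using L2_integrable[OF elim(3) interval_lmeasurable] L2_integrable[OF elim(4) interval_lmeasurable] by simp
    then show ?case using elim(1,2) by simp
  qed
  then show ?thesis using Y Y0 Dxu N0 that by blast
qed

section \<open>First variation of the reduced cost\<close>

text \<open>The linearisation \<open>L \<phi> = \<phi>\<^sub>t + (\<beta> lam y^(\<beta>-1) y\<^sub>x\<^sub>x\<^sub>x \<phi>)\<^sub>x + ([lam y^\<beta> + \<epsilon>] \<phi>\<^sub>x\<^sub>x\<^sub>x)\<^sub>x\<close> of \<open>N\<close> at \<open>y\<close>.\<close>

definition lin_op :: "real \<Rightarrow> real \<Rightarrow> real \<Rightarrow> (nat \<Rightarrow> real) \<Rightarrow> (nat \<Rightarrow> real) \<Rightarrow> real \<Rightarrow> real" where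
  "lin_op lam \<beta> \<epsilon> Y \<Phi> h = h + flux_dx lam \<beta> \<epsilon> Y \<Phi> + reaction_dx lam \<beta> Y \<Phi>"

lemma flux_deriv:
  assumes "Y 0 + s * \<Phi> 0 > 0"
  shows "((\<lambda>s. (g + s * h) + flux_dx lam \<beta> \<epsilon> (\<lambda>k. Y k + s * \<Phi> k) (\<lambda>k. Y k + s * \<Phi> k)) has_real_derivative
    lin_op lam \<beta> \<epsilon> (\<lambda>k. Y k + s * \<Phi> k) \<Phi> h) (at s)"
proof -
  have p: "((\<lambda>s. (Y 0 + s * \<Phi> 0) powr q) has_real_derivative q * (Y 0 + s * \<Phi> 0) powr (q - 1) * \<Phi> 0) (at s)" for q
    by (rule DERIV_chain2[where f="\<lambda>z. z powr q" and g="\<lambda>s. Y 0 + s * \<Phi> 0", OF has_real_derivative_powr[OF assms]])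
       (auto intro!: derivative_eq_intros)
  have l: "((\<lambda>s. Y k + s * \<Phi> k) has_real_derivative \<Phi> k) (at s)" for k
    by (auto intro!: derivative_eq_intros)
  have gh: "((\<lambda>s. g + s * h) has_real_derivative h) (at s)" by (auto intro!: derivative_eq_intros)
  note 1 = DERIV_mult[OF DERIV_add[OF DERIV_cmult[OF p[of \<beta>], of lam] DERIV_const[of \<epsilon>]] l[of 4]]
  note 2 = DERIV_mult[OF DERIV_mult[OF DERIV_cmult[OF p[of "\<beta> - 1"], of "lam * \<beta>"] l[of 1]] l[of 3]]
  show ?thesis
    unfolding flux_dx_def
    by (rule DERIV_cong[OF DERIV_add[OF gh DERIV_add[OF 1 2]]])
       (simp add: lin_op_def flux_dx_def reaction_dx_def algebra_simps)
qed

text \<open>The coefficients along the segment are bounded and the third and fourth derivatives enter linearly; this gives the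
  square integrable majorant for the difference quotients of \<open>N\<close>.\<close>

lemma lin_op_bound:
  assumes v: "\<And>q. q \<in> {\<beta>, \<beta> - 1, \<beta> - 2} \<Longrightarrow> \<bar>V 0 powr q\<bar> \<le> P" and M: "\<bar>V 1\<bar> \<le> M" "\<bar>\<Phi> 0\<bar> \<le> M" "\<bar>\<Phi> 1\<bar> \<le> M"
    and pos: "lam \<ge> 0" "\<beta> \<ge> 1" "\<epsilon> \<ge> 0"
  shows "\<bar>lin_op lam \<beta> \<epsilon> V \<Phi> h\<bar> \<le> \<bar>h\<bar> + (lam * P + \<epsilon> + lam * \<beta> * P * M + \<beta> * lam * ((\<beta> - 1) * P * M * M + P * M + P * M))
     * (\<bar>V 3\<bar> + \<bar>V 4\<bar> + \<bar>\<Phi> 3\<bar> + \<bar>\<Phi> 4\<bar>)"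
proof -
  have "\<bar>V 0 powr \<beta>\<bar> \<le> P" by (rule v) simp
  then have P: "P \<ge> 0" by (rule order_trans[OF abs_ge_zero])
  have M0: "M \<ge> 0" using M(1) by (rule order_trans[OF abs_ge_zero])
  define S where "S = \<bar>V 3\<bar> + \<bar>V 4\<bar> + \<bar>\<Phi> 3\<bar> + \<bar>\<Phi> 4\<bar>"
  have S: "\<bar>V 3\<bar> \<le> S" "\<bar>V 4\<bar> \<le> S" "\<bar>\<Phi> 3\<bar> \<le> S" "\<bar>\<Phi> 4\<bar> \<le> S" "S \<ge> 0" by (auto simp: S_def)
  have p: "\<bar>V 0 powr \<beta>\<bar> \<le> P" "\<bar>V 0 powr (\<beta> - 1)\<bar> \<le> P" "\<bar>V 0 powr (\<beta> - 2)\<bar> \<le> P" by (intro v; simp)+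
  have c: "\<bar>lam * \<beta>\<bar> \<le> lam * \<beta>" "\<bar>\<beta> - 1\<bar> \<le> \<beta> - 1" "0 \<le> lam * \<beta>" "0 \<le> \<beta> - 1" using pos by (auto simp: abs_mult)
  have d: "\<bar>lam * V 0 powr \<beta> + \<epsilon>\<bar> \<le> lam * P + \<epsilon>"
  proof -
    have "\<bar>lam * V 0 powr \<beta>\<bar> \<le> lam * P" unfolding abs_mult abs_of_nonneg[OF pos(1)] by (rule mult_left_mono[OF p(1) pos(1)])
    then show ?thesis using pos(3) by linarith
  qed
  have d0: "0 \<le> lam * P + \<epsilon>" by (rule order_trans[OF abs_ge_zero d])
  note m = mult_mono mult_nonneg_nonneg p c M S(1-4) abs_ge_zero P M0 S(5)
  have b1: "\<bar>(lam * V 0 powr \<beta> + \<epsilon>) * \<Phi> 4\<bar> \<le> (lam * P + \<epsilon>) * S"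
    unfolding abs_mult by (intro mult_mono d d0 S abs_ge_zero)
  have b2: "\<bar>lam * \<beta> * V 0 powr (\<beta> - 1) * V 1 * \<Phi> 3\<bar> \<le> lam * \<beta> * P * M * S"
    unfolding abs_mult[of _ "\<Phi> 3"] abs_mult[of _ "V 1"] abs_mult[of "lam * \<beta>"] by (intro m)
  have b3: "\<bar>(\<beta> - 1) * V 0 powr (\<beta> - 2) * V 1 * V 3 * \<Phi> 0\<bar> \<le> (\<beta> - 1) * P * M * S * M"
    unfolding abs_mult by (intro m)
  have b4: "\<bar>V 0 powr (\<beta> - 1) * V 4 * \<Phi> 0\<bar> \<le> P * S * M" "\<bar>V 0 powr (\<beta> - 1) * V 3 * \<Phi> 1\<bar> \<le> P * S * M"
    unfolding abs_mult by (intro m)+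
  have "\<bar>(\<beta> - 1) * V 0 powr (\<beta> - 2) * V 1 * V 3 * \<Phi> 0 + V 0 powr (\<beta> - 1) * V 4 * \<Phi> 0 + V 0 powr (\<beta> - 1) * V 3 * \<Phi> 1\<bar>
      \<le> (\<beta> - 1) * P * M * S * M + P * S * M + P * S * M"
    using b3 b4 by linarith
  then have b5: "\<bar>reaction_dx lam \<beta> V \<Phi>\<bar> \<le> \<beta> * lam * ((\<beta> - 1) * P * M * S * M + P * S * M + P * S * M)"
    unfolding reaction_dx_def abs_mult[of "\<beta> * lam"] abs_of_nonneg[OF c(3)[unfolded mult.commute[of lam]]]
    by (rule mult_left_mono[OF _ c(3)[unfolded mult.commute[of lam]]])
  have "\<bar>lin_op lam \<beta> \<epsilon> V \<Phi> h\<bar> \<le> \<bar>h\<bar> + (\<bar>(lam * V 0 powr \<beta> + \<epsilon>) * \<Phi> 4\<bar> + \<bar>lam * \<beta> * V 0 powr (\<beta> - 1) * V 1 * \<Phi> 3\<bar>) + \<bar>reaction_dx lam \<beta> V \<Phi>\<bar>"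
    unfolding lin_op_def flux_dx_def by linarith
  also have "\<dots> \<le> \<bar>h\<bar> + ((lam * P + \<epsilon>) * S + lam * \<beta> * P * M * S) + \<beta> * lam * ((\<beta> - 1) * P * M * S * M + P * S * M + P * S * M)"
    using b1 b2 b5 by linarith
  also have "\<dots> = \<bar>h\<bar> + (lam * P + \<epsilon> + lam * \<beta> * P * M + \<beta> * lam * ((\<beta> - 1) * P * M * M + P * M + P * M)) * S"
    by (simp add: algebra_simps)
  finally show ?thesis by (simp add: S_def)
qed


text \<open>The difference quotients of \<open>s \<mapsto> N(y + s\<phi>)\<close> are dominated by a square integrable function, so the cost along the
  segment can be differentiated under the integral.\<close>

lemma first_variation:
  fixes yd :: "real \<times> real \<Rightarrow> real"
  assumes T: "0 < T" and ab: "a < b" and Y: "xrepN T a b Y g" and F: "xrepN T a b \<Phi> h"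
    and c: "0 < C0" "AE p in Leb2 T a b. Y 0 p \<ge> C0" "AE p in Leb2 T a b. Y 0 p + \<Phi> 0 p \<ge> C0"
    and pos: "lam \<ge> 0" "\<beta> \<ge> 1" "\<epsilon> \<ge> 0" and yd: "yd \<in> L2 (cyl T a b)"
    and J: "\<And>s. J s = 1 / 2 * (LINT p|Leb2 T a b. (Y 0 p + s * \<Phi> 0 p - yd p)\<^sup>2)
      + \<alpha> / 2 * (LINT p|Leb2 T a b. (state_op lam \<beta> \<epsilon> (\<lambda>k p. Y k p + s * \<Phi> k p) (\<lambda>p. g p + s * h p) p)\<^sup>2)"
    and min: "\<And>s. 0 < s \<Longrightarrow> s \<le> 1 \<Longrightarrow> J 0 \<le> J s"
  shows "0 \<le> (LINT p|Leb2 T a b. (Y 0 p - yd p) * \<Phi> 0 p)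
    + \<alpha> * (LINT p|Leb2 T a b. state_op lam \<beta> \<epsilon> Y g p * lin_op lam \<beta> \<epsilon> (\<lambda>k. Y k p) (\<lambda>k. \<Phi> k p) (h p))"
proof -
  let ?M = "Leb2 T a b"
  define n where "n s p = state_op lam \<beta> \<epsilon> (\<lambda>k p. Y k p + s * \<Phi> k p) (\<lambda>p. g p + s * h p) p" for s p
  define dn where "dn p = lin_op lam \<beta> \<epsilon> (\<lambda>k. Y k p) (\<lambda>k. \<Phi> k p) (h p)" for p
  have n0: "n 0 = state_op lam \<beta> \<epsilon> Y g" by (simp add: n_def[abs_def])
  have geS: "Y 0 p + s * \<Phi> 0 p \<ge> C0" if "Y 0 p \<ge> C0" "Y 0 p + \<Phi> 0 p \<ge> C0" "0 \<le> s" "s \<le> 1" for s p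
  proof -
    have "(1 - s) * C0 + s * C0 \<le> (1 - s) * Y 0 p + s * (Y 0 p + \<Phi> 0 p)"
      using that by (intro add_mono mult_left_mono) auto
    then show ?thesis by (simp add: algebra_simps)
  qed
  have nL: "n s \<in> L2 (cyl T a b)" if s: "0 \<le> s" "s \<le> 1" for s
  proof -
    have "AE p in ?M. Y 0 p + s * \<Phi> 0 p \<ge> C0" using c(2,3) by eventually_elim (rule geS[OF _ _ s])
    then show ?thesis unfolding n_def[abs_def]
      by (intro state_op_L2[OF T ab xrepN_add[OF Y xrepN_cmult[OF F]] c(1)])
  qed
  obtain M1 where M1: "AE p in ?M. \<bar>Y 0 p\<bar> \<le> M1" using xrepN_bounded(1)[OF T ab Y] by (auto simp: essentially_bounded_def)
  obtain M2 where M2: "AE p in ?M. \<bar>Y 1 p\<bar> \<le> M2" using xrepN_bounded(2)[OF T ab Y] by (auto simp: essentially_bounded_def)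
  obtain M3 where M3: "AE p in ?M. \<bar>\<Phi> 0 p\<bar> \<le> M3" using xrepN_bounded(1)[OF T ab F] by (auto simp: essentially_bounded_def)
  obtain M4 where M4: "AE p in ?M. \<bar>\<Phi> 1 p\<bar> \<le> M4" using xrepN_bounded(2)[OF T ab F] by (auto simp: essentially_bounded_def)
  define M where "M = \<bar>M1\<bar> + \<bar>M2\<bar> + \<bar>M3\<bar> + \<bar>M4\<bar>"
  define P where "P = (C0 powr \<beta> + M powr \<beta>) + (C0 powr (\<beta> - 1) + M powr (\<beta> - 1)) + (C0 powr (\<beta> - 2) + M powr (\<beta> - 2))"
  define K where "K = lam * P + \<epsilon> + lam * \<beta> * P * M + \<beta> * lam * ((\<beta> - 1) * P * M * M + P * M + P * M)"
  have M0: "M \<ge> 0" by (simp add: M_def)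
  have P0: "P \<ge> 0" by (simp add: P_def)
  have K0: "K \<ge> 0" unfolding K_def using pos M0 P0 by (intro add_nonneg_nonneg mult_nonneg_nonneg) auto
  \<comment> \<open>a majorant of the derivative of \<open>s \<mapsto> N(y + s \<phi>)\<close> on \<open>[0,1]\<close>\<close>
  define w where "w p = \<bar>h p\<bar> + K * ((\<bar>Y 3 p\<bar> + \<bar>\<Phi> 3 p\<bar>) + (\<bar>Y 4 p\<bar> + \<bar>\<Phi> 4 p\<bar>) + \<bar>\<Phi> 3 p\<bar> + \<bar>\<Phi> 4 p\<bar>)" for p
  have absL: "(\<lambda>p. \<bar>f p\<bar>) \<in> L2 (cyl T a b)" if "f \<in> L2 (cyl T a b)" for f
    by (rule L2_bound[OF that]) (use L2_measurable[OF that] in auto)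
  have wL: "w \<in> L2 (cyl T a b)" unfolding w_def[abs_def]
    by (intro L2_add L2_cmult absL xrepN_L2(1)[OF Y] xrepN_L2(1)[OF F] xrepN_L2(2)[OF F]) auto
  have good: "AE p in ?M. (\<forall>s. 0 < s \<longrightarrow> s \<le> 1 \<longrightarrow> \<bar>n s p - n 0 p\<bar> \<le> s * w p) \<and> ((\<lambda>s. n s p) has_real_derivative dn p) (at 0)"
    using c(2,3) M1 M2 M3 M4
  proof eventually_elim
    case (elim p)
    have d: "((\<lambda>s. n s p) has_real_derivative lin_op lam \<beta> \<epsilon> (\<lambda>k. Y k p + s * \<Phi> k p) (\<lambda>k. \<Phi> k p) (h p)) (at s)" if s: "0 \<le> s" "s \<le> 1" for s
      unfolding n_def state_op_def
      by (rule flux_deriv[where Y="\<lambda>k. Y k p" and \<Phi>="\<lambda>k. \<Phi> k p"]) (use geS[OF elim(1,2) s] c(1) in linarith)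
    have bd: "\<bar>lin_op lam \<beta> \<epsilon> (\<lambda>k. Y k p + s * \<Phi> k p) (\<lambda>k. \<Phi> k p) (h p)\<bar> \<le> w p" if s: "0 \<le> s" "s \<le> 1" for s
    proof -
      have tri: "\<bar>u + s * v\<bar> \<le> \<bar>u\<bar> + \<bar>v\<bar>" for u v :: real
      proof -
        have "\<bar>s * v\<bar> \<le> 1 * \<bar>v\<bar>" unfolding abs_mult using s by (intro mult_right_mono) auto
        then show ?thesis using abs_triangle_ineq[of u "s * v"] by linarith
      qed
      have "\<bar>Y 0 p + s * \<Phi> 0 p\<bar> \<le> M" using tri[of "Y 0 p" "\<Phi> 0 p"] elim unfolding M_def by linarith
      then have yM: "Y 0 p + s * \<Phi> 0 p \<le> M" by linarith
      have pw: "\<bar>(Y 0 p + s * \<Phi> 0 p) powr q\<bar> \<le> P" if "q \<in> {\<beta>, \<beta> - 1, \<beta> - 2}" for q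
      proof -
        have "\<bar>(Y 0 p + s * \<Phi> 0 p) powr q\<bar> \<le> C0 powr q + M powr q" by (rule powr_bound[OF c(1) geS[OF elim(1,2) s] yM])
        also have "\<dots> \<le> P" unfolding P_def using that by auto
        finally show ?thesis .
      qed
      have "\<bar>Y 1 p + s * \<Phi> 1 p\<bar> \<le> M" "\<bar>\<Phi> 0 p\<bar> \<le> M" "\<bar>\<Phi> 1 p\<bar> \<le> M"
        using tri[of "Y 1 p" "\<Phi> 1 p"] elim unfolding M_def by linarith+
      from lin_op_bound[where V="\<lambda>k. Y k p + s * \<Phi> k p" and \<Phi>="\<lambda>k. \<Phi> k p", OF pw this pos, of "h p"]
      have "\<bar>lin_op lam \<beta> \<epsilon> (\<lambda>k. Y k p + s * \<Phi> k p) (\<lambda>k. \<Phi> k p) (h p)\<bar> \<le> \<bar>h p\<bar> + K * (\<bar>Y 3 p + s * \<Phi> 3 p\<bar> + \<bar>Y 4 p + s * \<Phi> 4 p\<bar> + \<bar>\<Phi> 3 p\<bar> + \<bar>\<Phi> 4 p\<bar>)"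
        by (simp add: K_def)
      also have "\<dots> \<le> w p" unfolding w_def using K0 by (intro add_mono mult_left_mono tri order_refl)
      finally show ?thesis .
    qed
    have "\<bar>n s p - n 0 p\<bar> \<le> s * w p" if s: "0 < s" "s \<le> 1" for s
    proof -
      have "\<exists>z>0. z < s \<and> n s p - n 0 p = (s - 0) * lin_op lam \<beta> \<epsilon> (\<lambda>k. Y k p + z * \<Phi> k p) (\<lambda>k. \<Phi> k p) (h p)"
        by (rule MVT2[OF s(1)]) (use d s(2) in auto)
      then obtain z where z: "0 < z" "z < s" "n s p - n 0 p = s * lin_op lam \<beta> \<epsilon> (\<lambda>k. Y k p + z * \<Phi> k p) (\<lambda>k. \<Phi> k p) (h p)"
        by auto
      have "\<bar>lin_op lam \<beta> \<epsilon> (\<lambda>k. Y k p + z * \<Phi> k p) (\<lambda>k. \<Phi> k p) (h p)\<bar> \<le> w p" using bd[of z] z s(2) by auto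
      then show ?thesis unfolding z(3) abs_mult using s by (simp add: mult_left_mono)
    qed
    moreover have "((\<lambda>s. n s p) has_real_derivative dn p) (at 0)" using d[of 0] by (simp add: dn_def)
    ultimately show ?case by blast
  qed
  define \<sigma> where "\<sigma> k = 1 / real (Suc k)" for k
  have \<sigma>: "0 < \<sigma> k" "\<sigma> k \<le> 1" for k by (auto simp: \<sigma>_def)
  have \<sigma>0: "\<sigma> \<longlonglongrightarrow> 0" unfolding \<sigma>_def[abs_def] using LIMSEQ_inverse_real_of_nat by (simp add: inverse_eq_divide)
  have int_n2: "integrable ?M (\<lambda>p. (n s p)\<^sup>2)" if "0 \<le> s" "s \<le> 1" for s by (rule L2_square_integrable[OF nL[OF that]])
  have dnL: "dn \<in> L2 (cyl T a b)"
    unfolding dn_def[abs_def] lin_op_def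
    by (intro L2_add xrepN_L2(2)[OF F] flux_L2(1)[OF T ab Y F c(1,2)] flux_L2(2)[OF T ab Y F c(1,2)])
  have lim: "(\<lambda>k. LINT p|?M. ((n (\<sigma> k) p)\<^sup>2 - (n 0 p)\<^sup>2) / \<sigma> k) \<longlonglongrightarrow> (LINT p|?M. dn p * (2 * n 0 p))"
  proof (rule integral_dominated_convergence[where w="\<lambda>p. w p * (2 * \<bar>n 0 p\<bar> + w p)"])
    show "(\<lambda>p. ((n (\<sigma> k) p)\<^sup>2 - (n 0 p)\<^sup>2) / \<sigma> k) \<in> borel_measurable ?M" for k
      using borel_measurable_integrable[OF int_n2[of "\<sigma> k"]] borel_measurable_integrable[OF int_n2[of 0]] \<sigma>[of k]
      by (intro borel_measurable_divide borel_measurable_diff) auto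
    show "integrable ?M (\<lambda>p. w p * (2 * \<bar>n 0 p\<bar> + w p))"
      by (intro L2_mult_integrable wL L2_add L2_cmult absL nL) auto
    show "AE p in ?M. (\<lambda>k. ((n (\<sigma> k) p)\<^sup>2 - (n 0 p)\<^sup>2) / \<sigma> k) \<longlonglongrightarrow> dn p * (2 * n 0 p)"
      using good
    proof eventually_elim
      case (elim p)
      have "((\<lambda>s. (n s p)\<^sup>2) has_real_derivative 2 * n 0 p * dn p) (at 0)"
        using DERIV_power[OF conjunct2[OF elim], of 2] by (simp add: mult_ac)
      then have "((\<lambda>s. ((n s p)\<^sup>2 - (n 0 p)\<^sup>2) / (s - 0)) \<longlongrightarrow> 2 * n 0 p * dn p) (at 0)"
        by (simp add: has_field_derivative_iff)
      then have "((\<lambda>k. ((n (\<sigma> k) p)\<^sup>2 - (n 0 p)\<^sup>2) / (\<sigma> k - 0)) \<longlongrightarrow> 2 * n 0 p * dn p) sequentially"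
      proof (rule filterlim_compose)
        show "filterlim \<sigma> (at 0) sequentially"
        proof (rule filterlim_atI[OF \<sigma>0])
          have "\<sigma> k \<noteq> 0" for k using \<sigma>(1)[of k] by linarith
          then show "\<forall>\<^sub>F k in sequentially. \<sigma> k \<noteq> 0" by simp
        qed
      qed
      then show ?case by (simp add: mult_ac)
    qed
    show "AE p in ?M. norm (((n (\<sigma> k) p)\<^sup>2 - (n 0 p)\<^sup>2) / \<sigma> k) \<le> w p * (2 * \<bar>n 0 p\<bar> + w p)" for k
      using good
    proof eventually_elim
      case (elim p)
      have 1: "\<bar>n (\<sigma> k) p - n 0 p\<bar> \<le> \<sigma> k * w p" using elim \<sigma>[of k] by blast
      have w0: "w p \<ge> 0" unfolding w_def using K0 by (intro add_nonneg_nonneg mult_nonneg_nonneg) auto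
      have "\<sigma> k * w p \<le> 1 * w p" using \<sigma>[of k] w0 by (intro mult_right_mono) auto
      then have 2: "\<bar>n (\<sigma> k) p + n 0 p\<bar> \<le> 2 * \<bar>n 0 p\<bar> + w p" using 1 by linarith
      have "\<bar>(n (\<sigma> k) p)\<^sup>2 - (n 0 p)\<^sup>2\<bar> = \<bar>n (\<sigma> k) p - n 0 p\<bar> * \<bar>n (\<sigma> k) p + n 0 p\<bar>"
        by (simp add: abs_mult[symmetric] power2_eq_square algebra_simps)
      also have "\<dots> \<le> (\<sigma> k * w p) * (2 * \<bar>n 0 p\<bar> + w p)" using 1 2 w0 \<sigma>[of k] by (intro mult_mono) auto
      finally have "\<bar>(n (\<sigma> k) p)\<^sup>2 - (n 0 p)\<^sup>2\<bar> / \<sigma> k \<le> w p * (2 * \<bar>n 0 p\<bar> + w p)"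
        using \<sigma>(1)[of k] by (simp add: pos_divide_le_eq mult_ac)
      then show ?case using \<sigma>(1)[of k] by (simp add: abs_divide)
    qed
    show "(\<lambda>p. dn p * (2 * n 0 p)) \<in> borel_measurable ?M"
      by (intro borel_measurable_times borel_measurable_const L2_measurable[OF dnL] L2_measurable[OF nL]) auto
  qed
  define A where "A = (LINT p|?M. (Y 0 p - yd p) * \<Phi> 0 p)"
  define B where "B = (LINT p|?M. (\<Phi> 0 p)\<^sup>2)"
  have YL: "Y 0 \<in> L2 (cyl T a b)" and FL: "\<Phi> 0 \<in> L2 (cyl T a b)" using xrepN_L2(1)[OF Y, of 0] xrepN_L2(1)[OF F, of 0] by auto
  have q: "(LINT p|?M. (Y 0 p + s * \<Phi> 0 p - yd p)\<^sup>2) = (LINT p|?M. (Y 0 p - yd p)\<^sup>2) + s * (2 * A + s * B)" for s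
  proof -
    note i = L2_square_integrable[OF L2_diff[OF YL yd]] L2_mult_integrable[OF L2_diff[OF YL yd] FL] L2_square_integrable[OF FL]
    have "(LINT p|?M. (Y 0 p + s * \<Phi> 0 p - yd p)\<^sup>2) = (LINT p|?M. (Y 0 p - yd p)\<^sup>2 + ((2 * s) * ((Y 0 p - yd p) * \<Phi> 0 p) + s\<^sup>2 * (\<Phi> 0 p)\<^sup>2))"
      by (intro LINT_cong) (auto simp: power2_eq_square algebra_simps)
    also have "\<dots> = (LINT p|?M. (Y 0 p - yd p)\<^sup>2) + ((2 * s) * A + s\<^sup>2 * B)"
      unfolding A_def B_def
      using i by (subst LINT_add, force, force intro!: LINT_integrable_add integrable_mult_right)
        (subst LINT_add, auto intro!: integrable_mult_right)
    finally show ?thesis by (simp add: power2_eq_square algebra_simps)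
  qed
  define I where "I k = (LINT p|?M. ((n (\<sigma> k) p)\<^sup>2 - (n 0 p)\<^sup>2) / \<sigma> k)" for k
  have Ieq: "\<sigma> k * I k = (LINT p|?M. (n (\<sigma> k) p)\<^sup>2) - (LINT p|?M. (n 0 p)\<^sup>2)" for k
    using int_n2[of "\<sigma> k"] int_n2[of 0] \<sigma>[of k] by (simp add: I_def)
  have nonneg: "0 \<le> 1 / 2 * (2 * A + \<sigma> k * B) + \<alpha> / 2 * I k" for k
  proof -
    have "0 \<le> J (\<sigma> k) - J 0" using min[OF \<sigma>[of k]] by simp
    also have "\<dots> = 1 / 2 * (\<sigma> k * (2 * A + \<sigma> k * B)) + \<alpha> / 2 * (\<sigma> k * I k)"
      unfolding J n_def[symmetric] q Ieq by (simp add: algebra_simps)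
    also have "\<dots> = \<sigma> k * (1 / 2 * (2 * A + \<sigma> k * B) + \<alpha> / 2 * I k)" by (simp add: algebra_simps)
    finally show ?thesis using \<sigma>(1)[of k] by (simp add: zero_le_mult_iff)
  qed
  have "(\<lambda>k. 1 / 2 * (2 * A + \<sigma> k * B) + \<alpha> / 2 * I k) \<longlonglongrightarrow> 1 / 2 * (2 * A + 0 * B) + \<alpha> / 2 * (LINT p|?M. dn p * (2 * n 0 p))"
    using lim unfolding I_def[symmetric] by (intro tendsto_intros \<sigma>0)
  then have "0 \<le> 1 / 2 * (2 * A + 0 * B) + \<alpha> / 2 * (LINT p|?M. dn p * (2 * n 0 p))"
    by (rule LIMSEQ_le_const) (use nonneg in blast)
  also have "(LINT p|?M. dn p * (2 * n 0 p)) = 2 * (LINT p|?M. n 0 p * dn p)"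
    by (subst integral_mult_right_zero[symmetric]) (simp add: mult_ac)
  finally show ?thesis by (simp add: A_def n0 dn_def)
qed

section \<open>Positive functionals of functions of time\<close>

text \<open>The Radon-Nikodym theorem for the measure \<open>A \<mapsto> \<Lambda>(1_A)\<close>. The bound by \<open>K\<close> times the \<open>L\<^sup>1\<close> norm gives countable
  additivity, absolute continuity, the bound of the density, and the passage from simple to integrable functions.\<close>

lemma positive_functional_density:
  fixes \<Lambda> :: "('a \<Rightarrow> real) \<Rightarrow> real"
  assumes M: "finite_measure M"
    and add: "\<And>p q. integrable M p \<Longrightarrow> integrable M q \<Longrightarrow> \<Lambda> (\<lambda>t. p t + q t) = \<Lambda> p + \<Lambda> q"
    and scale: "\<And>k q. integrable M q \<Longrightarrow> \<Lambda> (\<lambda>t. k * q t) = k * \<Lambda> q"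
    and pos: "\<And>q. integrable M q \<Longrightarrow> (\<And>t. 0 \<le> q t) \<Longrightarrow> 0 \<le> \<Lambda> q"
    and bound: "\<And>q. integrable M q \<Longrightarrow> \<bar>\<Lambda> q\<bar> \<le> K * (LINT t|M. \<bar>q t\<bar>)"
  obtains c where "c \<in> borel_measurable M" "AE t in M. 0 \<le> c t \<and> c t \<le> K"
    "\<And>q. integrable M q \<Longrightarrow> \<Lambda> q = (LINT t|M. c t * q t)"
proof -
  interpret finite_measure M by (rule M)
  have ind: "integrable M (indicator A :: 'a \<Rightarrow> real)" if "A \<in> sets M" for A
    using that by (intro integrable_real_indicator) (simp_all add: less_top[symmetric])
  define l where "l A = \<Lambda> (indicator A)" for A
  have l0: "0 \<le> l A" if "A \<in> sets M" for A unfolding l_def by (rule pos[OF ind[OF that]]) simp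
  have lK: "\<bar>l A\<bar> \<le> K * measure M A" if "A \<in> sets M" for A
    using bound[OF ind[OF that]] that by (simp add: l_def)
  have lU: "l (A \<union> B) = l A + l B" if "A \<in> sets M" "B \<in> sets M" "A \<inter> B = {}" for A B
  proof -
    have "(indicator (A \<union> B) :: 'a \<Rightarrow> real) = (\<lambda>t. indicator A t + indicator B t)"
      using that(3) by (intro ext) (auto simp: indicator_def)
    then show ?thesis unfolding l_def using add[OF ind[OF that(1)] ind[OF that(2)]] by simp
  qed
  have l_empty: "l {} = 0" using lK[of "{}"] by simp
  have ca: "countably_additive (sets M) (\<lambda>A. ennreal (l A))"
    unfolding countably_additive_def
  proof (intro allI impI)
    fix A :: "nat \<Rightarrow> 'a set"
    assume A: "range A \<subseteq> sets M" "disjoint_family A" "(\<Union>i. A i) \<in> sets M"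
    let ?U = "\<Union>i. A i"
    have As: "A i \<in> sets M" for i using A(1) by auto
    have Us: "(\<Union>i<n. A i) \<in> sets M" for n using As by auto
    have fin: "l (\<Union>i<n. A i) = (\<Sum>i<n. l (A i))" for n
    proof (induction n)
      case (Suc n)
      have "A n \<inter> A i = {}" if "i < n" for i using A(2) that unfolding disjoint_family_on_def by simp
      then have "A n \<inter> (\<Union>i<n. A i) = {}" by blast
      then show ?case using lU[OF As[of n] Us[of n]] Suc by (simp add: lessThan_Suc)
    qed (simp add: l_empty)
    have mfin: "measure M (\<Union>i<n. A i) = (\<Sum>i<n. measure M (A i))" for n
      using A(2) As by (intro finite_measure_finite_Union) (auto simp: disjoint_family_on_def)
    have "(\<lambda>n. K * (measure M ?U - (\<Sum>i<n. measure M (A i)))) \<longlonglongrightarrow> K * (measure M ?U - measure M ?U)"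
      using finite_measure_UNION[OF A(1,2)] unfolding sums_def by (intro tendsto_intros)
    then have z: "(\<lambda>n. K * (measure M ?U - (\<Sum>i<n. measure M (A i)))) \<longlonglongrightarrow> 0" by simp
    have "(\<lambda>n. (\<Sum>i<n. l (A i)) - l ?U) \<longlonglongrightarrow> 0"
    proof (rule Lim_null_comparison[OF always_eventually z], intro allI)
      fix n
      have "?U = (\<Union>i<n. A i) \<union> (?U - (\<Union>i<n. A i))" by auto
      then have "l ?U = l (\<Union>i<n. A i) + l (?U - (\<Union>i<n. A i))"
        using lU[OF Us[of n] sets.Diff[OF A(3) Us[of n]]] by (metis Diff_disjoint)
      moreover have "measure M (?U - (\<Union>i<n. A i)) = measure M ?U - (\<Sum>i<n. measure M (A i))"
        unfolding mfin[symmetric] using A(3) Us by (intro finite_measure_Diff) auto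
      ultimately show "norm ((\<Sum>i<n. l (A i)) - l ?U) \<le> K * (measure M ?U - (\<Sum>i<n. measure M (A i)))"
        using lK[OF sets.Diff[OF A(3) Us[of n]]] by (simp add: fin)
    qed
    then have "(\<lambda>i. l (A i)) sums l ?U" unfolding sums_def by (rule LIM_zero_cancel)
    then show "(\<Sum>i. ennreal (l (A i))) = ennreal (l ?U)" using l0[OF As] by (intro suminf_ennreal_eq)
  qed
  define N where "N = measure_of (space M) (sets M) (\<lambda>A. ennreal (l A))"
  have sN: "sets N = sets M" by (simp add: N_def)
  have eN: "emeasure N A = ennreal (l A)" if "A \<in> sets M" for A
    unfolding N_def by (rule emeasure_measure_of_sigma[OF sets.sigma_algebra_axioms _ ca that]) (simp add: positive_def l_empty)
  have "absolutely_continuous M N"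
    unfolding absolutely_continuous_def
  proof
    fix A assume A: "A \<in> null_sets M"
    then have "l A = 0" using lK[of A] by (auto simp: null_sets_def measure_def)
    then show "A \<in> null_sets N" using A eN[of A] by (auto simp: null_sets_def sN)
  qed
  moreover have "finite_measure N" by (rule finite_measureI) (simp add: eN sets_eq_imp_space_eq[OF sN])
  ultimately obtain D where D: "D \<in> borel_measurable M" "AE x in M. RN_deriv M N x = ennreal (D x)" "\<And>x. 0 \<le> D x"
    using real_RN_deriv[of N] sN by blast
  have dN: "density M (\<lambda>x. ennreal (D x)) = N"
    using density_RN_deriv[OF \<open>absolutely_continuous M N\<close> sN] D(1,2)
      density_cong[of "RN_deriv M N" M "\<lambda>x. ennreal (D x)"] by simp
  have nD: "(\<integral>\<^sup>+x. ennreal (indicator A x * D x) \<partial>M) = ennreal (l A)" if "A \<in> sets M" for A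
  proof -
    have "ennreal (l A) = emeasure (density M (\<lambda>x. ennreal (D x))) A" by (simp add: dN eN[OF that])
    also have "\<dots> = (\<integral>\<^sup>+x. ennreal (D x) * indicator A x \<partial>M)" using D(1) that by (intro emeasure_density) auto
    also have "\<dots> = (\<integral>\<^sup>+x. ennreal (indicator A x * D x) \<partial>M)" by (intro nn_integral_cong) (auto simp: indicator_def)
    finally show ?thesis by simp
  qed
  have iA: "integrable M (\<lambda>x. indicator A x * D x)" if "A \<in> sets M" for A
    using D(1,3) nD[OF that] that by (intro integrableI_nonneg) auto
  have LA: "(LINT x|M. indicator A x * D x) = l A" if "A \<in> sets M" for A
    using D(1,3) nD[OF that] l0[OF that] that by (subst integral_eq_nn_integral) auto
  have iD: "integrable M D" using iA[OF sets.top] Bochner_Integration.integrable_cong[OF refl, of M "\<lambda>x. indicator (space M) x * D x" D] by auto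
  have b: "AE t in M. D t \<in> {0..K}"
  proof (rule averaging_theorem[OF iD])
    fix A assume A: "A \<in> sets M" "0 < measure M A"
    have "set_lebesgue_integral M A D = l A" using LA[OF A(1)] by (simp add: set_lebesgue_integral_def)
    moreover have "0 \<le> l A" "l A \<le> K * measure M A" using l0[OF A(1)] lK[OF A(1)] by auto
    ultimately show "(1 / measure M A) *\<^sub>R set_lebesgue_integral M A D \<in> {0..K}" using A(2) by (simp add: field_simps)
  qed simp
  have bd: "AE t in M. \<bar>D t\<bar> \<le> K" using b by eventually_elim auto
  have iDq: "integrable M (\<lambda>t. D t * q t)" if "integrable M q" for q
  proof (rule LINT_integrable_bound[where f="\<lambda>t. K * q t"])
    show "AE t in M. norm (D t * q t) \<le> norm (K * q t)"
      using bd by eventually_elim (auto simp: abs_mult intro!: mult_right_mono)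
  qed (use that D(1) in auto)
  have "\<Lambda> q = (LINT t|M. D t * q t)" if "integrable M q" for q
    using that
  proof (induction rule: integrable_induct)
    case (base A c)
    have "\<Lambda> (\<lambda>t. c * indicator A t) = c * l A" using scale[OF ind[OF base(1)]] by (simp add: l_def)
    then show ?case using LA[OF base(1)] by (simp add: mult_ac)
  next
    case (add f g)
    have "(LINT t|M. D t * (f t + g t)) = (LINT t|M. D t * f t) + (LINT t|M. D t * g t)"
      using iDq[OF add(1)] iDq[OF add(2)] by (simp add: distrib_left)
    then show ?case using add assms(2)[OF add(1,2)] by simp
  next
    case (lim f s)
    have "(\<lambda>i. LINT t|M. \<bar>s i t - f t\<bar>) \<longlonglongrightarrow> (LINT t|M. 0)"
    proof (rule integral_dominated_convergence[where w="\<lambda>t. 3 * \<bar>f t\<bar>"])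
      show "AE t in M. (\<lambda>i. \<bar>s i t - f t\<bar>) \<longlonglongrightarrow> 0"
      proof (rule AE_I2)
        fix t assume "t \<in> space M"
        then show "(\<lambda>i. \<bar>s i t - f t\<bar>) \<longlonglongrightarrow> 0" using lim(2) by (intro tendsto_rabs_zero LIM_zero)
      qed
      show "AE t in M. norm \<bar>s i t - f t\<bar> \<le> 3 * \<bar>f t\<bar>" for i
      proof (rule AE_I2)
        fix t assume "t \<in> space M"
        then show "norm \<bar>s i t - f t\<bar> \<le> 3 * \<bar>f t\<bar>" using lim(3)[of t i] by simp
      qed
    qed (use lim in \<open>auto intro: borel_measurable_integrable\<close>)
    then have z: "(\<lambda>i. K * (LINT t|M. \<bar>s i t - f t\<bar>)) \<longlonglongrightarrow> 0" using tendsto_mult_right_zero by fastforce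
    have "(\<lambda>i. \<Lambda> (s i) - \<Lambda> f) \<longlonglongrightarrow> 0"
    proof (rule Lim_null_comparison[OF always_eventually z], intro allI)
      fix i
      have d: "integrable M (\<lambda>t. s i t + (- 1) * f t)" using lim(1)[of i] lim(4) by simp
      have "\<Lambda> (\<lambda>t. s i t + (- 1) * f t) = \<Lambda> (s i) + \<Lambda> (\<lambda>t. (- 1) * f t)" by (rule add[OF lim(1)]) (use lim(4) in simp)
      also have "\<Lambda> (\<lambda>t. (- 1) * f t) = (- 1) * \<Lambda> f" by (rule scale[OF lim(4)])
      finally show "norm (\<Lambda> (s i) - \<Lambda> f) \<le> K * (LINT t|M. \<bar>s i t - f t\<bar>)" using bound[OF d] by simp
    qed
    then have 1: "(\<lambda>i. \<Lambda> (s i)) \<longlonglongrightarrow> \<Lambda> f" by (rule LIM_zero_cancel)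
    have 2: "(\<lambda>i. LINT t|M. D t * s i t) \<longlonglongrightarrow> (LINT t|M. D t * f t)"
    proof (rule integral_dominated_convergence[where w="\<lambda>t. K * (2 * \<bar>f t\<bar>)"])
      show "AE t in M. (\<lambda>i. D t * s i t) \<longlonglongrightarrow> D t * f t"
        by (rule AE_I2) (intro tendsto_mult_left lim(2))
      show "AE t in M. norm (D t * s i t) \<le> K * (2 * \<bar>f t\<bar>)" for i
        using bd AE_space
      proof eventually_elim
        case (elim t)
        then show ?case using lim(3)[of t i] by (auto simp: abs_mult intro!: mult_mono)
      qed
    qed (use lim D(1) in \<open>auto intro: borel_measurable_integrable\<close>)
    show ?case by (rule LIMSEQ_unique[OF 1]) (use 2 lim(5) in simp)
  qed
  moreover have "AE t in M. 0 \<le> D t \<and> D t \<le> K" using b by eventually_elim auto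
  ultimately show ?thesis using D(1) that by blast
qed

section \<open>Initial values\<close>

lemma initial_value_add:
  assumes "initial_value T a b f f0" "initial_value T a b g g0"
  shows "initial_value T a b (\<lambda>p. f p + g p) (\<lambda>x. f0 x + g0 x)"
proof -
  obtain F G where F: "continuous_on ({0..T} \<times> {a..b}) F" "AE p in Leb2 T a b. F p = f p" "AE x in Leb a b. F (0, x) = f0 x"
    and G: "continuous_on ({0..T} \<times> {a..b}) G" "AE p in Leb2 T a b. G p = g p" "AE x in Leb a b. G (0, x) = g0 x"
    using assms unfolding initial_value_def by blast
  have "AE p in Leb2 T a b. F p + G p = f p + g p" using F(2) G(2) by eventually_elim simp
  moreover have "AE x in Leb a b. F (0, x) + G (0, x) = f0 x + g0 x" using F(3) G(3) by eventually_elim simp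
  ultimately show ?thesis unfolding initial_value_def using continuous_on_add[OF F(1) G(1)] by blast
qed

lemma initial_value_time_mult:
  assumes "initial_value T a b f f0" and \<theta>: "continuous_on UNIV \<theta>"
  shows "initial_value T a b (\<lambda>p. \<theta> (fst p) * f p) (\<lambda>x. \<theta> 0 * f0 x)"
proof -
  obtain F where F: "continuous_on ({0..T} \<times> {a..b}) F" "AE p in Leb2 T a b. F p = f p" "AE x in Leb a b. F (0, x) = f0 x"
    using assms unfolding initial_value_def by blast
  have "continuous_on ({0..T} \<times> {a..b}) (\<lambda>p. \<theta> (fst p) * F p)"
    by (intro continuous_on_mult F(1) continuous_on_compose2[OF \<theta>] continuous_intros) auto
  moreover have "AE p in Leb2 T a b. \<theta> (fst p) * F p = \<theta> (fst p) * f p" using F(2) by eventually_elim simp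
  moreover have "AE x in Leb a b. \<theta> (fst (0, x)) * F (0, x) = \<theta> 0 * f0 x" using F(3) by eventually_elim simp
  ultimately show ?thesis unfolding initial_value_def by blast
qed

lemma initial_value_of_time:
  assumes "continuous_on {0..T} m" shows "initial_value T a b (\<lambda>p. m (fst p)) (\<lambda>_. m 0)"
proof -
  have "continuous_on ({0..T} \<times> {a..b}) (\<lambda>p. m (fst p))"
    by (rule continuous_on_compose2[OF assms]) (auto intro!: continuous_intros)
  then show ?thesis unfolding initial_value_def by (intro exI[of _ "\<lambda>p. m (fst p)"]) simp
qed

text \<open>Almost every slice in time is continuous up to \<open>t = 0\<close>.\<close>

lemma initial_value_ge:
  assumes T: "0 < T" and iv: "initial_value T a b f f0" and ge: "AE p in Leb2 T a b. f p \<ge> C"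
  shows "AE x in Leb a b. f0 x \<ge> C"
proof -
  obtain F where F: "continuous_on ({0..T} \<times> {a..b}) F" "AE p in Leb2 T a b. F p = f p" "AE x in Leb a b. F (0, x) = f0 x"
    using iv unfolding initial_value_def by blast
  have "AE p in Leb2 T a b. F p \<ge> C" using F(2) ge by eventually_elim simp
  from AE_cyl_slices(2)[OF this] have "AE x in Leb a b. AE t in Leb 0 T. F (t, x) \<ge> C" .
  moreover have "AE x in Leb a b. x \<in> {a<..<b}" by (rule AE_I2) simp
  ultimately show ?thesis using F(3)
  proof eventually_elim
    case (elim x)
    have "continuous_on {0..T} (\<lambda>t. F (t, x))"
      by (rule continuous_on_compose2[OF F(1)]) (use elim(2) in \<open>auto intro!: continuous_intros\<close>)
    from continuous_AE_ge[OF T this elim(1), of 0] have "F (0, x) \<ge> C" using T by simp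
    then show ?case using elim(3) by simp
  qed
qed

text \<open>On almost every slice in time the continuous representative and the primitive of \<open>g\<close> coincide up to \<open>t = 0\<close>, which
  identifies the constant of integration.\<close>

lemma xrep_slices_integral:
  assumes T: "0 < T" and x: "xrep T a b D g" and iv: "initial_value T a b (D 0) f0"
  shows "AE t in Leb 0 T. AE x in Leb a b. D 0 (t, x) = f0 x + integral {0..t} (\<lambda>s. g (s, x))"
proof -
  have D: "D 0 \<in> L2 (cyl T a b)" and g: "g \<in> L2 (cyl T a b)" and ta: "time_ac T a b (D 0) g" using x by (auto simp: xrep_def)
  obtain c where c: "AE t in Leb 0 T. AE x in Leb a b. D 0 (t, x) = c x + integral {0..t} (\<lambda>s. g (s, x))"
    "AE x in Leb a b. AE t in Leb 0 T. D 0 (t, x) = c x + integral {0..t} (\<lambda>s. g (s, x))"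
    using time_ac_good_times[OF T D g ta] by blast
  obtain F where F: "continuous_on ({0..T} \<times> {a..b}) F" "AE p in Leb2 T a b. F p = D 0 p" "AE x in Leb a b. F (0, x) = f0 x"
    using iv unfolding initial_value_def by blast
  have "AE x in Leb a b. x \<in> {a<..<b}" by (rule AE_I2) simp
  then have "AE x in Leb a b. c x = f0 x"
    using c(2) AE_cyl_slices(2)[OF F(2)] F(3) L2_slices(2)[OF g]
  proof eventually_elim
    case (elim x)
    have cF: "continuous_on {0..T} (\<lambda>t. F (t, x))"
      by (rule continuous_on_compose2[OF F(1)]) (use elim(1) in \<open>auto intro!: continuous_intros\<close>)
    have "(\<lambda>s. g (s, x)) integrable_on {0..T}"
      using L2_absolutely_integrable[OF elim(5)] by (rule abs_integrable_on)
    then have cI: "continuous_on {0..T} (\<lambda>t. c x + integral {0..t} (\<lambda>s. g (s, x)))"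
      by (intro continuous_intros indefinite_integral_continuous_1)
    have "AE t in Leb 0 T. F (t, x) = c x + integral {0..t} (\<lambda>s. g (s, x))"
      using elim(2,3) by eventually_elim simp
    from continuous_AE_eq[OF T cF cI this, of 0] have "F (0, x) = c x" using T by simp
    then show ?case using elim(4) by simp
  qed
  then show ?thesis
    using c(1)
  proof -
    have e: "AE x in Leb a b. c x = f0 x" by fact
    show ?thesis using c(1)
    proof eventually_elim
      case (elim t)
      show ?case using elim e by eventually_elim simp
    qed
  qed
qed

lemma xrep_mean_conserved:
  assumes T: "0 < T" and ab: "a < b" and x: "xrep T a b D g" and iv: "initial_value T a b (D 0) f0"
    and mass: "AE t in Leb 0 T. (LINT x|Leb a b. g (t, x)) = 0"
    and f0: "integrable (Leb a b) f0"
  shows "AE t in Leb 0 T. (LINT x|Leb a b. D 0 (t, x)) = (LINT x|Leb a b. f0 x)"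
proof -
  have g: "g \<in> L2 (cyl T a b)" using x by (auto simp: xrep_def)
  have gx: "AE x in Leb a b. (\<lambda>t. g (t, x)) \<in> L2 {0<..<T}" by (rule L2_slices(2)[OF g])
  have "AE t in Leb 0 T. t \<in> {0<..<T}" by (rule AE_I2) simp
  then show ?thesis
    using xrep_slices_integral[OF T x iv]
  proof eventually_elim
    case (elim t)
    define h where "h p = indicator {0<..<t} (fst p) * g p" for p :: "real \<times> real"
    have "(\<lambda>p. indicator {0<..<t} (fst p) :: real) \<in> borel_measurable (Leb2 T a b)"
    proof -
      have "(\<lambda>p :: real \<times> real. indicator {0<..<t} (fst p) :: real) \<in> borel_measurable borel"
        unfolding borel_prod[symmetric] by measurable
      then show ?thesis by (intro measurable_restrict_space1 measurable_completion) simp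
    qed
    then have "h \<in> L2 (cyl T a b)" unfolding h_def[abs_def]
      by (rule L2_bounded_mult[OF g, of _ 1]) (simp add: indicator_def)
    then have hi: "integrable (Leb2 T a b) h" by (rule L2_integrable[OF _ cyl_lmeasurable])
    have hx: "AE x in Leb a b. (LINT s|Leb 0 T. h (s, x)) = integral {0..t} (\<lambda>s. g (s, x))"
      using gx
    proof eventually_elim
      case (elim x)
      have "(\<lambda>s. g (s, x)) absolutely_integrable_on {0..t}"
        using \<open>t \<in> {0<..<T}\<close> by (intro absolutely_integrable_on_subinterval[OF L2_absolutely_integrable[OF elim]]) auto
      from LINT_indicator_interval[OF this, of 0 T] show ?case using \<open>t \<in> {0<..<T}\<close> by (simp add: h_def)
    qed
    have ht: "AE s in Leb 0 T. (LINT x|Leb a b. h (s, x)) = 0"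
      using mass by eventually_elim (simp add: h_def)
    have "(LINT x|Leb a b. LINT s|Leb 0 T. h (s, x)) = (LINT s|Leb 0 T. LINT x|Leb a b. h (s, x))"
      by (simp add: cyl_Fubini(3,6)[OF hi])
    also have "\<dots> = (LINT s|Leb 0 T. 0)" by (rule integral_lebesgue_on_cong_AE[OF ht]) simp
    finally have h0: "(LINT x|Leb a b. LINT s|Leb 0 T. h (s, x)) = 0" by simp
    have "AE x in Leb a b. D 0 (t, x) = f0 x + (LINT s|Leb 0 T. h (s, x))"
      using elim(2) hx by eventually_elim simp
    then have "(LINT x|Leb a b. D 0 (t, x)) = (LINT x|Leb a b. f0 x + (LINT s|Leb 0 T. h (s, x)))"
      by (rule integral_lebesgue_on_cong_AE) simp
    also have "\<dots> = (LINT x|Leb a b. f0 x)"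
      using h0 f0 cyl_Fubini(5)[OF hi] by simp
    finally show ?case .
  qed
qed

lemma initial_value_integrable:
  assumes T: "0 < T" and ab: "a < b" and iv: "initial_value T a b f f0"
  shows "integrable (Leb a b) f0"
proof -
  obtain F where F: "continuous_on ({0..T} \<times> {a..b}) F" "AE x in Leb a b. F (0, x) = f0 x"
    using iv unfolding initial_value_def by blast
  have c: "continuous_on {a..b} (\<lambda>x. F (0, x))"
    by (rule continuous_on_compose2[OF F(1)]) (use T in \<open>auto intro!: continuous_intros\<close>)
  have "(\<lambda>x. F (0, x)) absolutely_integrable_on {a..b}" by (rule absolutely_integrable_continuous_real[OF c])
  then have "integrable (Leb a b) (\<lambda>x. F (0, x))" using integrable_lebesgue_on_interval by blast
  moreover from this have "f0 \<in> borel_measurable (Leb a b)"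
    using borel_measurable_lebesgue_on_AE[OF _ F(2)] by (auto intro: borel_measurable_integrable)
  ultimately show ?thesis using F(2) by (subst integrable_cong_AE[symmetric, where f="\<lambda>x. F (0, x)"]) auto
qed

text \<open>Near \<open>t = 0\<close> the state itself is at least \<open>3/2 C0\<close>, by uniform continuity; at later times the mean takes over.\<close>

lemma slater_gap:
  assumes T: "0 < T" and ab: "a < b" and C0: "C0 > 0" and iv: "initial_value T a b y y0"
    and y0: "AE x in Leb a b. y0 x \<ge> 2 * C0"
    and y: "AE p in Leb2 T a b. y p \<ge> C0" and m: "m \<ge> 2 * C0"
  obtains d where "d > 0" "AE p in Leb2 T a b. (1 - fst p / T) * (y p - C0) + fst p / T * (m - C0) \<ge> d"
proof -
  obtain F where F: "continuous_on ({0..T} \<times> {a..b}) F" "AE p in Leb2 T a b. F p = y p" "AE x in Leb a b. F (0, x) = y0 x"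
    using iv unfolding initial_value_def by blast
  have c: "continuous_on {a..b} (\<lambda>x. F (0, x))"
    by (rule continuous_on_compose2[OF F(1)]) (use T in \<open>auto intro!: continuous_intros\<close>)
  have "AE x in Leb a b. F (0, x) \<ge> 2 * C0" using F(3) y0 by eventually_elim simp
  then have F0: "F (0, x) \<ge> 2 * C0" if "x \<in> {a..b}" for x by (rule continuous_AE_ge[OF ab c _ that])
  have "uniformly_continuous_on ({0..T} \<times> {a..b}) F"
    by (rule compact_uniformly_continuous[OF F(1)]) (intro compact_Times compact_Icc)
  then obtain r where r: "r > 0" "\<And>p q. p \<in> {0..T} \<times> {a..b} \<Longrightarrow> q \<in> {0..T} \<times> {a..b} \<Longrightarrow> dist q p < r \<Longrightarrow> dist (F q) (F p) < C0 / 2"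
    unfolding uniformly_continuous_on_def using C0 half_gt_zero[OF C0] by meson
  have near: "F (t, x) \<ge> 3 / 2 * C0" if "t \<in> {0..T}" "t < r" "x \<in> {a..b}" for t x
  proof -
    have "dist (t, x) (0, x) < r" using that by (simp add: dist_Pair_Pair)
    then have "dist (F (t, x)) (F (0, x)) < C0 / 2" using that T by (intro r(2)) auto
    then show ?thesis using F0[OF that(3)] by (simp add: dist_real_def abs_if split: if_splits)
  qed
  \<comment> \<open>the first bound serves \<open>t < r\<close>, the second \<open>t \<ge> r\<close>\<close>
  define d where "d = min (C0 / 2) (r / T * C0)"
  have "d > 0" using C0 r(1) T by (simp add: d_def)
  moreover have "AE p in Leb2 T a b. (1 - fst p / T) * (y p - C0) + fst p / T * (m - C0) \<ge> d"
  proof -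
    have "AE p in Leb2 T a b. p \<in> cyl T a b" by (rule AE_I2) simp
    then show ?thesis using F(2) y
    proof eventually_elim
      case (elim p)
      obtain t x where p: "p = (t, x)" by (cases p)
      have t: "0 < t" "t < T" and x: "x \<in> {a..b}" using elim(1) by (auto simp: p mem_cyl)
      have ft: "fst p = t" by (simp add: p)
      have f: "0 \<le> 1 - t / T" "0 \<le> t / T" using t T by auto
      show ?case
      proof (cases "t < r")
        case True
        have "y p - C0 \<ge> C0 / 2" using near[of t x] t x True elim(2) by (simp add: p)
        moreover have "m - C0 \<ge> C0 / 2" using m C0 by linarith
        ultimately have "(1 - t / T) * (C0 / 2) + t / T * (C0 / 2) \<le> (1 - t / T) * (y p - C0) + t / T * (m - C0)"
          using f by (intro add_mono mult_left_mono)
        moreover have "(1 - t / T) * (C0 / 2) + t / T * (C0 / 2) = C0 / 2" by (simp only: distrib_right[symmetric]) simp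
        ultimately have "C0 / 2 \<le> (1 - t / T) * (y p - C0) + t / T * (m - C0)" by linarith
        then show ?thesis unfolding d_def ft by (rule min.coboundedI1)
      next
        case False
        have "0 \<le> (1 - t / T) * (y p - C0)" using f elim(3) by (intro mult_nonneg_nonneg) auto
        moreover have "r / T * C0 \<le> t / T * (m - C0)"
          using False T t r(1) C0 m by (intro mult_mono divide_right_mono) auto
        ultimately show ?thesis by (simp add: p d_def)
      qed
    qed
  qed
  ultimately show ?thesis using that by blast
qed

section \<open>Optimality of the state alone\<close>

text \<open>The derivative at the state \<open>Y\<close> of the cost as a function of the state, \<open>\<langle>y - yd, \<phi>\<rangle> + \<alpha> \<langle>N(y), L \<phi>\<rangle>\<close>.\<close>

definition cost_derivative :: "real \<Rightarrow> real \<Rightarrow> real \<Rightarrow> real \<Rightarrow> real \<Rightarrow> real \<Rightarrow> real \<Rightarrow> (real \<times> real \<Rightarrow> real) \<Rightarrow>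
    (nat \<Rightarrow> real \<times> real \<Rightarrow> real) \<Rightarrow> (real \<times> real \<Rightarrow> real) \<Rightarrow> (nat \<Rightarrow> real \<times> real \<Rightarrow> real) \<Rightarrow> (real \<times> real \<Rightarrow> real) \<Rightarrow> real" where
  "cost_derivative T a b lam \<beta> \<epsilon> \<alpha> yd Y g \<Phi> h =
     (LINT p|Leb2 T a b. (Y 0 p - yd p) * \<Phi> 0 p)
     + \<alpha> * (LINT p|Leb2 T a b. state_op lam \<beta> \<epsilon> Y g p * lin_op lam \<beta> \<epsilon> (\<lambda>k. Y k p) (\<lambda>k. \<Phi> k p) (h p))"

text \<open>Admissible directions for the state: zero initial values, the boundary conditions and conservation of mass.\<close>

definition variation :: "real \<Rightarrow> real \<Rightarrow> real \<Rightarrow> (nat \<Rightarrow> real \<times> real \<Rightarrow> real) \<Rightarrow> (real \<times> real \<Rightarrow> real) \<Rightarrow> bool" where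
  "variation T a b \<Phi> h \<longleftrightarrow> xrepN T a b \<Phi> h \<and> initial_value T a b (\<Phi> 0) (\<lambda>_. 0) \<and>
     (AE t in Leb 0 T. (LINT x|Leb a b. h (t, x)) = 0)"

lemma mass_add:
  fixes f g :: "real \<times> real \<Rightarrow> real"
  assumes "f \<in> L2 (cyl T a b)" "g \<in> L2 (cyl T a b)"
  shows "AE t in Leb 0 T. (LINT x|Leb a b. f (t, x) + g (t, x))
    = (LINT x|Leb a b. f (t, x)) + (LINT x|Leb a b. g (t, x))"
  using L2_slices(1)[OF assms(1)] L2_slices(1)[OF assms(2)]
proof eventually_elim
  case (elim t)
  show ?case using L2_integrable[OF elim(1) interval_lmeasurable] L2_integrable[OF elim(2) interval_lmeasurable] by simp
qed

lemma variation_add: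
  assumes "variation T a b \<Phi> h" "variation T a b \<Psi> k"
  shows "variation T a b (\<lambda>j p. \<Phi> j p + \<Psi> j p) (\<lambda>p. h p + k p)"
proof -
  have 1: "xrepN T a b \<Phi> h" "xrepN T a b \<Psi> k" using assms by (auto simp: variation_def)
  have "initial_value T a b (\<lambda>p. \<Phi> 0 p + \<Psi> 0 p) (\<lambda>_. 0)"
    using initial_value_add[of T a b "\<Phi> 0" "\<lambda>_. 0" "\<Psi> 0" "\<lambda>_. 0"] assms by (simp add: variation_def)
  moreover have "AE t in Leb 0 T. (LINT x|Leb a b. h (t, x) + k (t, x)) = 0"
    using mass_add[OF xrepN_L2(2)[OF 1(1)] xrepN_L2(2)[OF 1(2)]] assms[unfolded variation_def, THEN conjunct2, THEN conjunct2]
    by eventually_elim simp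
  ultimately show ?thesis unfolding variation_def using xrepN_add[OF 1] by blast
qed

lemma variation_cmult:
  assumes "variation T a b \<Phi> h" shows "variation T a b (\<lambda>j p. c * \<Phi> j p) (\<lambda>p. c * h p)"
proof -
  have 1: "xrepN T a b \<Phi> h" using assms by (auto simp: variation_def)
  have "initial_value T a b (\<lambda>p. c * \<Phi> 0 p) (\<lambda>_. 0)"
    using initial_value_time_mult[of T a b "\<Phi> 0" "\<lambda>_. 0" "\<lambda>_. c"] assms by (simp add: variation_def)
  moreover have "AE t in Leb 0 T. (LINT x|Leb a b. c * h (t, x)) = 0"
    using assms[unfolded variation_def, THEN conjunct2, THEN conjunct2] by eventually_elim simp
  ultimately show ?thesis unfolding variation_def using xrepN_cmult[OF 1] by blast
qed

lemma variation_time: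
  assumes T: "0 < T" and ab: "a < b" and x: "xrepN T a b D g" and iv: "initial_value T a b (D 0) f0"
    and mass: "AE t in Leb 0 T. (LINT x|Leb a b. g (t, x)) = 0"
    and mean: "AE t in Leb 0 T. (LINT x|Leb a b. D 0 (t, x)) = 0"
  shows "variation T a b (\<lambda>k p. fst p / T * D k p) (\<lambda>p. 1 / T * D 0 p + fst p / T * g p)"
proof -
  have ac: "ac 0 T (\<lambda>t. t / T) (\<lambda>t. 1 / T)"
    by (rule ac_C1) (use T in \<open>auto intro!: derivative_eq_intros continuous_intros\<close>)
  have c: "continuous_on UNIV (\<lambda>t. t / T)" "continuous_on UNIV (\<lambda>t :: real. 1 / T)"
    using T by (auto intro!: continuous_intros)
  have "xrepN T a b (\<lambda>k p. fst p / T * D k p) (\<lambda>p. 1 / T * D 0 p + fst p / T * g p)"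
    by (rule xrepN_time_mult[OF x ac c])
  moreover have "initial_value T a b (\<lambda>p. fst p / T * D 0 p) (\<lambda>_. 0)"
    using initial_value_time_mult[OF iv c(1)] by simp
  moreover have "AE t in Leb 0 T. (LINT x|Leb a b. 1 / T * D 0 (t, x) + t / T * g (t, x)) = 0"
    using L2_slices(1)[OF xrepN_L2(1)[OF x, of 0, simplified]] L2_slices(1)[OF xrepN_L2(2)[OF x]] mass mean
  proof eventually_elim
    case (elim t)
    show ?case using L2_integrable[OF elim(1) interval_lmeasurable] L2_integrable[OF elim(2) interval_lmeasurable] elim(3,4) by simp
  qed
  ultimately show ?thesis by (simp add: variation_def)
qed

text \<open>Every point of the segment from \<open>y\<close> to \<open>y + \<phi>\<close> conserves mass and satisfies the constraint, so a control exists for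
  it and its cost is not smaller than that of \<open>y\<close>.\<close>

lemma variational_inequality:
  assumes T: "0 < T" and ab: "a < b" and pos: "lam \<ge> 0" "\<beta> \<ge> 1" "\<epsilon> \<ge> 0" and c0: "0 < C0" and yd: "yd \<in> L2 (cyl T a b)"
    and Y: "xrepN T a b Y g" and adm: "admissible T a b lam \<beta> \<epsilon> y0 C0 (Y 0) u"
    and N: "AE p in Leb2 T a b. Dx T a b 1 u p = state_op lam \<beta> \<epsilon> Y g p"
    and mass: "AE t in Leb 0 T. (LINT x|Leb a b. g (t, x)) = 0"
    and min: "\<forall>y' u'. admissible T a b lam \<beta> \<epsilon> y0 C0 y' u' \<longrightarrow> cost T a b \<alpha> yd (Y 0) u \<le> cost T a b \<alpha> yd y' u'"
    and F: "variation T a b \<Phi> h" and ge: "AE p in Leb2 T a b. Y 0 p + \<Phi> 0 p \<ge> C0"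
  shows "0 \<le> cost_derivative T a b lam \<beta> \<epsilon> \<alpha> yd Y g \<Phi> h"
proof -
  let ?M = "Leb2 T a b"
  have Fx: "xrepN T a b \<Phi> h" using F by (simp add: variation_def)
  have c: "AE p in ?M. Y 0 p \<ge> C0" and iv: "initial_value T a b (Y 0) y0" using adm by (simp_all add: admissible_def)
  define J where "J s = 1 / 2 * (LINT p|?M. (Y 0 p + s * \<Phi> 0 p - yd p)\<^sup>2)
      + \<alpha> / 2 * (LINT p|?M. (state_op lam \<beta> \<epsilon> (\<lambda>k p. Y k p + s * \<Phi> k p) (\<lambda>p. g p + s * h p) p)\<^sup>2)" for s
  have costJ: "cost T a b \<alpha> yd (\<lambda>p. Y 0 p + s * \<Phi> 0 p) v = J s"
    if "AE p in ?M. Dx T a b 1 v p = state_op lam \<beta> \<epsilon> (\<lambda>k p. Y k p + s * \<Phi> k p) (\<lambda>p. g p + s * h p) p" for s v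
  proof -
    have "(LINT p|?M. \<bar>Dx T a b 1 v p\<bar>\<^sup>2) = (LINT p|?M. (state_op lam \<beta> \<epsilon> (\<lambda>k p. Y k p + s * \<Phi> k p) (\<lambda>p. g p + s * h p) p)\<^sup>2)"
      by (rule integral_lebesgue_on_cong_AE[OF _ cyl_sets]) (use that in eventually_elim, simp)
    then show ?thesis by (simp add: cost_def J_def)
  qed
  have J0: "cost T a b \<alpha> yd (Y 0) u = J 0" using costJ[of u 0] N by simp
  have Jmin: "J 0 \<le> J s" if s: "0 < s" "s \<le> 1" for s
  proof -
    have Fs: "variation T a b (\<lambda>j p. s * \<Phi> j p) (\<lambda>p. s * h p)" by (rule variation_cmult[OF F])
    then have Fsx: "xrepN T a b (\<lambda>j p. s * \<Phi> j p) (\<lambda>p. s * h p)" by (simp add: variation_def)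
    have V: "xrepN T a b (\<lambda>k p. Y k p + s * \<Phi> k p) (\<lambda>p. g p + s * h p)" by (rule xrepN_add[OF Y Fsx])
    have Vge: "AE p in ?M. Y 0 p + s * \<Phi> 0 p \<ge> C0"
      using c ge
    proof eventually_elim
      case (elim p)
      have "(1 - s) * C0 + s * C0 \<le> (1 - s) * Y 0 p + s * (Y 0 p + \<Phi> 0 p)"
        using elim s by (intro add_mono mult_left_mono) auto
      then show ?case by (simp add: algebra_simps)
    qed
    have Viv: "initial_value T a b (\<lambda>p. Y 0 p + s * \<Phi> 0 p) y0"
      using initial_value_add[OF iv, of "\<lambda>p. s * \<Phi> 0 p" "\<lambda>_. 0"] Fs by (simp add: variation_def)
    have Vm: "AE t in Leb 0 T. (LINT x|Leb a b. g (t, x) + s * h (t, x)) = 0"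
      using mass_add[OF xrepN_L2(2)[OF Y] xrepN_L2(2)[OF Fsx]] mass Fs[unfolded variation_def, THEN conjunct2, THEN conjunct2]
      by eventually_elim simp
    obtain v where v: "admissible T a b lam \<beta> \<epsilon> y0 C0 (\<lambda>p. Y 0 p + s * \<Phi> 0 p) v"
      "AE p in ?M. Dx T a b 1 v p = state_op lam \<beta> \<epsilon> (\<lambda>k p. Y k p + s * \<Phi> k p) (\<lambda>p. g p + s * h p) p"
      by (rule admissible_of_state[OF T ab V c0 Vge Viv Vm])
    have "cost T a b \<alpha> yd (Y 0) u \<le> cost T a b \<alpha> yd (\<lambda>p. Y 0 p + s * \<Phi> 0 p) v" using min v(1) by simp
    then show ?thesis using J0 costJ[OF v(2)] by simp
  qed
  show ?thesis unfolding cost_derivative_def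
    by (rule first_variation[OF T ab Y Fx c0 c ge pos yd J_def Jmin])
qed

section \<open>The multiplier\<close>

text \<open>All functions that are bounded off a null set, measurable or not. The domain is this large in order that the extended
  functional may be evaluated on functions of time alone.\<close>

definition ae_bounded :: "real \<Rightarrow> real \<Rightarrow> real \<Rightarrow> (real \<times> real \<Rightarrow> real) set" where
  "ae_bounded T a b = {f. \<exists>K\<ge>0. AE p in Leb2 T a b. \<bar>f p\<bar> \<le> K}"

lemma ae_bounded_space: "function_space (ae_bounded T a b)"
  unfolding function_space_def
proof (intro conjI ballI allI)
  show "(\<lambda>_. 0) \<in> ae_bounded T a b" unfolding ae_bounded_def by (auto intro!: exI[of _ 0])
next
  fix f g assume "f \<in> ae_bounded T a b" "g \<in> ae_bounded T a b"
  then obtain K L where K: "K \<ge> 0" "AE p in Leb2 T a b. \<bar>f p\<bar> \<le> K"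
    and L: "L \<ge> 0" "AE p in Leb2 T a b. \<bar>g p\<bar> \<le> L" by (auto simp: ae_bounded_def)
  have "AE p in Leb2 T a b. \<bar>f p + g p\<bar> \<le> K + L" using K(2) L(2) by eventually_elim linarith
  then show "(\<lambda>p. f p + g p) \<in> ae_bounded T a b" using K(1) L(1) unfolding ae_bounded_def by (auto intro!: exI[of _ "K + L"])
next
  fix c f assume "f \<in> ae_bounded T a b"
  then obtain K where K: "K \<ge> 0" "AE p in Leb2 T a b. \<bar>f p\<bar> \<le> K" by (auto simp: ae_bounded_def)
  have "AE p in Leb2 T a b. \<bar>c * f p\<bar> \<le> \<bar>c\<bar> * K"
    using K(2) by eventually_elim (simp add: abs_mult mult_left_mono)
  then show "(\<lambda>p. c * f p) \<in> ae_bounded T a b" using K(1) unfolding ae_bounded_def by (auto intro!: exI[of _ "\<bar>c\<bar> * K"])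
qed

lemma ae_boundedI: "AE p in Leb2 T a b. \<bar>f p\<bar> \<le> K \<Longrightarrow> f \<in> ae_bounded T a b"
  unfolding ae_bounded_def by (auto intro!: exI[of _ "\<bar>K\<bar>"] elim!: eventually_mono)

lemma xrep_ae_bounded: "0 < T \<Longrightarrow> a < b \<Longrightarrow> xrep T a b D g \<Longrightarrow> D 0 \<in> ae_bounded T a b"
  using xrep_bounded[of T a b D g] by (auto simp: essentially_bounded_def intro: ae_boundedI)

text \<open>The situation at the minimiser after elimination of the control.\<close>

locale constrained_optimum =
  fixes T a b lam \<beta> \<epsilon> \<alpha> C0 :: real and yd :: "real \<times> real \<Rightarrow> real" and y0 :: "real \<Rightarrow> real"
    and Y :: "nat \<Rightarrow> real \<times> real \<Rightarrow> real" and g :: "real \<times> real \<Rightarrow> real"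
  assumes T: "0 < T" and ab: "a < b" and C0: "0 < C0" and yd: "yd \<in> L2 (cyl T a b)"
    and Y: "xrepN T a b Y g" and ge: "AE p in Leb2 T a b. Y 0 p \<ge> C0"
    and iv: "initial_value T a b (Y 0) y0" and y0: "AE x in Leb a b. y0 x \<ge> 2 * C0"
    and mass: "AE t in Leb 0 T. (LINT x|Leb a b. g (t, x)) = 0"
    and control_mass: "AE t in Leb 0 T. (LINT x|Leb a b. state_op lam \<beta> \<epsilon> Y g (t, x)) = 0"
    and vi: "\<And>\<Phi> h. variation T a b \<Phi> h \<Longrightarrow> AE p in Leb2 T a b. Y 0 p + \<Phi> 0 p \<ge> C0 \<Longrightarrow>
      0 \<le> cost_derivative T a b lam \<beta> \<epsilon> \<alpha> yd Y g \<Phi> h"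
begin

abbreviation "M \<equiv> Leb2 T a b"
abbreviation "N \<equiv> state_op lam \<beta> \<epsilon> Y g"
abbreviation "\<L> \<Phi> h p \<equiv> lin_op lam \<beta> \<epsilon> (\<lambda>k. Y k p) (\<lambda>k. \<Phi> k p) (h p)"
abbreviation "dJ \<equiv> cost_derivative T a b lam \<beta> \<epsilon> \<alpha> yd Y g"

lemma N_L2: "N \<in> L2 (cyl T a b)" by (rule state_op_L2[OF T ab Y C0 ge])

lemma gap_L2: "(\<lambda>p. Y 0 p - yd p) \<in> L2 (cyl T a b)" using L2_diff[OF xrepN_L2(1)[OF Y] yd] by simp

lemma lin_op_L2: "xrepN T a b \<Phi> h \<Longrightarrow> \<L> \<Phi> h \<in> L2 (cyl T a b)"
  unfolding lin_op_def by (intro L2_add xrepN_L2(2) flux_L2[OF T ab Y _ C0 ge])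

lemma dJ_add:
  assumes "xrepN T a b \<Phi> h" "xrepN T a b \<Psi> k"
  shows "dJ (\<lambda>j p. \<Phi> j p + \<Psi> j p) (\<lambda>p. h p + k p) = dJ \<Phi> h + dJ \<Psi> k"
proof -
  have 1: "(LINT p|M. (Y 0 p - yd p) * (\<Phi> 0 p + \<Psi> 0 p)) = (LINT p|M. (Y 0 p - yd p) * \<Phi> 0 p) + (LINT p|M. (Y 0 p - yd p) * \<Psi> 0 p)"
    using L2_mult_integrable[OF gap_L2 xrepN_L2(1)[OF assms(1), of 0]] L2_mult_integrable[OF gap_L2 xrepN_L2(1)[OF assms(2), of 0]]
    by (simp add: distrib_left)
  have "\<L> (\<lambda>j p. \<Phi> j p + \<Psi> j p) (\<lambda>p. h p + k p) p = \<L> \<Phi> h p + \<L> \<Psi> k p" for p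
    by (simp add: lin_op_def flux_dx_def reaction_dx_def algebra_simps)
  then have 2: "(LINT p|M. N p * \<L> (\<lambda>j p. \<Phi> j p + \<Psi> j p) (\<lambda>p. h p + k p) p) = (LINT p|M. N p * \<L> \<Phi> h p) + (LINT p|M. N p * \<L> \<Psi> k p)"
    using L2_mult_integrable[OF N_L2 lin_op_L2[OF assms(1)]] L2_mult_integrable[OF N_L2 lin_op_L2[OF assms(2)]]
    by (simp add: distrib_left)
  show ?thesis unfolding cost_derivative_def 1 2 by (simp add: algebra_simps)
qed

lemma dJ_cmult: "dJ (\<lambda>j p. c * \<Phi> j p) (\<lambda>p. c * h p) = c * dJ \<Phi> h"
proof -
  have 1: "(\<lambda>p. (Y 0 p - yd p) * (c * \<Phi> 0 p)) = (\<lambda>p. c * ((Y 0 p - yd p) * \<Phi> 0 p))" by (simp add: mult_ac)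
  have 2: "(\<lambda>p. N p * \<L> (\<lambda>j p. c * \<Phi> j p) (\<lambda>p. c * h p) p) = (\<lambda>p. c * (N p * \<L> \<Phi> h p))"
    by (rule ext) (simp add: lin_op_def flux_dx_def reaction_dx_def algebra_simps)
  show ?thesis unfolding cost_derivative_def 1 2 integral_mult_right_zero by (simp add: algebra_simps)
qed

definition m :: real where "m = (LINT x|Leb a b. y0 x) / (b - a)"

lemma m_ge: "m \<ge> 2 * C0"
proof -
  have "(LINT x|Leb a b. 2 * C0) \<le> (LINT x|Leb a b. y0 x)"
    using y0 by (intro integral_mono_AE initial_value_integrable[OF T ab iv] L2_integrable[OF L2_const] interval_lmeasurable)
  then show ?thesis unfolding LINT_const_interval[OF ab] m_def using ab by (simp add: pos_le_divide_eq mult_ac)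
qed

text \<open>Moving the state towards its mean at a speed proportional to \<open>t\<close> keeps the initial value and the mass; by \<open>slater_gap\<close>
  it makes the constraint strict.\<close>

lemma slater_direction:
  obtains \<Phi> h d where "variation T a b \<Phi> h" "d > 0" "AE p in M. \<Phi> 0 p + (Y 0 p - C0) \<ge> d"
proof -
  have qz: "zrep {0<..<T} (\<lambda>t :: real. 0 :: real)" by (simp add: zrep_def)
  have Mx: "xrepN T a b (\<lambda>k p. if k = 0 then m else 0) (\<lambda>p. 0)"
    using xrepN_time[OF T ab ac_const qz L2_const[OF interval_lmeasurable]] by simp
  define D where "D k p = (if k = 0 then m else 0) + (- 1) * Y k p" for k p
  have Dx: "xrepN T a b D (\<lambda>p. 0 + (- 1) * g p)"
    unfolding D_def[abs_def] by (rule xrepN_add[OF Mx xrepN_cmult[OF Y]])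
  have Div: "initial_value T a b (D 0) (\<lambda>x. m + (- 1) * y0 x)"
    using initial_value_add[OF initial_value_of_time[OF continuous_on_const] initial_value_time_mult[OF iv continuous_on_const], of m "- 1"]
    by (simp add: D_def[abs_def])
  have Dm: "AE t in Leb 0 T. (LINT x|Leb a b. D 0 (t, x)) = 0"
    using xrep_mean_conserved[OF T ab xrepN_xrep[OF Y] iv mass initial_value_integrable[OF T ab iv]]
      L2_slices(1)[OF xrepN_L2(1)[OF Y, of 0, simplified]]
  proof eventually_elim
    case (elim t)
    have i: "integrable (Leb a b) (\<lambda>x. m)" by (rule L2_integrable[OF L2_const]) (rule interval_lmeasurable)+
    have "(LINT x|Leb a b. D 0 (t, x)) = (LINT x|Leb a b. m - Y 0 (t, x))" by (simp add: D_def)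
    also have "\<dots> = (LINT x|Leb a b. m) - (LINT x|Leb a b. Y 0 (t, x))"
      by (rule LINT_diff[OF i L2_integrable[OF elim(2) interval_lmeasurable]])
    also have "\<dots> = 0" unfolding LINT_const_interval[OF ab] elim(1) m_def using ab by simp
    finally show ?case .
  qed
  have Dg: "AE t in Leb 0 T. (LINT x|Leb a b. 0 + (- 1) * g (t, x)) = 0"
    using mass by eventually_elim simp
  note v = variation_time[OF T ab Dx Div Dg Dm]
  obtain d where d: "d > 0" "AE p in M. (1 - fst p / T) * (Y 0 p - C0) + fst p / T * (m - C0) \<ge> d"
    by (rule slater_gap[OF T ab C0 iv y0 ge m_ge])
  have "AE p in M. fst p / T * D 0 p + (Y 0 p - C0) \<ge> d"
    using d(2) by eventually_elim (simp add: D_def algebra_simps)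
  then show ?thesis using that[OF v d(1)] by simp
qed

text \<open>The functional \<open>\<phi> + s (y - C0) \<mapsto> J'(\<phi>)\<close> is positive: if \<open>\<phi> + s (y - C0) \<ge> 0\<close> then \<open>y + \<phi>/k \<ge> C0\<close> for large \<open>k\<close>, and
  the variational inequality applies to \<open>\<phi>/k\<close>. It is given by a graph, whose single-valuedness is part of the extension
  theorem. The Slater direction provides the order unit, and the order unit bounds the extension.\<close>

lemma positive_multiplier:
  obtains \<nu> K where "\<And>f f'. f \<in> ae_bounded T a b \<Longrightarrow> f' \<in> ae_bounded T a b \<Longrightarrow> \<nu> (\<lambda>p. f p + f' p) = \<nu> f + \<nu> f'"
    "\<And>c f. f \<in> ae_bounded T a b \<Longrightarrow> \<nu> (\<lambda>p. c * f p) = c * \<nu> f"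
    "\<And>\<Phi> h. variation T a b \<Phi> h \<Longrightarrow> \<nu> (\<Phi> 0) = dJ \<Phi> h"
    "\<nu> (\<lambda>p. Y 0 p - C0) = 0"
    "\<And>f. f \<in> ae_bounded T a b \<Longrightarrow> AE p in M. 0 \<le> f p \<Longrightarrow> 0 \<le> \<nu> f"
    "0 \<le> K" "\<And>f k. 0 \<le> k \<Longrightarrow> AE p in M. \<bar>f p\<bar> \<le> k \<Longrightarrow> \<bar>\<nu> f\<bar> \<le> K * k"
proof -
  let ?E = "ae_bounded T a b"
  let ?P = "\<lambda>f. AE p in M. 0 \<le> f p"
  note E = function_spaceD[OF ae_bounded_space]
  define G0 where "G0 = {(f, r). \<exists>\<Phi> h s. variation T a b \<Phi> h \<and> f = (\<lambda>p. \<Phi> 0 p + s * (Y 0 p - C0)) \<and> r = dJ \<Phi> h}"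
  have G0I: "((\<lambda>p. \<Phi> 0 p + s * (Y 0 p - C0)), dJ \<Phi> h) \<in> G0" if "variation T a b \<Phi> h" for \<Phi> h s
    using that by (auto simp: G0_def)
  obtain \<Phi>1 h1 d where sl: "variation T a b \<Phi>1 h1" "d > 0" "AE p in M. \<Phi>1 0 p + (Y 0 p - C0) \<ge> d"
    by (rule slater_direction)
  have v0: "variation T a b (\<lambda>j p. 0 * \<Phi>1 j p) (\<lambda>p. 0 * h1 p)" by (rule variation_cmult[OF sl(1)])
  have dJ0: "dJ (\<lambda>j p. 0 * \<Phi>1 j p) (\<lambda>p. 0 * h1 p) = 0" unfolding dJ_cmult by simp
  have lin: "linear_graph G0"
    unfolding linear_graph_def
  proof (intro conjI allI impI)
    show "((\<lambda>_. 0), 0) \<in> G0" using G0I[OF v0, of 0] dJ0 by simp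
  next
    fix f r f' s assume "(f, r) \<in> G0" "(f', s) \<in> G0"
    then obtain \<Phi> h c \<Psi> k e where 1: "variation T a b \<Phi> h" "f = (\<lambda>p. \<Phi> 0 p + c * (Y 0 p - C0))" "r = dJ \<Phi> h"
      and 2: "variation T a b \<Psi> k" "f' = (\<lambda>p. \<Psi> 0 p + e * (Y 0 p - C0))" "s = dJ \<Psi> k" unfolding G0_def by blast
    have "dJ (\<lambda>j p. \<Phi> j p + \<Psi> j p) (\<lambda>p. h p + k p) = r + s"
      unfolding 1(3) 2(3) using 1(1) 2(1) by (intro dJ_add) (auto simp: variation_def)
    then show "((\<lambda>p. f p + f' p), r + s) \<in> G0"
      using G0I[OF variation_add[OF 1(1) 2(1)], of "c + e"] by (simp add: 1(2) 2(2) algebra_simps)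
  next
    fix c f r assume "(f, r) \<in> G0"
    then obtain \<Phi> h s where 1: "variation T a b \<Phi> h" "f = (\<lambda>p. \<Phi> 0 p + s * (Y 0 p - C0))" "r = dJ \<Phi> h" unfolding G0_def by blast
    show "((\<lambda>p. c * f p), c * r) \<in> G0"
      using G0I[OF variation_cmult[OF 1(1)], of c "c * s"] unfolding dJ_cmult by (simp add: 1(2,3) algebra_simps)
  qed
  have YE: "Y 0 \<in> ?E" by (rule xrep_ae_bounded[OF T ab xrepN_xrep[OF Y]])
  have gE: "(\<lambda>p. Y 0 p - C0) \<in> ?E"
    using E(2)[OF YE ae_boundedI[where f="\<lambda>_. - C0" and K="\<bar>C0\<bar>"]] by simp
  have sub: "f \<in> ?E" if fr: "(f, r) \<in> G0" for f r
  proof -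
    obtain \<Phi> h s where 1: "variation T a b \<Phi> h" "f = (\<lambda>p. \<Phi> 0 p + s * (Y 0 p - C0))" using fr unfolding G0_def by blast
    have "\<Phi> 0 \<in> ?E" using 1(1) by (intro xrep_ae_bounded[OF T ab xrepN_xrep]) (auto simp: variation_def)
    then show ?thesis unfolding 1(2) by (rule E(2)) (rule E(3)[OF gE])
  qed
  have pos: "r \<ge> 0" if fr: "(f, r) \<in> G0" "?P f" for f r
  proof -
    obtain \<Phi> h s where 1: "variation T a b \<Phi> h" "f = (\<lambda>p. \<Phi> 0 p + s * (Y 0 p - C0))" "r = dJ \<Phi> h"
      using fr(1) unfolding G0_def by blast
    \<comment> \<open>enlarging the coefficient of \<open>y - C0\<close> preserves nonnegativity and allows division by it\<close>
    define k where "k = max s 1"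
    have k: "k \<ge> s" "k > 0" by (auto simp: k_def)
    have "AE p in M. Y 0 p + 1 / k * \<Phi> 0 p \<ge> C0"
      using fr(2) ge
    proof eventually_elim
      case (elim p)
      have "s * (Y 0 p - C0) \<le> k * (Y 0 p - C0)" using elim(2) k by (intro mult_right_mono) auto
      then have "0 \<le> \<Phi> 0 p + k * (Y 0 p - C0)" using elim(1) by (simp add: 1(2))
      then have "0 \<le> 1 / k * (\<Phi> 0 p + k * (Y 0 p - C0))" using k(2) by simp
      then show ?case using k(2) by (simp add: distrib_left field_simps)
    qed
    then have "0 \<le> dJ (\<lambda>j p. 1 / k * \<Phi> j p) (\<lambda>p. 1 / k * h p)" by (intro vi variation_cmult[OF 1(1)])
    then have "0 \<le> 1 / k * r" unfolding dJ_cmult 1(3) .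
    then show ?thesis using k(2) by (simp add: zero_le_divide_iff)
  qed
  define e where "e p = \<Phi>1 0 p + 1 * (Y 0 p - C0)" for p
  have eG: "(e, dJ \<Phi>1 h1) \<in> G0" unfolding e_def[abs_def] by (rule G0I[OF sl(1)])
  have ed: "AE p in M. e p \<ge> d" using sl(3) by (simp add: e_def)
  have dom: "AE p in M. \<bar>f p\<bar> \<le> k / d * e p" if "0 \<le> k" "AE p in M. \<bar>f p\<bar> \<le> k" for f k
    using that(2) ed
  proof eventually_elim
    case (elim p)
    have "k / d * d \<le> k / d * e p" using that(1) sl(2) elim(2) by (intro mult_left_mono) auto
    then show ?case using elim(1) sl(2) by simp
  qed
  obtain \<nu> where nu: "\<And>f f'. f \<in> ?E \<Longrightarrow> f' \<in> ?E \<Longrightarrow> \<nu> (\<lambda>p. f p + f' p) = \<nu> f + \<nu> f'"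
    "\<And>c f. f \<in> ?E \<Longrightarrow> \<nu> (\<lambda>p. c * f p) = c * \<nu> f"
    "\<And>f r. (f, r) \<in> G0 \<Longrightarrow> \<nu> f = r" "\<And>f. f \<in> ?E \<Longrightarrow> ?P f \<Longrightarrow> \<nu> f \<ge> 0"
  proof (rule positive_extension[where P="?P" and E="?E" and ?G0.0=G0 and e=e and re="dJ \<Phi>1 h1"])
    fix f f' :: "real \<times> real \<Rightarrow> real" assume "?P f" "?P f'"
    then show "?P (\<lambda>p. f p + f' p)" by eventually_elim simp
  next
    fix c :: real and f :: "real \<times> real \<Rightarrow> real" assume "c \<ge> 0" "?P f"
    from this(2) show "?P (\<lambda>p. c * f p)" by eventually_elim (simp add: \<open>c \<ge> 0\<close>)
  next
    show "function_space ?E" by (rule ae_bounded_space)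
    show "linear_graph G0" by (rule lin)
    show "(e, dJ \<Phi>1 h1) \<in> G0" by (rule eG)
  next
    fix f assume "f \<in> ?E"
    then obtain k where "k \<ge> 0" "AE p in M. \<bar>f p\<bar> \<le> k" by (auto simp: ae_bounded_def)
    from dom[OF this] have "AE p in M. 0 \<le> k / d * e p - f p" by eventually_elim linarith
    then show "\<exists>c. AE p in M. 0 \<le> c * e p - f p" by blast
  qed (use sub pos in auto)
  have eE: "e \<in> ?E" by (rule sub[OF eG])
  define K where "K = \<nu> e / d"
  have "AE p in M. 0 \<le> e p" using ed by eventually_elim (use sl(2) in linarith)
  then have K0: "K \<ge> 0" unfolding K_def using nu(4)[OF eE] sl(2) by simp
  have bd: "\<bar>\<nu> f\<bar> \<le> K * k" if k: "0 \<le> k" "AE p in M. \<bar>f p\<bar> \<le> k" for f k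
  proof -
    have fE: "f \<in> ?E" by (rule ae_boundedI[OF k(2)])
    have one: "s * \<nu> f \<le> K * k" if s: "\<bar>s\<bar> = 1" for s
    proof -
      have "AE p in M. 0 \<le> k / d * e p + (- s) * f p"
        using dom[OF k]
      proof eventually_elim
        case (elim p)
        have "\<bar>(- s) * f p\<bar> = \<bar>f p\<bar>" using s by (simp add: abs_mult)
        then show ?case using elim by linarith
      qed
      then have "0 \<le> \<nu> (\<lambda>p. k / d * e p + (- s) * f p)" by (intro nu(4) E(2) E(3) eE fE)
      also have "\<dots> = k / d * \<nu> e + (- s) * \<nu> f" unfolding nu(1)[OF E(3)[OF eE] E(3)[OF fE]] nu(2)[OF eE] nu(2)[OF fE] ..
      finally show ?thesis by (simp add: K_def mult_ac)
    qed
    show ?thesis using one[of 1] one[of "- 1"] by auto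
  qed
  have nuV: "\<nu> (\<Phi> 0) = dJ \<Phi> h" if "variation T a b \<Phi> h" for \<Phi> h using nu(3)[OF G0I[OF that, of 0]] by simp
  have "\<nu> (\<lambda>p. Y 0 p - C0) = 0" using nu(3)[OF G0I[OF v0, of 1]] dJ0 by simp
  from that[OF nu(1,2) nuV this nu(4) K0 bd] show ?thesis .
qed

end

section \<open>The costate\<close>

definition time_primitive :: "real \<Rightarrow> (real \<Rightarrow> real) \<Rightarrow> real \<Rightarrow> real" where
  "time_primitive T q t = (LINT s|Leb 0 T. indicator {0<..<t} s * q s)"

lemma indicator_mult_integrable:
  fixes q :: "real \<Rightarrow> real"
  assumes "integrable (Leb 0 T) q" shows "integrable (Leb 0 T) (\<lambda>s. indicator {0<..<t} s * q s)"
proof (rule LINT_integrable_bound[OF assms])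
  have "(indicator {0<..<t} :: real \<Rightarrow> real) \<in> borel_measurable (Leb 0 T)"
    by (intro measurable_restrict_space1 measurable_completion) simp
  then show "(\<lambda>s. indicator {0<..<t} s * q s) \<in> borel_measurable (Leb 0 T)"
    using assms by (intro borel_measurable_times) auto
  show "AE s in Leb 0 T. norm (indicator {0<..<t} s * q s) \<le> norm (q s)"
    by (rule AE_I2) (simp add: indicator_def)
qed

lemma time_primitive_ac:
  assumes T: "0 < T" and q: "integrable (Leb 0 T) q"
  shows "ac 0 T (time_primitive T q) q" "time_primitive T q 0 = 0" "time_primitive T q T = (LINT t|Leb 0 T. q t)"
proof -
  have ai: "q absolutely_integrable_on {0..T}" using q integrable_lebesgue_on_interval by blast
  have eq: "time_primitive T q t = integral {0..t} q" if "t \<in> {0..T}" for t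
  proof -
    have "q absolutely_integrable_on {0..t}" using that by (intro absolutely_integrable_on_subinterval[OF ai]) auto
    from LINT_indicator_interval[OF this, of 0 T] show ?thesis using that by (simp add: time_primitive_def)
  qed
  show "ac 0 T (time_primitive T q) q" by (rule acI_primitive[OF ai, of _ 0]) (simp add: eq)
  show "time_primitive T q 0 = 0" using eq[of 0] T by simp
  show "time_primitive T q T = (LINT t|Leb 0 T. q t)" using eq[of T] T LINT_interval[OF ai] by simp
qed

lemma time_primitive_bound:
  assumes "integrable (Leb 0 T) q"
  shows "\<bar>time_primitive T q t\<bar> \<le> (LINT s|Leb 0 T. \<bar>q s\<bar>)"
proof -
  note i = indicator_mult_integrable[OF assms, of t]
  have "\<bar>time_primitive T q t\<bar> \<le> (LINT s|Leb 0 T. \<bar>indicator {0<..<t} s * q s\<bar>)"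
    unfolding time_primitive_def by (rule integral_abs_bound)
  also have "\<dots> \<le> (LINT s|Leb 0 T. \<bar>q s\<bar>)"
    by (intro integral_mono integrable_abs i assms) (simp add: indicator_def)
  finally show ?thesis .
qed

lemma space_integral_L2:
  assumes ab: "a < b" and f: "f \<in> L2 (cyl T a b)"
  shows "(\<lambda>t. LINT x|Leb a b. f (t, x)) \<in> L2 {0<..<T}"
  unfolding L2_def
proof (intro CollectI conjI)
  have "integrable (Leb 0 T) (\<lambda>t. LINT x|Leb a b. f (t, x))"
    by (rule cyl_Fubini(2)[OF L2_integrable[OF f cyl_lmeasurable]])
  then show 1: "(\<lambda>t. LINT x|Leb a b. f (t, x)) \<in> borel_measurable (Leb 0 T)" by simp
  have 2: "integrable (Leb 0 T) (\<lambda>t. (b - a) * (LINT x|Leb a b. (f (t, x))\<^sup>2))"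
    by (rule integrable_mult_right[OF cyl_Fubini(2)[OF L2_square_integrable[OF f]]])
  show "integrable (Leb 0 T) (\<lambda>t. (LINT x|Leb a b. f (t, x))\<^sup>2)"
  proof (rule LINT_integrable_bound[OF 2])
    show "AE t in Leb 0 T. norm ((LINT x|Leb a b. f (t, x))\<^sup>2) \<le> norm ((b - a) * (LINT x|Leb a b. (f (t, x))\<^sup>2))"
      using L2_slices(1)[OF f]
    proof eventually_elim
      case (elim t)
      note ai = L2_absolutely_integrable[OF elim]
      have "\<bar>LINT x|Leb a b. f (t, x)\<bar> \<le> integral {a..b} (\<lambda>x. \<bar>f (t, x)\<bar>)"
        unfolding LINT_interval[OF ai] by (rule integral_abs_bound_abs[OF ai])
      then have "\<bar>LINT x|Leb a b. f (t, x)\<bar>\<^sup>2 \<le> (integral {a..b} (\<lambda>x. \<bar>f (t, x)\<bar>))\<^sup>2" by (intro power_mono) auto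
      also have "\<dots> \<le> (b - a) * (LINT x|Leb a b. (f (t, x))\<^sup>2)" by (rule integral_abs_square_le[OF ab elim])
      finally show ?case by simp
    qed
  qed (use 1 in simp)
qed

text \<open>Functions of time may be taken out of the space integral.\<close>

lemma time_pairing:
  fixes c :: "real \<Rightarrow> real" and f :: "real \<times> real \<Rightarrow> real"
  assumes "integrable (Leb2 T a b) (\<lambda>p. c (fst p) * f p)"
  shows "(LINT p|Leb2 T a b. c (fst p) * f p) = (LINT t|Leb 0 T. c t * (LINT x|Leb a b. f (t, x)))"
    and "integrable (Leb 0 T) (\<lambda>t. c t * (LINT x|Leb a b. f (t, x)))"
  using cyl_Fubini(2,3)[OF assms] by (simp_all add: integral_mult_right_zero)

text \<open>A positive functional bounded for the essential supremum, evaluated on \<open>t \<mapsto> \<integral>\<^sub>0\<^sup>t q\<close>, is a positive functional of \<open>q\<close>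
  bounded for the \<open>L\<^sup>1\<close> norm.\<close>

lemma time_functional_density:
  assumes T: "0 < T"
    and add: "\<And>f f'. f \<in> ae_bounded T a b \<Longrightarrow> f' \<in> ae_bounded T a b \<Longrightarrow> \<nu> (\<lambda>p. f p + f' p) = \<nu> f + \<nu> f'"
    and scale: "\<And>c f. f \<in> ae_bounded T a b \<Longrightarrow> \<nu> (\<lambda>p. c * f p) = c * \<nu> f"
    and pos: "\<And>f. f \<in> ae_bounded T a b \<Longrightarrow> AE p in Leb2 T a b. 0 \<le> f p \<Longrightarrow> 0 \<le> \<nu> f"
    and bd: "\<And>f k. 0 \<le> k \<Longrightarrow> AE p in Leb2 T a b. \<bar>f p\<bar> \<le> k \<Longrightarrow> \<bar>\<nu> f\<bar> \<le> K * k"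
  obtains c where "c \<in> borel_measurable (Leb 0 T)" "AE t in Leb 0 T. 0 \<le> c t \<and> c t \<le> K"
    "\<And>q. integrable (Leb 0 T) q \<Longrightarrow> \<nu> (\<lambda>p. time_primitive T q (fst p)) = (LINT t|Leb 0 T. c t * q t)"
proof (rule positive_functional_density[where M="Leb 0 T" and \<Lambda>="\<lambda>q. \<nu> (\<lambda>p. time_primitive T q (fst p))" and K=K])
  let ?M = "Leb 0 T"
  show "finite_measure ?M" by (rule finite_measure_lebesgue_on[OF interval_lmeasurable])
  have E: "(\<lambda>p. time_primitive T q (fst p)) \<in> ae_bounded T a b" if "integrable ?M q" for q
    by (rule ae_boundedI[where K="LINT s|?M. \<bar>q s\<bar>"]) (simp add: time_primitive_bound[OF that])
  fix q p :: "real \<Rightarrow> real" assume q: "integrable ?M q" 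
  { assume p: "integrable ?M p"
    have "time_primitive T (\<lambda>t. p t + q t) s = time_primitive T p s + time_primitive T q s" for s
      unfolding time_primitive_def distrib_left
      by (rule LINT_add[OF indicator_mult_integrable[OF p] indicator_mult_integrable[OF q]])
    then show "\<nu> (\<lambda>r. time_primitive T (\<lambda>t. p t + q t) (fst r)) = \<nu> (\<lambda>r. time_primitive T p (fst r)) + \<nu> (\<lambda>r. time_primitive T q (fst r))"
      using add[OF E[OF p] E[OF q]] by simp }
  { fix k :: real
    have "time_primitive T (\<lambda>t. k * q t) s = k * time_primitive T q s" for s
      unfolding time_primitive_def integral_mult_right_zero[symmetric] by (simp add: mult_ac)
    then show "\<nu> (\<lambda>p. time_primitive T (\<lambda>t. k * q t) (fst p)) = k * \<nu> (\<lambda>p. time_primitive T q (fst p))"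
      using scale[OF E[OF q]] by simp }
  { assume q0: "\<And>t. 0 \<le> q t"
    have "0 \<le> time_primitive T q s" for s
      unfolding time_primitive_def by (rule LINT_nonneg) (simp add: q0)
    then show "0 \<le> \<nu> (\<lambda>p. time_primitive T q (fst p))" by (intro pos E[OF q]) simp }
  show "\<bar>\<nu> (\<lambda>p. time_primitive T q (fst p))\<bar> \<le> K * (LINT t|?M. \<bar>q t\<bar>)"
    by (rule bd) (simp_all add: time_primitive_bound[OF q])
qed (use that in blast)

context constrained_optimum
begin

abbreviation "B p \<equiv> reaction_dx lam \<beta> (\<lambda>k. Y k p) (\<lambda>k. if k = 0 then 1 else 0)"

definition r :: "real \<Rightarrow> real" where
  "r t = (LINT x|Leb a b. (Y 0 (t, x) - yd (t, x)) + \<alpha> * (N (t, x) * B (t, x)))"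

definition R :: "real \<Rightarrow> real" where
  "R t = (LINT s|Leb 0 T. r s) - time_primitive T r t"

lemma r_integrable: "integrable (Leb 0 T) r"
proof -
  have qz: "zrep {0<..<T} (\<lambda>t :: real. 0 :: real)" by (simp add: zrep_def)
  have "xrepN T a b (\<lambda>k p. if k = 0 then 1 else 0) (\<lambda>p. 0)"
    using xrepN_time[OF T ab ac_const qz L2_const[OF interval_lmeasurable]] by simp
  then have "B \<in> L2 (cyl T a b)" by (rule flux_L2(2)[OF T ab Y _ C0 ge])
  then have "integrable M (\<lambda>p. (Y 0 p - yd p) + \<alpha> * (N p * B p))"
    by (intro LINT_integrable_add integrable_mult_right L2_mult_integrable N_L2 L2_integrable[OF gap_L2 cyl_lmeasurable])
  from cyl_Fubini(2)[OF this] show ?thesis by (simp add: r_def[abs_def])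
qed

text \<open>On \<open>m(t) = \<integral>\<^sub>0\<^sup>t q\<close> the linearisation is \<open>L m = q + m B\<close>. The term with \<open>q\<close> drops out because \<open>N(y)\<close> has mean zero, and the
  rest is \<open>\<integral> m r = \<integral> q R\<close> with \<open>R(t) = \<integral>_t^T r\<close>.\<close>

lemma dJ_time:
  assumes q: "zrep {0<..<T} q" "q \<in> L2 {0<..<T}"
  shows "dJ (\<lambda>k p. if k = 0 then time_primitive T q (fst p) else 0) (\<lambda>p. q (fst p)) = (LINT t|Leb 0 T. q t * R t)"
    and "integrable (Leb 0 T) (\<lambda>t. q t * R t)"
proof -
  let ?m = "time_primitive T q"
  let ?\<Phi> = "\<lambda>(k::nat) p :: real \<times> real. if k = 0 then ?m (fst p) else 0"
  have qi: "integrable (Leb 0 T) q" by (rule L2_integrable[OF q(2) interval_lmeasurable])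
  note m = time_primitive_ac[OF T qi]
  have x: "xrepN T a b ?\<Phi> (\<lambda>p. q (fst p))" by (rule xrepN_time[OF T ab m(1) q])
  have mB: "reaction_dx lam \<beta> (\<lambda>k. Y k p) (\<lambda>k. ?\<Phi> k p) = ?m (fst p) * B p" for p
    by (simp add: reaction_dx_def algebra_simps)
  have lin: "\<L> ?\<Phi> (\<lambda>p. q (fst p)) p = q (fst p) + ?m (fst p) * B p" for p
    unfolding lin_op_def mB by (simp add: flux_dx_def)
  have mL: "(\<lambda>p. ?m (fst p)) \<in> L2 (cyl T a b)" using xrepN_L2(1)[OF x, of 0] by simp
  have mBL: "(\<lambda>p. ?m (fst p) * B p) \<in> L2 (cyl T a b)"
    using flux_L2(2)[OF T ab Y x C0 ge, of lam \<beta>] unfolding mB .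
  have qL: "(\<lambda>p. q (fst p)) \<in> L2 (cyl T a b)" by (rule L2_of_time[OF q ab])
  have i1: "integrable M (\<lambda>p. (Y 0 p - yd p) * ?m (fst p))" by (rule L2_mult_integrable[OF gap_L2 mL])
  have i2: "integrable M (\<lambda>p. N p * (?m (fst p) * B p))" by (rule L2_mult_integrable[OF N_L2 mBL])
  have i3: "integrable M (\<lambda>p. q (fst p) * N p)" by (rule L2_mult_integrable[OF qL N_L2])
  have "(\<lambda>p. ?m (fst p) * ((Y 0 p - yd p) + \<alpha> * (N p * B p))) = (\<lambda>p. (Y 0 p - yd p) * ?m (fst p) + \<alpha> * (N p * (?m (fst p) * B p)))"
    by (simp add: algebra_simps)
  then have i4: "integrable M (\<lambda>p. ?m (fst p) * ((Y 0 p - yd p) + \<alpha> * (N p * B p)))"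
    and e4: "(LINT p|M. ?m (fst p) * ((Y 0 p - yd p) + \<alpha> * (N p * B p))) = (LINT p|M. (Y 0 p - yd p) * ?m (fst p)) + \<alpha> * (LINT p|M. N p * (?m (fst p) * B p))"
    using i1 i2 by simp_all
  have "(LINT p|M. q (fst p) * N p) = (LINT t|Leb 0 T. q t * (LINT x|Leb a b. N (t, x)))"
    by (rule time_pairing(1)[OF i3])
  also have "\<dots> = (LINT t|Leb 0 T. 0)"
    by (rule integral_lebesgue_on_cong_AE) (use control_mass in \<open>eventually_elim, simp\<close>, simp)
  finally have e3: "(LINT p|M. q (fst p) * N p) = 0" by simp
  have "(LINT p|M. N p * \<L> ?\<Phi> (\<lambda>p. q (fst p)) p) = (LINT p|M. q (fst p) * N p + N p * (?m (fst p) * B p))"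
    unfolding lin by (simp add: algebra_simps)
  also have "\<dots> = (LINT p|M. N p * (?m (fst p) * B p))" using i2 i3 e3 by simp
  finally have "dJ ?\<Phi> (\<lambda>p. q (fst p)) = (LINT p|M. ?m (fst p) * ((Y 0 p - yd p) + \<alpha> * (N p * B p)))"
    unfolding cost_derivative_def e4 by simp
  also have "\<dots> = (LINT t|Leb 0 T. ?m t * r t)" unfolding time_pairing(1)[OF i4] r_def ..
  finally have 1: "dJ ?\<Phi> (\<lambda>p. q (fst p)) = (LINT t|Leb 0 T. ?m t * r t)" .
  have i5: "integrable (Leb 0 T) (\<lambda>t. ?m t * r t)" using time_pairing(2)[OF i4] unfolding r_def .
  note rr = time_primitive_ac[OF T r_integrable]
  have Rac: "ac 0 T R (\<lambda>t. 0 - r t)" unfolding R_def[abs_def] by (rule ac_diff[OF ac_const rr(1)])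
  note p = ac_mult[OF m(1) Rac]
  have RT: "R T = 0" by (simp add: R_def rr(3))
  have "((\<lambda>t. q t * R t + ?m t * (0 - r t)) has_integral (?m T * R T - ?m 0 * R 0)) {0..T}"
    by (rule ac_integral[OF p]) (use T in auto)
  then have "integral {0..T} (\<lambda>t. q t * R t + ?m t * (0 - r t)) = 0" using RT m(2) by (simp add: integral_unique)
  then have z: "(LINT t|Leb 0 T. q t * R t + ?m t * (0 - r t)) = 0" using LINT_interval[OF acD_integrable[OF p]] by simp
  have i6: "integrable (Leb 0 T) (\<lambda>t. q t * R t + ?m t * (0 - r t))"
    using acD_integrable[OF p] integrable_lebesgue_on_interval by blast
  have e: "q t * R t = (q t * R t + ?m t * (0 - r t)) + ?m t * r t" for t by (simp add: algebra_simps)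
  show "integrable (Leb 0 T) (\<lambda>t. q t * R t)"
    by (subst e) (rule LINT_integrable_add[OF i6 i5])
  have "(LINT t|Leb 0 T. q t * R t) = (LINT t|Leb 0 T. ?m t * r t)"
    by (subst e) (simp only: LINT_add[OF i6 i5] z)
  then show "dJ ?\<Phi> (\<lambda>p. q (fst p)) = (LINT t|Leb 0 T. q t * R t)" using 1 by simp
qed

lemma R_bounded: obtains k where "\<And>t. t \<in> {0..T} \<Longrightarrow> \<bar>R t\<bar> \<le> k"
proof -
  have "ac 0 T R (\<lambda>t. 0 - r t)" unfolding R_def[abs_def] by (rule ac_diff[OF ac_const time_primitive_ac(1)[OF T r_integrable]])
  from continuous_bound[OF ac_continuous[OF this]] show ?thesis using that by blast
qed

lemma R_measurable: "R \<in> borel_measurable (Leb 0 T)"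
proof -
  have "ac 0 T R (\<lambda>t. 0 - r t)" unfolding R_def[abs_def] by (rule ac_diff[OF ac_const time_primitive_ac(1)[OF T r_integrable]])
  from ac_continuous[OF this] have "R absolutely_integrable_on {0..T}" by (rule absolutely_integrable_continuous_real)
  then have "integrable (Leb 0 T) R" using integrable_lebesgue_on_interval by blast
  then show ?thesis by simp
qed

lemma lin_op_mass:
  assumes F: "xrepN T a b \<Phi> h"
  shows "AE t in Leb 0 T. (LINT x|Leb a b. \<L> \<Phi> h (t, x)) = (LINT x|Leb a b. h (t, x))"
proof -
  note f = flux_L2(1)[OF T ab Y F C0 ge, of lam \<beta> \<epsilon>] flux_L2(2)[OF T ab Y F C0 ge, of lam \<beta>]
  have "AE t in Leb 0 T. (LINT x|Leb a b. \<L> \<Phi> h (t, x))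
      = (LINT x|Leb a b. h (t, x)) + (LINT x|Leb a b. flux_dx lam \<beta> \<epsilon> (\<lambda>k. Y k (t, x)) (\<lambda>k. \<Phi> k (t, x)))
        + (LINT x|Leb a b. reaction_dx lam \<beta> (\<lambda>k. Y k (t, x)) (\<lambda>k. \<Phi> k (t, x)))"
    using mass_add[OF L2_add[OF xrepN_L2(2)[OF F] f(1)] f(2)] mass_add[OF xrepN_L2(2)[OF F] f(1)]
    unfolding lin_op_def by eventually_elim simp
  then show ?thesis
    using flux_weak_dx(3)[OF T ab Y F C0 ge, of lam \<beta> \<epsilon>] flux_weak_dx(4)[OF T ab Y F C0 ge, of lam \<beta>]
    by eventually_elim simp
qed

text \<open>Let \<open>q\<close> be the mean of \<open>\<phi>\<^sub>t\<close> and \<open>m(t) = \<integral>\<^sub>0\<^sup>t q\<close>. Then \<open>\<phi> - m\<close> conserves mass, where \<open>\<nu>\<close> agrees with the cost derivative, and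
  on \<open>m\<close> both are integrals of \<open>q\<close>. So \<open>\<nu>(\<phi>) - J'(\<phi>)\<close> is \<open>\<integral> (d - R) q\<close>, and this is \<open>\<integral> c(t) L \<phi>\<close> with
  \<open>c = (d - R)/(b - a)\<close> because \<open>L \<phi>\<close> has the same space integrals as \<open>\<phi>\<^sub>t\<close>.\<close>

lemma costate:
  obtains \<nu> K c where "\<And>f f'. f \<in> ae_bounded T a b \<Longrightarrow> f' \<in> ae_bounded T a b \<Longrightarrow> \<nu> (\<lambda>p. f p + f' p) = \<nu> f + \<nu> f'"
    "\<And>c f. f \<in> ae_bounded T a b \<Longrightarrow> \<nu> (\<lambda>p. c * f p) = c * \<nu> f"
    "\<nu> (\<lambda>p. Y 0 p - C0) = 0"
    "\<And>f. f \<in> ae_bounded T a b \<Longrightarrow> AE p in M. 0 \<le> f p \<Longrightarrow> 0 \<le> \<nu> f"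
    "0 \<le> K" "\<And>f k. 0 \<le> k \<Longrightarrow> AE p in M. \<bar>f p\<bar> \<le> k \<Longrightarrow> \<bar>\<nu> f\<bar> \<le> K * k"
    "(\<lambda>p. c (fst p)) \<in> L2 (cyl T a b)"
    "\<And>\<Phi> h. xrepN T a b \<Phi> h \<Longrightarrow> initial_value T a b (\<Phi> 0) (\<lambda>_. 0) \<Longrightarrow> \<nu> (\<Phi> 0) = dJ \<Phi> h + (LINT p|M. c (fst p) * \<L> \<Phi> h p)"
proof -
  let ?MT = "Leb 0 T"
  obtain \<nu> K where nu: "\<And>f f'. f \<in> ae_bounded T a b \<Longrightarrow> f' \<in> ae_bounded T a b \<Longrightarrow> \<nu> (\<lambda>p. f p + f' p) = \<nu> f + \<nu> f'"
    "\<And>c f. f \<in> ae_bounded T a b \<Longrightarrow> \<nu> (\<lambda>p. c * f p) = c * \<nu> f"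
    "\<And>\<Phi> h. variation T a b \<Phi> h \<Longrightarrow> \<nu> (\<Phi> 0) = dJ \<Phi> h"
    "\<nu> (\<lambda>p. Y 0 p - C0) = 0"
    "\<And>f. f \<in> ae_bounded T a b \<Longrightarrow> AE p in M. 0 \<le> f p \<Longrightarrow> 0 \<le> \<nu> f"
    "0 \<le> K" "\<And>f k. 0 \<le> k \<Longrightarrow> AE p in M. \<bar>f p\<bar> \<le> k \<Longrightarrow> \<bar>\<nu> f\<bar> \<le> K * k"
    by (rule positive_multiplier) (rule that; assumption)
  obtain d where d: "d \<in> borel_measurable ?MT" "AE t in ?MT. 0 \<le> d t \<and> d t \<le> K"
    "\<And>q. integrable ?MT q \<Longrightarrow> \<nu> (\<lambda>p. time_primitive T q (fst p)) = (LINT t|?MT. d t * q t)"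
    by (rule time_functional_density[where T=T and a=a and b=b and \<nu>=\<nu> and K=K])
      (rule T | (rule nu(1,2,5,7) that; assumption))+
  obtain k where k: "\<And>t. t \<in> {0..T} \<Longrightarrow> \<bar>R t\<bar> \<le> k" by (rule R_bounded) (rule that)
  have "AE t in ?MT. t \<in> {0<..<T}" by (rule AE_I2) simp
  with d(2) have "AE t in ?MT. \<bar>(d t - R t) / (b - a)\<bar> \<le> (K + k) / (b - a)"
  proof eventually_elim
    case (elim t)
    have "\<bar>d t - R t\<bar> \<le> K + k" using elim k[of t] by auto
    then show ?case using ab by (simp add: divide_right_mono)
  qed
  then have c0L: "(\<lambda>t. (d t - R t) / (b - a)) \<in> L2 {0<..<T}"
    using d(1) R_measurable by (intro L2_bounded[OF interval_lmeasurable]) auto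
  obtain c where c: "zrep {0<..<T} c" "AE t in ?MT. (d t - R t) / (b - a) = c t"
    using zrep_exists[OF L2_measurable[OF c0L]] by auto
  have cL: "c \<in> L2 {0<..<T}" by (rule L2_cong_AE[OF c0L c(2)]) simp
  have cML: "(\<lambda>p. c (fst p)) \<in> L2 (cyl T a b)" by (rule L2_of_time[OF c(1) cL ab])
  have "\<nu> (\<Phi> 0) = dJ \<Phi> h + (LINT p|M. c (fst p) * \<L> \<Phi> h p)"
    if F: "xrepN T a b \<Phi> h" and F0: "initial_value T a b (\<Phi> 0) (\<lambda>_. 0)" for \<Phi> h
  proof -
    note hL = xrepN_L2(2)[OF F]
    have q0: "(\<lambda>t. 1 / (b - a) * (LINT x|Leb a b. h (t, x))) \<in> L2 {0<..<T}"
      by (rule L2_cmult[OF space_integral_L2[OF ab hL]])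
    obtain q where q: "zrep {0<..<T} q" "AE t in ?MT. 1 / (b - a) * (LINT x|Leb a b. h (t, x)) = q t"
      using zrep_exists[OF L2_measurable[OF q0]] by auto
    have qL: "q \<in> L2 {0<..<T}" by (rule L2_cong_AE[OF q0 q(2)]) simp
    have qi: "integrable ?MT q" by (rule L2_integrable[OF qL interval_lmeasurable])
    have hq: "AE t in ?MT. (LINT x|Leb a b. h (t, x)) = (b - a) * q t"
      using q(2) by eventually_elim (use ab in \<open>simp add: field_simps\<close>)
    let ?m = "time_primitive T q"
    let ?Q = "\<lambda>(k::nat) p :: real \<times> real. if k = 0 then ?m (fst p) else 0"
    note m = time_primitive_ac[OF T qi]
    have Q: "xrepN T a b ?Q (\<lambda>p. q (fst p))" by (rule xrepN_time[OF T ab m(1) q(1) qL])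
    have Qm: "xrepN T a b (\<lambda>k p. (- 1) * ?Q k p) (\<lambda>p. (- 1) * q (fst p))" by (rule xrepN_cmult[OF Q])
    define \<Psi> where "\<Psi> k p = \<Phi> k p + (- 1) * ?Q k p" for k p
    have P: "xrepN T a b \<Psi> (\<lambda>p. h p + (- 1) * q (fst p))"
      unfolding \<Psi>_def[abs_def] by (rule xrepN_add[OF F Qm])
    have m0: "initial_value T a b (\<lambda>p. ?m (fst p)) (\<lambda>_. 0)"
      using initial_value_of_time[OF ac_continuous[OF m(1)]] m(2) by simp
    have "initial_value T a b (\<Psi> 0) (\<lambda>_. 0)"
      using initial_value_add[OF F0 initial_value_time_mult[OF m0 continuous_on_const, of "- 1"]] by (simp add: \<Psi>_def[abs_def])
    moreover have "AE t in ?MT. (LINT x|Leb a b. h (t, x) + (- 1) * q (fst (t, x))) = 0"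
      using mass_add[OF hL xrepN_L2(2)[OF Qm]] hq
    proof eventually_elim
      case (elim t)
      show ?case using elim(1) unfolding elim(2) fst_conv LINT_const_interval[OF ab] by (simp add: algebra_simps)
    qed
    ultimately have vP: "variation T a b \<Psi> (\<lambda>p. h p + (- 1) * q (fst p))" using P by (simp add: variation_def)
    have E: "\<Psi> 0 \<in> ae_bounded T a b" "(\<lambda>p. ?m (fst p)) \<in> ae_bounded T a b"
      using xrep_ae_bounded[OF T ab xrepN_xrep[OF P]] xrep_ae_bounded[OF T ab xrepN_xrep[OF Q]] by simp_all
    have "\<Phi> 0 = (\<lambda>p. \<Psi> 0 p + ?m (fst p))" by (simp add: \<Psi>_def)
    then have "\<nu> (\<Phi> 0) = \<nu> (\<Psi> 0) + \<nu> (\<lambda>p. ?m (fst p))" using nu(1)[OF E] by simp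
    also have "\<dots> = dJ \<Psi> (\<lambda>p. h p + (- 1) * q (fst p)) + (LINT t|?MT. d t * q t)"
      unfolding nu(3)[OF vP] d(3)[OF qi] ..
    also have "dJ \<Psi> (\<lambda>p. h p + (- 1) * q (fst p)) = dJ \<Phi> h - (LINT t|?MT. q t * R t)"
      unfolding \<Psi>_def[abs_def] dJ_add[OF F Qm] dJ_cmult dJ_time(1)[OF q(1) qL] by simp
    finally have 1: "\<nu> (\<Phi> 0) = dJ \<Phi> h - (LINT t|?MT. q t * R t) + (LINT t|?MT. d t * q t)" .
    have di: "integrable ?MT (\<lambda>t. d t * q t)"
    proof (rule LINT_integrable_bound[where f="\<lambda>t. K * q t"])
      show "AE t in ?MT. norm (d t * q t) \<le> norm (K * q t)"
        using d(2) by eventually_elim (auto simp: abs_mult intro!: mult_right_mono)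
    qed (use qi d(1) in auto)
    have "(LINT p|M. c (fst p) * \<L> \<Phi> h p) = (LINT t|?MT. c t * (LINT x|Leb a b. \<L> \<Phi> h (t, x)))"
      by (rule time_pairing(1)[OF L2_mult_integrable[OF cML lin_op_L2[OF F]]])
    also have "\<dots> = (LINT t|?MT. d t * q t - q t * R t)"
    proof (rule integral_lebesgue_on_cong_AE)
      show "AE t in ?MT. c t * (LINT x|Leb a b. \<L> \<Phi> h (t, x)) = d t * q t - q t * R t"
        using c(2) lin_op_mass[OF F] hq
      proof eventually_elim
        case (elim t)
        show ?case unfolding elim(2,3) elim(1)[symmetric] using ab by (simp add: field_simps)
      qed
    qed simp
    also have "\<dots> = (LINT t|?MT. d t * q t) - (LINT t|?MT. q t * R t)"
      by (rule LINT_diff[OF di dJ_time(2)[OF q(1) qL]])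
    finally show ?thesis using 1 by simp
  qed
  from that[OF nu(1,2,4,5,6,7) cML this] show ?thesis .
qed

end

section \<open>The optimality system\<close>

lemma graph_norm2_le_norm_X:
  assumes T: "0 < T" and ab: "a < b" and x: "xrep T a b D g"
  shows "sqrt (graph_norm2 T a b D g) \<le> norm_X T a b (D 0)"
proof -
  note X = xrep_X[OF T ab x]
  have sq: "inner_L2 (cyl T a b) f f = (LINT p|Leb2 T a b. (f p)\<^sup>2)" for f
    by (simp add: inner_L2_def power2_eq_square)
  have 1: "inner_L2 (cyl T a b) (Dx T a b k (D 0)) (Dx T a b k (D 0)) = (LINT p|Leb2 T a b. (D k p)\<^sup>2)" if "k \<le> 4" for k
    unfolding sq[symmetric] by (rule inner_L2_cong_AE[OF X(4)[OF that] X(4)[OF that] cyl_sets])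
  have 2: "inner_L2 (cyl T a b) (Dt T a b (D 0)) (Dt T a b (D 0)) = (LINT p|Leb2 T a b. (g p)\<^sup>2)"
    unfolding sq[symmetric] by (rule inner_L2_cong_AE[OF X(5) X(5) cyl_sets])
  define A B C where "A = (\<Sum>k\<le>4. LINT p|Leb2 T a b. (D k p)\<^sup>2)"
    and "B = (LINT p|Leb2 T a b. (D 0 p)\<^sup>2)" and "C = (LINT p|Leb2 T a b. (g p)\<^sup>2)"
  have n: "norm_X T a b (D 0) = sqrt A + sqrt (B + C)"
    unfolding norm_X_def norm_L2H_def norm_H1L2_def 2 A_def B_def C_def using 1 sq[of "D 0"] by simp
  have 0: "A \<ge> 0" "B \<ge> 0" "C \<ge> 0" unfolding A_def B_def C_def by (intro sum_nonneg LINT_nonneg; simp)+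
  have "sqrt (A + C) \<le> sqrt A + sqrt C" using 0 by (intro sqrt_add_le_add_sqrt) auto
  also have "\<dots> \<le> sqrt A + sqrt (B + C)" using 0 by simp
  finally show ?thesis unfolding n graph_norm2_def A_def C_def .
qed

text \<open>The embedding \<open>X_bounded\<close> compares the essential supremum with the norm of \<open>X\<close>.\<close>

lemma ae_bounded_dual:
  assumes T: "0 < T" and ab: "a < b"
    and add: "\<And>f f'. f \<in> ae_bounded T a b \<Longrightarrow> f' \<in> ae_bounded T a b \<Longrightarrow> \<nu> (\<lambda>p. f p + f' p) = \<nu> f + \<nu> f'"
    and scale: "\<And>c f. f \<in> ae_bounded T a b \<Longrightarrow> \<nu> (\<lambda>p. c * f p) = c * \<nu> f"
    and K: "0 \<le> K" and bd: "\<And>f k. 0 \<le> k \<Longrightarrow> AE p in Leb2 T a b. \<bar>f p\<bar> \<le> k \<Longrightarrow> \<bar>\<nu> f\<bar> \<le> K * k"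
  shows "\<nu> \<in> dual_space (X T a b) (norm_X T a b)"
proof -
  obtain C where C: "C \<ge> 0" "\<forall>D g. xrep T a b D g \<longrightarrow> (AE p in Leb2 T a b. (D 0 p)\<^sup>2 \<le> C * graph_norm2 T a b D g)"
    using X_bounded[OF T ab] by blast
  have E: "f \<in> ae_bounded T a b" if f: "f \<in> X T a b" for f
  proof -
    obtain D g where D: "xrep T a b D g" "D 0 = f" by (rule X_imp_xrep[OF T ab f])
    show ?thesis using xrep_ae_bounded[OF T ab D(1)] D(2) by simp
  qed
  have "\<bar>\<nu> f\<bar> \<le> (K * sqrt C) * norm_X T a b f" if f: "f \<in> X T a b" for f
  proof -
    obtain D g where D: "xrep T a b D g" "D 0 = f" by (rule X_imp_xrep[OF T ab f])
    have n: "sqrt (graph_norm2 T a b D g) \<le> norm_X T a b f" using graph_norm2_le_norm_X[OF T ab D(1)] D(2) by simp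
    have 0: "0 \<le> sqrt C * norm_X T a b f"
      using order_trans[OF _ n, of 0] graph_norm2_ge(3)[of T a b D g] C(1) by simp
    have "AE p in Leb2 T a b. (D 0 p)\<^sup>2 \<le> C * graph_norm2 T a b D g" using C(2) D(1) by simp
    then have "AE p in Leb2 T a b. \<bar>f p\<bar> \<le> sqrt C * norm_X T a b f"
    proof eventually_elim
      case (elim p)
      have "\<bar>D 0 p\<bar> \<le> sqrt (C * graph_norm2 T a b D g)" using elim by (simp add: real_le_rsqrt)
      also have "\<dots> \<le> sqrt C * norm_X T a b f" unfolding real_sqrt_mult using n C(1) by (intro mult_left_mono) auto
      finally show ?case by (simp add: D(2))
    qed
    from bd[OF 0 this] show ?thesis by (simp add: mult.assoc)
  qed
  then show ?thesis unfolding dual_space_def using add scale E by blast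
qed

lemma dual_space_uminus:
  assumes "\<nu> \<in> dual_space V n" shows "(\<lambda>f. - \<nu> f) \<in> dual_space V n"
  using assms unfolding dual_space_def by simp

theorem theorem4p3:
  fixes T a b \<beta> lam \<alpha> \<epsilon> C0 :: real
    and yd yhat y u :: "real \<times> real \<Rightarrow> real"
    and y0 :: "real \<Rightarrow> real"
  assumes "0 < T" and "a < b"
    and "\<beta> \<ge> 4" and "lam > 0" and "\<alpha> > 0" and "\<epsilon> > 0"
    and "yd \<in> L2 (cyl T a b)"
    and "y0 \<in> H a b 2" and "C0 > 0" and "AE x in lebesgue_on {a<..<b}. y0 x \<ge> C0"
    and "thin_film_weak_solution T a b lam \<beta> y0 yhat"
    and "\<forall>p\<in>{0..T} \<times> {a..b}. yhat p \<ge> 2 * C0"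
    and "admissible T a b lam \<beta> \<epsilon> y0 C0 y u"
    and "\<forall>y' u'. admissible T a b lam \<beta> \<epsilon> y0 C0 y' u' \<longrightarrow>
           cost T a b \<alpha> yd y u \<le> cost T a b \<alpha> yd y' u'"
  shows "\<exists>z \<in> L2 (cyl T a b). \<exists>\<mu> \<in> dual_space (X T a b) (norm_X T a b).
      state_equation T a b lam \<beta> \<epsilon> y u \<and>
      (AE p in lebesgue_on (cyl T a b). y p \<ge> C0) \<and>
      (\<forall>w\<in>X T a b. (AE p in lebesgue_on (cyl T a b). w p \<ge> C0) \<longrightarrow>
         0 \<ge> \<mu> (\<lambda>p. w p - y p)) \<and>
      (\<forall>\<phi>\<in>X T a b.
         initial_value T a b \<phi> (\<lambda>_. 0) \<and> dx_zero_bdry T a b 1 \<phi> \<and> dx_zero_bdry T a b 3 \<phi> \<longrightarrow>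
         0 = inner_L2 (cyl T a b) (\<lambda>p. y p - yd p) \<phi>
           + inner_L2 (cyl T a b) z
               (\<lambda>p. Dt T a b \<phi> p
                  + Dx T a b 1 (\<lambda>q. \<beta> * lam * y q powr (\<beta> - 1) * Dx T a b 3 y q * \<phi> q) p)
           + inner_L2 (cyl T a b) z
               (Dx T a b 1 (\<lambda>q. (lam * \<bar>y q\<bar> powr \<beta> + \<epsilon>) * Dx T a b 3 \<phi> q))
           + \<mu> \<phi>) \<and>
      (AE t in lebesgue_on {0<..<T}. \<forall>v\<in>H10 a b.
         0 = - \<alpha> * deriv_Hm1 a b (\<lambda>x. Dx T a b 1 u (t, x)) v
             + deriv_Hm1 a b (\<lambda>x. z (t, x)) v) \<and>
      initial_value T a b y y0 \<and> dx_zero_bdry T a b 1 y \<and> dx_zero_bdry T a b 3 y"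
proof -
  note T = \<open>0 < T\<close> and ab = \<open>a < b\<close> and C0 = \<open>C0 > 0\<close> and yd = \<open>yd \<in> L2 (cyl T a b)\<close>
  let ?M = "Leb2 T a b"
  have pos: "lam \<ge> 0" "\<beta> \<ge> 1" "\<epsilon> \<ge> 0" using \<open>lam > 0\<close> \<open>\<beta> \<ge> 4\<close> \<open>\<epsilon> > 0\<close> by simp_all
  note adm = \<open>admissible T a b lam \<beta> \<epsilon> y0 C0 y u\<close>
  obtain Y g where repr: "xrepN T a b Y g" "Y 0 = y"
    and N: "AE p in ?M. Dx T a b 1 u p = state_op lam \<beta> \<epsilon> Y g p"
    and Nm: "AE t in Leb 0 T. (LINT x|Leb a b. state_op lam \<beta> \<epsilon> Y g (t, x)) = 0"
    and gm: "AE t in Leb 0 T. (LINT x|Leb a b. g (t, x)) = 0"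
    by (rule admissible_state[OF T ab C0 adm])
  have yiv: "initial_value T a b y y0" and yge: "AE p in ?M. y p \<ge> C0" and se: "state_equation T a b lam \<beta> \<epsilon> y u"
    and bc: "dx_zero_bdry T a b 1 y" "dx_zero_bdry T a b 3 y"
    using adm by (simp_all add: admissible_def)
  have y0: "AE x in Leb a b. y0 x \<ge> 2 * C0"
  proof (rule initial_value_ge[OF T])
    show "initial_value T a b yhat y0" using assms(11) by (simp add: thin_film_weak_solution_def)
    show "AE p in ?M. yhat p \<ge> 2 * C0"
    proof (rule AE_I2)
      fix p assume "p \<in> space ?M"
      then have "p \<in> {0..T} \<times> {a..b}" by (auto simp: cyl_def)
      then show "yhat p \<ge> 2 * C0" by (rule bspec[OF assms(12)])
    qed
  qed
  interpret constrained_optimum T a b lam \<beta> \<epsilon> \<alpha> C0 yd y0 Y g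
  proof
    fix \<Phi> h assume F: "variation T a b \<Phi> h" "AE p in ?M. Y 0 p + \<Phi> 0 p \<ge> C0"
    show "0 \<le> cost_derivative T a b lam \<beta> \<epsilon> \<alpha> yd Y g \<Phi> h"
      by (rule variational_inequality[OF T ab pos C0 yd repr(1) _ N gm _ F]) (use repr(2) adm assms(14) in simp_all)
  qed (use T ab C0 yd repr yge yiv y0 gm Nm in simp_all)
  obtain \<nu> K c where nu: "\<And>f f'. f \<in> ae_bounded T a b \<Longrightarrow> f' \<in> ae_bounded T a b \<Longrightarrow> \<nu> (\<lambda>p. f p + f' p) = \<nu> f + \<nu> f'"
    "\<And>c f. f \<in> ae_bounded T a b \<Longrightarrow> \<nu> (\<lambda>p. c * f p) = c * \<nu> f"
    "\<nu> (\<lambda>p. Y 0 p - C0) = 0"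
    "\<And>f. f \<in> ae_bounded T a b \<Longrightarrow> AE p in ?M. 0 \<le> f p \<Longrightarrow> 0 \<le> \<nu> f"
    "0 \<le> K" "\<And>f k. 0 \<le> k \<Longrightarrow> AE p in ?M. \<bar>f p\<bar> \<le> k \<Longrightarrow> \<bar>\<nu> f\<bar> \<le> K * k"
    and cL: "(\<lambda>p. c (fst p)) \<in> L2 (cyl T a b)"
    and cs: "\<And>\<Phi> h. xrepN T a b \<Phi> h \<Longrightarrow> initial_value T a b (\<Phi> 0) (\<lambda>_. 0) \<Longrightarrow>
      \<nu> (\<Phi> 0) = dJ \<Phi> h + (LINT p|?M. c (fst p) * \<L> \<Phi> h p)"
    by (rule costate) (rule that; assumption)
  \<comment> \<open>\<open>N\<close> is \<open>u\<^sub>x\<close> almost everywhere, so this is \<open>\<alpha> u\<^sub>x + c(t)\<close>\<close>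
  define z where "z p = \<alpha> * N p + c (fst p)" for p
  have zL: "z \<in> L2 (cyl T a b)" unfolding z_def[abs_def] by (intro L2_add L2_cmult N_L2 cL)
  have mu: "(\<lambda>f. - \<nu> f) \<in> dual_space (X T a b) (norm_X T a b)"
    by (rule dual_space_uminus, rule ae_bounded_dual[where K=K]) (rule T ab nu(5) | (rule nu(1,2,6); assumption))+
  note E = function_spaceD[OF ae_bounded_space]
  have XE: "f \<in> ae_bounded T a b" if f: "f \<in> X T a b" for f
  proof -
    obtain D g where D: "xrep T a b D g" "D 0 = f" by (rule X_imp_xrep[OF T ab f])
    show ?thesis using xrep_ae_bounded[OF T ab D(1)] D(2) by simp
  qed
  have C: "(\<lambda>p. - C0) \<in> ae_bounded T a b" by (rule ae_boundedI[where K="\<bar>C0\<bar>"]) simp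
  have yE: "y \<in> ae_bounded T a b" using xrep_ae_bounded[OF T ab xrepN_xrep[OF repr(1)]] repr(2) by simp
  have comp: "0 \<ge> - \<nu> (\<lambda>p. w p - y p)" if w: "w \<in> X T a b" "AE p in ?M. w p \<ge> C0" for w
  proof -
    have 1: "(\<lambda>p. w p + - C0) \<in> ae_bounded T a b" "(\<lambda>p. y p + - C0) \<in> ae_bounded T a b" by (intro E(2) C yE XE w)+
    have "\<nu> (\<lambda>p. (w p + - C0) + (- 1) * (y p + - C0)) = \<nu> (\<lambda>p. w p + - C0) + (- 1) * \<nu> (\<lambda>p. y p + - C0)"
      unfolding nu(1)[OF 1(1) E(3)[OF 1(2)]] nu(2)[OF 1(2)] ..
    moreover have "0 \<le> \<nu> (\<lambda>p. w p + - C0)" by (rule nu(4)[OF 1(1)]) (use w(2) in eventually_elim, simp)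
    ultimately show ?thesis using nu(3) repr(2) by simp
  qed
  have Yx: "AE p in ?M. Dx T a b 3 y p = Y 3 p" using xrep_X(4)[OF T ab xrepN_xrep[OF repr(1)], of 3] repr(2) by simp
  have adj: "0 = inner_L2 (cyl T a b) (\<lambda>p. y p - yd p) \<phi>
           + inner_L2 (cyl T a b) z
               (\<lambda>p. Dt T a b \<phi> p
                  + Dx T a b 1 (\<lambda>q. \<beta> * lam * y q powr (\<beta> - 1) * Dx T a b 3 y q * \<phi> q) p)
           + inner_L2 (cyl T a b) z
               (Dx T a b 1 (\<lambda>q. (lam * \<bar>y q\<bar> powr \<beta> + \<epsilon>) * Dx T a b 3 \<phi> q))
           + - \<nu> \<phi>"
    if \<phi>: "\<phi> \<in> X T a b" and \<phi>0: "initial_value T a b \<phi> (\<lambda>_. 0)" and \<phi>b: "dx_zero_bdry T a b 1 \<phi>" "dx_zero_bdry T a b 3 \<phi>" for \<phi>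
  proof -
    obtain \<Phi> h where F: "xrepN T a b \<Phi> h" "\<Phi> 0 = \<phi>" by (rule X_imp_xrepN[OF T ab \<phi> \<phi>b])
    note X = xrep_X[OF T ab xrepN_xrep[OF F(1)], unfolded F(2)]
    let ?fl = "\<lambda>p. flux_dx lam \<beta> \<epsilon> (\<lambda>k. Y k p) (\<lambda>k. \<Phi> k p)" and ?re = "\<lambda>p. reaction_dx lam \<beta> (\<lambda>k. Y k p) (\<lambda>k. \<Phi> k p)"
    have fL: "?fl \<in> L2 (cyl T a b)" by (rule flux_L2(1)[OF T ab repr(1) F(1) C0]) (simp add: repr(2) yge)
    have rL: "?re \<in> L2 (cyl T a b)" by (rule flux_L2(2)[OF T ab repr(1) F(1) C0]) (simp add: repr(2) yge)
    have hL: "h \<in> L2 (cyl T a b)" by (rule xrepN_L2(2)[OF F(1)])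
    have gY: "AE p in ?M. Y 0 p \<ge> C0" by (simp add: repr(2) yge)
    have F3: "AE p in ?M. Dx T a b 3 \<phi> p = \<Phi> 3 p" using X(4)[of 3] by simp
    have wf: "AE p in ?M. Dx T a b 1 (\<lambda>q. (lam * \<bar>y q\<bar> powr \<beta> + \<epsilon>) * Dx T a b 3 \<phi> q) p = ?fl p"
      by (rule Dx_AE, rule weak_dx_cong[OF flux_weak_dx(1)[OF T ab repr(1) F(1) C0 gY]])
        (use F3 in \<open>eventually_elim, simp add: repr(2)\<close>)
    have wr: "AE p in ?M. Dx T a b 1 (\<lambda>q. \<beta> * lam * y q powr (\<beta> - 1) * Dx T a b 3 y q * \<phi> q) p = ?re p"
      by (rule Dx_AE, rule weak_dx_cong[OF flux_weak_dx(2)[OF T ab repr(1) F(1) C0 gY]])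
        (use Yx in \<open>eventually_elim, simp add: repr(2) F(2)\<close>)
    have refl: "AE p in ?M. z p = z p" by simp
    have "AE p in ?M. Dt T a b \<phi> p + Dx T a b 1 (\<lambda>q. \<beta> * lam * y q powr (\<beta> - 1) * Dx T a b 3 y q * \<phi> q) p = h p + ?re p"
      using X(5) wr by eventually_elim simp
    note i1 = inner_L2_cong_AE[OF refl this cyl_sets] and i2 = inner_L2_cong_AE[OF refl wf cyl_sets]
    have "(LINT p|?M. z p * \<L> \<Phi> h p) = (LINT p|?M. z p * (h p + ?re p) + z p * ?fl p)"
      by (simp add: lin_op_def algebra_simps)
    also have "\<dots> = (LINT p|?M. z p * (h p + ?re p)) + (LINT p|?M. z p * ?fl p)"
      by (rule LINT_add[OF L2_mult_integrable[OF zL L2_add[OF hL rL]] L2_mult_integrable[OF zL fL]])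
    finally have 1: "(LINT p|?M. z p * (h p + ?re p)) + (LINT p|?M. z p * ?fl p) = (LINT p|?M. z p * \<L> \<Phi> h p)" ..
    have i3: "integrable ?M (\<lambda>p. \<alpha> * (N p * \<L> \<Phi> h p))"
      by (rule integrable_mult_right[OF L2_mult_integrable[OF N_L2 lin_op_L2[OF F(1)]]])
    have i4: "integrable ?M (\<lambda>p. c (fst p) * \<L> \<Phi> h p)" by (rule L2_mult_integrable[OF cL lin_op_L2[OF F(1)]])
    have "(LINT p|?M. z p * \<L> \<Phi> h p) = (LINT p|?M. \<alpha> * (N p * \<L> \<Phi> h p) + c (fst p) * \<L> \<Phi> h p)"
      by (simp add: z_def algebra_simps)
    also have "\<dots> = \<alpha> * (LINT p|?M. N p * \<L> \<Phi> h p) + (LINT p|?M. c (fst p) * \<L> \<Phi> h p)"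
      unfolding LINT_add[OF i3 i4] integral_mult_right_zero ..
    finally have 2: "(LINT p|?M. z p * \<L> \<Phi> h p) = \<alpha> * (LINT p|?M. N p * \<L> \<Phi> h p) + (LINT p|?M. c (fst p) * \<L> \<Phi> h p)" .
    have "\<nu> \<phi> = (LINT p|?M. (y p - yd p) * \<phi> p) + (LINT p|?M. z p * \<L> \<Phi> h p)"
      using cs[OF F(1)] \<phi>0 unfolding F(2) 2 cost_derivative_def repr(2) by simp
    then show ?thesis unfolding i1 i2 unfolding inner_L2_def 1[symmetric] by simp
  qed
  have ctl: "AE t in Leb 0 T. \<forall>v\<in>H10 a b.
         0 = - \<alpha> * deriv_Hm1 a b (\<lambda>x. Dx T a b 1 u (t, x)) v + deriv_Hm1 a b (\<lambda>x. z (t, x)) v"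
    using AE_cyl_slices(1)[OF N] L2_slices(1)[OF N_L2]
  proof eventually_elim
    case (elim t)
    show ?case
    proof
      fix v assume v: "v \<in> H10 a b"
      then obtain w where w: "w \<in> L2 {a<..<b}" "weak_deriv a b 1 v w" by (auto simp: H10_def H_def)
      then have wv: "AE x in Leb a b. wderiv a b 1 v x = w x" by (intro wderiv_AE)
      have sets: "{a<..<b} \<in> sets lebesgue" by simp
      have refl: "AE x in Leb a b. z (t, x) = z (t, x)" by simp
      have iN: "integrable (Leb a b) (\<lambda>x. \<alpha> * (N (t, x) * w x))"
        by (rule integrable_mult_right[OF L2_mult_integrable[OF elim(2) w(1)]])
      have iw: "integrable (Leb a b) (\<lambda>x. c t * w x)"
        by (rule integrable_mult_right[OF L2_integrable[OF w(1) interval_lmeasurable]])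
      have w0: "(LINT x|Leb a b. w x) = 0"
        using H10_integral_zero[OF ab v w(2,1)] LINT_interval[OF L2_absolutely_integrable[OF w(1)]] by simp
      have 1: "deriv_Hm1 a b (\<lambda>x. Dx T a b 1 u (t, x)) v = - (LINT x|Leb a b. N (t, x) * w x)"
        unfolding deriv_Hm1_def inner_L2_cong_AE[OF elim(1) wv sets] unfolding inner_L2_def ..
      have "deriv_Hm1 a b (\<lambda>x. z (t, x)) v = - (LINT x|Leb a b. \<alpha> * (N (t, x) * w x) + c t * w x)"
        unfolding deriv_Hm1_def inner_L2_cong_AE[OF refl wv sets] unfolding inner_L2_def z_def by (simp add: algebra_simps)
      also have "\<dots> = - (\<alpha> * (LINT x|Leb a b. N (t, x) * w x))"
        unfolding LINT_add[OF iN iw] integral_mult_right_zero w0 by simp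
      finally show "0 = - \<alpha> * deriv_Hm1 a b (\<lambda>x. Dx T a b 1 u (t, x)) v + deriv_Hm1 a b (\<lambda>x. z (t, x)) v"
        unfolding 1 by simp
    qed
  qed
  show ?thesis
    by (rule bexI[OF _ zL], rule bexI[OF _ mu]) (use se yge comp adj ctl yiv bc in blast)
qed

end
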